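(* Let $A=\Bbbk Q/I$ be a gentle algebra over an algebraically closed field $\Bbbk$. A string $A$-module $M$ is a required summand (i.e. a direct summand of every maximal almost rigid $A$-module) if and only if $M$ is a simple module $M=S(i)$ where the vertex $i$ has indegree at most $1$ and outdegree at most $1$ in $Q$, or $M=M(w)$ where $w$ is a maximal direct string which is not trivial.
   Context: Conventions: $\Bbbk$ is an algebraically closed field, $Q=(Q_0,Q_1)$ is a finite connected quiver, paths are written left to right ($\alpha\beta$ means first $\alpha$, then $\beta$, with $t(\alpha)=s(\beta)$), $I$ is an admissible ideal, and modules are finitely generated right modules, identified with representations of $Q$ satisfying the relations in $I$. The indegree (outdegree) of a vertex is the number of arrows with that target (source); a loop counts in both. Gentle algebra: a finite-dimensional algebra $A=\Bbbk Q/I$ such that (G1) every vertex is the source of at most two arrows and the target of at most two arrows; (G2) for each arrow $\alpha$ there is at most one arrow $\beta$ with $t(\alpha)=s(\beta)$ and $\alpha\beta\notin I$, and at most one arrow $\gamma$ with $t(\gamma)=s(\alpha)$ and $\gamma\alpha\notin I$; (G3) for each arrow $\alpha$ there is at most one arrow $\beta'$ with $t(\alpha)=s(\beta')$ and $\alpha\beta'\in I$, and at most one arrow $\gamma'$ with $t(\gamma')=s(\alpha)$ and $\gamma'\alpha\in I$; (G4) $I$ is generated by paths of length 2. Strings and string modules: for each arrow $\alpha$ let $\alpha^{-1}$ be a formal inverse with source and target exchanged. A string is either a trivial string $1_v$ ($v\in Q_0$) or a walk $w=\alpha_1\cdots\alpha_\ell$ with $\ell\ge1$, $\alpha_i\in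 Q_1\cup Q_1^{-1}$, $t(\alpha_i)=s(\alpha_{i+1})$, containing no subwalk $\alpha\alpha^{-1}$ or $\alpha^{-1}\alpha$, and no subwalk $\alpha\beta$ with $\alpha\beta\in I$ or $(\alpha\beta)^{-1}\in I$. The string module $M(w)$ has a basis $b_1,\dots,b_{\ell+1}$, with $b_i$ placed at the $i$-th vertex visited by $w$; if $\alpha_i$ is an arrow it sends $b_i$ to $b_{i+1}$, if $\alpha_i$ is an inverse arrow then the arrow $\alpha_i^{-1}$ sends $b_{i+1}$ to $b_i$, and all other actions are zero. $M(1_v)=S(v)$. $M(w)\cong M(w')$ iff $w'\in\{w,w^{-1}\}$. A string $\alpha_1\cdots\alpha_\ell$ is direct if all $\alpha_i\in Q_1$ (trivial strings are direct). A direct string $w$ is maximal if there is no arrow $\beta\in Q_1$ such that $w\beta$ is a string and no arrow $\beta\in Q_1$ such that $\beta w$ is a string. Maximal almost rigid modules: a basic $A$-module $T$ is almost rigid if (M1) $T$ is a direct sum of string modules and (M2) for each pair $M,N$ of (possibly equal) indecomposable summands of $T$, every short exact sequence $0\to N\to E\to M\to0$ either splits or has indecomposable middle term $E$. $T$ is maximal almost rigid if it is almost rigid and $T\oplus L$ is not almost rigid for every nonzero string $A$-module $L$. *)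

theory Defs
  imports
    "HOL-Computational_Algebra.Polynomial"
    "HOL-Algebra.Ideal"
    "Graph_Theory.Digraph_Component"
    "Jordan_Normal_Form.Matrix"
begin

section \<open>The path algebra of a quiver and its admissible ideals\<close>

text \<open>
  A quiver is a \<^typ>\<open>('v, 'a) pre_digraph\<close>. A path is a triple of its source, its list of arrows
  (from left to right) and its target; \<open>(v, [], v)\<close> is the trivial path at \<open>v\<close>.
\<close>

type_synonym ('v, 'a) qpath = "'v \<times> 'a list \<times> 'v"

definition qpaths :: "('v, 'a) pre_digraph \<Rightarrow> ('v, 'a) qpath set" where
  "qpaths Q = {(u, p, v). pre_digraph.awalk Q u p v}"

definition path_elem :: "('v, 'a) qpath \<Rightarrow> ('v, 'a) qpath \<Rightarrow> 'k::field" where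
  "path_elem p = (\<lambda>q. if q = p then 1 else 0)"

text \<open>
  The coefficient of a path in a product is the sum over its factorisations.
  As the path algebra has a unit (the quivers below are finite), its ring ideals are closed
  under scalar multiplication.
\<close>

definition path_algebra :: "('v, 'a) pre_digraph \<Rightarrow> (('v, 'a) qpath \<Rightarrow> 'k::field) ring" where
  "path_algebra Q =
    \<lparr>carrier = {x. finite {p. x p \<noteq> 0} \<and> {p. x p \<noteq> 0} \<subseteq> qpaths Q},
     mult = (\<lambda>x y (u, p, w).
       \<Sum>(p1, v, p2) \<in> {(p1, v, p2). p = p1 @ p2 \<and> (u, p1, v) \<in> qpaths Q \<and> (v, p2, w) \<in> qpaths Q}.
         x (u, p1, v) * y (v, p2, w)),
     one = (\<lambda>(u, p, v). if u \<in> verts Q \<and> p = [] \<and> u = v then 1 else 0),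
     zero = (\<lambda>p. 0),
     add = (\<lambda>x y p. x p + y p)\<rparr>"

text \<open>The \<open>m\<close>-th power of the arrow ideal is spanned by the paths of length at least \<open>m\<close>.\<close>

definition arrow_ideal_power ::
    "('v, 'a) pre_digraph \<Rightarrow> nat \<Rightarrow> (('v, 'a) qpath \<Rightarrow> 'k::field) set" where
  "arrow_ideal_power Q m =
    {x \<in> carrier (path_algebra Q). \<forall>u p v. x (u, p, v) \<noteq> 0 \<longrightarrow> m \<le> length p}"

text \<open>In particular, the quotient of the path algebra by an admissible ideal has finite dimension.\<close>

definition admissible_ideal ::
    "('v, 'a) pre_digraph \<Rightarrow> (('v, 'a) qpath \<Rightarrow> 'k::field) set \<Rightarrow> bool" where
  "admissible_ideal Q I \<longleftrightarrow> ideal I (path_algebra Q) \<and>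
     (\<exists>m\<ge>2. arrow_ideal_power Q m \<subseteq> I \<and> I \<subseteq> arrow_ideal_power Q 2)"


section \<open>Gentle algebras\<close>

abbreviation two_path :: "('v, 'a) pre_digraph \<Rightarrow> 'a \<Rightarrow> 'a \<Rightarrow> ('v, 'a) qpath \<Rightarrow> 'k::field" where
  "two_path Q a b \<equiv> path_elem (tail Q a, [a, b], head Q b)"

definition gentle :: "('v, 'a) pre_digraph \<Rightarrow> (('v, 'a) qpath \<Rightarrow> 'k::field) set \<Rightarrow> bool" where
  "gentle Q I \<longleftrightarrow>
     fin_digraph Q \<and> Digraph_Component.connected Q \<and> admissible_ideal Q I \<and>
     (\<forall>v \<in> verts Q. out_degree Q v \<le> 2 \<and> in_degree Q v \<le> 2) \<and>
     (\<forall>a \<in> arcs Q.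
        card {b \<in> arcs Q. head Q a = tail Q b \<and> two_path Q a b \<notin> I} \<le> 1 \<and>
        card {c \<in> arcs Q. head Q c = tail Q a \<and> two_path Q c a \<notin> I} \<le> 1) \<and>
     (\<forall>a \<in> arcs Q.
        card {b \<in> arcs Q. head Q a = tail Q b \<and> two_path Q a b \<in> I} \<le> 1 \<and>
        card {c \<in> arcs Q. head Q c = tail Q a \<and> two_path Q c a \<in> I} \<le> 1) \<and>
     (\<exists>P \<subseteq> {(u, p, v) \<in> qpaths Q. length p = 2}. I = genideal (path_algebra Q) (path_elem ` P))"


section \<open>Modules as representations of the bound quiver\<close>

text \<open>
  A representation has the coordinate space of dimension \<open>rdim M v\<close> at the vertex \<open>v\<close>, and the
  arrow \<open>a\<close> acts on column vectors by the matrix \<open>rmap M a\<close>. Every finite-dimensional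
  representation is isomorphic to one of this kind. Values of \<open>rdim\<close> and \<open>rmap\<close> outside the
  quiver carry no information.
\<close>

record ('v, 'a, 'k) rep =
  rdim :: "'v \<Rightarrow> nat"
  rmap :: "'a \<Rightarrow> 'k mat"

definition is_rep :: "('v, 'a) pre_digraph \<Rightarrow> ('v, 'a, 'k::field) rep \<Rightarrow> bool" where
  "is_rep Q M \<longleftrightarrow> (\<forall>a \<in> arcs Q. rmap M a \<in> carrier_mat (rdim M (head Q a)) (rdim M (tail Q a)))"

text \<open>The first arrow of a path acts first, so it is the rightmost factor.\<close>

definition path_map :: "('v, 'a, 'k::field) rep \<Rightarrow> 'v \<Rightarrow> 'a list \<Rightarrow> 'k mat" where
  "path_map M u p = foldl (\<lambda>X a. rmap M a * X) (1\<^sub>m (rdim M u)) p"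

text \<open>
  The relations in \<open>I\<close> are imposed entrywise: each \<open>x \<in> I\<close> acts as zero from the space at \<open>u\<close> to the
  space at \<open>v\<close>, for all vertices \<open>u\<close> and \<open>v\<close>.
\<close>

definition A_module ::
    "('v, 'a) pre_digraph \<Rightarrow> (('v, 'a) qpath \<Rightarrow> 'k::field) set \<Rightarrow> ('v, 'a, 'k) rep \<Rightarrow> bool" where
  "A_module Q I M \<longleftrightarrow> is_rep Q M \<and>
     (\<forall>x \<in> I. \<forall>u \<in> verts Q. \<forall>v \<in> verts Q. \<forall>i < rdim M v. \<forall>j < rdim M u.
        (\<Sum>p \<in> {p. x (u, p, v) \<noteq> 0}. x (u, p, v) * path_map M u p $$ (i, j)) = 0)"

definition rep_hom :: "('v, 'a) pre_digraph \<Rightarrow> ('v, 'a, 'k::field) rep \<Rightarrow> ('v, 'a, 'k) rep \<Rightarrow>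
    ('v \<Rightarrow> 'k mat) \<Rightarrow> bool" where
  "rep_hom Q M N f \<longleftrightarrow>
     (\<forall>v \<in> verts Q. f v \<in> carrier_mat (rdim N v) (rdim M v)) \<and>
     (\<forall>a \<in> arcs Q. f (head Q a) * rmap M a = rmap N a * f (tail Q a))"

definition rep_iso :: "('v, 'a) pre_digraph \<Rightarrow> ('v, 'a, 'k::field) rep \<Rightarrow> ('v, 'a, 'k) rep \<Rightarrow> bool"
  where
  "rep_iso Q M N \<longleftrightarrow> (\<exists>f g. rep_hom Q M N f \<and> rep_hom Q N M g \<and>
     (\<forall>v \<in> verts Q. g v * f v = 1\<^sub>m (rdim M v) \<and> f v * g v = 1\<^sub>m (rdim N v)))"

definition zero_rep :: "('v, 'a, 'k::field) rep" where
  "zero_rep = \<lparr>rdim = (\<lambda>v. 0), rmap = (\<lambda>a. 0\<^sub>m 0 0)\<rparr>"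

definition is_zero_rep :: "('v, 'a) pre_digraph \<Rightarrow> ('v, 'a, 'k::field) rep \<Rightarrow> bool" where
  "is_zero_rep Q M \<longleftrightarrow> (\<forall>v \<in> verts Q. rdim M v = 0)"

definition dsum :: "('v, 'a) pre_digraph \<Rightarrow> ('v, 'a, 'k::field) rep \<Rightarrow> ('v, 'a, 'k) rep \<Rightarrow>
    ('v, 'a, 'k) rep" where
  "dsum Q M N =
    \<lparr>rdim = (\<lambda>v. rdim M v + rdim N v),
     rmap = (\<lambda>a. four_block_mat
       (rmap M a) (0\<^sub>m (rdim M (head Q a)) (rdim N (tail Q a)))
       (0\<^sub>m (rdim N (head Q a)) (rdim M (tail Q a))) (rmap N a))\<rparr>"

definition dsum_list :: "('v, 'a) pre_digraph \<Rightarrow> ('v, 'a, 'k::field) rep list \<Rightarrow> ('v, 'a, 'k) rep"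
  where
  "dsum_list Q Ms = foldr (dsum Q) Ms zero_rep"

definition direct_summand :: "('v, 'a) pre_digraph \<Rightarrow> (('v, 'a) qpath \<Rightarrow> 'k::field) set \<Rightarrow>
    ('v, 'a, 'k) rep \<Rightarrow> ('v, 'a, 'k) rep \<Rightarrow> bool" where
  "direct_summand Q I M T \<longleftrightarrow> A_module Q I M \<and> A_module Q I T \<and>
     (\<exists>X. A_module Q I X \<and> rep_iso Q T (dsum Q M X))"

definition indecomposable ::
    "('v, 'a) pre_digraph \<Rightarrow> (('v, 'a) qpath \<Rightarrow> 'k::field) set \<Rightarrow> ('v, 'a, 'k) rep \<Rightarrow> bool" where
  "indecomposable Q I M \<longleftrightarrow> A_module Q I M \<and> \<not> is_zero_rep Q M \<and>
     (\<forall>X Y. A_module Q I X \<and> A_module Q I Y \<and> rep_iso Q M (dsum Q X Y) \<longrightarrow>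
        is_zero_rep Q X \<or> is_zero_rep Q Y)"

definition basic_module ::
    "('v, 'a) pre_digraph \<Rightarrow> (('v, 'a) qpath \<Rightarrow> 'k::field) set \<Rightarrow> ('v, 'a, 'k) rep \<Rightarrow> bool" where
  "basic_module Q I T \<longleftrightarrow> A_module Q I T \<and>
     (\<exists>Ms. (\<forall>M \<in> set Ms. indecomposable Q I M) \<and>
        (\<forall>i j. i < j \<and> j < length Ms \<longrightarrow> \<not> rep_iso Q (Ms ! i) (Ms ! j)) \<and>
        rep_iso Q T (dsum_list Q Ms))"

text \<open>\<open>short_exact Q N f E g M\<close>: the sequence \<open>0 \<rightarrow> N \<rightarrow> E \<rightarrow> M \<rightarrow> 0\<close> with maps \<open>f\<close> and \<open>g\<close> is exact.\<close>

definition short_exact :: "('v, 'a) pre_digraph \<Rightarrow> ('v, 'a, 'k::field) rep \<Rightarrow> ('v \<Rightarrow> 'k mat) \<Rightarrow>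
    ('v, 'a, 'k) rep \<Rightarrow> ('v \<Rightarrow> 'k mat) \<Rightarrow> ('v, 'a, 'k) rep \<Rightarrow> bool" where
  "short_exact Q N f E g M \<longleftrightarrow> rep_hom Q N E f \<and> rep_hom Q E M g \<and>
     (\<forall>v \<in> verts Q.
        inj_on (\<lambda>x. f v *\<^sub>v x) (carrier_vec (rdim N v)) \<and>
        (\<lambda>x. f v *\<^sub>v x) ` carrier_vec (rdim N v) =
          {y \<in> carrier_vec (rdim E v). g v *\<^sub>v y = 0\<^sub>v (rdim M v)} \<and>
        (\<lambda>y. g v *\<^sub>v y) ` carrier_vec (rdim E v) = carrier_vec (rdim M v))"

definition splits :: "('v, 'a) pre_digraph \<Rightarrow> ('v, 'a, 'k::field) rep \<Rightarrow> ('v \<Rightarrow> 'k mat) \<Rightarrow>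
    ('v, 'a, 'k) rep \<Rightarrow> bool" where
  "splits Q E g M \<longleftrightarrow>
     (\<exists>s. rep_hom Q M E s \<and> (\<forall>v \<in> verts Q. g v * s v = 1\<^sub>m (rdim M v)))"

definition simple_rep :: "('v, 'a) pre_digraph \<Rightarrow> 'v \<Rightarrow> ('v, 'a, 'k::field) rep" where
  "simple_rep Q i =
    \<lparr>rdim = (\<lambda>v. if v = i then 1 else 0),
     rmap = (\<lambda>a. 0\<^sub>m (if head Q a = i then 1 else 0) (if tail Q a = i then 1 else 0))\<rparr>"


section \<open>Strings and string modules\<close>

datatype 'a letter = Dir 'a | Inv 'a

primrec letter_arrow :: "'a letter \<Rightarrow> 'a" where
  "letter_arrow (Dir a) = a"
| "letter_arrow (Inv a) = a"

primrec letter_source :: "('v, 'a) pre_digraph \<Rightarrow> 'a letter \<Rightarrow> 'v" where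
  "letter_source Q (Dir a) = tail Q a"
| "letter_source Q (Inv a) = head Q a"

primrec letter_target :: "('v, 'a) pre_digraph \<Rightarrow> 'a letter \<Rightarrow> 'v" where
  "letter_target Q (Dir a) = head Q a"
| "letter_target Q (Inv a) = tail Q a"

primrec letter_inv :: "'a letter \<Rightarrow> 'a letter" where
  "letter_inv (Dir a) = Inv a"
| "letter_inv (Inv a) = Dir a"

text \<open>
  A walk is a pair of its starting vertex and its list of letters; \<open>(v, [])\<close> is the trivial walk
  at \<open>v\<close>.
\<close>

type_synonym ('v, 'a) walk = "'v \<times> 'a letter list"

definition walk_verts :: "('v, 'a) pre_digraph \<Rightarrow> ('v, 'a) walk \<Rightarrow> 'v list" where
  "walk_verts Q w = fst w # map (letter_target Q) (snd w)"

text \<open>A formal inverse path \<open>b\<^sup>-\<^sup>1 a\<^sup>-\<^sup>1\<close> is forbidden when its inverse \<open>ab\<close> is in \<open>I\<close>.\<close>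

definition is_string ::
    "('v, 'a) pre_digraph \<Rightarrow> (('v, 'a) qpath \<Rightarrow> 'k::field) set \<Rightarrow> ('v, 'a) walk \<Rightarrow> bool" where
  "is_string Q I w \<longleftrightarrow> (case w of (u, ls) \<Rightarrow>
     u \<in> verts Q \<and>
     (\<forall>i < length ls. letter_arrow (ls ! i) \<in> arcs Q \<and>
        letter_source Q (ls ! i) = walk_verts Q w ! i) \<and>
     (\<forall>i. Suc i < length ls \<longrightarrow>
        ls ! Suc i \<noteq> letter_inv (ls ! i) \<and>
        (\<forall>a b. ls ! i = Dir a \<and> ls ! Suc i = Dir b \<longrightarrow> two_path Q a b \<notin> I) \<and>
        (\<forall>a b. ls ! i = Inv b \<and> ls ! Suc i = Inv a \<longrightarrow> two_path Q a b \<notin> I)))"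

text \<open>
  The basis vector attached to the position \<open>i = 0, \<dots>, \<ell>\<close> of a walk lives at the \<open>i\<close>-th visited
  vertex \<open>v\<close>. It is coordinate number \<open>walk_pos Q w i\<close> of the space at \<open>v\<close>, counted by the earlier
  visits to \<open>v\<close>.
\<close>

definition walk_pos :: "('v, 'a) pre_digraph \<Rightarrow> ('v, 'a) walk \<Rightarrow> nat \<Rightarrow> nat" where
  "walk_pos Q w i = count_list (take i (walk_verts Q w)) (walk_verts Q w ! i)"

definition string_rep :: "('v, 'a) pre_digraph \<Rightarrow> ('v, 'a) walk \<Rightarrow> ('v, 'a, 'k::field) rep" where
  "string_rep Q w =
    (let d = count_list (walk_verts Q w); ls = snd w in
     \<lparr>rdim = d,
      rmap = (\<lambda>a. mat (d (head Q a)) (d (tail Q a)) (\<lambda>(r, c).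
        if \<exists>i < length ls.
             ls ! i = Dir a \<and> c = walk_pos Q w i \<and> r = walk_pos Q w (Suc i) \<or>
             ls ! i = Inv a \<and> c = walk_pos Q w (Suc i) \<and> r = walk_pos Q w i
        then 1 else 0))\<rparr>)"

definition string_module ::
    "('v, 'a) pre_digraph \<Rightarrow> (('v, 'a) qpath \<Rightarrow> 'k::field) set \<Rightarrow> ('v, 'a, 'k) rep \<Rightarrow> bool" where
  "string_module Q I M \<longleftrightarrow> A_module Q I M \<and> (\<exists>w. is_string Q I w \<and> rep_iso Q M (string_rep Q w))"

definition direct_string ::
    "('v, 'a) pre_digraph \<Rightarrow> (('v, 'a) qpath \<Rightarrow> 'k::field) set \<Rightarrow> ('v, 'a) walk \<Rightarrow> bool" where
  "direct_string Q I w \<longleftrightarrow> is_string Q I w \<and> (\<forall>l \<in> set (snd w). \<exists>a. l = Dir a)"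

definition maximal_direct_string ::
    "('v, 'a) pre_digraph \<Rightarrow> (('v, 'a) qpath \<Rightarrow> 'k::field) set \<Rightarrow> ('v, 'a) walk \<Rightarrow> bool" where
  "maximal_direct_string Q I w \<longleftrightarrow> direct_string Q I w \<and>
     \<not> (\<exists>b \<in> arcs Q. is_string Q I (fst w, snd w @ [Dir b])) \<and>
     \<not> (\<exists>b \<in> arcs Q. head Q b = fst w \<and> is_string Q I (tail Q b, Dir b # snd w))"


section \<open>Maximal almost rigid modules\<close>

definition almost_rigid ::
    "('v, 'a) pre_digraph \<Rightarrow> (('v, 'a) qpath \<Rightarrow> 'k::field) set \<Rightarrow> ('v, 'a, 'k) rep \<Rightarrow> bool" where
  "almost_rigid Q I T \<longleftrightarrow> basic_module Q I T \<and>
     (\<exists>Ms. (\<forall>M \<in> set Ms. string_module Q I M) \<and> rep_iso Q T (dsum_list Q Ms)) \<and>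
     (\<forall>M N E f g.
        indecomposable Q I M \<and> direct_summand Q I M T \<and>
        indecomposable Q I N \<and> direct_summand Q I N T \<and>
        A_module Q I E \<and> short_exact Q N f E g M \<longrightarrow>
        splits Q E g M \<or> indecomposable Q I E)"

definition maximal_almost_rigid ::
    "('v, 'a) pre_digraph \<Rightarrow> (('v, 'a) qpath \<Rightarrow> 'k::field) set \<Rightarrow> ('v, 'a, 'k) rep \<Rightarrow> bool" where
  "maximal_almost_rigid Q I T \<longleftrightarrow> almost_rigid Q I T \<and>
     (\<forall>L. string_module Q I L \<and> \<not> is_zero_rep Q L \<longrightarrow> \<not> almost_rigid Q I (dsum Q T L))"

definition required_summand ::
    "('v, 'a) pre_digraph \<Rightarrow> (('v, 'a) qpath \<Rightarrow> 'k::field) set \<Rightarrow> ('v, 'a, 'k) rep \<Rightarrow> bool" where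
  "required_summand Q I M \<longleftrightarrow> (\<forall>T. maximal_almost_rigid Q I T \<longrightarrow> direct_summand Q I M T)"

end

theory Submission
  imports Defs "HOL-Library.Function_Algebras"
begin

text \<open>Call a pair of modules bad if some non-split extension of one by the other has a decomposable
  middle term. Let \<open>P\<close> be the set of strings \<open>p\<^sup>-\<^sup>1 q\<close> with right maximal paths \<open>p\<close> and \<open>q\<close> starting at
  the same vertex, where one side may be missing, and both may be missing if at most one arrow
  starts there. Gluing bases shows that a string in \<open>P\<close> is never the quotient of a bad extension of
  string modules, while cutting a string outside \<open>P\<close> at a sink, or at an end that can be prolonged,
  gives a bad extension of it by a string in \<open>P\<close>. Hence the strings in \<open>P\<close> form a maximal almost
  rigid module. Transposition of matrices exchanges \<open>Q\<close> with its opposite and yields another one,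
  formed by the strings of the dual shape. A required summand is a summand of both, so its string has
  both shapes, which leaves the maximal direct strings and the vertices of indegree and outdegree at
  most one. Conversely, a string of both shapes forms a bad pair with no string, so that it can be
  added to any almost rigid module.\<close>

text \<open>What can go wrong in the gluing is that the arrow missing at the top of the quotient
  sends every lift of the top vector to a combination of several basis vectors of the submodule.
  Changing the lift removes the components in the image of that arrow, and the two sides at each
  vertex of a gentle quiver force the remaining ones to the ends of the string. If both ends occur,
  the string is compared with its inverse, from which it always differs. At the first difference one
  of them reads a direct and the other an inverse letter, so a change of basis absorbs one end into
  the other and turns the combination into the end vector of a string basis. A similar comparison of
  half-words makes endomorphisms of string modules triangular with constant diagonal. This gives
  indecomposability, then local endomorphism rings by Fitting's lemma and the Krull-Schmidt
  property, which controls the summands of an enlarged module. A representation is handled as one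
  space of coordinate functions on which the arrows act; matrices occur only where the definitions
  or transposition call for them.\<close>

declare plus_fun_apply [simp del] zero_fun_apply [simp del] minus_apply [simp del] uminus_apply [simp del]

section \<open>Matrix entries and the vector space of coordinate functions\<close>

lemma sum_fun_apply: "(\<Sum>i\<in>A. f i) x = (\<Sum>i\<in>A. f i x)"
  by (induction A rule: infinite_finite_induct) (auto simp: plus_fun_apply zero_fun_apply)

lemma mat_times_index:
  assumes "A \<in> carrier_mat n m" "B \<in> carrier_mat m k" "i < n" "j < k"
  shows "(A * B) $$ (i, j) = (\<Sum>l<m. A $$ (i, l) * B $$ (l, j))"
  using assms by (auto simp: scalar_prod_def atLeast0LessThan intro!: sum.cong)

lemma mat_vec_index:
  assumes "A \<in> carrier_mat n m" "x \<in> carrier_vec m" "i < n"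
  shows "(A *\<^sub>v x) $ i = (\<Sum>l<m. A $$ (i, l) * x $ l)"
  using assms by (auto simp: scalar_prod_def atLeast0LessThan intro!: sum.cong)

definition smul :: "'k::times \<Rightarrow> ('b \<Rightarrow> 'k) \<Rightarrow> 'b \<Rightarrow> 'k" (infixr "*\<^sub>F" 75) where
  "c *\<^sub>F x = (\<lambda>i. c * x i)"

lemma smul_apply: "(c *\<^sub>F x) i = c * x i"
  by (simp add: smul_def)

lemmas fun_ops = fun_eq_iff plus_fun_apply zero_fun_apply minus_apply uminus_apply smul_apply sum_fun_apply

text \<open>Opens the generic theory of independence, span and dimension over an arbitrary field,
  which is used through local interpretations.\<close>

lemma vector_space_smul: "vector_space (smul :: 'k::field \<Rightarrow> ('b \<Rightarrow> 'k) \<Rightarrow> _)"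
  by unfold_locales (auto simp: fun_ops algebra_simps)

lemma smul_simps [simp]:
  fixes x :: "'b \<Rightarrow> 'k::field"
  shows "0 *\<^sub>F x = 0" "1 *\<^sub>F x = x" "c *\<^sub>F (0 :: 'b \<Rightarrow> 'k) = 0" "c *\<^sub>F d *\<^sub>F x = (c * d) *\<^sub>F x"
  by (auto simp: fun_ops)

lemma smul_add: "c *\<^sub>F (x + y) = c *\<^sub>F x + c *\<^sub>F (y :: 'b \<Rightarrow> 'k::field)"
  and add_smul: "(c + d) *\<^sub>F x = c *\<^sub>F x + d *\<^sub>F x"
  and smul_diff: "c *\<^sub>F (x - y) = c *\<^sub>F x - c *\<^sub>F y"
  and diff_smul: "(c - d) *\<^sub>F x = c *\<^sub>F x - d *\<^sub>F x"
  and smul_minus: "(- c) *\<^sub>F x = - (c *\<^sub>F x)"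
  by (auto simp: fun_ops algebra_simps)

lemma smul_sum: "c *\<^sub>F (\<Sum>i\<in>A. f i) = (\<Sum>i\<in>A. c *\<^sub>F (f i :: 'b \<Rightarrow> 'k::field))"
  by (auto simp: fun_ops sum_distrib_left)

lemma smul_eq_0_iff: "c *\<^sub>F x = 0 \<longleftrightarrow> c = 0 \<or> x = (0 :: 'b \<Rightarrow> 'k::field)"
  by (auto simp: fun_ops)

section \<open>Representations as total spaces with vertex projections and arrow actions\<close>

type_synonym ('v, 'k) tvec = "'v \<times> nat \<Rightarrow> 'k"

text \<open>The direct sum of the spaces at all vertices. Since the functions vanish outside the
  range of \<open>M\<close>, equality of elements is plain equality of functions, and a whole family
  of matrices becomes one map.\<close>

definition tot :: "('v, 'a) pre_digraph \<Rightarrow> ('v, 'a, 'k::field) rep \<Rightarrow> ('v, 'k) tvec set" where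
  "tot Q M = {x. \<forall>v r. x (v, r) \<noteq> 0 \<longrightarrow> v \<in> verts Q \<and> r < rdim M v}"

text \<open>Only the coordinates below \<open>rdim M (tail Q a)\<close> at the source are read, so
  the map is linear on all functions and the rules in \<open>act_linear\<close> need no membership
  conditions.\<close>

definition act :: "('v, 'a) pre_digraph \<Rightarrow> ('v, 'a, 'k::field) rep \<Rightarrow> 'a \<Rightarrow> ('v, 'k) tvec \<Rightarrow> ('v, 'k) tvec" where
  "act Q M a x = (\<lambda>(v, r). if v = head Q a \<and> r < rdim M v
     then \<Sum>c<rdim M (tail Q a). rmap M a $$ (r, c) * x (tail Q a, c) else 0)"

definition pr :: "'v \<Rightarrow> ('v, 'k::field) tvec \<Rightarrow> ('v, 'k) tvec" where
  "pr v x = (\<lambda>(u, r). if u = v then x (u, r) else 0)"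

definition unitf :: "'v \<Rightarrow> nat \<Rightarrow> ('v, 'k::field) tvec" where
  "unitf v c = (\<lambda>p. if p = (v, c) then 1 else 0)"

text \<open>Commuting with \<open>pr\<close> says that the map is graded by the vertices. All
  conditions are restricted to \<open>tot Q M\<close>, so that maps defined by choice on that space
  need no care elsewhere.\<close>

definition mhom :: "('v, 'a) pre_digraph \<Rightarrow> ('v, 'a, 'k::field) rep \<Rightarrow> ('v, 'a, 'k) rep \<Rightarrow>
    (('v, 'k) tvec \<Rightarrow> ('v, 'k) tvec) \<Rightarrow> bool" where
  "mhom Q M N F \<longleftrightarrow>
     (\<forall>x \<in> tot Q M. F x \<in> tot Q N) \<and>
     (\<forall>x \<in> tot Q M. \<forall>y \<in> tot Q M. F (x + y) = F x + F y) \<and>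
     (\<forall>c. \<forall>x \<in> tot Q M. F (c *\<^sub>F x) = c *\<^sub>F F x) \<and>
     (\<forall>v \<in> verts Q. \<forall>x \<in> tot Q M. F (pr v x) = pr v (F x)) \<and>
     (\<forall>a \<in> arcs Q. \<forall>x \<in> tot Q M. F (act Q M a x) = act Q N a (F x))"

definition app :: "('v, 'a) pre_digraph \<Rightarrow> ('v, 'a, 'k::field) rep \<Rightarrow> ('v, 'a, 'k) rep \<Rightarrow>
    ('v \<Rightarrow> 'k mat) \<Rightarrow> ('v, 'k) tvec \<Rightarrow> ('v, 'k) tvec" where
  "app Q M N f x = (\<lambda>(v, r). if v \<in> verts Q \<and> r < rdim N v
     then \<Sum>c<rdim M v. f v $$ (r, c) * x (v, c) else 0)"

lemma tot_0 [simp]: "0 \<in> tot Q M"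
  by (simp add: tot_def zero_fun_apply)

lemma tot_add: "x \<in> tot Q M \<Longrightarrow> y \<in> tot Q M \<Longrightarrow> x + y \<in> tot Q M"
  by (auto simp: tot_def plus_fun_apply) (metis add.right_neutral)+

lemma tot_smul: "x \<in> tot Q M \<Longrightarrow> c *\<^sub>F x \<in> tot Q M"
  by (auto simp: tot_def fun_ops)

lemma tot_uminus: "x \<in> tot Q M \<Longrightarrow> - x \<in> tot Q M"
  by (auto simp: tot_def fun_ops)

lemma tot_diff: "x \<in> tot Q M \<Longrightarrow> y \<in> tot Q M \<Longrightarrow> x - y \<in> tot Q M"
  using tot_add[of x Q M "- y"] tot_uminus[of y Q M] by simp

lemma tot_sum: "(\<And>i. i \<in> A \<Longrightarrow> f i \<in> tot Q M) \<Longrightarrow> (\<Sum>i\<in>A. f i) \<in> tot Q M"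
  by (induction A rule: infinite_finite_induct) (auto intro: tot_add)

lemma tot_pr: "x \<in> tot Q M \<Longrightarrow> pr v x \<in> tot Q M"
  by (auto simp: tot_def pr_def)

lemma tot_unitf: "v \<in> verts Q \<Longrightarrow> r < rdim M v \<Longrightarrow> unitf v r \<in> tot Q M"
  by (auto simp: tot_def unitf_def)

lemmas tot_intros = tot_0 tot_add tot_smul tot_uminus tot_diff tot_sum tot_pr tot_unitf

lemma pr_simps [simp]:
  "pr v (0 :: ('v, 'k::field) tvec) = 0"
  "pr v (x + y) = pr v x + pr v (y :: ('v, 'k::field) tvec)"
  "pr v (x - y) = pr v x - pr v y"
  "pr v (- x) = - pr v x"
  "pr v (c *\<^sub>F x) = c *\<^sub>F pr v x"
  "pr v (pr u x) = (if u = v then pr v x else 0)"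
  by (auto simp: fun_ops pr_def)

lemma pr_sum: "pr v (\<Sum>i\<in>A. f i) = (\<Sum>i\<in>A. pr v (f i :: ('v, 'k::field) tvec))"
  by (auto simp: fun_ops pr_def sum_fun_apply)

lemma act_linear [simp]:
  "act Q M a 0 = 0"
  "act Q M a (x + y) = act Q M a x + act Q M a y"
  "act Q M a (x - y) = act Q M a x - act Q M a y"
  "act Q M a (- x) = - act Q M a x"
  "act Q M a (c *\<^sub>F x) = c *\<^sub>F act Q M a x"
  by (auto simp: fun_ops act_def algebra_simps sum.distrib sum_subtractf sum_distrib_left sum_negf)

lemma act_sum: "act Q M a (\<Sum>i\<in>A. f i) = (\<Sum>i\<in>A. act Q M a (f i))"
  by (induction A rule: infinite_finite_induct) auto

lemma pr_act: "pr v (act Q M a x) = (if v = head Q a then act Q M a x else 0)"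
  by (auto simp: fun_ops act_def pr_def)

lemma act_pr: "act Q M a (pr v x) = (if v = tail Q a then act Q M a x else 0)"
  by (auto simp: fun_ops act_def pr_def)

lemma mhomD:
  assumes "mhom Q M N F"
  shows "x \<in> tot Q M \<Longrightarrow> F x \<in> tot Q N"
    and "x \<in> tot Q M \<Longrightarrow> y \<in> tot Q M \<Longrightarrow> F (x + y) = F x + F y"
    and "x \<in> tot Q M \<Longrightarrow> F (c *\<^sub>F x) = c *\<^sub>F F x"
    and "v \<in> verts Q \<Longrightarrow> x \<in> tot Q M \<Longrightarrow> F (pr v x) = pr v (F x)"
    and "a \<in> arcs Q \<Longrightarrow> x \<in> tot Q M \<Longrightarrow> F (act Q M a x) = act Q N a (F x)"
  using assms unfolding mhom_def by blast+

lemma mhom_0: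
  assumes "mhom Q M N F"
  shows "F 0 = 0"
  using mhomD(3)[OF assms tot_0, of 0] by simp

lemma mhom_uminus:
  assumes "mhom Q M N F" "x \<in> tot Q M"
  shows "F (- x) = - F x"
  using mhomD(3)[OF assms, of "- 1"] by (simp add: smul_minus)

lemma mhom_diff:
  assumes "mhom Q M N F" "x \<in> tot Q M" "y \<in> tot Q M"
  shows "F (x - y) = F x - F y"
  using mhomD(2)[OF assms(1,2) tot_uminus[OF assms(3)]] mhom_uminus[OF assms(1,3)] by simp

lemma mhom_sum:
  assumes "mhom Q M N F" "\<And>i. i \<in> A \<Longrightarrow> f i \<in> tot Q M"
  shows "F (\<Sum>i\<in>A. f i) = (\<Sum>i\<in>A. F (f i))"
  using assms(2)
proof (induction A rule: infinite_finite_induct)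
  case (insert a A)
  then show ?case
    using mhomD(2)[OF assms(1), of "f a" "sum f A"] by (simp add: tot_sum)
qed (simp_all add: mhom_0[OF assms(1)])

lemma mhom_comp: "mhom Q M N F \<Longrightarrow> mhom Q N L G \<Longrightarrow> mhom Q M L (\<lambda>x. G (F x))"
  unfolding mhom_def by simp

lemma mhom_id: "mhom Q M M (\<lambda>x. x)"
  unfolding mhom_def by simp

lemma mhom_zero: "mhom Q M N (\<lambda>x. 0)"
  unfolding mhom_def by simp

lemma mhom_add: "mhom Q M N F \<Longrightarrow> mhom Q M N G \<Longrightarrow> mhom Q M N (\<lambda>x. F x + G x)"
  unfolding mhom_def by (auto simp: tot_add smul_add)

lemma mhom_smul: "mhom Q M N F \<Longrightarrow> mhom Q M N (\<lambda>x. c *\<^sub>F F x)"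
  unfolding mhom_def by (auto simp: tot_smul smul_add mult.commute)

lemma mhom_minus: "mhom Q M N F \<Longrightarrow> mhom Q M N G \<Longrightarrow> mhom Q M N (\<lambda>x. F x - G x)"
  using mhom_add[of Q M N F "\<lambda>x. (- 1) *\<^sub>F G x"] mhom_smul[of Q M N G "- 1"]
  by (simp add: smul_minus)

lemma mhom_sum_fun: "(\<And>i. i \<in> A \<Longrightarrow> mhom Q M N (F i)) \<Longrightarrow> mhom Q M N (\<lambda>x. \<Sum>i\<in>A. F i x)"
  by (induction A rule: infinite_finite_induct) (auto intro: mhom_add mhom_zero)

text \<open>A homomorphism is judged only on \<open>tot Q M\<close> and may be changed freely
  elsewhere; the condition on the end points of arrows keeps \<open>act\<close> inside that
  space.\<close>

lemma mhom_cong: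
  assumes "mhom Q M N F" "\<And>x. x \<in> tot Q M \<Longrightarrow> F x = G x"
    and "\<And>a. a \<in> arcs Q \<Longrightarrow> tail Q a \<in> verts Q \<and> head Q a \<in> verts Q"
  shows "mhom Q M N G"
proof -
  have [simp]: "act Q M a x \<in> tot Q M" if "a \<in> arcs Q" for a x
    using assms(3)[OF that] by (auto simp: act_def tot_def split: if_splits)
  show ?thesis
    using assms(1) unfolding mhom_def by (simp add: assms(2)[symmetric] tot_intros)
qed

section \<open>Translation between families of matrices and maps of total spaces\<close>

locale finite_quiver =
  fixes Q :: "('v, 'a) pre_digraph"
  assumes finite_verts: "finite (verts Q)"
    and finite_arcs: "finite (arcs Q)"
    and tail_verts: "a \<in> arcs Q \<Longrightarrow> tail Q a \<in> verts Q"
    and head_verts: "a \<in> arcs Q \<Longrightarrow> head Q a \<in> verts Q"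
begin

lemma tot_act: "a \<in> arcs Q \<Longrightarrow> act Q M a x \<in> tot Q M"
  using head_verts by (auto simp: act_def tot_def split: if_splits)

lemma tot_expand:
  fixes M :: "('v, 'a, 'k::field) rep"
  assumes "x \<in> tot Q M"
  shows "x = (\<Sum>v\<in>verts Q. \<Sum>c<rdim M v. x (v, c) *\<^sub>F unitf v c)"
proof
  fix p :: "'v \<times> nat"
  obtain u r where p: "p = (u, r)" by force
  have "(\<Sum>v\<in>verts Q. \<Sum>c<rdim M v. x (v, c) *\<^sub>F unitf v c) p =
      (\<Sum>v\<in>verts Q. \<Sum>c<rdim M v. x (v, c) * (if v = u \<and> c = r then 1 else (0 :: 'k)))"
    by (auto simp: p fun_ops unitf_def intro!: sum.cong)
  also have "\<dots> = (\<Sum>v\<in>verts Q. if v = u then \<Sum>c<rdim M v. if c = r then x (v, c) else 0 else 0)"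
  proof (rule sum.cong[OF refl])
    fix v
    have "x (v, c) * (if v = u \<and> c = r then 1 else 0) = (if v = u then if c = r then x (v, c) else 0 else 0)" for c
      by simp
    then show "(\<Sum>c<rdim M v. x (v, c) * (if v = u \<and> c = r then 1 else 0)) =
        (if v = u then \<Sum>c<rdim M v. if c = r then x (v, c) else 0 else 0)"
      by (cases "v = u") (simp_all only: if_True if_False sum.neutral_const refl)
  qed
  also have "\<dots> = x p"
    using assms finite_verts
    by (auto simp: p tot_def)
  finally show "x p = (\<Sum>v\<in>verts Q. \<Sum>c<rdim M v. x (v, c) *\<^sub>F unitf v c) p" by simp
qed

lemma tot_eqI:
  assumes "x \<in> tot Q M" "\<And>v. v \<in> verts Q \<Longrightarrow> pr v x = 0"
  shows "x = 0"
proof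
  fix p
  show "x p = 0 p"
    using assms(1) fun_cong[OF assms(2)[of "fst p"], of p] by (cases p) (auto simp: tot_def pr_def zero_fun_apply)
qed

lemma tot_sum_pr:
  assumes "x \<in> tot Q M"
  shows "x = (\<Sum>v\<in>verts Q. pr v x)"
  using assms finite_verts
  by (auto simp: fun_ops pr_def tot_def)

lemma tot_app: "app Q M N f x \<in> tot Q N"
  by (auto simp: app_def tot_def split: if_splits)

lemma app_unitf:
  assumes "v \<in> verts Q" "r < rdim N v" "c < rdim M v"
  shows "app Q M N f (unitf v c) (v, r) = f v $$ (r, c)"
  using assms by (simp add: app_def unitf_def if_distrib[where f = "\<lambda>x. _ * x"] cong: if_cong)

lemma rep_hom_mhom:
  assumes "is_rep Q M" "is_rep Q N" "rep_hom Q M N f"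
  shows "mhom Q M N (app Q M N f)"
proof -
  have "app Q M N f (act Q M a x) = act Q N a (app Q M N f x)" if a: "a \<in> arcs Q" for a x
  proof
    fix p :: "'v \<times> nat"
    obtain v r where p: "p = (v, r)" by force
    let ?h = "head Q a" and ?t = "tail Q a"
    note vs = tail_verts[OF a] head_verts[OF a]
    have car: "rmap M a \<in> carrier_mat (rdim M ?h) (rdim M ?t)"
      "rmap N a \<in> carrier_mat (rdim N ?h) (rdim N ?t)"
      "f ?h \<in> carrier_mat (rdim N ?h) (rdim M ?h)" "f ?t \<in> carrier_mat (rdim N ?t) (rdim M ?t)"
      and eq: "f ?h * rmap M a = rmap N a * f ?t"
      using assms a vs by (auto simp: is_rep_def rep_hom_def)
    show "app Q M N f (act Q M a x) p = act Q N a (app Q M N f x) p"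
    proof (cases "v = ?h \<and> r < rdim N v")
      case True
      have "app Q M N f (act Q M a x) p =
          (\<Sum>c<rdim M ?h. \<Sum>d<rdim M ?t. f ?h $$ (r, c) * rmap M a $$ (c, d) * x (?t, d))"
        using True vs by (auto simp: p app_def act_def sum_distrib_left mult.assoc)
      also have "\<dots> = (\<Sum>d<rdim M ?t. (\<Sum>c<rdim M ?h. f ?h $$ (r, c) * rmap M a $$ (c, d)) * x (?t, d))"
        by (subst sum.swap) (simp add: sum_distrib_right)
      also have "\<dots> = (\<Sum>d<rdim M ?t. (\<Sum>c<rdim N ?t. rmap N a $$ (r, c) * f ?t $$ (c, d)) * x (?t, d))"
        using True car eq by (intro sum.cong) (auto simp flip: mat_times_index)
      also have "\<dots> = (\<Sum>c<rdim N ?t. \<Sum>d<rdim M ?t. rmap N a $$ (r, c) * f ?t $$ (c, d) * x (?t, d))"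
        by (subst sum.swap) (simp add: sum_distrib_right)
      also have "\<dots> = act Q N a (app Q M N f x) p"
        using True vs by (auto simp: p app_def act_def sum_distrib_left mult.assoc)
      finally show ?thesis .
    next
      case False
      then show ?thesis by (cases "v = ?h") (auto simp: p app_def act_def)
    qed
  qed
  moreover have "app Q M N f (pr v x) = pr v (app Q M N f x)" for v x
    by (auto simp: fun_ops app_def pr_def)
  moreover have "app Q M N f (x + y) = app Q M N f x + app Q M N f y" for x y
    by (auto simp: fun_ops app_def algebra_simps sum.distrib)
  moreover have "app Q M N f (c *\<^sub>F x) = c *\<^sub>F app Q M N f x" for c x
    by (auto simp: fun_ops app_def algebra_simps sum_distrib_left)
  ultimately show ?thesis
    by (simp add: mhom_def tot_app)
qed

text \<open>The columns of the matrices are the images of the unit vectors. Compatibility with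
  \<open>pr\<close> makes the image of a unit vector at \<open>v\<close> vanish away from
  \<open>v\<close>, so one block per vertex determines the map.\<close>

lemma mhom_rep_hom:
  assumes "is_rep Q M" "is_rep Q N" "mhom Q M N F"
  obtains f where "rep_hom Q M N f" "\<And>x. x \<in> tot Q M \<Longrightarrow> app Q M N f x = F x"
proof -
  define f where "f v = mat (rdim N v) (rdim M v) (\<lambda>(r, c). F (unitf v c) (v, r))" for v
  have app: "app Q M N f x = F x" if x: "x \<in> tot Q M" for x
  proof
    fix p :: "'v \<times> nat"
    obtain u r where p: "p = (u, r)" by force
    show "app Q M N f x p = F x p"
    proof (cases "u \<in> verts Q \<and> r < rdim N u")
      case True
      have "F x = (\<Sum>v\<in>verts Q. \<Sum>c<rdim M v. x (v, c) *\<^sub>F F (unitf v c))"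
        by (subst tot_expand[OF x], subst mhom_sum[OF assms(3)], (auto intro!: tot_intros)[1],
            rule sum.cong[OF refl], subst mhom_sum[OF assms(3)])
          (auto intro!: tot_intros sum.cong mhomD(3)[OF assms(3)])
      then have "F x p = (\<Sum>v\<in>verts Q. \<Sum>c<rdim M v. x (v, c) * F (unitf v c) p)"
        by (simp add: sum_fun_apply smul_apply)
      also have "\<dots> = (\<Sum>v\<in>verts Q. if v = u then \<Sum>c<rdim M v. x (v, c) * F (unitf v c) p else 0)"
      proof (intro sum.cong refl)
        fix v assume v: "v \<in> verts Q"
        have "F (unitf v c) p = 0" if "v \<noteq> u" "c < rdim M v" for c
        proof -
          have "unitf v c = pr v (unitf v c)" by (auto simp: unitf_def pr_def fun_ops)
          then have "F (unitf v c) = pr v (F (unitf v c))"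
            using mhomD(4)[OF assms(3) v tot_unitf[OF v that(2)]] by metis
          then show ?thesis using that by (metis (mono_tags, lifting) p pr_def case_prod_conv)
        qed
        then show "(\<Sum>c<rdim M v. x (v, c) * F (unitf v c) p) =
            (if v = u then \<Sum>c<rdim M v. x (v, c) * F (unitf v c) p else 0)"
          by (auto intro!: sum.neutral)
      qed
      also have "\<dots> = app Q M N f x p"
        using True finite_verts by (auto simp: p app_def f_def intro!: sum.cong)
      finally show ?thesis by simp
    next
      case False
      then show ?thesis using mhomD(1)[OF assms(3) x] by (auto simp: p app_def tot_def)
    qed
  qed
  have "rep_hom Q M N f"
    unfolding rep_hom_def
  proof (intro conjI ballI)
    fix a assume a: "a \<in> arcs Q"
    let ?h = "head Q a" and ?t = "tail Q a"
    note vs = tail_verts[OF a] head_verts[OF a]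
    have car: "rmap M a \<in> carrier_mat (rdim M ?h) (rdim M ?t)"
      "rmap N a \<in> carrier_mat (rdim N ?h) (rdim N ?t)"
      "f ?h \<in> carrier_mat (rdim N ?h) (rdim M ?h)" "f ?t \<in> carrier_mat (rdim N ?t) (rdim M ?t)"
      using assms a vs by (auto simp: is_rep_def f_def)
    show "f ?h * rmap M a = rmap N a * f ?t"
    proof (rule eq_matI)
      fix r d assume "r < dim_row (rmap N a * f ?t)" "d < dim_col (rmap N a * f ?t)"
      then have rd: "r < rdim N ?h" "d < rdim M ?t" using car by auto
      have actu: "act Q M a (unitf ?t d) (?h, c) = rmap M a $$ (c, d)" if "c < rdim M ?h" for c
        using that rd by (simp add: act_def unitf_def if_distrib[where f = "\<lambda>x. _ * x"] cong: if_cong)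
      have "(f ?h * rmap M a) $$ (r, d) = app Q M N f (act Q M a (unitf ?t d)) (?h, r)"
        using car rd vs by (simp add: mat_times_index actu app_def del: index_mult_mat)
      also have "\<dots> = act Q N a (app Q M N f (unitf ?t d)) (?h, r)"
        using vs rd a by (simp add: app tot_unitf tot_act mhomD(5)[OF assms(3)])
      also have "\<dots> = (rmap N a * f ?t) $$ (r, d)"
        using car rd vs by (simp add: mat_times_index act_def app_unitf del: index_mult_mat)
      finally show "(f ?h * rmap M a) $$ (r, d) = (rmap N a * f ?t) $$ (r, d)" .
    qed (use car in auto)
  qed (simp add: f_def)
  with app that show thesis by blast
qed

lemma app_comp:
  assumes "\<And>v. v \<in> verts Q \<Longrightarrow> f v \<in> carrier_mat (rdim N v) (rdim M v)"
    and "\<And>v. v \<in> verts Q \<Longrightarrow> g v \<in> carrier_mat (rdim L v) (rdim N v)"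
  shows "app Q M L (\<lambda>v. g v * f v) x = app Q N L g (app Q M N f x)"
proof
  fix p :: "'v \<times> nat"
  obtain v r where p: "p = (v, r)" by force
  show "app Q M L (\<lambda>v. g v * f v) x p = app Q N L g (app Q M N f x) p"
  proof (cases "v \<in> verts Q \<and> r < rdim L v")
    case True
    have "app Q M L (\<lambda>v. g v * f v) x p =
        (\<Sum>d<rdim M v. \<Sum>c<rdim N v. g v $$ (r, c) * f v $$ (c, d) * x (v, d))"
      using True assms[of v]
      by (simp add: p app_def mat_times_index sum_distrib_right mult.assoc del: index_mult_mat)
    also have "\<dots> = app Q N L g (app Q M N f x) p"
      using True by (subst sum.swap) (simp add: p app_def sum_distrib_left mult.assoc)
    finally show ?thesis .
  qed (auto simp: p app_def)
qed

lemma app_one: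
  assumes "x \<in> tot Q M" "\<And>v. v \<in> verts Q \<Longrightarrow> f v = 1\<^sub>m (rdim M v)"
  shows "app Q M M f x = x"
  using assms by (auto simp: app_def fun_ops tot_def if_distrib[where f = "\<lambda>y. y * _"] cong: if_cong)

lemma app_inject:
  assumes "f v \<in> carrier_mat (rdim N v) (rdim M v)" "g v \<in> carrier_mat (rdim N v) (rdim M v)"
    and "v \<in> verts Q" "\<And>x. x \<in> tot Q M \<Longrightarrow> app Q M N f x = app Q M N g x"
  shows "f v = g v"
proof (rule eq_matI)
  fix r c assume "r < dim_row (g v)" "c < dim_col (g v)"
  then have rc: "r < rdim N v" "c < rdim M v" using assms by auto
  show "f v $$ (r, c) = g v $$ (r, c)"
    using app_unitf[OF assms(3) rc, of f] app_unitf[OF assms(3) rc, of g]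
      assms(4)[OF tot_unitf[of v Q c M]] assms(3) rc by simp
qed (use assms in auto)

lemma app_inverse:
  assumes "\<And>v. v \<in> verts Q \<Longrightarrow> f v \<in> carrier_mat (rdim N v) (rdim M v)"
    and "\<And>v. v \<in> verts Q \<Longrightarrow> g v \<in> carrier_mat (rdim M v) (rdim N v)"
    and "\<And>x. x \<in> tot Q M \<Longrightarrow> app Q N M g (app Q M N f x) = x" and v: "v \<in> verts Q"
  shows "g v * f v = 1\<^sub>m (rdim M v)"
proof -
  have "app Q M M (\<lambda>v. g v * f v) x = app Q M M (\<lambda>v. 1\<^sub>m (rdim M v)) x" if "x \<in> tot Q M" for x
    using app_comp[of f N M g M x, OF assms(1,2)] assms(3)[OF that] app_one[OF that] by simp
  then show ?thesis
    using app_inject[of "\<lambda>v. g v * f v" v M M "\<lambda>v. 1\<^sub>m (rdim M v)"]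
      mult_carrier_mat[OF assms(2,1)[OF v]] v by auto
qed

lemma mhom_inverse:
  assumes F: "mhom Q M N F" and bij: "bij_betw F (tot Q M) (tot Q N)"
  obtains G where "mhom Q N M G" "\<And>x. x \<in> tot Q M \<Longrightarrow> G (F x) = x"
    "\<And>y. y \<in> tot Q N \<Longrightarrow> F (G y) = y"
proof -
  define G where "G = inv_into (tot Q M) F"
  have GF: "G (F x) = x" if "x \<in> tot Q M" for x
    using bij that by (simp add: G_def bij_betw_def)
  have FG: "F (G y) = y" "G y \<in> tot Q M" if "y \<in> tot Q N" for y
    using bij that by (auto simp: G_def bij_betw_def intro: inv_into_into) (metis f_inv_into_f)
  have "G y = x" if "y = F x" "x \<in> tot Q M" for x y
    using GF that by simp
  note Geq = this
  have "mhom Q N M G"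
    unfolding mhom_def using FG
    by (auto intro!: Geq tot_intros tot_act simp: mhomD[OF F] tot_act)
  with GF FG(1) that show thesis by blast
qed

definition miso where
  "miso M N F \<longleftrightarrow> mhom Q M N F \<and> bij_betw F (tot Q M) (tot Q N)"

lemma misoI:
  assumes "mhom Q M N F" "mhom Q N M G" "\<And>x. x \<in> tot Q M \<Longrightarrow> G (F x) = x"
    "\<And>y. y \<in> tot Q N \<Longrightarrow> F (G y) = y"
  shows "miso M N F"
  unfolding miso_def using assms mhomD(1)[OF assms(1)] mhomD(1)[OF assms(2)]
  by (auto intro!: bij_betw_byWitness[where f' = G])

text \<open>Lets a bijection of total spaces stand for a pair of mutually inverse matrix families;
  the inverse homomorphism for the way back comes from \<open>mhom_inverse\<close>.\<close>

lemma rep_iso_iff: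
  assumes "is_rep Q M" "is_rep Q N"
  shows "rep_iso Q M N \<longleftrightarrow> (\<exists>F. miso M N F)"
proof
  assume "rep_iso Q M N"
  then obtain f g where fg: "rep_hom Q M N f" "rep_hom Q N M g"
    "\<And>v. v \<in> verts Q \<Longrightarrow> g v * f v = 1\<^sub>m (rdim M v)" "\<And>v. v \<in> verts Q \<Longrightarrow> f v * g v = 1\<^sub>m (rdim N v)"
    unfolding rep_iso_def by blast
  have car: "f v \<in> carrier_mat (rdim N v) (rdim M v)" "g v \<in> carrier_mat (rdim M v) (rdim N v)"
    if "v \<in> verts Q" for v using fg(1,2) that by (auto simp: rep_hom_def)
  have "miso M N (app Q M N f)"
  proof (rule misoI)
    show "mhom Q M N (app Q M N f)" "mhom Q N M (app Q N M g)"
      using assms fg rep_hom_mhom by blast+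
    show "app Q N M g (app Q M N f x) = x" if "x \<in> tot Q M" for x
      by (subst app_comp[symmetric]) (use car fg that in \<open>auto intro!: app_one\<close>)
    show "app Q M N f (app Q N M g x) = x" if "x \<in> tot Q N" for x
      by (subst app_comp[symmetric]) (use car fg that in \<open>auto intro!: app_one\<close>)
  qed
  then show "\<exists>F. miso M N F" by blast
next
  assume "\<exists>F. miso M N F"
  then obtain F where F: "mhom Q M N F" "bij_betw F (tot Q M) (tot Q N)"
    unfolding miso_def by blast
  obtain G where G: "mhom Q N M G" "\<And>x. x \<in> tot Q M \<Longrightarrow> G (F x) = x"
    "\<And>y. y \<in> tot Q N \<Longrightarrow> F (G y) = y"
    using mhom_inverse[OF F] by blast
  obtain f where f: "rep_hom Q M N f" "\<And>x. x \<in> tot Q M \<Longrightarrow> app Q M N f x = F x"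
    using mhom_rep_hom[OF assms F(1)] by blast
  obtain g where g: "rep_hom Q N M g" "\<And>x. x \<in> tot Q N \<Longrightarrow> app Q N M g x = G x"
    using mhom_rep_hom[OF assms(2,1) G(1)] by blast
  have car: "f v \<in> carrier_mat (rdim N v) (rdim M v)" "g v \<in> carrier_mat (rdim M v) (rdim N v)"
    if "v \<in> verts Q" for v using f(1) g(1) that by (auto simp: rep_hom_def)
  have "app Q N M g (app Q M N f x) = x" if "x \<in> tot Q M" for x
    using f(2)[OF that] g(2)[OF mhomD(1)[OF F(1) that]] G(2)[OF that] by simp
  from app_inverse[OF car this] have "g v * f v = 1\<^sub>m (rdim M v)" if v: "v \<in> verts Q" for v
    using that by blast
  moreover have "app Q M N f (app Q N M g x) = x" if "x \<in> tot Q N" for x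
    using g(2)[OF that] f(2)[OF mhomD(1)[OF G(1) that]] G(3)[OF that] by simp
  from app_inverse[OF car(2,1) this] have "f v * g v = 1\<^sub>m (rdim N v)" if v: "v \<in> verts Q" for v
    using that by blast
  ultimately show "rep_iso Q M N" unfolding rep_iso_def using f g by blast
qed

lemma miso_id: "miso M M (\<lambda>x. x)"
  by (auto simp: miso_def mhom_id bij_betw_def)

lemma miso_comp: "miso M N F \<Longrightarrow> miso N L G \<Longrightarrow> miso M L (\<lambda>x. G (F x))"
  unfolding miso_def using mhom_comp bij_betw_trans[of F _ _ G] by (auto simp: comp_def)

lemma splits_iff:
  assumes "is_rep Q E" "is_rep Q M" "rep_hom Q E M g"
  shows "splits Q E g M \<longleftrightarrow> (\<exists>S. mhom Q M E S \<and> (\<forall>x\<in>tot Q M. app Q E M g (S x) = x))"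
proof
  assume "splits Q E g M"
  then obtain s where s: "rep_hom Q M E s" "\<And>v. v \<in> verts Q \<Longrightarrow> g v * s v = 1\<^sub>m (rdim M v)"
    unfolding splits_def by blast
  have "app Q E M g (app Q M E s x) = x" if "x \<in> tot Q M" for x
    by (subst app_comp[symmetric]) (use assms s that in \<open>auto simp: rep_hom_def intro!: app_one\<close>)
  then show "\<exists>S. mhom Q M E S \<and> (\<forall>x\<in>tot Q M. app Q E M g (S x) = x)"
    using rep_hom_mhom[OF assms(2,1) s(1)] by blast
next
  assume "\<exists>S. mhom Q M E S \<and> (\<forall>x\<in>tot Q M. app Q E M g (S x) = x)"
  then obtain S where S: "mhom Q M E S" "\<And>x. x \<in> tot Q M \<Longrightarrow> app Q E M g (S x) = x" by blast
  obtain s where s: "rep_hom Q M E s" "\<And>x. x \<in> tot Q M \<Longrightarrow> app Q M E s x = S x"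
    using mhom_rep_hom[OF assms(2,1) S(1)] by blast
  have car: "s v \<in> carrier_mat (rdim E v) (rdim M v)" "g v \<in> carrier_mat (rdim M v) (rdim E v)"
    if "v \<in> verts Q" for v using s(1) assms(3) that by (auto simp: rep_hom_def)
  have "app Q E M g (app Q M E s x) = x" if "x \<in> tot Q M" for x
    using s(2)[OF that] S(2)[OF that] by simp
  from app_inverse[OF car this] have "g v * s v = 1\<^sub>m (rdim M v)" if v: "v \<in> verts Q" for v
    using that by blast
  then show "splits Q E g M" unfolding splits_def using s by blast
qed

section \<open>Short exact sequences on total spaces\<close>

definition exact :: "('v, 'a, 'k::field) rep \<Rightarrow> (('v, 'k) tvec \<Rightarrow> ('v, 'k) tvec) \<Rightarrow>
    ('v, 'a, 'k) rep \<Rightarrow> (('v, 'k) tvec \<Rightarrow> ('v, 'k) tvec) \<Rightarrow> ('v, 'a, 'k) rep \<Rightarrow> bool" where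
  "exact N F E G M \<longleftrightarrow> mhom Q N E F \<and> mhom Q E M G \<and> inj_on F (tot Q N) \<and>
     F ` tot Q N = {y \<in> tot Q E. G y = 0} \<and> G ` tot Q E = tot Q M"

text \<open>Carries a vector of the space at one vertex into the total space: the definition of
  exactness speaks of \<open>vec\<close>, the later arguments of coordinate functions.\<close>

definition emb :: "('v, 'a, 'k::field) rep \<Rightarrow> 'v \<Rightarrow> 'k vec \<Rightarrow> ('v, 'k) tvec" where
  "emb M v x = (\<lambda>(u, r). if u = v \<and> r < rdim M v then x $ r else 0)"

lemma tot_emb: "v \<in> verts Q \<Longrightarrow> emb M v x \<in> tot Q M"
  by (auto simp: emb_def tot_def split: if_splits)

lemma emb_inj: "x \<in> carrier_vec (rdim M v) \<Longrightarrow> y \<in> carrier_vec (rdim M v) \<Longrightarrow>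
    emb M v x = emb M v y \<longleftrightarrow> x = y"
proof
  assume a: "x \<in> carrier_vec (rdim M v)" "y \<in> carrier_vec (rdim M v)" "emb M v x = emb M v y"
  have "x $ i = y $ i" if "i < rdim M v" for i
    using fun_cong[OF a(3), of "(v, i)"] that by (simp add: emb_def)
  then show "x = y" using a by auto
qed simp

lemma emb_surj: "pr v x = x \<Longrightarrow> x \<in> tot Q M \<Longrightarrow> x = emb M v (vec (rdim M v) (\<lambda>r. x (v, r)))"
proof
  fix p assume a: "pr v x = x" "x \<in> tot Q M"
  show "x p = emb M v (vec (rdim M v) (\<lambda>r. x (v, r))) p"
    using a(2) fun_cong[OF a(1), of p] by (cases p) (auto simp: emb_def pr_def tot_def split: if_splits)
qed

lemma pr_emb: "pr v (emb M v x) = emb M v x"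
  by (auto simp: emb_def pr_def fun_ops)

lemma app_emb:
  assumes "f v \<in> carrier_mat (rdim N v) (rdim M v)" "x \<in> carrier_vec (rdim M v)" "v \<in> verts Q"
  shows "app Q M N f (emb M v x) = emb N v (f v *\<^sub>v x)"
proof
  fix p :: "'v \<times> nat"
  obtain u r where p: "p = (u, r)" by force
  show "app Q M N f (emb M v x) p = emb N v (f v *\<^sub>v x) p"
    using assms by (cases "u = v")
      (auto simp: p app_def emb_def mat_vec_index simp del: index_mult_mat_vec)
qed

lemma app_emb':
  assumes "f v \<in> carrier_mat (rdim N v) (rdim M v)" "x \<in> tot Q M" "v \<in> verts Q"
  shows "pr v (app Q M N f x) = emb N v (f v *\<^sub>v vec (rdim M v) (\<lambda>r. x (v, r)))"
  using assms by (auto simp: app_def emb_def pr_def fun_ops mat_vec_index simp del: index_mult_mat_vec)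

text \<open>Everything is checked vertex by vertex: \<open>loc\<close> writes each projection of an
  element as an embedded vector, and the preimages found at the single vertices are added
  up.\<close>

lemma short_exact_iff:
  fixes N E M :: "('v, 'a, 'k::field) rep"
  assumes "is_rep Q N" "is_rep Q E" "is_rep Q M" "rep_hom Q N E f" "rep_hom Q E M g"
  shows "short_exact Q N f E g M \<longleftrightarrow> exact N (app Q N E f) E (app Q E M g) M"
proof -
  define F where "F = app Q N E f"
  define G where "G = app Q E M g"
  have F: "mhom Q N E F" and G: "mhom Q E M G"
    using rep_hom_mhom assms by (auto simp: F_def G_def)
  have carf: "f v \<in> carrier_mat (rdim E v) (rdim N v)" if "v \<in> verts Q" for v
    using assms(4) that by (auto simp: rep_hom_def)
  have carg: "g v \<in> carrier_mat (rdim M v) (rdim E v)" if "v \<in> verts Q" for v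
    using assms(5) that by (auto simp: rep_hom_def)
  have Femb: "F (emb N v x) = emb E v (f v *\<^sub>v x)" if "v \<in> verts Q" "x \<in> carrier_vec (rdim N v)" for v x
    using app_emb[of f v E N x, OF carf[OF that(1)] that(2,1)] that by (simp add: F_def)
  have Gemb: "G (emb E v x) = emb M v (g v *\<^sub>v x)" if "v \<in> verts Q" "x \<in> carrier_vec (rdim E v)" for v x
    using app_emb[of g v M E x, OF carg[OF that(1)] that(2,1)] that by (simp add: G_def)
  have emb0: "emb M v (0\<^sub>v (rdim M v)) = 0" for v and M :: "('v, 'a, 'k::field) rep"
    by (auto simp: emb_def fun_ops)
  have cf: "f v *\<^sub>v x \<in> carrier_vec (rdim E v)" if "v \<in> verts Q" "x \<in> carrier_vec (rdim N v)" for v x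
    using carf[OF that(1)] that(2) by simp
  have cg: "g v *\<^sub>v x \<in> carrier_vec (rdim M v)" if "v \<in> verts Q" "x \<in> carrier_vec (rdim E v)" for v x
    using carg[OF that(1)] that(2) by simp
  let ?e = "\<lambda>M v x. vec (rdim M v) (\<lambda>r. x (v, r))"
  have loc: "\<exists>z \<in> carrier_vec (rdim M v). pr v x = emb M v z" if "x \<in> tot Q M" for v x and M :: "('v, 'a, 'k) rep"
    using emb_surj[of v "pr v x" M] that by (intro bexI[of _ "?e M v (pr v x)"]) (auto intro: tot_pr)
  have "exact N F E G M" if se: "short_exact Q N f E g M"
  proof -
    have inj: "inj_on (\<lambda>x. f v *\<^sub>v x) (carrier_vec (rdim N v))"
      and im: "(\<lambda>x. f v *\<^sub>v x) ` carrier_vec (rdim N v) =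
          {y \<in> carrier_vec (rdim E v). g v *\<^sub>v y = 0\<^sub>v (rdim M v)}"
      and sur: "(\<lambda>y. g v *\<^sub>v y) ` carrier_vec (rdim E v) = carrier_vec (rdim M v)"
      if "v \<in> verts Q" for v
      using se that by (auto simp: short_exact_def)
    have injF: "inj_on F (tot Q N)"
    proof (rule inj_onI)
      fix x y assume xy: "x \<in> tot Q N" "y \<in> tot Q N" "F x = F y"
      have "x - y = 0"
      proof (rule tot_eqI)
        show "x - y \<in> tot Q N" using xy by (auto intro: tot_intros)
        fix v assume v: "v \<in> verts Q"
        obtain z where z: "z \<in> carrier_vec (rdim N v)" "pr v (x - y) = emb N v z"
          using loc[OF tot_diff[OF xy(1,2)]] by blast
        have "F (pr v (x - y)) = 0"
          using mhomD(4)[OF F v tot_diff[OF xy(1,2)]] mhom_diff[OF F xy(1,2)] xy(3) by simp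
        then have "emb E v (f v *\<^sub>v z) = emb E v (0\<^sub>v (rdim E v))"
          using Femb[OF v z(1)] z(2) emb0 by metis
        then have "f v *\<^sub>v z = 0\<^sub>v (rdim E v)"
          using emb_inj[OF cf[OF v z(1)]] by simp
        also have "\<dots> = f v *\<^sub>v 0\<^sub>v (rdim N v)" using carf[OF v] by (auto intro!: eq_vecI)
        finally have "z = 0\<^sub>v (rdim N v)" using inj[OF v] z(1) by (auto dest: inj_onD)
        then show "pr v (x - y) = 0" using z(2) emb0 by metis
      qed
      then show "x = y" by simp
    qed
    have GF: "G (F x) = 0" if x: "x \<in> tot Q N" for x
    proof (rule tot_eqI)
      show "G (F x) \<in> tot Q M" using x mhomD(1) F G by blast
      fix v assume v: "v \<in> verts Q"
      obtain z where z: "z \<in> carrier_vec (rdim N v)" "pr v x = emb N v z" using loc[OF x] by blast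
      have "pr v (G (F x)) = G (F (pr v x))"
        using mhomD(1,4)[OF F] mhomD(4)[OF G] x v by simp
      also have "\<dots> = emb M v (g v *\<^sub>v (f v *\<^sub>v z))" using z Femb Gemb v cf by simp
      also have "g v *\<^sub>v (f v *\<^sub>v z) = 0\<^sub>v (rdim M v)" using im[OF v] z(1) by blast
      finally show "pr v (G (F x)) = 0" using emb0 by metis
    qed
    have ker: "y \<in> F ` tot Q N" if y: "y \<in> tot Q E" "G y = 0" for y
    proof -
      have "\<exists>x \<in> tot Q N. F x = pr v y" if v: "v \<in> verts Q" for v
      proof -
        obtain z where z: "z \<in> carrier_vec (rdim E v)" "pr v y = emb E v z" using loc[OF y(1)] by blast
        have "G (pr v y) = 0" using mhomD(4)[OF G v y(1)] y(2) by simp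
        then have "emb M v (g v *\<^sub>v z) = emb M v (0\<^sub>v (rdim M v))" using Gemb[OF v z(1)] z(2) emb0 by metis
        then have "g v *\<^sub>v z = 0\<^sub>v (rdim M v)" using emb_inj[OF cg[OF v z(1)]] by simp
        then obtain t where "t \<in> carrier_vec (rdim N v)" "z = f v *\<^sub>v t" using im[OF v] z(1) by blast
        then show ?thesis using Femb[OF v] z(2) tot_emb[OF v] by metis
      qed
      then obtain x where x: "\<And>v. v \<in> verts Q \<Longrightarrow> x v \<in> tot Q N \<and> F (x v) = pr v y" by metis
      have "F (\<Sum>v\<in>verts Q. x v) = (\<Sum>v\<in>verts Q. pr v y)"
        using mhom_sum[OF F, of "verts Q" x] x by simp
      then have "F (\<Sum>v\<in>verts Q. x v) = y" using tot_sum_pr[OF y(1)] by simp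
      moreover have "(\<Sum>v\<in>verts Q. x v) \<in> tot Q N" using x by (auto intro: tot_sum)
      ultimately show ?thesis by blast
    qed
    have surj: "y \<in> G ` tot Q E" if y: "y \<in> tot Q M" for y
    proof -
      have "\<exists>x \<in> tot Q E. G x = pr v y" if v: "v \<in> verts Q" for v
      proof -
        obtain z where z: "z \<in> carrier_vec (rdim M v)" "pr v y = emb M v z" using loc[OF y(1)] by blast
        then obtain t where "t \<in> carrier_vec (rdim E v)" "z = g v *\<^sub>v t" using sur[OF v] by blast
        then show ?thesis using Gemb[OF v] z(2) tot_emb[OF v] by metis
      qed
      then obtain x where x: "\<And>v. v \<in> verts Q \<Longrightarrow> x v \<in> tot Q E \<and> G (x v) = pr v y" by metis
      have "G (\<Sum>v\<in>verts Q. x v) = (\<Sum>v\<in>verts Q. pr v y)"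
        using mhom_sum[OF G, of "verts Q" x] x by simp
      then have "G (\<Sum>v\<in>verts Q. x v) = y" using tot_sum_pr[OF y(1)] by simp
      moreover have "(\<Sum>v\<in>verts Q. x v) \<in> tot Q E" using x by (auto intro: tot_sum)
      ultimately show ?thesis by blast
    qed
    show ?thesis
      unfolding exact_def using F G injF GF ker surj mhomD(1)[OF F] mhomD(1)[OF G] by blast
  qed
  moreover have "short_exact Q N f E g M" if ex: "exact N F E G M"
    unfolding short_exact_def
  proof (intro conjI ballI assms)
    fix v assume v: "v \<in> verts Q"
    show "inj_on (\<lambda>x. f v *\<^sub>v x) (carrier_vec (rdim N v))"
    proof (rule inj_onI)
      fix x y assume xy: "x \<in> carrier_vec (rdim N v)" "y \<in> carrier_vec (rdim N v)" "f v *\<^sub>v x = f v *\<^sub>v y"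
      then have "F (emb N v x) = F (emb N v y)" using Femb v by simp
      then have "emb N v x = emb N v y"
        using ex tot_emb[OF v, of N] unfolding exact_def by (meson inj_onD)
      then show "x = y" using emb_inj xy by blast
    qed
    show "(\<lambda>y. g v *\<^sub>v y) ` carrier_vec (rdim E v) = carrier_vec (rdim M v)"
    proof (intro equalityI subsetI)
      fix y :: "'k vec" assume y: "y \<in> carrier_vec (rdim M v)"
      have "emb M v y \<in> G ` tot Q E" using ex tot_emb[OF v, of M y] by (simp add: exact_def)
      then obtain x where x: "x \<in> tot Q E" "G x = emb M v y" by auto
      obtain z where z: "z \<in> carrier_vec (rdim E v)" "pr v x = emb E v z" using loc[OF x(1)] by blast
      have "emb M v (g v *\<^sub>v z) = emb M v y"
        using Gemb[OF v z(1)] z(2) mhomD(4)[OF G v x(1)] x(2) pr_emb by metis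
      then have "g v *\<^sub>v z = y" using emb_inj[OF cg[OF v z(1)] y] by simp
      then show "y \<in> (\<lambda>y. g v *\<^sub>v y) ` carrier_vec (rdim E v)" using z by blast
    qed (use cg v in auto)
    show "(\<lambda>x. f v *\<^sub>v x) ` carrier_vec (rdim N v) = {y \<in> carrier_vec (rdim E v). g v *\<^sub>v y = 0\<^sub>v (rdim M v)}"
    proof (intro equalityI subsetI)
      fix y assume "y \<in> (\<lambda>x. f v *\<^sub>v x) ` carrier_vec (rdim N v)"
      then obtain x where x: "x \<in> carrier_vec (rdim N v)" "y = f v *\<^sub>v x" by blast
      have "G (F (emb N v x)) = 0" using ex tot_emb[OF v] by (auto simp: exact_def)
      then have "emb M v (g v *\<^sub>v y) = emb M v (0\<^sub>v (rdim M v))"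
        using Femb[OF v x(1)] Gemb[OF v cf[OF v x(1)]] x emb0 by metis
      then have "g v *\<^sub>v y = 0\<^sub>v (rdim M v)" using emb_inj[OF cg[OF v]] cf[OF v x(1)] x by simp
      then show "y \<in> {y \<in> carrier_vec (rdim E v). g v *\<^sub>v y = 0\<^sub>v (rdim M v)}" using x cf v by simp
    next
      fix y assume "y \<in> {y \<in> carrier_vec (rdim E v). g v *\<^sub>v y = 0\<^sub>v (rdim M v)}"
      then have y: "y \<in> carrier_vec (rdim E v)" "g v *\<^sub>v y = 0\<^sub>v (rdim M v)" by auto
      have "G (emb E v y) = 0" using Gemb[OF v y(1)] y(2) emb0 by metis
      then have "emb E v y \<in> F ` tot Q N" using ex tot_emb[OF v, of E y] by (simp add: exact_def)
      then obtain x where x: "x \<in> tot Q N" "F x = emb E v y" by auto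
      obtain z where z: "z \<in> carrier_vec (rdim N v)" "pr v x = emb N v z" using loc[OF x(1)] by blast
      have "emb E v (f v *\<^sub>v z) = emb E v y"
        using Femb[OF v z(1)] z(2) mhomD(4)[OF F v x(1)] x(2) pr_emb by metis
      then have "f v *\<^sub>v z = y" using emb_inj[OF cf[OF v z(1)] y(1)] by simp
      then show "y \<in> (\<lambda>x. f v *\<^sub>v x) ` carrier_vec (rdim N v)" using z by blast
    qed
  qed
  ultimately show ?thesis unfolding F_def G_def by blast
qed

end

section \<open>Bases and dimensions of subspaces of function spaces\<close>

lemma sum_lessThan_add:
  fixes g :: "nat \<Rightarrow> 'b::comm_monoid_add"
  shows "(\<Sum>c<m + n. g c) = (\<Sum>c<m. g c) + (\<Sum>c<n. g (m + c))"
  by (induction n) (auto simp: add.assoc)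

text \<open>The basis is indexed by the numbers below \<open>n\<close> because the coordinates of a
  representation are numbers; this lets a subspace be turned into a coordinate space in
  \<open>idempotent_split\<close>.\<close>

lemma subspace_basis:
  fixes S :: "('b \<Rightarrow> 'k::field) set"
  assumes S: "0 \<in> S" "\<And>x y. x \<in> S \<Longrightarrow> y \<in> S \<Longrightarrow> x + y \<in> S" "\<And>c x. x \<in> S \<Longrightarrow> c *\<^sub>F x \<in> S"
    and T: "finite T" "S \<subseteq> module.span smul T"
  obtains n :: nat and bs where "\<And>r. r < n \<Longrightarrow> bs r \<in> S" "\<And>x. x \<in> S \<Longrightarrow> \<exists>c. x = (\<Sum>r<n. c r *\<^sub>F bs r)"
    "\<And>c r. (\<Sum>r<n. c r *\<^sub>F bs r) = 0 \<Longrightarrow> r < n \<Longrightarrow> c r = 0"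
proof -
  interpret V: vector_space "smul :: 'k \<Rightarrow> ('b \<Rightarrow> 'k) \<Rightarrow> _" by (rule vector_space_smul)
  obtain B where B: "B \<subseteq> S" "V.independent B" "S \<subseteq> V.span B"
    by (rule V.basis_exists[of S])
  have fin: "finite B"
    by (rule V.independent_span_bound[OF T(1) B(2) order_trans[OF B(1) T(2)], THEN conjunct1])
  obtain f where f: "bij_betw f {0..<card B} B" using ex_bij_betw_nat_finite[OF fin] by blast
  have re: "(\<Sum>r<card B. c r *\<^sub>F f r) = (\<Sum>b\<in>B. c (the_inv_into {0..<card B} f b) *\<^sub>F b)" for c
  proof -
    have "(\<Sum>b\<in>B. c (the_inv_into {0..<card B} f b) *\<^sub>F b) =
        (\<Sum>r\<in>{0..<card B}. c (the_inv_into {0..<card B} f (f r)) *\<^sub>F f r)"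
      by (rule sum.reindex_bij_betw[OF f, symmetric])
    also have "\<dots> = (\<Sum>r<card B. c r *\<^sub>F f r)"
      using f by (auto simp: the_inv_into_f_f bij_betw_def atLeast0LessThan intro!: sum.cong)
    finally show ?thesis by simp
  qed
  show thesis
  proof (rule that[of "card B" f])
    show "f r \<in> S" if "r < card B" for r
      using f that B(1) by (auto simp: bij_betw_def)
    fix x assume "x \<in> S"
    then have "x \<in> V.span B" using B(3) by (simp add: subset_iff)
    then have "\<exists>u. x = (\<Sum>b\<in>B. u b *\<^sub>F b)"
      by (simp only: V.span_finite[OF fin] image_iff UNIV_I bex_simps)
    then obtain u where "x = (\<Sum>b\<in>B. u b *\<^sub>F b)" ..
    also have "\<dots> = (\<Sum>r<card B. u (f r) *\<^sub>F f r)"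
      using sum.reindex_bij_betw[OF f, of "\<lambda>b. u b *\<^sub>F b"] by (simp add: atLeast0LessThan)
    finally show "\<exists>c. x = (\<Sum>r<card B. c r *\<^sub>F f r)" by (rule exI[of _ "\<lambda>r. u (f r)"])
  next
    fix c r assume c: "(\<Sum>r<card B. c r *\<^sub>F f r) = 0" and r: "r < card B"
    have "c (the_inv_into {0..<card B} f (f r)) = 0"
    proof (rule V.independentD[OF B(2) fin subset_refl, of "\<lambda>b. c (the_inv_into {0..<card B} f b)" "f r"])
      show "(\<Sum>b\<in>B. c (the_inv_into {0..<card B} f b) *\<^sub>F b) = 0" using c re by simp
      show "f r \<in> B" using f r by (auto simp: bij_betw_def)
    qed
    then show "c r = 0" using f r by (simp add: the_inv_into_f_f bij_betw_def)
  qed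
qed

definition is_sub :: "('b \<Rightarrow> 'k::field) set \<Rightarrow> bool" where
  "is_sub S \<longleftrightarrow> 0 \<in> S \<and> (\<forall>x\<in>S. \<forall>y\<in>S. x + y \<in> S) \<and> (\<forall>c. \<forall>x\<in>S. c *\<^sub>F x \<in> S)"

text \<open>The ambient function spaces are infinite-dimensional in general, hence the explicit finite
  spanning set \<open>T\<close>.\<close>

lemma sub_dim_less:
  fixes S S' :: "('b \<Rightarrow> 'k::field) set"
  assumes S: "is_sub S" and T: "finite T" "S' \<subseteq> module.span smul T" and lt: "S \<subset> S'"
  shows "vector_space.dim smul S < vector_space.dim smul S'"
    and "vector_space.dim smul S' \<le> card T"
proof -
  interpret V: vector_space "smul :: 'k \<Rightarrow> ('b \<Rightarrow> 'k) \<Rightarrow> _" by (rule vector_space_smul)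
  obtain B where B: "B \<subseteq> S" "V.independent B" "S \<subseteq> V.span B" "card B = V.dim S"
    by (rule V.basis_exists[of S])
  have "V.subspace S" using S by (auto simp: is_sub_def V.subspace_def)
  then have sp: "V.span B \<subseteq> S" using B(1) by (intro V.span_minimal)
  obtain x where x: "x \<in> S'" "x \<notin> S" using lt by blast
  have "x \<notin> V.span B" using x(2) sp by (rule contra_subsetD[rotated])
  then have ind: "V.independent (insert x B)" using B(2) V.independent_insert[of x B] by (simp split: if_splits)
  have "insert x B \<subseteq> S'" using x(1) B(1) lt by auto
  then obtain B' where B': "insert x B \<subseteq> B'" "B' \<subseteq> S'" "V.independent B'" "S' \<subseteq> V.span B'"
    using ind by (rule V.maximal_independent_subset_extend)
  have fin: "finite B' \<and> card B' \<le> card T"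
    by (rule V.independent_span_bound[OF T(1) B'(3) order_trans[OF B'(2) T(2)]])
  have dim: "card B' = V.dim S'" using V.basis_card_eq_dim[OF B'(2,4,3)] .
  have "B \<subset> B'" using B'(1) x(2) B(1) by auto
  then show "V.dim S < V.dim S'" using psubset_card_mono[of B' B] fin dim B(4) by simp
  show "V.dim S' \<le> card T" using dim fin by simp
qed

section \<open>Modules over quadratic monomial relations, biproducts and finite direct sums\<close>

locale bound_quiver = finite_quiver Q for Q :: "('v, 'a) pre_digraph" +
  fixes R :: "'a \<Rightarrow> 'a \<Rightarrow> bool"
begin

text \<open>Stands in for \<open>A_module\<close>: only paths of length two are required to vanish,
  and only those marked by \<open>R\<close>. That this suffices for gentle algebras is the content
  of \<open>A_module_amod\<close>.\<close>

definition amod :: "('v, 'a, 'k::field) rep \<Rightarrow> bool" where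
  "amod M \<longleftrightarrow> is_rep Q M \<and> (\<forall>a\<in>arcs Q. \<forall>b\<in>arcs Q. head Q a = tail Q b \<and> R a b \<longrightarrow>
     (\<forall>x\<in>tot Q M. act Q M b (act Q M a x) = 0))"

definition indec :: "('v, 'a, 'k::field) rep \<Rightarrow> bool" where
  "indec M \<longleftrightarrow> amod M \<and> \<not> is_zero_rep Q M \<and>
     (\<forall>X Y. amod X \<and> amod Y \<and> rep_iso Q M (dsum Q X Y) \<longrightarrow> is_zero_rep Q X \<or> is_zero_rep Q Y)"

lemma amod_rep [simp]: "amod M \<Longrightarrow> is_rep Q M"
  by (simp add: amod_def)

lemma is_zero_rep_iff:
  fixes M :: "('v, 'a, 'k::field) rep"
  shows "is_zero_rep Q M \<longleftrightarrow> tot Q M = {0}"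
proof
  assume "is_zero_rep Q M"
  then show "tot Q M = {0}" by (force simp: is_zero_rep_def tot_def fun_ops)
next
  assume a: "tot Q M = {0}"
  show "is_zero_rep Q M"
    unfolding is_zero_rep_def
  proof (intro ballI, rule ccontr)
    fix v assume v: "v \<in> verts Q" "rdim M v \<noteq> 0"
    then have "unitf v 0 = (0 :: ('v, 'k) tvec)" using tot_unitf[of v Q 0 M] a by auto
    then have "unitf v 0 (v, 0) = (0 :: 'k)" by (simp add: zero_fun_apply)
    then show False by (simp add: unitf_def)
  qed
qed

text \<open>Relations can be tested after an injective map, so they pass to submodules. This is how
  the images of idempotents are recognised as modules.\<close>

lemma amod_embed:
  assumes M: "amod M" and N: "is_rep Q N" and F: "mhom Q N M F" and inj: "inj_on F (tot Q N)"
  shows "amod N"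
  unfolding amod_def
proof (intro conjI ballI impI N)
  fix a b x assume ab: "a \<in> arcs Q" "b \<in> arcs Q" "head Q a = tail Q b \<and> R a b" "x \<in> tot Q N"
  have "F (act Q N b (act Q N a x)) = act Q M b (act Q M a (F x))"
    using ab by (simp add: mhomD(5)[OF F] tot_act)
  also have "\<dots> = F 0"
    using M ab mhomD(1)[OF F] mhom_0[OF F] by (auto simp: amod_def)
  finally show "act Q N b (act Q N a x) = 0"
    using inj_onD[OF inj] tot_act[OF ab(2)] tot_0 by blast
qed

lemma miso_sym:
  assumes "miso M N F"
  shows "\<exists>G. miso N M G \<and> (\<forall>x\<in>tot Q M. G (F x) = x) \<and> (\<forall>y\<in>tot Q N. F (G y) = y)"
proof -
  obtain G where G: "mhom Q N M G" "\<And>x. x \<in> tot Q M \<Longrightarrow> G (F x) = x"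
    "\<And>y. y \<in> tot Q N \<Longrightarrow> F (G y) = y"
    using mhom_inverse assms unfolding miso_def by metis
  then have "miso N M G" using assms by (intro misoI[of N M G F]) (auto simp: miso_def)
  then show ?thesis using G by blast
qed

text \<open>Characterises a direct sum by its inclusions and projections, so that block matrices
  have to be opened only in \<open>act_dsum\<close>.\<close>

definition biprod where
  "biprod T X Y i1 p1 i2 p2 \<longleftrightarrow> mhom Q X T i1 \<and> mhom Q T X p1 \<and> mhom Q Y T i2 \<and> mhom Q T Y p2 \<and>
     (\<forall>x\<in>tot Q X. p1 (i1 x) = x \<and> p2 (i1 x) = 0) \<and> (\<forall>y\<in>tot Q Y. p2 (i2 y) = y \<and> p1 (i2 y) = 0) \<and>
     (\<forall>t\<in>tot Q T. i1 (p1 t) + i2 (p2 t) = t)"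

lemma is_rep_dsum: "is_rep Q M \<Longrightarrow> is_rep Q N \<Longrightarrow> is_rep Q (dsum Q M N)"
  by (auto simp: is_rep_def dsum_def)

text \<open>In \<open>dsum\<close> the coordinates of the first summand come first. Its inclusion is
  therefore the identity on coordinate functions, and only the two projections and the second
  inclusion need names.\<close>

definition dp1 where "dp1 M x = (\<lambda>(v, r). if r < rdim M v then x (v, r) else 0)"
definition di2 where "di2 M x = (\<lambda>(v, r). if r < rdim M v then 0 else x (v, r - rdim M v))"
definition dp2 where "dp2 M x = (\<lambda>(v, r). x (v, r + rdim M v))"

lemma act_dsum:
  assumes "is_rep Q M" "is_rep Q N" "a \<in> arcs Q"
  shows "act Q (dsum Q M N) a x = act Q M a (dp1 M x) + di2 M (act Q N a (dp2 M x))"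
proof
  fix p :: "'v \<times> nat"
  obtain v r where p: "p = (v, r)" by force
  let ?h = "head Q a" and ?t = "tail Q a"
  have car: "rmap M a \<in> carrier_mat (rdim M ?h) (rdim M ?t)"
    "rmap N a \<in> carrier_mat (rdim N ?h) (rdim N ?t)"
    using assms by (auto simp: is_rep_def)
  consider "v \<noteq> ?h" | "v = ?h" "r < rdim M v" | "v = ?h" "rdim M v \<le> r" "r < rdim M v + rdim N v"
    | "v = ?h" "r \<ge> rdim M v + rdim N v" by linarith
  then show "act Q (dsum Q M N) a x p = (act Q M a (dp1 M x) + di2 M (act Q N a (dp2 M x))) p"
    by cases (use car in \<open>auto simp: p act_def dsum_def dp1_def dp2_def di2_def plus_fun_apply
      sum_lessThan_add add.commute intro!: sum.cong\<close>)
qed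

lemma biprod_dsum:
  fixes M N :: "('v, 'a, 'k::field) rep"
  assumes "is_rep Q M" "is_rep Q N"
  shows "biprod (dsum Q M N) M N (\<lambda>x. x) (dp1 M) (di2 M) (dp2 M)"
proof -
  have t1: "dp1 M x \<in> tot Q M" if "x \<in> tot Q (dsum Q M N)" for x
    using that by (auto simp: tot_def dp1_def split: if_splits)
  have t2: "dp2 M x \<in> tot Q N" if "x \<in> tot Q (dsum Q M N)" for x
    using that by (force simp: tot_def dp2_def dsum_def)
  have t3: "x \<in> tot Q (dsum Q M N)" if "x \<in> tot Q M" for x
    using that by (force simp: tot_def dsum_def)
  have t4: "di2 M x \<in> tot Q (dsum Q M N)" if "x \<in> tot Q N" for x
    using that by (force simp: tot_def di2_def dsum_def split: if_splits)
  have a1: "dp1 M x = x" "dp2 M x = 0" if "x \<in> tot Q M" for x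
    using that by (force simp: tot_def dp1_def dp2_def fun_ops)+
  have a2: "dp2 M (di2 M x) = x" "dp1 M (di2 M x) = 0" for x
    by (auto simp: di2_def dp1_def dp2_def fun_ops)
  have a3: "dp1 M x + di2 M (dp2 M x) = x" for x :: "('v, 'k) tvec"
    by (auto simp: di2_def dp1_def dp2_def fun_ops)
  have lin: "dp1 M (x + y) = dp1 M x + dp1 M y" "dp2 M (x + y) = dp2 M x + dp2 M y"
    "di2 M (x + y) = di2 M x + di2 M y" "dp1 M (c *\<^sub>F x) = c *\<^sub>F dp1 M x"
    "dp2 M (c *\<^sub>F x) = c *\<^sub>F dp2 M x" "di2 M (c *\<^sub>F x) = c *\<^sub>F di2 M x"
    "dp1 M (pr v x) = pr v (dp1 M x)" "dp2 M (pr v x) = pr v (dp2 M x)" "di2 M (pr v x) = pr v (di2 M x)"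
    "di2 M 0 = 0"
    for x y :: "('v, 'k) tvec" and c v
    by (auto simp: di2_def dp1_def dp2_def pr_def fun_ops)
  show ?thesis
    unfolding biprod_def mhom_def
    using t1 t2 t3 t4 a1 a2 a3
    by (simp add: lin act_dsum[OF assms] a1 a2 tot_act)
qed

lemma biprod_iso:
  assumes "biprod T X Y i1 p1 i2 p2" "biprod T' X Y j1 q1 j2 q2"
  shows "\<exists>F. miso T T' F"
proof (intro exI)
  have b: "mhom Q X T i1" "mhom Q T X p1" "mhom Q Y T i2" "mhom Q T Y p2"
    "mhom Q X T' j1" "mhom Q T' X q1" "mhom Q Y T' j2" "mhom Q T' Y q2"
    using assms by (auto simp: biprod_def)
  have *: "i1 (q1 (j1 (p1 x) + j2 (p2 x))) + i2 (q2 (j1 (p1 x) + j2 (p2 x))) = x"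
    if "x \<in> tot Q T" and a: "biprod T X Y i1 p1 i2 p2" "biprod T' X Y j1 q1 j2 q2"
    for T T' i1 p1 i2 p2 j1 q1 j2 q2 x
  proof -
    have m: "mhom Q X T' j1" "mhom Q T' X q1" "mhom Q Y T' j2" "mhom Q T' Y q2"
      "p1 x \<in> tot Q X" "p2 x \<in> tot Q Y"
      using a that(1) by (auto simp: biprod_def mhom_def)
    then have "q1 (j1 (p1 x) + j2 (p2 x)) = p1 x" "q2 (j1 (p1 x) + j2 (p2 x)) = p2 x"
      using a by (simp_all add: biprod_def mhomD(2)[OF m(2)] mhomD(2)[OF m(4)] mhomD(1)[OF m(1)] mhomD(1)[OF m(3)])
    then show ?thesis using a that(1) by (simp add: biprod_def)
  qed
  show "miso T T' (\<lambda>x. j1 (p1 x) + j2 (p2 x))"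
    by (rule misoI[where G = "\<lambda>x. i1 (q1 x) + i2 (q2 x)"])
      (simp_all add: mhom_add[OF mhom_comp[OF b(2,5)] mhom_comp[OF b(4,7)]]
        mhom_add[OF mhom_comp[OF b(6,1)] mhom_comp[OF b(8,3)]] *[OF _ assms] *[OF _ assms(2,1)])
qed

lemma biprod_transport:
  assumes "biprod T X Y i1 p1 i2 p2" "miso T' T F"
  shows "\<exists>i1 p1 i2 p2. biprod T' X Y i1 p1 i2 p2"
proof -
  obtain G where G: "miso T T' G" "\<And>x. x \<in> tot Q T' \<Longrightarrow> G (F x) = x" "\<And>y. y \<in> tot Q T \<Longrightarrow> F (G y) = y"
    using miso_sym[OF assms(2)] by blast
  have h: "mhom Q T' T F" "mhom Q T T' G" using assms(2) G(1) by (auto simp: miso_def)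
  have b: "mhom Q X T i1" "mhom Q T X p1" "mhom Q Y T i2" "mhom Q T Y p2"
    using assms by (auto simp: biprod_def)
  have "biprod T' X Y (\<lambda>x. G (i1 x)) (\<lambda>t. p1 (F t)) (\<lambda>x. G (i2 x)) (\<lambda>t. p2 (F t))"
    unfolding biprod_def
  proof (intro conjI ballI)
    fix t assume t: "t \<in> tot Q T'"
    have "G (i1 (p1 (F t))) + G (i2 (p2 (F t))) = G (i1 (p1 (F t)) + i2 (p2 (F t)))"
      using t mhomD(1)[OF h(1)] mhomD(1)[OF b(1)] mhomD(1)[OF b(2)] mhomD(1)[OF b(3)] mhomD(1)[OF b(4)]
      by (intro mhomD(2)[OF h(2), symmetric]) auto
    also have "\<dots> = t" using assms(1) G(2) mhomD(1)[OF h(1)] t by (simp add: biprod_def)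
    finally show "G (i1 (p1 (F t))) + G (i2 (p2 (F t))) = t" .
  qed (use assms(1) G(3) mhomD(1)[OF b(1)] mhomD(1)[OF b(3)] in
      \<open>auto simp: biprod_def intro: mhom_comp[OF b(1) h(2)] mhom_comp[OF b(3) h(2)] mhom_comp[OF h(1) b(2)]
        mhom_comp[OF h(1) b(4)]\<close>)
  then show ?thesis by blast
qed

lemma rep_iso_dsum_iff:
  assumes "is_rep Q T" "is_rep Q X" "is_rep Q Y"
  shows "rep_iso Q T (dsum Q X Y) \<longleftrightarrow> (\<exists>i1 p1 i2 p2. biprod T X Y i1 p1 i2 p2)"
proof -
  note bp = biprod_dsum[OF assms(2,3)]
  show ?thesis
    unfolding rep_iso_iff[OF assms(1) is_rep_dsum[OF assms(2,3)]]
    using biprod_transport[OF bp] biprod_iso[OF _ bp] by blast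
qed

lemma amod_biprod:
  assumes "biprod T X Y i1 p1 i2 p2" "is_rep Q T" "amod X" "amod Y"
  shows "amod T"
  unfolding amod_def
proof (intro conjI ballI impI assms(2))
  fix a b t assume ab: "a \<in> arcs Q" "b \<in> arcs Q" "head Q a = tail Q b \<and> R a b" "t \<in> tot Q T"
  have h: "mhom Q X T i1" "mhom Q T X p1" "mhom Q Y T i2" "mhom Q T Y p2"
    using assms by (auto simp: biprod_def)
  let ?s = "act Q T b (act Q T a t)"
  have "p1 ?s = 0" "p2 ?s = 0"
    using ab assms(3,4) mhomD(1)[OF h(2)] mhomD(1)[OF h(4)]
    by (simp_all add: mhomD(5)[OF h(2)] mhomD(5)[OF h(4)] tot_act amod_def)
  then show "?s = 0"
    using assms(1) tot_act[OF ab(2)] mhom_0[OF h(1)] mhom_0[OF h(3)] unfolding biprod_def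
    by (metis add.right_neutral)
qed

lemma amod_dsum: "amod X \<Longrightarrow> amod Y \<Longrightarrow> amod (dsum Q X Y)"
  using amod_biprod[OF biprod_dsum] is_rep_dsum amod_rep by blast

text \<open>The analogue of \<open>biprod\<close> for a finite list, indexed by positions so that a
  summand may be repeated.\<close>

definition sys where
  "sys T Ms ii pp \<longleftrightarrow>
     (\<forall>k<length Ms. mhom Q (Ms ! k) T (ii k) \<and> mhom Q T (Ms ! k) (pp k)) \<and>
     (\<forall>k<length Ms. \<forall>l<length Ms. \<forall>x\<in>tot Q (Ms ! l). pp k (ii l x) = (if k = l then x else 0)) \<and>
     (\<forall>t\<in>tot Q T. t = (\<Sum>k<length Ms. ii k (pp k t)))"

lemma sysD:
  assumes "sys T Ms ii pp"
  shows "k < length Ms \<Longrightarrow> mhom Q (Ms ! k) T (ii k)" "k < length Ms \<Longrightarrow> mhom Q T (Ms ! k) (pp k)"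
    "k < length Ms \<Longrightarrow> l < length Ms \<Longrightarrow> x \<in> tot Q (Ms ! l) \<Longrightarrow> pp k (ii l x) = (if k = l then x else 0)"
    "t \<in> tot Q T \<Longrightarrow> t = (\<Sum>k<length Ms. ii k (pp k t))"
  using assms unfolding sys_def by blast+

lemma sys_Cons:
  assumes bp: "biprod T X Y i1 p1 i2 p2" and sy: "sys Y Ms ii pp"
  shows "sys T (X # Ms) (case_nat i1 (\<lambda>k x. i2 (ii k x))) (case_nat p1 (\<lambda>k t. pp k (p2 t)))"
proof -
  have h: "mhom Q X T i1" "mhom Q T X p1" "mhom Q Y T i2" "mhom Q T Y p2"
    using bp by (auto simp: biprod_def)
  show ?thesis
    unfolding sys_def
  proof (intro conjI allI impI ballI)
    fix k assume k: "k < length (X # Ms)"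
    show "mhom Q ((X # Ms) ! k) T (case_nat i1 (\<lambda>k x. i2 (ii k x)) k)"
      using k h mhom_comp[OF sysD(1)[OF sy] h(3)] by (cases k) simp_all
    show "mhom Q T ((X # Ms) ! k) (case_nat p1 (\<lambda>k t. pp k (p2 t)) k)"
      using k h mhom_comp[OF h(4) sysD(2)[OF sy]] by (cases k) simp_all
  next
    fix k l x assume kl: "k < length (X # Ms)" "l < length (X # Ms)" "x \<in> tot Q ((X # Ms) ! l)"
    show "case_nat p1 (\<lambda>k t. pp k (p2 t)) k (case_nat i1 (\<lambda>k x. i2 (ii k x)) l x) = (if k = l then x else 0)"
    proof (cases l)
      case 0
      then show ?thesis using kl bp mhom_0[OF sysD(2)[OF sy]] by (cases k) (simp_all add: biprod_def)
    next
      case (Suc l')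
      then have l': "l' < length Ms" "x \<in> tot Q (Ms ! l')" using kl by auto
      show ?thesis using Suc l' kl bp mhomD(1)[OF sysD(1)[OF sy l'(1)] l'(2)] sysD(3)[OF sy _ l']
        by (cases k) (simp_all add: biprod_def)
    qed
  next
    fix t assume t: "t \<in> tot Q T"
    then have "t = i1 (p1 t) + i2 (p2 t)" using bp by (simp add: biprod_def)
    also have "i2 (p2 t) = i2 (\<Sum>k<length Ms. ii k (pp k (p2 t)))"
      using sysD(4)[OF sy mhomD(1)[OF h(4) t]] by simp
    also have "\<dots> = (\<Sum>k<length Ms. i2 (ii k (pp k (p2 t))))"
      using mhomD(1)[OF sysD(1)[OF sy]] mhomD(1)[OF sysD(2)[OF sy]] mhomD(1)[OF h(4) t]
      by (intro mhom_sum[OF h(3)]) auto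
    also have "i1 (p1 t) + \<dots> =
        (\<Sum>k<length (X # Ms). case_nat i1 (\<lambda>k x. i2 (ii k x)) k (case_nat p1 (\<lambda>k t. pp k (p2 t)) k t))"
      by (simp only: length_Cons sum.lessThan_Suc_shift old.nat.case)
    finally show "t = (\<Sum>k<length (X # Ms). case_nat i1 (\<lambda>k x. i2 (ii k x)) k (case_nat p1 (\<lambda>k t. pp k (p2 t)) k t))" .
  qed
qed

lemma sys_dsum_list:
  fixes Ms :: "('v, 'a, 'k::field) rep list"
  assumes "\<forall>M\<in>set Ms. is_rep Q M"
  shows "is_rep Q (dsum_list Q Ms) \<and> (\<exists>ii pp. sys (dsum_list Q Ms) Ms ii pp)"
  using assms
proof (induction Ms)
  case Nil
  have "is_zero_rep Q (zero_rep :: ('v, 'a, 'k) rep)" by (simp add: is_zero_rep_def zero_rep_def)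
  then have "tot Q (zero_rep :: ('v, 'a, 'k) rep) = {0}" using is_zero_rep_iff by blast
  then show ?case by (auto simp: dsum_list_def is_rep_def sys_def) (auto simp: zero_rep_def)
next
  case (Cons M Ms)
  have [simp]: "dsum_list Q (M # Ms) = dsum Q M (dsum_list Q Ms)" by (simp add: dsum_list_def)
  obtain ii pp where ip: "sys (dsum_list Q Ms) Ms ii pp" and r: "is_rep Q (dsum_list Q Ms)" "is_rep Q M"
    using Cons by auto
  show ?case using sys_Cons[OF biprod_dsum[OF r(2,1)] ip] is_rep_dsum[OF r(2,1)] by auto
qed

lemma sys_comp:
  assumes a: "sys T Ms ii pp" and b: "sys T' Ms jj qq" and t: "t \<in> tot Q T"
  shows "(\<Sum>k<length Ms. ii k (qq k (\<Sum>l<length Ms. jj l (pp l t)))) = t"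
proof -
  have "qq k (\<Sum>l<length Ms. jj l (pp l t)) = pp k t" if k: "k < length Ms" for k
  proof -
    have "qq k (\<Sum>l<length Ms. jj l (pp l t)) = (\<Sum>l<length Ms. qq k (jj l (pp l t)))"
      using mhomD(1)[OF sysD(1)[OF b]] mhomD(1)[OF sysD(2)[OF a] t]
      by (intro mhom_sum[OF sysD(2)[OF b k]]) auto
    also have "\<dots> = (\<Sum>l<length Ms. if k = l then pp l t else 0)"
      using sysD(3)[OF b k] mhomD(1)[OF sysD(2)[OF a] t] by (intro sum.cong) auto
    also have "\<dots> = pp k t" using k by simp
    finally show ?thesis .
  qed
  then show ?thesis using sysD(4)[OF a t] by simp
qed

lemma sys_iso:
  assumes a: "sys T Ms ii pp" and b: "sys T' Ms jj qq"
  shows "miso T T' (\<lambda>t. \<Sum>k<length Ms. jj k (pp k t))"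
proof (rule misoI[where G = "\<lambda>t. \<Sum>k<length Ms. ii k (qq k t)"])
  show "mhom Q T T' (\<lambda>t. \<Sum>k<length Ms. jj k (pp k t))"
    by (rule mhom_sum_fun, rule mhom_comp[OF sysD(2)[OF a] sysD(1)[OF b]]) auto
  show "mhom Q T' T (\<lambda>t. \<Sum>k<length Ms. ii k (qq k t))"
    by (rule mhom_sum_fun, rule mhom_comp[OF sysD(2)[OF b] sysD(1)[OF a]]) auto
qed (simp_all add: sys_comp[OF a b] sys_comp[OF b a])

lemma sys_transport:
  assumes sy: "sys T Ms ii pp" and F: "miso T' T F"
  shows "\<exists>ii pp. sys T' Ms ii pp"
proof -
  obtain G where G: "miso T T' G" "\<And>x. x \<in> tot Q T' \<Longrightarrow> G (F x) = x" "\<And>y. y \<in> tot Q T \<Longrightarrow> F (G y) = y"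
    using miso_sym[OF F] by blast
  have h: "mhom Q T' T F" "mhom Q T T' G" using F G(1) by (auto simp: miso_def)
  have "sys T' Ms (\<lambda>k x. G (ii k x)) (\<lambda>k t. pp k (F t))"
    unfolding sys_def
  proof (intro conjI allI impI ballI)
    fix t assume t: "t \<in> tot Q T'"
    have "t = G (\<Sum>k<length Ms. ii k (pp k (F t)))"
      using sysD(4)[OF sy mhomD(1)[OF h(1) t]] G(2)[OF t] by simp
    also have "\<dots> = (\<Sum>k<length Ms. G (ii k (pp k (F t))))"
      using mhomD(1)[OF sysD(1)[OF sy]] mhomD(1)[OF sysD(2)[OF sy]] mhomD(1)[OF h(1) t]
      by (intro mhom_sum[OF h(2)]) auto
    finally show "t = (\<Sum>k<length Ms. G (ii k (pp k (F t))))" .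
  next
    fix k assume "k < length Ms"
    then show "mhom Q (Ms ! k) T' (\<lambda>x. G (ii k x))" "mhom Q T' (Ms ! k) (\<lambda>t. pp k (F t))"
      using mhom_comp[OF sysD(1)[OF sy] h(2)] mhom_comp[OF h(1) sysD(2)[OF sy]] by blast+
  next
    fix k l x assume kl: "k < length Ms" "l < length Ms" "x \<in> tot Q (Ms ! l)"
    then show "pp k (F (G (ii l x))) = (if k = l then x else 0)"
      using sysD(3)[OF sy kl] G(3)[OF mhomD(1)[OF sysD(1)[OF sy kl(2)] kl(3)]] by simp
  qed
  then show ?thesis by blast
qed

lemma rep_iso_dsum_list_iff:
  assumes "is_rep Q T" "\<forall>M\<in>set Ms. is_rep Q M"
  shows "rep_iso Q T (dsum_list Q Ms) \<longleftrightarrow> (\<exists>ii pp. sys T Ms ii pp)"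
proof -
  obtain ii pp where r: "is_rep Q (dsum_list Q Ms)" and sy: "sys (dsum_list Q Ms) Ms ii pp"
    using sys_dsum_list[OF assms(2)] by blast
  show ?thesis
    unfolding rep_iso_iff[OF assms(1) r] using sys_transport[OF sy] sys_iso[OF _ sy] by blast
qed

text \<open>The mirror image of \<open>sys_Cons\<close>. In \<open>dsum Q T L\<close> the new
  summand stands on the right; appending it leaves the indices of the old summands
  unchanged.\<close>

lemma sys_snoc:
  assumes bp: "biprod T X Y i1 p1 i2 p2" and sy: "sys X Ms ii pp"
  shows "sys T (Ms @ [Y]) (\<lambda>k x. if k < length Ms then i1 (ii k x) else i2 x)
    (\<lambda>k t. if k < length Ms then pp k (p1 t) else p2 t)"
proof -
  have h: "mhom Q X T i1" "mhom Q T X p1" "mhom Q Y T i2" "mhom Q T Y p2"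
    using bp by (auto simp: biprod_def)
  show ?thesis
    unfolding sys_def
  proof (intro conjI allI impI ballI)
    fix k assume k: "k < length (Ms @ [Y])"
    show "mhom Q ((Ms @ [Y]) ! k) T (\<lambda>x. if k < length Ms then i1 (ii k x) else i2 x)"
      using k h mhom_comp[OF sysD(1)[OF sy] h(1)] by (cases "k < length Ms") (simp_all add: nth_append)
    show "mhom Q T ((Ms @ [Y]) ! k) (\<lambda>t. if k < length Ms then pp k (p1 t) else p2 t)"
      using k h mhom_comp[OF h(2) sysD(2)[OF sy]] by (cases "k < length Ms") (simp_all add: nth_append)
  next
    fix k l x assume kl: "k < length (Ms @ [Y])" "l < length (Ms @ [Y])" "x \<in> tot Q ((Ms @ [Y]) ! l)"
    show "(if k < length Ms then pp k (p1 (if l < length Ms then i1 (ii l x) else i2 x))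
        else p2 (if l < length Ms then i1 (ii l x) else i2 x)) = (if k = l then x else 0)"
    proof (cases "l < length Ms")
      case True
      then have l': "x \<in> tot Q (Ms ! l)" using kl by (simp add: nth_append)
      show ?thesis using True l' kl bp mhomD(1)[OF sysD(1)[OF sy True] l'] sysD(3)[OF sy _ True l']
        by (cases "k < length Ms") (simp_all add: biprod_def)
    next
      case False
      then have "l = length Ms" "x \<in> tot Q Y" using kl by (simp_all add: nth_append)
      then show ?thesis using kl bp mhom_0[OF sysD(2)[OF sy]]
        by (cases "k < length Ms") (simp_all add: biprod_def)
    qed
  next
    fix t assume t: "t \<in> tot Q T"
    then have "t = i1 (p1 t) + i2 (p2 t)" using bp by (simp add: biprod_def)
    also have "i1 (p1 t) = i1 (\<Sum>k<length Ms. ii k (pp k (p1 t)))"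
      using sysD(4)[OF sy mhomD(1)[OF h(2) t]] by simp
    also have "\<dots> = (\<Sum>k<length Ms. i1 (ii k (pp k (p1 t))))"
      using mhomD(1)[OF sysD(1)[OF sy]] mhomD(1)[OF sysD(2)[OF sy]] mhomD(1)[OF h(2) t]
      by (intro mhom_sum[OF h(1)]) auto
    finally show "t = (\<Sum>k<length (Ms @ [Y]). if k < length Ms
        then i1 (ii k (if k < length Ms then pp k (p1 t) else p2 t))
        else i2 (if k < length Ms then pp k (p1 t) else p2 t))" by simp
  qed
qed

end

section \<open>Splitting idempotents; summands and indecomposability\<close>

context bound_quiver
begin

lemma mhom_factor:
  assumes inc: "mhom Q X M \<iota>" "inj_on \<iota> (tot Q X)" and e: "mhom Q N M e"
    and p: "\<And>y. y \<in> tot Q N \<Longrightarrow> p y \<in> tot Q X" "\<And>y. y \<in> tot Q N \<Longrightarrow> \<iota> (p y) = e y"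
  shows "mhom Q N X p"
proof -
  have eq: "x = y" if "\<iota> x = \<iota> y" "x \<in> tot Q X" "y \<in> tot Q X" for x y
    using inc(2) that by (auto dest: inj_onD)
  show ?thesis
    unfolding mhom_def
  proof (intro conjI ballI allI p(1))
    fix x assume x: "x \<in> tot Q N"
    show "p (c *\<^sub>F x) = c *\<^sub>F p x" for c
      by (rule eq) (use x in \<open>simp_all add: p mhomD(3)[OF inc(1)] mhomD(3)[OF e] tot_intros\<close>)
    show "p (pr v x) = pr v (p x)" if "v \<in> verts Q" for v
      by (rule eq) (use x that in \<open>simp_all add: p mhomD(4)[OF inc(1)] mhomD(4)[OF e] tot_intros\<close>)
    show "p (act Q N a x) = act Q X a (p x)" if "a \<in> arcs Q" for a
      by (rule eq) (use x that in \<open>simp_all add: p mhomD(5)[OF inc(1)] mhomD(5)[OF e] tot_act\<close>)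
    show "p (x + y) = p x + p y" if "y \<in> tot Q N" for y
      by (rule eq) (use x that in \<open>simp_all add: p mhomD(2)[OF inc(1)] mhomD(2)[OF e] tot_intros\<close>)
  qed
qed

text \<open>The image of \<open>e\<close> is a graded subspace stable under the arrows, but a
  representation must consist of coordinate spaces. So a basis of its part at each vertex is chosen,
  and the arrows act by the coefficients in these bases.\<close>

lemma idempotent_split:
  fixes M :: "('v, 'a, 'k::field) rep"
  assumes M: "is_rep Q M" and e: "mhom Q M M e" "\<And>x. x \<in> tot Q M \<Longrightarrow> e (e x) = e x"
  obtains X \<iota> \<pi> where "is_rep Q X" "mhom Q X M \<iota>" "mhom Q M X \<pi>"
    "\<And>x. x \<in> tot Q X \<Longrightarrow> \<pi> (\<iota> x) = x" "\<And>y. y \<in> tot Q M \<Longrightarrow> \<iota> (\<pi> y) = e y"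
proof -
  interpret V: vector_space "smul :: 'k \<Rightarrow> ('v, 'k) tvec \<Rightarrow> _" by (rule vector_space_smul)
  define S where "S v = {x \<in> tot Q M. pr v x = x \<and> e x = x}" for v
  define P where "P v n bs \<longleftrightarrow> (\<forall>r<n. bs r \<in> S v) \<and> (\<forall>x\<in>S v. \<exists>c. x = (\<Sum>r<n. c r *\<^sub>F bs r)) \<and>
      (\<forall>c. (\<Sum>r<n. c r *\<^sub>F bs r) = 0 \<longrightarrow> (\<forall>r<n. c r = 0))" for v and n :: nat and bs
  have ex: "\<exists>n bs. P v n bs" for v
  proof (rule subspace_basis[of "S v" "(\<lambda>(v, c). unitf v c) ` (SIGMA v:verts Q. {..<rdim M v})"])
    show "finite ((\<lambda>(v, c). unitf v c :: ('v, 'k) tvec) ` (SIGMA v:verts Q. {..<rdim M v}))"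
      using finite_verts by auto
    show "S v \<subseteq> V.span ((\<lambda>(v, c). unitf v c) ` (SIGMA v:verts Q. {..<rdim M v}))"
    proof
      fix x assume "x \<in> S v"
      then have "x = (\<Sum>v\<in>verts Q. \<Sum>c<rdim M v. x (v, c) *\<^sub>F unitf v c)"
        by (intro tot_expand) (simp add: S_def)
      also have "\<dots> \<in> V.span ((\<lambda>(v, c). unitf v c) ` (SIGMA v:verts Q. {..<rdim M v}))"
        by (intro V.span_sum V.span_scale V.span_base) (auto intro!: image_eqI[where x = "(_, _)"])
      finally show "x \<in> V.span ((\<lambda>(v, c). unitf v c) ` (SIGMA v:verts Q. {..<rdim M v}))" .
    qed
  next
    fix n :: nat and bs
    assume "\<And>r. r < n \<Longrightarrow> bs r \<in> S v" "\<And>x. x \<in> S v \<Longrightarrow> \<exists>c. x = (\<Sum>r<n. c r *\<^sub>F bs r)"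
      "\<And>c r. (\<Sum>r<n. c r *\<^sub>F bs r) = 0 \<Longrightarrow> r < n \<Longrightarrow> c r = 0"
    then have "P v n bs" unfolding P_def by blast
    then show ?thesis by blast
  qed (auto simp: S_def tot_intros mhomD[OF e(1)] mhom_0[OF e(1)])
  define n where "n v = (SOME n. \<exists>bs. P v n bs)" for v
  define bs where "bs v = (SOME bs. P v (n v) bs)" for v
  have P: "P v (n v) (bs v)" for v
    unfolding bs_def n_def by (rule someI_ex[OF someI_ex[OF ex]])
  have bs: "\<And>v r. r < n v \<Longrightarrow> bs v r \<in> S v"
    and span: "\<And>v x. x \<in> S v \<Longrightarrow> \<exists>c. x = (\<Sum>r<n v. c r *\<^sub>F bs v r)"
    using P unfolding P_def by blast+
  have ind: "c r = 0" if "(\<Sum>r<n v. c r *\<^sub>F bs v r) = 0" "r < n v" for v c r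
    using P[of v] that unfolding P_def by blast
  define cf where "cf v x = (SOME c. x = (\<Sum>r<n v. c r *\<^sub>F bs v r))" for v x
  have cf: "x = (\<Sum>r<n v. cf v x r *\<^sub>F bs v r)" if "x \<in> S v" for v x
    using someI_ex[OF span[OF that]] by (simp add: cf_def)
  have bs_tot: "bs v r \<in> tot Q M" "pr u (bs v r) = (if u = v then bs v r else 0)" "e (bs v r) = bs v r"
    if "r < n v" for u v r
  proof -
    have *: "bs v r \<in> tot Q M" "pr v (bs v r) = bs v r" "e (bs v r) = bs v r"
      using bs[OF that] by (auto simp: S_def)
    show "bs v r \<in> tot Q M" "e (bs v r) = bs v r" by fact+
    show "pr u (bs v r) = (if u = v then bs v r else 0)"
      using pr_simps(6)[of u v "bs v r"] *(2) by (simp split: if_splits)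
  qed
  have eS: "e (pr v y) \<in> S v" if "v \<in> verts Q" "y \<in> tot Q M" for v y
    using that e(2) by (simp add: S_def tot_intros mhomD[OF e(1)])
  have actS: "act Q M a x \<in> S (head Q a)" if "a \<in> arcs Q" "x \<in> tot Q M" "e x = x" for a x
    using that mhomD(5)[OF e(1) that(1,2)] by (simp add: S_def tot_act pr_act)
  define X :: "('v, 'a, 'k) rep" where
    "X = \<lparr>rdim = n, rmap = (\<lambda>a. mat (n (head Q a)) (n (tail Q a))
       (\<lambda>(r, c). cf (head Q a) (act Q M a (bs (tail Q a) c)) r))\<rparr>"
  define \<iota> where "\<iota> z = (\<Sum>v\<in>verts Q. \<Sum>r<n v. z (v, r) *\<^sub>F bs v r)" for z :: "('v, 'k) tvec"
  define \<pi> :: "('v, 'k) tvec \<Rightarrow> ('v, 'k) tvec" where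
    "\<pi> y = (\<lambda>(v, r). if v \<in> verts Q \<and> r < n v then cf v (e (pr v y)) r else 0)" for y
  have X: "is_rep Q X" by (simp add: is_rep_def X_def)
  have \<iota>_tot: "\<iota> z \<in> tot Q M" for z
    using bs_tot by (auto simp: \<iota>_def intro!: tot_intros)
  have pr\<iota>: "pr v (\<iota> z) = (\<Sum>r<n v. z (v, r) *\<^sub>F bs v r)" if "v \<in> verts Q" for v z
  proof -
    have "pr v (\<iota> z) = (\<Sum>u\<in>verts Q. if u = v then \<Sum>r<n v. z (v, r) *\<^sub>F bs v r else 0)"
      unfolding \<iota>_def pr_sum by (intro sum.cong refl) (auto simp: bs_tot)
    then show ?thesis using that finite_verts by simp
  qed
  have \<iota>_pr: "\<iota> (pr v z) = (\<Sum>r<n v. z (v, r) *\<^sub>F bs v r)" if "v \<in> verts Q" for v z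
  proof -
    have "\<iota> (pr v z) = (\<Sum>u\<in>verts Q. if u = v then \<Sum>r<n v. z (v, r) *\<^sub>F bs v r else 0)"
      unfolding \<iota>_def by (intro sum.cong refl) (auto simp: pr_def intro!: sum.neutral)
    then show ?thesis using that finite_verts by simp
  qed
  have \<iota>: "mhom Q X M \<iota>"
    unfolding mhom_def
  proof (intro conjI ballI allI)
    show "\<iota> z \<in> tot Q M" for z by (rule \<iota>_tot)
    show "\<iota> (x + y) = \<iota> x + \<iota> y" for x y
      by (simp add: \<iota>_def sum.distrib add_smul plus_fun_apply)
    show "\<iota> (c *\<^sub>F x) = c *\<^sub>F \<iota> x" for c x
      by (simp add: \<iota>_def smul_sum smul_apply)
    show "\<iota> (pr v x) = pr v (\<iota> x)" if "v \<in> verts Q" for v x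
      using that by (simp add: pr\<iota> \<iota>_pr)
    fix a x assume a: "a \<in> arcs Q"
    let ?h = "head Q a" and ?t = "tail Q a"
    note vs = tail_verts[OF a] head_verts[OF a]
    have "act Q M a (\<iota> x) = act Q M a (pr ?t (\<iota> x))" by (simp add: act_pr)
    also have "\<dots> = (\<Sum>c<n ?t. x (?t, c) *\<^sub>F act Q M a (bs ?t c))"
      using vs by (simp add: pr\<iota> act_sum)
    also have "\<dots> = (\<Sum>c<n ?t. x (?t, c) *\<^sub>F (\<Sum>r<n ?h. cf ?h (act Q M a (bs ?t c)) r *\<^sub>F bs ?h r))"
      using a bs_tot by (intro sum.cong refl) (simp flip: cf[OF actS])
    also have "\<dots> = (\<Sum>r<n ?h. \<Sum>c<n ?t. (x (?t, c) * cf ?h (act Q M a (bs ?t c)) r) *\<^sub>F bs ?h r)"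
      by (subst sum.swap) (simp add: smul_sum)
    also have "\<dots> = (\<Sum>r<n ?h. act Q X a x (?h, r) *\<^sub>F bs ?h r)"
    proof (intro sum.cong refl)
      fix r assume "r \<in> {..<n ?h}"
      then have "act Q X a x (?h, r) = (\<Sum>c<n ?t. x (?t, c) * cf ?h (act Q M a (bs ?t c)) r)"
        by (simp add: act_def X_def mult.commute)
      then show "(\<Sum>c<n ?t. (x (?t, c) * cf ?h (act Q M a (bs ?t c)) r) *\<^sub>F bs ?h r) =
          act Q X a x (?h, r) *\<^sub>F bs ?h r"
        by (simp add: fun_ops sum_distrib_right)
    qed
    also have "\<dots> = \<iota> (pr ?h (act Q X a x))" using vs by (simp add: \<iota>_pr)
    finally show "\<iota> (act Q X a x) = act Q M a (\<iota> x)" by (simp add: pr_act)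
  qed
  have inj: "inj_on \<iota> (tot Q X)"
  proof (rule inj_onI)
    fix x y assume xy: "x \<in> tot Q X" "y \<in> tot Q X" "\<iota> x = \<iota> y"
    have d: "\<iota> (x - y) = 0" "x - y \<in> tot Q X" using mhom_diff[OF \<iota> xy(1,2)] xy by (auto intro: tot_intros)
    have z: "(x - y) (v, r) = 0" if "v \<in> verts Q" "r < n v" for v r
      by (rule ind[of "\<lambda>r. (x - y) (v, r)" v r, OF _ that(2)]) (use pr\<iota>[OF that(1), of "x - y"] d in simp)
    have "x - y = 0"
    proof
      fix p show "(x - y) p = 0 p"
        using z d(2) by (cases p) (force simp: tot_def X_def zero_fun_apply)
    qed
    then show "x = y" by simp
  qed
  have \<pi>_tot: "\<pi> y \<in> tot Q X" for y
    by (auto simp: tot_def \<pi>_def X_def split: if_splits)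
  have \<iota>\<pi>: "\<iota> (\<pi> y) = e y" if y: "y \<in> tot Q M" for y
  proof -
    have "\<iota> (\<pi> y) = (\<Sum>v\<in>verts Q. e (pr v y))"
      unfolding \<iota>_def using y by (intro sum.cong refl) (simp add: \<pi>_def flip: cf[OF eS])
    also have "\<dots> = e y"
      using mhom_sum[OF e(1), of "verts Q" "\<lambda>v. pr v y"] y tot_sum_pr[OF y] by (simp add: tot_intros)
    finally show ?thesis .
  qed
  have e\<iota>: "e (\<iota> x) = \<iota> x" for x
  proof -
    have "e (\<iota> x) = (\<Sum>v\<in>verts Q. e (\<Sum>r<n v. x (v, r) *\<^sub>F bs v r))"
      unfolding \<iota>_def by (rule mhom_sum[OF e(1)]) (auto intro!: tot_intros bs_tot)
    also have "\<dots> = \<iota> x"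
      unfolding \<iota>_def
    proof (rule sum.cong[OF refl])
      fix v
      have "e (\<Sum>r<n v. x (v, r) *\<^sub>F bs v r) = (\<Sum>r<n v. e (x (v, r) *\<^sub>F bs v r))"
        by (rule mhom_sum[OF e(1)]) (auto intro!: tot_intros bs_tot)
      also have "\<dots> = (\<Sum>r<n v. x (v, r) *\<^sub>F bs v r)"
        by (intro sum.cong refl) (simp add: mhomD(3)[OF e(1)] bs_tot)
      finally show "e (\<Sum>r<n v. x (v, r) *\<^sub>F bs v r) = (\<Sum>r<n v. x (v, r) *\<^sub>F bs v r)" .
    qed
    finally show ?thesis .
  qed
  have \<pi>\<iota>: "\<pi> (\<iota> x) = x" if "x \<in> tot Q X" for x
    by (rule inj_onD[OF inj]) (use that \<pi>_tot \<iota>\<pi>[OF \<iota>_tot] e\<iota> in auto)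
  show thesis
    by (rule that[OF X \<iota> mhom_factor[OF \<iota> inj e(1) \<pi>_tot \<iota>\<pi>] \<pi>\<iota> \<iota>\<pi>])
qed

definition dsummand where
  "dsummand M T \<longleftrightarrow> amod M \<and> amod T \<and> (\<exists>X. amod X \<and> rep_iso Q T (dsum Q M X))"

text \<open>The complement is the image of the idempotent that sends \<open>x\<close> to
  \<open>x - \<iota> (\<pi> x)\<close>.\<close>

lemma idempotent_biprod:
  assumes M: "is_rep Q M" and \<iota>: "mhom Q X M \<iota>" "mhom Q M X \<pi>" "\<And>x. x \<in> tot Q X \<Longrightarrow> \<pi> (\<iota> x) = x"
  obtains Y j q where "is_rep Q Y" "biprod M X Y \<iota> \<pi> j q"
proof -
  have t: "\<iota> (\<pi> x) \<in> tot Q M" if "x \<in> tot Q M" for x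
    using that mhomD(1) \<iota> by blast
  have d: "mhom Q M M (\<lambda>x. x - \<iota> (\<pi> x))"
    by (intro mhom_minus mhom_id) (rule mhom_comp[OF \<iota>(2,1)])
  have i: "(x - \<iota> (\<pi> x)) - \<iota> (\<pi> (x - \<iota> (\<pi> x))) = x - \<iota> (\<pi> x)" if "x \<in> tot Q M" for x
    using that t \<iota>(3) mhomD(1)[OF \<iota>(2)] by (simp add: mhom_diff[OF \<iota>(2)] mhom_0[OF \<iota>(1)])
  obtain Y j q where Y: "is_rep Q Y" "mhom Q Y M j" "mhom Q M Y q"
    "\<And>x. x \<in> tot Q Y \<Longrightarrow> q (j x) = x" "\<And>y. y \<in> tot Q M \<Longrightarrow> j (q y) = y - \<iota> (\<pi> y)"
    using idempotent_split[OF M d i] by metis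
  have "q (\<iota> x) = 0" if x: "x \<in> tot Q X" for x
  proof -
    have "j (q (\<iota> x)) = 0" using Y(5)[OF mhomD(1)[OF \<iota>(1) x]] \<iota>(3)[OF x] by simp
    then show ?thesis
      using Y(4)[OF mhomD(1)[OF Y(3) mhomD(1)[OF \<iota>(1) x]]] mhom_0[OF Y(3)] by simp
  qed
  moreover have "\<pi> (j y) = 0" if y: "y \<in> tot Q Y" for y
  proof -
    note jy = mhomD(1)[OF Y(2) y]
    have "j y = j y - \<iota> (\<pi> (j y))" using Y(5)[OF jy] Y(4)[OF y] by simp
    then have "\<iota> (\<pi> (j y)) = 0" by simp
    then show ?thesis using \<iota>(3)[OF mhomD(1)[OF \<iota>(2) jy]] mhom_0[OF \<iota>(2)] by simp
  qed
  ultimately have "biprod M X Y \<iota> \<pi> j q"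
    using Y \<iota> by (simp add: biprod_def)
  with Y(1) that show thesis by blast
qed

lemma retract_inj: "(\<And>x. x \<in> A \<Longrightarrow> g (f x) = x) \<Longrightarrow> inj_on f A"
  by (metis inj_onI)

text \<open>Reduces summands to retracts: a section with a retraction can be composed and
  transported, while a complement would have to be constructed anew each time.\<close>

lemma dsummand_iff:
  "dsummand M T \<longleftrightarrow> amod M \<and> amod T \<and>
     (\<exists>\<iota> \<pi>. mhom Q M T \<iota> \<and> mhom Q T M \<pi> \<and> (\<forall>x\<in>tot Q M. \<pi> (\<iota> x) = x))"
proof
  assume "dsummand M T"
  then obtain X where X: "amod M" "amod T" "amod X" "rep_iso Q T (dsum Q M X)" unfolding dsummand_def by blast
  then obtain i1 p1 i2 p2 where "biprod T M X i1 p1 i2 p2"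
    using rep_iso_dsum_iff[of T M X] by auto
  then show "amod M \<and> amod T \<and>
     (\<exists>\<iota> \<pi>. mhom Q M T \<iota> \<and> mhom Q T M \<pi> \<and> (\<forall>x\<in>tot Q M. \<pi> (\<iota> x) = x))"
    using X unfolding biprod_def by blast
next
  assume "amod M \<and> amod T \<and>
     (\<exists>\<iota> \<pi>. mhom Q M T \<iota> \<and> mhom Q T M \<pi> \<and> (\<forall>x\<in>tot Q M. \<pi> (\<iota> x) = x))"
  then obtain \<iota> \<pi> where a: "amod M" "amod T" "mhom Q M T \<iota>" "mhom Q T M \<pi>" "\<And>x. x \<in> tot Q M \<Longrightarrow> \<pi> (\<iota> x) = x"
    by blast
  obtain Y j q where Y: "is_rep Q Y" "biprod T M Y \<iota> \<pi> j q"
    using idempotent_biprod[OF amod_rep[OF a(2)] a(3-5)] by blast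
  have "inj_on j (tot Q Y)" using Y(2) by (intro retract_inj[of _ q]) (auto simp: biprod_def)
  then have "amod Y" using amod_embed[OF a(2) Y(1)] Y(2) unfolding biprod_def by blast
  then show "dsummand M T" using rep_iso_dsum_iff[of T M Y] Y a by (auto simp: dsummand_def)
qed

lemma indec_idempotent:
  assumes M: "indec M" and e: "mhom Q M M e" "\<And>x. x \<in> tot Q M \<Longrightarrow> e (e x) = e x"
  shows "(\<forall>x\<in>tot Q M. e x = 0) \<or> (\<forall>x\<in>tot Q M. e x = x)"
proof -
  have am: "amod M" using M by (simp add: indec_def)
  obtain X \<iota> \<pi> where X: "is_rep Q X" "mhom Q X M \<iota>" "mhom Q M X \<pi>"
    "\<And>x. x \<in> tot Q X \<Longrightarrow> \<pi> (\<iota> x) = x" "\<And>y. y \<in> tot Q M \<Longrightarrow> \<iota> (\<pi> y) = e y"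
    using idempotent_split[OF amod_rep[OF am] e] by metis
  obtain Y j q where Y: "is_rep Q Y" "biprod M X Y \<iota> \<pi> j q"
    using idempotent_biprod[OF amod_rep[OF am] X(2-4)] by blast
  have "amod X" using amod_embed[OF am X(1,2)] retract_inj[of _ \<pi> \<iota>] X(4) by blast
  moreover have "inj_on j (tot Q Y)" using Y(2) by (intro retract_inj[of _ q]) (auto simp: biprod_def)
  then have "amod Y" using amod_embed[OF am Y(1)] Y(2) unfolding biprod_def by blast
  ultimately have "is_zero_rep Q X \<or> is_zero_rep Q Y"
    using M rep_iso_dsum_iff[OF amod_rep[OF am] X(1) Y(1)] Y(2) unfolding indec_def by blast
  then show ?thesis
  proof
    assume "is_zero_rep Q X"
    then have "\<pi> x = 0" if "x \<in> tot Q M" for x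
      using mhomD(1)[OF X(3) that] by (simp add: is_zero_rep_iff)
    then have "e x = 0" if "x \<in> tot Q M" for x
      using X(5)[OF that] mhom_0[OF X(2)] that by simp
    then show ?thesis by blast
  next
    assume "is_zero_rep Q Y"
    then have "q x = 0" if "x \<in> tot Q M" for x
      using mhomD(1)[of Q M Y q x] Y(2) that by (simp add: is_zero_rep_iff biprod_def)
    then have "e x = x" if "x \<in> tot Q M" for x
      using X(5)[OF that] Y(2) mhom_0[of Q Y M j] that unfolding biprod_def by (metis add.right_neutral)
    then show ?thesis by blast
  qed
qed

text \<open>The projection onto the first part of a decomposition is an idempotent; if it is zero or
  the identity, one of the two parts vanishes. The other direction is
  \<open>indec_idempotent\<close>.\<close>

lemma indecI:
  assumes am: "amod M" and nz: "tot Q M \<noteq> {0}"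
    and id: "\<And>e. mhom Q M M e \<Longrightarrow> (\<And>x. x \<in> tot Q M \<Longrightarrow> e (e x) = e x) \<Longrightarrow>
      (\<forall>x\<in>tot Q M. e x = 0) \<or> (\<forall>x\<in>tot Q M. e x = x)"
  shows "indec M"
  unfolding indec_def
proof (intro conjI allI impI am)
  show "\<not> is_zero_rep Q M" using nz by (simp add: is_zero_rep_iff)
  fix X Y :: "('v, 'a, 'b) rep"
  assume XY: "amod X \<and> amod Y \<and> rep_iso Q M (dsum Q X Y)"
  then obtain i1 p1 i2 p2 where bp: "biprod M X Y i1 p1 i2 p2"
    using rep_iso_dsum_iff[of M X Y] am by auto
  then have h: "mhom Q X M i1" "mhom Q M X p1" "mhom Q Y M i2" "mhom Q M Y p2" by (auto simp: biprod_def)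
  have "(\<forall>x\<in>tot Q M. i1 (p1 x) = 0) \<or> (\<forall>x\<in>tot Q M. i1 (p1 x) = x)"
    by (rule id[OF mhom_comp[OF h(2,1)]]) (use bp mhomD(1)[OF h(2)] in \<open>auto simp: biprod_def\<close>)
  then show "is_zero_rep Q X \<or> is_zero_rep Q Y"
  proof
    assume a: "\<forall>x\<in>tot Q M. i1 (p1 x) = 0"
    have "x = 0" if x: "x \<in> tot Q X" for x
    proof -
      have "i1 x = 0" using a bp mhomD(1)[OF h(1) x] x by (auto simp: biprod_def)
      then show ?thesis using bp x mhom_0[OF h(2)] unfolding biprod_def by metis
    qed
    then show ?thesis by (auto simp: is_zero_rep_iff)
  next
    assume a: "\<forall>x\<in>tot Q M. i1 (p1 x) = x"
    have "y = 0" if y: "y \<in> tot Q Y" for y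
    proof -
      have "i2 y = 0"
        using a bp mhomD(1)[OF h(3) y] y mhom_0[OF h(1)] unfolding biprod_def by metis
      then show ?thesis using bp y mhom_0[OF h(4)] unfolding biprod_def by metis
    qed
    then show ?thesis by (auto simp: is_zero_rep_iff)
  qed
qed

section \<open>Fitting's lemma\<close>

lemma mhom_funpow:
  assumes f: "mhom Q M M f"
  shows "mhom Q M M (f ^^ n)"
proof (induction n)
  case 0
  then show ?case using mhom_id by (simp add: id_def)
next
  case (Suc n)
  then show ?case using mhom_comp[OF Suc f] by (simp add: comp_def)
qed

text \<open>The images of the powers descend and their kernels ascend. A strict step changes the
  dimension, which is finite, so both chains contain an equality, and an equality at one step
  propagates to all later ones.\<close>

lemma fitting_exponent:
  fixes M :: "('v, 'a, 'k::field) rep"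
  assumes f: "mhom Q M M f"
  obtains n where "\<And>m. m \<ge> n \<Longrightarrow> (f ^^ m) ` tot Q M = (f ^^ n) ` tot Q M"
    "\<And>m x. m \<ge> n \<Longrightarrow> x \<in> tot Q M \<Longrightarrow> (f ^^ m) x = 0 \<Longrightarrow> (f ^^ n) x = 0"
proof -
  interpret V: vector_space "smul :: 'k \<Rightarrow> ('v, 'k) tvec \<Rightarrow> _" by (rule vector_space_smul)
  define T :: "('v, 'k) tvec set" where "T = (\<lambda>(v, c). unitf v c) ` (SIGMA v:verts Q. {..<rdim M v})"
  have T: "finite T" unfolding T_def using finite_verts by auto
  have TS: "tot Q M \<subseteq> V.span T"
  proof
    fix x assume "x \<in> tot Q M"
    then have "x = (\<Sum>v\<in>verts Q. \<Sum>c<rdim M v. x (v, c) *\<^sub>F unitf v c)"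
      by (rule tot_expand)
    also have "\<dots> \<in> V.span T"
      unfolding T_def
      by (intro V.span_sum V.span_scale V.span_base) (auto intro!: image_eqI[where x = "(_, _)"])
    finally show "x \<in> V.span T" .
  qed
  note fn = mhom_funpow[OF f]
  define I where "I n = (f ^^ n) ` tot Q M" for n
  define K where "K n = {x \<in> tot Q M. (f ^^ n) x = 0}" for n
  have It: "I n \<subseteq> tot Q M" for n using mhomD(1)[OF fn] by (auto simp: I_def)
  have Isub: "is_sub (I n)" for n
    unfolding is_sub_def I_def
  proof (intro conjI ballI allI)
    show "0 \<in> (f ^^ n) ` tot Q M" using mhom_0[OF fn, of n] by (metis imageI tot_0)
    fix x y c assume "x \<in> (f ^^ n) ` tot Q M"
    then obtain x' where x': "x' \<in> tot Q M" "x = (f ^^ n) x'" by auto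
    then show "c *\<^sub>F x \<in> (f ^^ n) ` tot Q M" using mhomD(3)[OF fn, of x' n c] by (metis imageI tot_smul)
    assume "y \<in> (f ^^ n) ` tot Q M"
    then obtain y' where y': "y' \<in> tot Q M" "y = (f ^^ n) y'" by auto
    then show "x + y \<in> (f ^^ n) ` tot Q M" using mhomD(2)[OF fn x'(1) y'(1), of n] x' by (metis imageI tot_add)
  qed
  have Ksub: "is_sub (K n)" for n
    unfolding is_sub_def K_def
    by (auto simp: mhomD(2,3)[OF fn] mhom_0[OF fn] tot_intros)
  have Imon: "I (Suc n) \<subseteq> I n" for n
    unfolding I_def using mhomD(1)[OF f] by (auto simp: funpow_swap1 image_iff)
  have Kmon: "K n \<subseteq> K (Suc n)" for n
    unfolding K_def using mhom_0[OF f] by auto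
  have bound: "V.dim S < V.dim S' \<and> V.dim S' \<le> card T" if "is_sub S" "S \<subset> S'" "S' \<subseteq> tot Q M" for S S'
    using sub_dim_less[OF that(1) T _ that(2)] that(3) TS by auto
  have "\<exists>n. I n = I (Suc n)"
  proof (rule ccontr)
    assume "\<nexists>n. I n = I (Suc n)"
    then have lt: "V.dim (I (Suc n)) < V.dim (I n)" for n
      using bound[OF Isub _ It, of "Suc n" n] Imon by blast
    have "V.dim (I n) + n \<le> V.dim (I 0)" for n
    proof (induction n)
      case (Suc n) then show ?case using lt[of n] by simp
    qed simp
    from this[of "Suc (V.dim (I 0))"] show False by simp
  qed
  then obtain i where i: "I i = I (Suc i)" ..
  have "\<exists>n. K n = K (Suc n)"
  proof (rule ccontr)
    assume "\<nexists>n. K n = K (Suc n)"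
    then have lt: "V.dim (K n) < V.dim (K (Suc n)) \<and> V.dim (K (Suc n)) \<le> card T" for n
      using bound[OF Ksub, of n "K (Suc n)"] Kmon K_def by blast
    have "n \<le> V.dim (K n)" for n
    proof (induction n)
      case (Suc n) then show ?case using lt[of n] by simp
    qed simp
    from this[of "Suc (card T)"] lt[of "card T"] show False by simp
  qed
  then obtain k where k: "K k = K (Suc k)" ..
  have I2: "I (Suc m) = I m" if "m \<ge> i" for m
    using that
  proof (induction m rule: dec_induct)
    case base then show ?case using i by simp
  next
    case (step m)
    have "I (Suc (Suc m)) = f ` I (Suc m)" by (simp add: I_def image_comp comp_def)
    also have "\<dots> = f ` I m" using step by simp
    also have "\<dots> = I (Suc m)" by (simp add: I_def image_comp comp_def)
    finally show ?case .
  qed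
  have K2: "K (Suc m) = K m" if "m \<ge> k" for m
    using that
  proof (induction m rule: dec_induct)
    case base then show ?case using k by simp
  next
    case (step m)
    have "x \<in> K (Suc m)" if "x \<in> K (Suc (Suc m))" for x
    proof -
      have "f x \<in> K (Suc m)" using that mhomD(1)[OF f] by (auto simp: K_def funpow_swap1)
      then have "f x \<in> K m" using step by simp
      then show ?thesis using that by (auto simp: K_def funpow_swap1)
    qed
    then show ?case using Kmon[of "Suc m"] by blast
  qed
  show thesis
  proof (rule that[of "max i k"])
    fix m assume m: "m \<ge> max i k"
    show "(f ^^ m) ` tot Q M = (f ^^ max i k) ` tot Q M"
      using m
    proof (induction m rule: dec_induct)
      case (step m) then show ?case using I2[of m] by (simp add: I_def)
    qed simp
    have "K m = K (max i k)"
      using m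
    proof (induction m rule: dec_induct)
      case (step m) then show ?case using K2[of m] by simp
    qed simp
    then show "(f ^^ max i k) x = 0" if "x \<in> tot Q M" "(f ^^ m) x = 0" for x
      using that by (auto simp: K_def)
  qed
qed

text \<open>The image and the kernel of a high power of \<open>f\<close> are complementary. The
  projection onto the image is an idempotent: if it is zero then \<open>f\<close> is nilpotent, and
  if it is the identity then \<open>f\<close> is bijective.\<close>

lemma fitting:
  fixes M :: "('v, 'a, 'k::field) rep"
  assumes M: "indec M" and f: "mhom Q M M f"
  shows "miso M M f \<or> (\<exists>n. \<forall>x\<in>tot Q M. (f ^^ n) x = 0)"
proof -
  obtain n where im: "\<And>m. m \<ge> n \<Longrightarrow> (f ^^ m) ` tot Q M = (f ^^ n) ` tot Q M"
    and ker: "\<And>m x. m \<ge> n \<Longrightarrow> x \<in> tot Q M \<Longrightarrow> (f ^^ m) x = 0 \<Longrightarrow> (f ^^ n) x = 0"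
    using fitting_exponent[OF f] by metis
  define g where "g = f ^^ n"
  have g: "mhom Q M M g" unfolding g_def by (rule mhom_funpow[OF f])
  have gg: "g (g x) = (f ^^ (n + n)) x" for x by (simp add: g_def funpow_add)
  have ker': "g x = 0" if "x \<in> tot Q M" "g (g x) = 0" for x
    using ker[of "n + n" x] that by (simp add: gg) (simp add: g_def)
  have ex: "\<exists>y\<in>tot Q M. g (g y) = g x" if "x \<in> tot Q M" for x
  proof -
    have "g x \<in> (f ^^ (n + n)) ` tot Q M" using im[of "n + n"] that by (simp add: g_def)
    then show ?thesis using gg by force
  qed
  \<comment> \<open>The projection onto the image of \<open>g\<close> along its kernel:
    \<open>g (g y) = g x\<close> says that \<open>x - g y\<close> lies in the kernel. The choice of
    \<open>y\<close> does not matter, because the kernels of \<open>g\<close> and of its square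
    agree.\<close>
  define e where "e x = g (SOME y. y \<in> tot Q M \<and> g (g y) = g x)" for x
  have ee: "e x = g y" if "x \<in> tot Q M" "y \<in> tot Q M" "g (g y) = g x" for x y
  proof -
    let ?z = "SOME y. y \<in> tot Q M \<and> g (g y) = g x"
    have z: "?z \<in> tot Q M \<and> g (g ?z) = g x"
      by (rule someI_ex[of "\<lambda>y. y \<in> tot Q M \<and> g (g y) = g x"]) (use ex[OF that(1)] in blast)
    then have "g (g (?z - y)) = 0"
      using that by (simp add: mhom_diff[OF g] mhomD(1)[OF g])
    then have "g (?z - y) = 0" using ker'[of "?z - y"] z that by (simp add: tot_intros)
    then show ?thesis using z that by (simp add: mhom_diff[OF g] e_def)
  qed
  have e: "mhom Q M M e"
    unfolding mhom_def
  proof (intro conjI ballI allI)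
    fix x assume x: "x \<in> tot Q M"
    obtain y where y: "y \<in> tot Q M" "g (g y) = g x" using ex[OF x] by blast
    show "e x \<in> tot Q M" using ee[OF x y] mhomD(1)[OF g y(1)] by simp
    show "e (c *\<^sub>F x) = c *\<^sub>F e x" for c
      using x y by (subst ee[of "c *\<^sub>F x" "c *\<^sub>F y"]) (auto simp: ee[OF x y] mhomD[OF g] tot_intros)
    show "e (pr v x) = pr v (e x)" if "v \<in> verts Q" for v
      using x y that by (subst ee[of "pr v x" "pr v y"]) (auto simp: ee[OF x y] mhomD[OF g] tot_intros)
    show "e (act Q M a x) = act Q M a (e x)" if "a \<in> arcs Q" for a
      using x y that by (subst ee[of "act Q M a x" "act Q M a y"]) (auto simp: ee[OF x y] mhomD[OF g] tot_act)
    fix x' assume x': "x' \<in> tot Q M"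
    obtain y' where y': "y' \<in> tot Q M" "g (g y') = g x'" using ex[OF x'] by blast
    show "e (x + x') = e x + e x'"
      using x y x' y' by (subst ee[of "x + x'" "y + y'"])
        (auto simp: ee[OF x y] ee[OF x' y'] mhomD[OF g] tot_intros)
  qed
  have "e (e x) = e x" if x: "x \<in> tot Q M" for x
  proof -
    obtain y where y: "y \<in> tot Q M" "g (g y) = g x" using ex[OF x] by blast
    then show ?thesis using ee[OF mhomD(1)[OF g y(1)] y(1)] ee[OF x y] by simp
  qed
  from indec_idempotent[OF M e this] consider "\<forall>x\<in>tot Q M. e x = 0" | "\<forall>x\<in>tot Q M. e x = x" by blast
  then show ?thesis
  proof cases
    case 1
    have "g x = 0" if x: "x \<in> tot Q M" for x
    proof -
      obtain y where y: "y \<in> tot Q M" "g (g y) = g x" using ex[OF x] by blast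
      then have "g y = 0" using ee[OF x y] 1 x by simp
      then show ?thesis using y mhom_0[OF g] by simp
    qed
    then show ?thesis unfolding g_def by blast
  next
    case 2
    have im_n: "x \<in> (f ^^ m) ` tot Q M" if x: "x \<in> tot Q M" "m \<ge> n" for x m
    proof -
      obtain y where y: "y \<in> tot Q M" "g (g y) = g x" using ex[OF x(1)] by blast
      then show ?thesis using ee[OF x(1) y] 2 x im[OF x(2)] by (simp add: g_def)
    qed
    have "x \<in> f ` tot Q M" if x: "x \<in> tot Q M" for x
      using im_n[OF x, of "Suc n"] mhomD(1)[OF mhom_funpow[OF f]] by (auto simp: image_iff)
    moreover have "inj_on f (tot Q M)"
    proof (rule inj_onI)
      fix x y assume xy: "x \<in> tot Q M" "y \<in> tot Q M" "f x = f y"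
      have d: "x - y \<in> tot Q M" "f (x - y) = 0" using xy by (auto simp: mhom_diff[OF f] tot_intros)
      have "(f ^^ Suc n) (x - y) = 0" using d mhom_0[OF mhom_funpow[OF f]] by (simp add: funpow_swap1)
      then have "(f ^^ n) (x - y) = 0" using ker[of "Suc n" "x - y"] d by simp
      then have "e (x - y) = 0"
        using ee[of "x - y" 0] d mhom_0[OF g] by (simp add: g_def)
      then show "x = y" using 2 d by simp
    qed
    ultimately show ?thesis
      using f mhomD(1)[OF f] by (auto simp: miso_def bij_betw_def)
  qed
qed

end

section \<open>Local endomorphism rings and the Krull-Schmidt property\<close>

context bound_quiver
begin

lemma miso_cong:
  assumes "miso M N F" "\<And>x. x \<in> tot Q M \<Longrightarrow> F x = G x"
  shows "miso M N G"
proof -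
  have "mhom Q M N G"
    using assms tail_verts head_verts by (intro mhom_cong[of Q M N F G]) (auto simp: miso_def)
  moreover have "bij_betw G (tot Q M) (tot Q N)"
    using assms bij_betw_cong[of "tot Q M" F G] by (auto simp: miso_def)
  ultimately show ?thesis by (simp add: miso_def)
qed

lemma miso_mhom: "miso M N F \<Longrightarrow> mhom Q M N F"
  by (simp add: miso_def)

text \<open>Preimages are given by the geometric series in \<open>f\<close>, which is finite here
  and telescopes.\<close>

lemma nilpotent_miso:
  assumes f: "mhom Q M M f" and nil: "\<And>x. x \<in> tot Q M \<Longrightarrow> (f ^^ n) x = 0"
  shows "miso M M (\<lambda>x. x - f x)"
proof -
  have h: "mhom Q M M (\<lambda>x. x - f x)" by (intro mhom_minus mhom_id f)
  have inj: "inj_on (\<lambda>x. x - f x) (tot Q M)"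
  proof (rule inj_onI)
    fix x y assume xy: "x \<in> tot Q M" "y \<in> tot Q M" "x - f x = y - f y"
    then have "f (x - y) = x - y" by (simp add: mhom_diff[OF f] algebra_simps)
    then have "(f ^^ m) (x - y) = x - y" for m by (induction m) auto
    then show "x = y" using nil[of "x - y"] xy by (simp add: tot_intros)
  qed
  have "y \<in> (\<lambda>x. x - f x) ` tot Q M" if y: "y \<in> tot Q M" for y
  proof (rule image_eqI)
    let ?x = "\<Sum>k<n. (f ^^ k) y"
    have t: "(f ^^ k) y \<in> tot Q M" for k using mhomD(1)[OF mhom_funpow[OF f] y] .
    then show "?x \<in> tot Q M" by (intro tot_intros)
    have "?x - f ?x = (\<Sum>k<n. (f ^^ k) y - (f ^^ Suc k) y)"
      using mhom_sum[OF f, of "{..<n}" "\<lambda>k. (f ^^ k) y"] t by (simp add: sum_subtractf)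
    also have "\<dots> = y - (f ^^ n) y"
      using sum_lessThan_telescope'[of "\<lambda>k. (f ^^ k) y" n] by simp
    finally show "y = ?x - f ?x" using nil[OF y] by simp
  qed
  then show ?thesis using h inj mhomD(1)[OF h] by (auto simp: miso_def bij_betw_def)
qed

text \<open>After composing with the inverse \<open>\<theta>\<close> of the sum, the two maps add up
  to the identity. By \<open>fitting\<close> the first is bijective or nilpotent, and in the latter
  case the second is identity minus nilpotent.\<close>

lemma indec_local:
  assumes M: "indec M" and F: "mhom Q M M F" and G: "mhom Q M M G" and FG: "miso M M (\<lambda>x. F x + G x)"
  shows "miso M M F \<or> miso M M G"
proof -
  obtain \<theta> where \<theta>: "miso M M \<theta>" "\<And>x. x \<in> tot Q M \<Longrightarrow> \<theta> (F x + G x) = x"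
    "\<And>x. x \<in> tot Q M \<Longrightarrow> F (\<theta> x) + G (\<theta> x) = x"
    using miso_sym[OF FG] by blast
  note \<theta>h = miso_mhom[OF \<theta>(1)]
  have cancel: "miso M M H" if "miso M M (\<lambda>x. H (\<theta> x))" for H
  proof (rule miso_cong[OF miso_comp[OF FG that]])
    show "H (\<theta> (F x + G x)) = H x" if "x \<in> tot Q M" for x using \<theta>(2)[OF that] by simp
  qed
  have F\<theta>: "mhom Q M M (\<lambda>x. F (\<theta> x))" by (rule mhom_comp[OF \<theta>h F])
  from fitting[OF M F\<theta>] show ?thesis
  proof
    assume "miso M M (\<lambda>x. F (\<theta> x))"
    then show ?thesis using cancel by blast
  next
    assume "\<exists>n. \<forall>x\<in>tot Q M. ((\<lambda>x. F (\<theta> x)) ^^ n) x = 0"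
    then have "miso M M (\<lambda>x. x - F (\<theta> x))" using nilpotent_miso[OF F\<theta>] by blast
    then have "miso M M (\<lambda>x. G (\<theta> x))"
    proof (rule miso_cong)
      show "x - F (\<theta> x) = G (\<theta> x)" if "x \<in> tot Q M" for x using \<theta>(3)[OF that] by (simp add: algebra_simps)
    qed
    then show ?thesis using cancel by blast
  qed
qed

lemma indec_nonzero: "indec M \<Longrightarrow> \<exists>x\<in>tot Q M. x \<noteq> 0"
  using is_zero_rep_iff tot_0 unfolding indec_def by blast

lemma zero_not_miso: "indec M \<Longrightarrow> \<not> miso M M (\<lambda>x. 0)"
  using indec_nonzero[of M] tot_0[of Q M] by (auto simp: miso_def bij_betw_def inj_on_def)

lemma indec_local_sum:
  assumes M: "indec M" and fin: "finite A" and F: "\<And>k. k \<in> A \<Longrightarrow> mhom Q M M (F k)"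
    and S: "miso M M (\<lambda>x. \<Sum>k\<in>A. F k x)"
  shows "\<exists>k\<in>A. miso M M (F k)"
  using fin F S
proof (induction A)
  case empty
  then show ?case using zero_not_miso[OF M] by simp
next
  case (insert k A)
  have "miso M M (\<lambda>x. F k x + (\<Sum>k\<in>A. F k x))" using insert by simp
  then have "miso M M (F k) \<or> miso M M (\<lambda>x. \<Sum>k\<in>A. F k x)"
    using insert by (intro indec_local[OF M] mhom_sum_fun) auto
  then show ?case using insert by blast
qed

text \<open>With \<open>\<theta>\<close> inverse to the composite, the map \<open>\<alpha>\<close>
  after \<open>\<theta>\<close> after \<open>\<beta>\<close> is an idempotent of \<open>N\<close>.
  It is not zero because \<open>M\<close> is not, hence it is the identity, so both factors are
  invertible.\<close>

lemma miso_factor: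
  assumes N: "indec N" and M: "indec M" and a: "mhom Q M N \<alpha>" and b: "mhom Q N M \<beta>"
    and ba: "miso M M (\<lambda>x. \<beta> (\<alpha> x))"
  shows "miso M N \<alpha>" "miso N M \<beta>"
proof -
  obtain \<theta> where \<theta>: "miso M M \<theta>" "\<And>x. x \<in> tot Q M \<Longrightarrow> \<theta> (\<beta> (\<alpha> x)) = x"
    "\<And>x. x \<in> tot Q M \<Longrightarrow> \<beta> (\<alpha> (\<theta> x)) = x"
    using miso_sym[OF ba] by blast
  note \<theta>h = miso_mhom[OF \<theta>(1)]
  have e: "mhom Q N N (\<lambda>y. \<alpha> (\<theta> (\<beta> y)))"
    by (rule mhom_comp[OF mhom_comp[OF b \<theta>h] a])
  have "(\<forall>y\<in>tot Q N. \<alpha> (\<theta> (\<beta> y)) = 0) \<or> (\<forall>y\<in>tot Q N. \<alpha> (\<theta> (\<beta> y)) = y)"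
    by (rule indec_idempotent[OF N e]) (simp add: \<theta>(3) mhomD(1)[OF b])
  moreover obtain x where x: "x \<in> tot Q M" "x \<noteq> 0" using indec_nonzero[OF M] by blast
  have "\<alpha> (\<theta> (\<beta> (\<alpha> x))) \<noteq> 0"
    using \<theta>(2)[OF x(1)] x mhom_0[OF b] mhom_0[OF \<theta>h] by force
  then have "\<not> (\<forall>y\<in>tot Q N. \<alpha> (\<theta> (\<beta> y)) = 0)" using mhomD(1)[OF a x(1)] by blast
  ultimately have id: "\<alpha> (\<theta> (\<beta> y)) = y" if "y \<in> tot Q N" for y using that by blast
  show "miso M N \<alpha>"
    by (rule misoI[OF a mhom_comp[OF b \<theta>h]]) (use \<theta>(2) id in auto)
  have "miso N M (\<lambda>y. \<theta> (\<beta> y))"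
    by (rule misoI[OF mhom_comp[OF b \<theta>h] a]) (use \<theta>(2) id in auto)
  from miso_comp[OF this ba] have "miso N M (\<lambda>y. \<beta> (\<alpha> (\<theta> (\<beta> y))))" .
  then show "miso N M \<beta>" by (rule miso_cong) (use id in auto)
qed

text \<open>The identity of \<open>M\<close> is the sum over \<open>k\<close> of the maps through
  \<open>Ms ! k\<close>; locality makes one of them invertible, and \<open>miso_factor\<close> turns
  its two halves into isomorphisms.\<close>

theorem krull_schmidt_summand:
  assumes M: "indec M" and h: "mhom Q M T \<iota>" "mhom Q T M \<pi>" "\<And>x. x \<in> tot Q M \<Longrightarrow> \<pi> (\<iota> x) = x"
    and sy: "sys T Ms ii pp" and Ms: "\<forall>N\<in>set Ms. indec N"
  shows "\<exists>k<length Ms. miso M (Ms ! k) (\<lambda>x. pp k (\<iota> x)) \<and> miso (Ms ! k) M (\<lambda>y. \<pi> (ii k y))"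
proof -
  have t: "mhom Q M (Ms ! k) (\<lambda>x. pp k (\<iota> x))" "mhom Q (Ms ! k) M (\<lambda>y. \<pi> (ii k y))"
    if "k < length Ms" for k
    using mhom_comp[OF h(1) sysD(2)[OF sy that]] mhom_comp[OF sysD(1)[OF sy that] h(2)] .
  have "miso M M (\<lambda>x. \<Sum>k\<in>{..<length Ms}. \<pi> (ii k (pp k (\<iota> x))))"
  proof (rule miso_cong[OF miso_id])
    fix x assume x: "x \<in> tot Q M"
    have "x = \<pi> (\<Sum>k<length Ms. ii k (pp k (\<iota> x)))"
      using sysD(4)[OF sy mhomD(1)[OF h(1) x]] h(3)[OF x] by simp
    also have "\<dots> = (\<Sum>k<length Ms. \<pi> (ii k (pp k (\<iota> x))))"
      using mhomD(1)[OF sysD(1)[OF sy]] mhomD(1)[OF t(1) x] by (intro mhom_sum[OF h(2)]) auto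
    finally show "x = (\<Sum>k<length Ms. \<pi> (ii k (pp k (\<iota> x))))" .
  qed
  from indec_local_sum[OF M _ _ this] obtain k where k: "k < length Ms" "miso M M (\<lambda>x. \<pi> (ii k (pp k (\<iota> x))))"
    using mhom_comp[OF t] by blast
  have "indec (Ms ! k)" using Ms k(1) by simp
  from miso_factor[OF this M t[OF k(1)] k(2)] k(1) show ?thesis by blast
qed

text \<open>A module with two independent copies of the same indecomposable summand is not basic.\<close>

lemma no_repeated_summand:
  assumes M: "indec M" and i: "mhom Q M T \<iota>\<^sub>1" "mhom Q M T \<iota>\<^sub>2" and p: "mhom Q T M \<pi>\<^sub>1" "mhom Q T M \<pi>\<^sub>2"
    and id: "\<And>x. x \<in> tot Q M \<Longrightarrow> \<pi>\<^sub>1 (\<iota>\<^sub>1 x) = x" "\<And>x. x \<in> tot Q M \<Longrightarrow> \<pi>\<^sub>2 (\<iota>\<^sub>2 x) = x"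
      "\<And>x. x \<in> tot Q M \<Longrightarrow> \<pi>\<^sub>2 (\<iota>\<^sub>1 x) = 0"
    and sy: "sys T Ms ii pp" and Ms: "\<forall>N\<in>set Ms. indec N"
    and ni: "\<And>k l F. k < l \<Longrightarrow> l < length Ms \<Longrightarrow> \<not> miso (Ms ! k) (Ms ! l) F"
  shows False
proof -
  have ni': "k = l" if "miso (Ms ! k) (Ms ! l) F" "k < length Ms" "l < length Ms" for k l F
    using ni[of k l F] ni[of l k] miso_sym[OF that(1)] that by (metis linorder_neqE_nat)
  obtain k where k: "k < length Ms" "miso M (Ms ! k) (\<lambda>x. pp k (\<iota>\<^sub>1 x))"
    using krull_schmidt_summand[OF M i(1) p(1) id(1) sy Ms] by blast
  obtain l where l: "l < length Ms" "miso M (Ms ! l) (\<lambda>x. pp l (\<iota>\<^sub>2 x))" "miso (Ms ! l) M (\<lambda>y. \<pi>\<^sub>2 (ii l y))"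
    using krull_schmidt_summand[OF M i(2) p(2) id(2) sy Ms] by blast
  have kl: "k = l"
  proof -
    obtain G where "miso (Ms ! k) M G" using miso_sym[OF k(2)] by blast
    then show ?thesis using ni'[OF miso_comp[OF _ l(2)]] k(1) l(1) by blast
  qed
  define H where "H j = (\<lambda>x. \<pi>\<^sub>2 (ii j (pp j (\<iota>\<^sub>1 x))))" for j
  have H: "mhom Q M M (H j)" if "j < length Ms" for j
    unfolding H_def
    by (rule mhom_comp[OF mhom_comp[OF mhom_comp[OF i(1) sysD(2)[OF sy that]] sysD(1)[OF sy that]] p(2)])
  have Hk: "miso M M (H k)" unfolding H_def using miso_comp[OF k(2)] l(3) kl by blast
  \<comment> \<open>This sum is \<open>\<pi>\<^sub>2\<close> after \<open>\<iota>\<^sub>1\<close>,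
    which vanishes, although its term at \<open>k\<close> is invertible. The other terms therefore
    add up to an isomorphism, and one of them is invertible: a second index isomorphic to
    \<open>M\<close>.\<close>
  have sum: "(\<Sum>j<length Ms. H j x) = 0" if x: "x \<in> tot Q M" for x
  proof -
    have "\<pi>\<^sub>2 (\<Sum>j<length Ms. ii j (pp j (\<iota>\<^sub>1 x))) = (\<Sum>j<length Ms. H j x)"
      unfolding H_def using mhomD(1)[OF sysD(1)[OF sy]] mhomD(1)[OF sysD(2)[OF sy] mhomD(1)[OF i(1) x]]
      by (intro mhom_sum[OF p(2)]) auto
    then show ?thesis using sysD(4)[OF sy mhomD(1)[OF i(1) x]] id(3)[OF x] by simp
  qed
  have "(\<Sum>j\<in>{..<length Ms} - {k}. H j x) = - H k x" if "x \<in> tot Q M" for x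
    using sum[OF that] k(1) by (simp add: sum.remove[of "{..<length Ms}" k] eq_neg_iff_add_eq_0 add.commute)
  moreover have "miso M M (\<lambda>x. - H k x)"
  proof -
    have "mhom Q M M (\<lambda>x. - H k x)"
      using mhom_minus[OF mhom_zero H[OF k(1)]] by simp
    moreover obtain G where G: "mhom Q M M G" "\<And>x. x \<in> tot Q M \<Longrightarrow> G (H k x) = x" "\<And>x. x \<in> tot Q M \<Longrightarrow> H k (G x) = x"
      using miso_sym[OF Hk] miso_mhom by blast
    moreover have "mhom Q M M (\<lambda>x. - G x)"
      using mhom_minus[OF mhom_zero G(1)] by simp
    ultimately show ?thesis
      using mhomD(1)[OF G(1)] mhomD(1)[OF H[OF k(1)]] mhom_uminus[OF G(1)] mhom_uminus[OF H[OF k(1)]]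
      by (intro misoI[of M M _ "\<lambda>x. - G x"]) auto
  qed
  ultimately have "miso M M (\<lambda>x. \<Sum>j\<in>{..<length Ms} - {k}. H j x)"
    using miso_cong[of M M "\<lambda>x. - H k x" "\<lambda>x. \<Sum>j\<in>{..<length Ms} - {k}. H j x"] by simp
  then obtain j where j: "j < length Ms" "j \<noteq> k" "miso M M (H j)"
    using indec_local_sum[OF M, of "{..<length Ms} - {k}" H] H by auto
  have "indec (Ms ! j)" using Ms j(1) by simp
  from miso_factor(1)[OF this M mhom_comp[OF i(1) sysD(2)[OF sy j(1)]] mhom_comp[OF sysD(1)[OF sy j(1)] p(2)]]
    j(3) have "miso M (Ms ! j) (\<lambda>x. pp j (\<iota>\<^sub>1 x))" by (simp add: H_def)
  then obtain G where "miso (Ms ! j) M G" using miso_sym by blast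
  then show False using ni'[OF miso_comp[OF _ k(2)]] j k(1) by blast
qed

end

section \<open>Gentle quivers: the two sides at a vertex, strings and their positions\<close>

locale gentle_quiver = bound_quiver Q R for Q :: "('v, 'a) pre_digraph" and R +
  assumes out_two: "\<lbrakk>a \<in> arcs Q; b \<in> arcs Q; c \<in> arcs Q; tail Q a = tail Q b; tail Q b = tail Q c\<rbrakk> \<Longrightarrow>
      a = b \<or> b = c \<or> a = c"
    and in_two: "\<lbrakk>a \<in> arcs Q; b \<in> arcs Q; c \<in> arcs Q; head Q a = head Q b; head Q b = head Q c\<rbrakk> \<Longrightarrow>
      a = b \<or> b = c \<or> a = c"
    and nonrel_right: "\<lbrakk>a \<in> arcs Q; b \<in> arcs Q; c \<in> arcs Q; head Q a = tail Q b; head Q a = tail Q c;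
      \<not> R a b; \<not> R a c\<rbrakk> \<Longrightarrow> b = c"
    and nonrel_left: "\<lbrakk>a \<in> arcs Q; b \<in> arcs Q; c \<in> arcs Q; head Q b = tail Q a; head Q c = tail Q a;
      \<not> R b a; \<not> R c a\<rbrakk> \<Longrightarrow> b = c"
    and rel_right: "\<lbrakk>a \<in> arcs Q; b \<in> arcs Q; c \<in> arcs Q; head Q a = tail Q b; head Q a = tail Q c;
      R a b; R a c\<rbrakk> \<Longrightarrow> b = c"
    and rel_left: "\<lbrakk>a \<in> arcs Q; b \<in> arcs Q; c \<in> arcs Q; head Q b = tail Q a; head Q c = tail Q a;
      R b a; R c a\<rbrakk> \<Longrightarrow> b = c"
    and bounded: "\<exists>m. \<forall>p. set p \<subseteq> arcs Q \<and> successively (\<lambda>a b. head Q a = tail Q b \<and> \<not> R a b) p \<longrightarrow> length p < m"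
begin

text \<open>\<open>opp l l'\<close> says that two letters starting at the same vertex can be the two sides of a
  string passing through it, that is, \<open>l\<^sup>-\<^sup>1 l'\<close> is a string.\<close>

fun opp :: "'a letter \<Rightarrow> 'a letter \<Rightarrow> bool" where
  "opp (Dir c) (Dir c') \<longleftrightarrow> c \<noteq> c'"
| "opp (Inv a) (Inv a') \<longleftrightarrow> a \<noteq> a'"
| "opp (Dir c) (Inv a) \<longleftrightarrow> \<not> R a c"
| "opp (Inv a) (Dir c) \<longleftrightarrow> \<not> R a c"

definition at_vertex :: "'v \<Rightarrow> 'a letter \<Rightarrow> bool" where
  "at_vertex v l \<longleftrightarrow> letter_arrow l \<in> arcs Q \<and> letter_source Q l = v"

lemma opp_sym: "opp l l' \<longleftrightarrow> opp l' l"
  by (cases l; cases l') auto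

lemma opp_irrefl [simp]: "\<not> opp l l"
  by (cases l) auto

lemma letter_inv_inv [simp]: "letter_inv (letter_inv l) = l"
  by (cases l) auto

lemma letter_inv_simps [simp]:
  "letter_arrow (letter_inv l) = letter_arrow l"
  "letter_source Q (letter_inv l) = letter_target Q l"
  "letter_target Q (letter_inv l) = letter_source Q l"
  "letter_inv l = letter_inv l' \<longleftrightarrow> l = l'"
  "letter_inv l = Dir a \<longleftrightarrow> l = Inv a"
  "letter_inv l = Inv a \<longleftrightarrow> l = Dir a"
  "letter_inv l \<noteq> l" "l \<noteq> letter_inv l"
  by (cases l; cases l'; auto)+

text \<open>Together with \<open>nopp_nopp\<close> this makes the negation of \<open>opp\<close> an
  equivalence relation with at most two classes at each vertex. The bounds on degrees and on nonzero
  products exclude a third class, the bounds on relations give transitivity.\<close>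

lemma opp_opp:
  assumes "at_vertex v l" "at_vertex v l'" "at_vertex v l''" "opp l l'" "opp l' l''"
  shows "\<not> opp l l''"
  using assms unfolding at_vertex_def
  by (cases l; cases l'; cases l''; simp) (metis out_two in_two nonrel_left nonrel_right rel_left rel_right)+

lemma nopp_nopp:
  assumes "at_vertex v l" "at_vertex v l'" "at_vertex v l''" "\<not> opp l l'" "\<not> opp l' l''"
  shows "\<not> opp l l''"
  using assms unfolding at_vertex_def
  by (cases l; cases l'; cases l''; simp) (metis out_two in_two nonrel_left nonrel_right rel_left rel_right)+

text \<open>A label for the two classes at a vertex, taken relative to an arbitrarily chosen letter
  there. Only the comparison of labels in \<open>opp_iff_side\<close> has a meaning, not the value
  itself.\<close>

definition side :: "'a letter \<Rightarrow> bool" where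
  "side l = opp l (SOME l'. at_vertex (letter_source Q l) l')"

lemma opp_iff_side:
  assumes "at_vertex v l" "at_vertex v l'"
  shows "opp l l' \<longleftrightarrow> side l \<noteq> side l'"
proof -
  define r where "r = (SOME l'. at_vertex v l')"
  have r: "at_vertex v r" unfolding r_def using assms(1) by (rule someI)
  have "side l = opp l r" "side l' = opp l' r"
    using assms by (auto simp: side_def r_def at_vertex_def)
  then show ?thesis
    using opp_opp[OF assms(1) r assms(2)] nopp_nopp[OF assms(1) r assms(2)]
      nopp_nopp[OF assms(1,2) r] nopp_nopp[OF assms(2,1) r] opp_sym by metis
qed

text \<open>For consecutive letters, the single condition \<open>opp (letter_inv l) l'\<close>
  covers all prohibitions at once: cancellation, and relations read in either direction.\<close>

definition is_str :: "('v, 'a) walk \<Rightarrow> bool" where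
  "is_str w \<longleftrightarrow> fst w \<in> verts Q \<and> (\<forall>l\<in>set (snd w). letter_arrow l \<in> arcs Q) \<and>
     (snd w \<noteq> [] \<longrightarrow> letter_source Q (hd (snd w)) = fst w) \<and>
     successively (\<lambda>l l'. letter_target Q l = letter_source Q l' \<and> opp (letter_inv l) l') (snd w)"

text \<open>The letter leaving position \<open>i\<close> to the right (\<open>d = True\<close>) or to the left, and the position
  it leads to.\<close>

definition out_letter :: "'a letter list \<Rightarrow> nat \<Rightarrow> bool \<Rightarrow> 'a letter option" where
  "out_letter ls i d = (if d then if i < length ls then Some (ls ! i) else None
     else if 0 < i then Some (letter_inv (ls ! (i - 1))) else None)"

definition nxt :: "nat \<Rightarrow> bool \<Rightarrow> nat" where
  "nxt i d = (if d then i + 1 else i - 1)"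

lemma walk_verts_Suc: "i < length (snd w) \<Longrightarrow> walk_verts Q w ! Suc i = letter_target Q (snd w ! i)"
  by (simp add: walk_verts_def)

lemma walk_verts_0 [simp]: "walk_verts Q w ! 0 = fst w"
  by (simp add: walk_verts_def)

lemma length_walk_verts [simp]: "length (walk_verts Q w) = Suc (length (snd w))"
  by (simp add: walk_verts_def)

lemma successively_nth: "successively P xs \<longleftrightarrow> (\<forall>i. Suc i < length xs \<longrightarrow> P (xs ! i) (xs ! Suc i))"
  by (induction P xs rule: successively.induct) (auto simp: nth_Cons All_less_Suc2 split: nat.splits)

lemma is_str_nth:
  "is_str w \<longleftrightarrow> fst w \<in> verts Q \<and>
     (\<forall>i<length (snd w). letter_arrow (snd w ! i) \<in> arcs Q \<and> letter_source Q (snd w ! i) = walk_verts Q w ! i) \<and>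
     (\<forall>i. Suc i < length (snd w) \<longrightarrow> opp (letter_inv (snd w ! i)) (snd w ! Suc i))"
proof -
  have *: "(snd w \<noteq> [] \<longrightarrow> letter_source Q (hd (snd w)) = fst w) \<and>
      (\<forall>i. Suc i < length (snd w) \<longrightarrow> letter_target Q (snd w ! i) = letter_source Q (snd w ! Suc i)) \<longleftrightarrow>
      (\<forall>i<length (snd w). letter_source Q (snd w ! i) = walk_verts Q w ! i)" (is "?l \<longleftrightarrow> ?r")
  proof
    assume ?l
    show ?r
    proof (intro allI impI)
      fix i assume "i < length (snd w)"
      then show "letter_source Q (snd w ! i) = walk_verts Q w ! i"
        using \<open>?l\<close> by (cases i) (auto simp: hd_conv_nth walk_verts_Suc)
    qed
  next
    assume ?r
    then show ?l by (auto simp: hd_conv_nth walk_verts_Suc)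
  qed
  show ?thesis
    unfolding is_str_def successively_nth all_set_conv_all_nth using * by blast
qed

lemma walk_verts_in:
  assumes "is_str w" "i \<le> length (snd w)"
  shows "walk_verts Q w ! i \<in> verts Q"
proof (cases i)
  case (Suc j)
  then have "letter_arrow (snd w ! j) \<in> arcs Q" using assms by (simp add: is_str_nth)
  then show ?thesis using Suc assms tail_verts head_verts
    by (cases "snd w ! j") (auto simp: walk_verts_Suc)
qed (use assms in \<open>simp add: is_str_def\<close>)

lemma out_letterD:
  assumes w: "is_str w" and i: "i \<le> length (snd w)" and l: "out_letter (snd w) i d = Some l"
  shows "at_vertex (walk_verts Q w ! i) l" "letter_target Q l = walk_verts Q w ! nxt i d"
    "nxt i d \<le> length (snd w)" "out_letter (snd w) (nxt i d) (\<not> d) = Some (letter_inv l)"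
proof -
  have *: "at_vertex (walk_verts Q w ! i) l \<and> letter_target Q l = walk_verts Q w ! nxt i d \<and>
    nxt i d \<le> length (snd w) \<and> out_letter (snd w) (nxt i d) (\<not> d) = Some (letter_inv l)"
  proof (cases d)
    case True
    then show ?thesis using assms
      by (auto simp: out_letter_def nxt_def is_str_nth at_vertex_def walk_verts_Suc split: if_splits)
  next
    case False
    then obtain j where j: "i = Suc j" "l = letter_inv (snd w ! j)"
      using l by (cases i) (auto simp: out_letter_def)
    then show ?thesis using assms False
      by (auto simp: out_letter_def nxt_def is_str_nth at_vertex_def walk_verts_Suc)
  qed
  then show "at_vertex (walk_verts Q w ! i) l" "letter_target Q l = walk_verts Q w ! nxt i d"
    "nxt i d \<le> length (snd w)" "out_letter (snd w) (nxt i d) (\<not> d) = Some (letter_inv l)" by auto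
qed

lemma nxt_nxt: "out_letter ls i d = Some l \<Longrightarrow> nxt (nxt i d) (\<not> d) = i"
  by (auto simp: nxt_def out_letter_def split: if_splits)

lemma out_letter_opp:
  assumes w: "is_str w" and l: "out_letter (snd w) i True = Some l" "out_letter (snd w) i False = Some l'"
  shows "opp l l'"
proof -
  obtain j where j: "i = Suc j" "l' = letter_inv (snd w ! j)"
    using l(2) by (cases i) (auto simp: out_letter_def)
  then show ?thesis using assms opp_sym by (auto simp: out_letter_def is_str_nth split: if_splits)
qed

lemma out_letter_eq:
  assumes "is_str w" "out_letter (snd w) i d = Some l" "out_letter (snd w) i d' = Some l"
  shows "d = d'"
  using assms out_letter_opp[OF assms(1), of i l l] by (cases d; cases d') auto

text \<open>The partial map on positions through which \<open>a\<close> acts on the basis of a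
  string module. For a string the two cases exclude each other by
  \<open>out_letter_eq\<close>.\<close>

definition stp :: "'a letter list \<Rightarrow> 'a \<Rightarrow> nat \<Rightarrow> nat option" where
  "stp ls a i = (if out_letter ls i True = Some (Dir a) then Some (nxt i True)
     else if out_letter ls i False = Some (Dir a) then Some (nxt i False) else None)"

lemma stp_Some_iff:
  assumes "is_str w"
  shows "stp (snd w) a i = Some j \<longleftrightarrow> (\<exists>d. out_letter (snd w) i d = Some (Dir a) \<and> j = nxt i d)"
  using out_letter_eq[OF assms, of i True "Dir a" False]
  unfolding stp_def by (auto simp: ex_bool_eq split: if_splits)

lemma stp_Some_iff':
  assumes "is_str w" "j \<le> length (snd w)"
  shows "(\<exists>i\<le>length (snd w). stp (snd w) a i = Some j \<and> i = k) \<longleftrightarrow>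
    (\<exists>d. out_letter (snd w) j d = Some (Inv a) \<and> k = nxt j d)"
proof
  assume "\<exists>i\<le>length (snd w). stp (snd w) a i = Some j \<and> i = k"
  then obtain d where d: "k \<le> length (snd w)" "out_letter (snd w) k d = Some (Dir a)" "j = nxt k d"
    using stp_Some_iff[OF assms(1)] by auto
  then show "\<exists>d. out_letter (snd w) j d = Some (Inv a) \<and> k = nxt j d"
    using out_letterD(4)[OF assms(1) d(1,2)] nxt_nxt[OF d(2)] by (intro exI[of _ "\<not> d"]) simp
next
  assume "\<exists>d. out_letter (snd w) j d = Some (Inv a) \<and> k = nxt j d"
  then obtain d where d: "out_letter (snd w) j d = Some (Inv a)" "k = nxt j d" by blast
  then have "out_letter (snd w) k (\<not> d) = Some (Dir a)" "k \<le> length (snd w)" "nxt k (\<not> d) = j"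
    using out_letterD(3,4)[OF assms d(1)] nxt_nxt[OF d(1)] by auto
  then show "\<exists>i\<le>length (snd w). stp (snd w) a i = Some j \<and> i = k"
    using stp_Some_iff[OF assms(1)] by blast
qed

lemma stp_inj:
  assumes "is_str w" "i \<le> length (snd w)" "i' \<le> length (snd w)"
    "stp (snd w) a i = Some j" "stp (snd w) a i' = Some j"
  shows "i = i'"
proof -
  obtain d where d: "out_letter (snd w) i d = Some (Dir a)" "j = nxt i d" using assms stp_Some_iff by blast
  obtain d' where d': "out_letter (snd w) i' d' = Some (Dir a)" "j = nxt i' d'" using assms stp_Some_iff by blast
  have "out_letter (snd w) j (\<not> d) = Some (Inv a)" "out_letter (snd w) j (\<not> d') = Some (Inv a)"
    using out_letterD(4)[OF assms(1,2) d(1)] out_letterD(4)[OF assms(1,3) d'(1)] d(2) d'(2) by auto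
  then have "(\<not> d) = (\<not> d')" using out_letter_eq[OF assms(1)] by blast
  then show ?thesis using nxt_nxt[OF d(1)] nxt_nxt[OF d'(1)] d(2) d'(2) by simp
qed

lemma stp_verts:
  assumes "is_str w" "i \<le> length (snd w)" "stp (snd w) a i = Some j"
  shows "walk_verts Q w ! i = tail Q a" "walk_verts Q w ! j = head Q a" "j \<le> length (snd w)" "a \<in> arcs Q"
proof -
  obtain d where d: "out_letter (snd w) i d = Some (Dir a)" "j = nxt i d" using assms stp_Some_iff by blast
  show "walk_verts Q w ! i = tail Q a" "walk_verts Q w ! j = head Q a" "j \<le> length (snd w)" "a \<in> arcs Q"
    using out_letterD[OF assms(1,2) d(1)] d(2) by (auto simp: at_vertex_def)
qed

section \<open>String bases and the homomorphisms they define\<close>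

definition sfam :: "('v, 'a, 'k::field) rep \<Rightarrow> ('v, 'a) walk \<Rightarrow> (nat \<Rightarrow> ('v, 'k) tvec) \<Rightarrow> bool" where
  "sfam M w b \<longleftrightarrow> (\<forall>i\<le>length (snd w). b i \<in> tot Q M \<and> pr (walk_verts Q w ! i) (b i) = b i \<and>
     (\<forall>a\<in>arcs Q. act Q M a (b i) = (case stp (snd w) a i of None \<Rightarrow> 0 | Some j \<Rightarrow> b j)))"

text \<open>The working form of being isomorphic to the module of \<open>w\<close>, see
  \<open>sbasis_iff_miso\<close>. An \<open>sfam\<close> obeys the same rules without being
  independent or spanning; such families are the images of a string basis under
  homomorphisms.\<close>

definition sbasis :: "('v, 'a, 'k::field) rep \<Rightarrow> ('v, 'a) walk \<Rightarrow> (nat \<Rightarrow> ('v, 'k) tvec) \<Rightarrow> bool" where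
  "sbasis M w b \<longleftrightarrow> sfam M w b \<and>
     (\<forall>x\<in>tot Q M. \<exists>c. x = (\<Sum>i\<le>length (snd w). c i *\<^sub>F b i)) \<and>
     (\<forall>c. (\<Sum>i\<le>length (snd w). c i *\<^sub>F b i) = 0 \<longrightarrow> (\<forall>i\<le>length (snd w). c i = 0))"

lemma sfamD:
  assumes "sfam M w b" "i \<le> length (snd w)"
  shows "b i \<in> tot Q M" "pr (walk_verts Q w ! i) (b i) = b i"
    "a \<in> arcs Q \<Longrightarrow> act Q M a (b i) = (case stp (snd w) a i of None \<Rightarrow> 0 | Some j \<Rightarrow> b j)"
  using assms unfolding sfam_def by blast+

lemma sfam_pr:
  assumes "sfam M w b" "i \<le> length (snd w)"
  shows "pr v (b i) = (if v = walk_verts Q w ! i then b i else 0)"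
  using sfamD(2)[OF assms] pr_simps(6)[of v "walk_verts Q w ! i" "b i"] by (auto split: if_splits)

lemma sbasisD:
  assumes "sbasis M w b"
  shows "sfam M w b" "x \<in> tot Q M \<Longrightarrow> \<exists>c. x = (\<Sum>i\<le>length (snd w). c i *\<^sub>F b i)"
    "(\<Sum>i\<le>length (snd w). c i *\<^sub>F b i) = 0 \<Longrightarrow> i \<le> length (snd w) \<Longrightarrow> c i = 0"
  using assms unfolding sbasis_def by blast+

lemma sbasis_unique:
  assumes "sbasis M w b" "(\<Sum>i\<le>length (snd w). c i *\<^sub>F b i) = (\<Sum>i\<le>length (snd w). c' i *\<^sub>F b i)" "i \<le> length (snd w)"
  shows "c i = c' i"
proof -
  have "(\<Sum>i\<le>length (snd w). (c i - c' i) *\<^sub>F b i) = 0"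
    using assms(2) by (simp add: diff_smul sum_subtractf)
  from sbasisD(3)[OF assms(1) this assms(3)] show ?thesis by simp
qed

lemma sum_smul_single: "i \<le> n \<Longrightarrow> (\<Sum>j\<le>(n::nat). (if j = i then 1 else 0) *\<^sub>F b j) = (b i :: 'b \<Rightarrow> 'k::field)"
  by (subst sum.remove[of _ i]) (auto intro!: sum.neutral)

text \<open>The universal property of the string module. The explicit value on combinations is
  recorded as well, since exactness arguments compare coefficients.\<close>

lemma sbasis_hom:
  fixes M N :: "('v, 'a, 'k::field) rep"
  assumes b: "sbasis M w b" and y: "sfam N w y"
  obtains F where "mhom Q M N F" "\<And>i. i \<le> length (snd w) \<Longrightarrow> F (b i) = y i"
    "\<And>c. F (\<Sum>i\<le>length (snd w). c i *\<^sub>F b i) = (\<Sum>i\<le>length (snd w). c i *\<^sub>F y i)"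
proof -
  let ?n = "length (snd w)"
  define cf where "cf x = (SOME c. x = (\<Sum>i\<le>?n. c i *\<^sub>F b i))" for x
  have cf: "x = (\<Sum>i\<le>?n. cf x i *\<^sub>F b i)" if "x \<in> tot Q M" for x
    unfolding cf_def using sbasisD(2)[OF b that] by (rule someI_ex)
  define F where "F x = (\<Sum>i\<le>?n. cf x i *\<^sub>F y i)" for x
  note bt = sfamD(1)[OF sbasisD(1)[OF b]]
  note yt = sfamD(1)[OF y]
  have F: "F (\<Sum>i\<le>?n. c i *\<^sub>F b i) = (\<Sum>i\<le>?n. c i *\<^sub>F y i)" for c
  proof -
    have t: "(\<Sum>i\<le>?n. c i *\<^sub>F b i) \<in> tot Q M" using bt by (auto intro!: tot_intros)
    show ?thesis
      unfolding F_def using sbasis_unique[OF b cf[OF t, symmetric]] by (intro sum.cong) auto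
  qed
  have Fb: "F (b i) = y i" if "i \<le> ?n" for i
    using F[of "\<lambda>j. if j = i then 1 else 0"] that by (simp add: sum_smul_single)
  have add: "F (x + x') = F x + F x'" if "x \<in> tot Q M" "x' \<in> tot Q M" for x x'
  proof -
    have "x + x' = (\<Sum>i\<le>?n. (cf x i + cf x' i) *\<^sub>F b i)"
      using cf[OF that(1)] cf[OF that(2)] by (simp add: add_smul sum.distrib)
    then have "F (x + x') = (\<Sum>i\<le>?n. (cf x i + cf x' i) *\<^sub>F y i)" using F by presburger
    then show ?thesis by (simp add: F_def add_smul sum.distrib)
  qed
  have scale: "F (c *\<^sub>F x) = c *\<^sub>F F x" if "x \<in> tot Q M" for x c
  proof -
    have "c *\<^sub>F x = (\<Sum>i\<le>?n. (c * cf x i) *\<^sub>F b i)"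
      by (subst cf[OF that]) (simp add: smul_sum)
    then have "F (c *\<^sub>F x) = (\<Sum>i\<le>?n. (c * cf x i) *\<^sub>F y i)" using F by presburger
    then show ?thesis by (simp add: F_def smul_sum)
  qed
  have F0: "F 0 = 0" using scale[of 0 0] by simp
  have Fsum: "F (\<Sum>i\<in>A. g i) = (\<Sum>i\<in>A. F (g i))" if "\<And>i. i \<in> A \<Longrightarrow> g i \<in> tot Q M" for A and g :: "nat \<Rightarrow> _"
    using that
  proof (induction A rule: infinite_finite_induct)
    case (insert a A)
    then show ?case using add[of "g a" "sum g A"] by (simp add: tot_sum)
  qed (simp_all add: F0)
  have "mhom Q M N F"
    unfolding mhom_def
  proof (intro conjI ballI allI)
    fix x assume x: "x \<in> tot Q M"
    show "F x \<in> tot Q N" unfolding F_def using yt by (auto intro!: tot_intros)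
    show "F (x + x') = F x + F x'" if "x' \<in> tot Q M" for x' using add x that by blast
    show "F (c *\<^sub>F x) = c *\<^sub>F F x" for c using scale x by blast
    show "F (pr v x) = pr v (F x)" for v
    proof -
      have "F (pr v x) = F (\<Sum>i\<le>?n. cf x i *\<^sub>F pr v (b i))"
        by (subst cf[OF x]) (simp add: pr_sum)
      also have "\<dots> = (\<Sum>i\<le>?n. F (cf x i *\<^sub>F pr v (b i)))"
        using bt by (intro Fsum) (auto intro!: tot_intros)
      also have "\<dots> = (\<Sum>i\<le>?n. cf x i *\<^sub>F pr v (y i))"
        using bt by (intro sum.cong refl)
          (auto simp: scale tot_intros sfam_pr[OF y] sfam_pr[OF sbasisD(1)[OF b]] Fb F0)
      finally show ?thesis by (simp add: F_def pr_sum)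
    qed
    fix a assume a: "a \<in> arcs Q"
    have "F (act Q M a x) = F (\<Sum>i\<le>?n. cf x i *\<^sub>F act Q M a (b i))"
      by (subst cf[OF x]) (simp add: act_sum)
    also have "\<dots> = (\<Sum>i\<le>?n. F (cf x i *\<^sub>F act Q M a (b i)))"
      using a by (intro Fsum) (auto intro!: tot_intros tot_act)
    also have "\<dots> = (\<Sum>i\<le>?n. cf x i *\<^sub>F act Q N a (y i))"
    proof (intro sum.cong refl)
      fix i assume "i \<in> {..?n}"
      then have i: "i \<le> ?n" by simp
      have "F (act Q M a (b i)) = act Q N a (y i)"
        using sfamD(3)[OF y i a] sfamD(3)[OF sbasisD(1)[OF b] i a]
      proof (cases "stp (snd w) a i")
        case (Some j)
        then have "j \<le> ?n" using i unfolding stp_def out_letter_def nxt_def by (auto split: if_splits)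
        then show ?thesis
          using Some sfamD(3)[OF y i a] sfamD(3)[OF sbasisD(1)[OF b] i a] Fb by simp
      qed (simp add: F0)
      then show "F (cf x i *\<^sub>F act Q M a (b i)) = cf x i *\<^sub>F act Q N a (y i)"
        using a by (simp add: scale tot_act)
    qed
    finally show "F (act Q M a x) = act Q N a (F x)" by (simp add: F_def act_sum)
  qed
  with Fb F that show thesis by blast
qed

lemma sfam_mhom:
  assumes y: "sfam M w y" and F: "mhom Q M N F" and w: "is_str w"
  shows "sfam N w (\<lambda>i. F (y i))"
  unfolding sfam_def
proof (intro allI impI conjI ballI)
  fix i assume i: "i \<le> length (snd w)"
  note t = sfamD(1)[OF y i]
  show "F (y i) \<in> tot Q N" using mhomD(1)[OF F t] .
  show "pr (walk_verts Q w ! i) (F (y i)) = F (y i)"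
    using mhomD(4)[OF F walk_verts_in[OF w i] t] sfamD(2)[OF y i] by simp
  show "act Q N a (F (y i)) = (case stp (snd w) a i of None \<Rightarrow> 0 | Some j \<Rightarrow> F (y j))" if "a \<in> arcs Q" for a
    using mhomD(5)[OF F that t] sfamD(3)[OF y i that] mhom_0[OF F] by (auto split: option.splits)
qed

lemma sbasis_miso:
  assumes b: "sbasis M w b" and y: "sbasis N w y"
  shows "\<exists>F. miso M N F \<and> (\<forall>i\<le>length (snd w). F (b i) = y i)"
proof -
  obtain F where F: "mhom Q M N F" "\<And>i. i \<le> length (snd w) \<Longrightarrow> F (b i) = y i"
    "\<And>c. F (\<Sum>i\<le>length (snd w). c i *\<^sub>F b i) = (\<Sum>i\<le>length (snd w). c i *\<^sub>F y i)"
    using sbasis_hom[OF b sbasisD(1)[OF y]] by blast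
  obtain G where G: "mhom Q N M G" "\<And>i. i \<le> length (snd w) \<Longrightarrow> G (y i) = b i"
    "\<And>c. G (\<Sum>i\<le>length (snd w). c i *\<^sub>F y i) = (\<Sum>i\<le>length (snd w). c i *\<^sub>F b i)"
    using sbasis_hom[OF y sbasisD(1)[OF b]] by blast
  have "miso M N F"
  proof (rule misoI[OF F(1) G(1)])
    show "G (F x) = x" if "x \<in> tot Q M" for x using sbasisD(2)[OF b that] F(3) G(3) by auto
    show "F (G x) = x" if "x \<in> tot Q N" for x using sbasisD(2)[OF y that] F(3) G(3) by auto
  qed
  then show ?thesis using F(2) by blast
qed

lemma sbasis_transport:
  assumes b: "sbasis M w b" and F: "miso M N F" and w: "is_str w"
  shows "sbasis N w (\<lambda>i. F (b i))"
  unfolding sbasis_def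
proof (intro conjI ballI allI impI)
  note h = miso_mhom[OF F]
  show "sfam N w (\<lambda>i. F (b i))" by (rule sfam_mhom[OF sbasisD(1)[OF b] h w])
  have e: "F (\<Sum>i\<le>length (snd w). c i *\<^sub>F b i) = (\<Sum>i\<le>length (snd w). c i *\<^sub>F F (b i))" for c
    using sfamD(1)[OF sbasisD(1)[OF b]]
    by (subst mhom_sum[OF h]) (auto intro!: tot_intros sum.cong simp: mhomD(3)[OF h])
  show "\<exists>c. x = (\<Sum>i\<le>length (snd w). c i *\<^sub>F F (b i))" if "x \<in> tot Q N" for x
  proof -
    have "x \<in> F ` tot Q M" using F that by (simp add: miso_def bij_betw_def)
    then obtain z where z: "z \<in> tot Q M" "x = F z" by auto
    then show ?thesis using sbasisD(2)[OF b z(1)] e by auto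
  qed
  fix c i assume c: "(\<Sum>i\<le>length (snd w). c i *\<^sub>F F (b i)) = 0" "i \<le> length (snd w)"
  have "F (\<Sum>i\<le>length (snd w). c i *\<^sub>F b i) = F 0" using c e mhom_0[OF h] by simp
  moreover have "(\<Sum>i\<le>length (snd w). c i *\<^sub>F b i) \<in> tot Q M"
    using sfamD(1)[OF sbasisD(1)[OF b]] by (auto intro!: tot_intros)
  ultimately have "(\<Sum>i\<le>length (snd w). c i *\<^sub>F b i) = 0"
    using F tot_0 unfolding miso_def bij_betw_def by (meson inj_onD)
  then show "c i = 0" using sbasisD(3)[OF b] c(2) by blast
qed

text \<open>If \<open>a\<close> leads from one position to the next, then the letter behind is
  \<open>Inv a\<close> and the letter ahead, if any, is \<open>opp\<close> to it. So a direct letter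
  \<open>a'\<close> ahead satisfies \<open>\<not> R a a'\<close>, and no relation is
  violated.\<close>

lemma sbasis_amod:
  assumes r: "is_rep Q M" and b: "sbasis M w b" and w: "is_str w"
  shows "amod M"
  unfolding amod_def
proof (intro conjI ballI impI r)
  fix a a' x assume a: "a \<in> arcs Q" "a' \<in> arcs Q" "head Q a = tail Q a' \<and> R a a'" "x \<in> tot Q M"
  have z: "act Q M a' (act Q M a (b i)) = 0" if i: "i \<le> length (snd w)" for i
  proof (cases "stp (snd w) a i")
    case None
    then show ?thesis using sfamD(3)[OF sbasisD(1)[OF b] i a(1)] by simp
  next
    case (Some j)
    then obtain d where d: "out_letter (snd w) i d = Some (Dir a)" "j = nxt i d" using stp_Some_iff[OF w] by blast
    have j: "j \<le> length (snd w)" "out_letter (snd w) j (\<not> d) = Some (Inv a)"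
      using out_letterD(3,4)[OF w i d(1)] d(2) by auto
    have "stp (snd w) a' j = None"
    proof (rule ccontr)
      assume "stp (snd w) a' j \<noteq> None"
      then obtain d' where d': "out_letter (snd w) j d' = Some (Dir a')" using stp_Some_iff[OF w] by blast
      then have "d' = d" using j(2) by (cases d; cases d') auto
      then have "opp (Dir a') (Inv a)"
        using out_letter_opp[OF w, of j "Dir a'" "Inv a"] out_letter_opp[OF w, of j "Inv a" "Dir a'"] d' j(2)
        by (cases d) (simp_all add: opp_sym)
      then show False using a(3) by simp
    qed
    then show ?thesis
      using Some sfamD(3)[OF sbasisD(1)[OF b] i a(1)] sfamD(3)[OF sbasisD(1)[OF b] j(1) a(2)] by simp
  qed
  obtain c where "x = (\<Sum>i\<le>length (snd w). c i *\<^sub>F b i)" using sbasisD(2)[OF b a(4)] by blast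
  then show "act Q M a' (act Q M a x) = 0" using z by (simp add: act_sum)
qed

end

section \<open>Inverse walks and the coordinates of the string representation\<close>

context gentle_quiver
begin

lemma sfamI:
  assumes "\<And>i. i \<le> length (snd w) \<Longrightarrow> b i \<in> tot Q M"
    and "\<And>i. i \<le> length (snd w) \<Longrightarrow> pr (walk_verts Q w ! i) (b i) = b i"
    and "\<And>i a d. i \<le> length (snd w) \<Longrightarrow> a \<in> arcs Q \<Longrightarrow> out_letter (snd w) i d = Some (Dir a) \<Longrightarrow>
      act Q M a (b i) = b (nxt i d)"
    and "\<And>i a. i \<le> length (snd w) \<Longrightarrow> a \<in> arcs Q \<Longrightarrow> out_letter (snd w) i True \<noteq> Some (Dir a) \<Longrightarrow>
      out_letter (snd w) i False \<noteq> Some (Dir a) \<Longrightarrow> act Q M a (b i) = 0"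
  shows "sfam M w b"
  unfolding sfam_def stp_def using assms by auto

lemma sfam_out:
  assumes "is_str w" "sfam M w b" "i \<le> length (snd w)" "a \<in> arcs Q" "out_letter (snd w) i d = Some (Dir a)"
  shows "act Q M a (b i) = b (nxt i d)"
proof -
  have "stp (snd w) a i = Some (nxt i d)" using stp_Some_iff[OF assms(1)] assms(5) by blast
  then show ?thesis using sfamD(3)[OF assms(2-4)] by simp
qed

lemma sfam_zero:
  assumes "sfam M w b" "i \<le> length (snd w)" "a \<in> arcs Q" "\<And>d. out_letter (snd w) i d \<noteq> Some (Dir a)"
  shows "act Q M a (b i) = 0"
  using sfamD(3)[OF assms(1-3)] assms(4) by (simp add: stp_def)

definition rev_walk :: "('v, 'a) walk \<Rightarrow> ('v, 'a) walk" where
  "rev_walk w = (walk_verts Q w ! length (snd w), map letter_inv (rev (snd w)))"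

lemma walk_verts_rev:
  assumes "is_str w" "i \<le> length (snd w)"
  shows "walk_verts Q (rev_walk w) ! i = walk_verts Q w ! (length (snd w) - i)"
proof (cases i)
  case (Suc j)
  then have "walk_verts Q (rev_walk w) ! i = letter_source Q (snd w ! (length (snd w) - Suc j))"
    using assms(2) by (simp add: rev_walk_def walk_verts_Suc rev_nth)
  then show ?thesis using Suc assms by (simp add: is_str_nth)
qed (simp add: rev_walk_def)

lemma is_str_rev: "is_str w \<Longrightarrow> is_str (rev_walk w)"
  unfolding is_str_def
  using walk_verts_in[of w "length (snd w)"]
proof (elim conjE, intro conjI)
  assume w: "is_str w \<Longrightarrow> length (snd w) \<le> length (snd w) \<Longrightarrow> walk_verts Q w ! length (snd w) \<in> verts Q"
    and a: "fst w \<in> verts Q" "\<forall>l\<in>set (snd w). letter_arrow l \<in> arcs Q"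
      "snd w \<noteq> [] \<longrightarrow> letter_source Q (hd (snd w)) = fst w"
    and s: "successively (\<lambda>l l'. letter_target Q l = letter_source Q l' \<and> opp (letter_inv l) l') (snd w)"
  have "is_str w" using a s by (simp add: is_str_def)
  then show "fst (rev_walk w) \<in> verts Q" using w by (simp add: rev_walk_def)
  show "\<forall>l\<in>set (snd (rev_walk w)). letter_arrow l \<in> arcs Q" using a by (simp add: rev_walk_def)
  show "snd (rev_walk w) \<noteq> [] \<longrightarrow> letter_source Q (hd (snd (rev_walk w))) = fst (rev_walk w)"
    by (cases "snd w" rule: rev_cases) (auto simp: rev_walk_def walk_verts_Suc)
  show "successively (\<lambda>l l'. letter_target Q l = letter_source Q l' \<and> opp (letter_inv l) l') (snd (rev_walk w))"
    using s by (auto simp: rev_walk_def successively_map opp_sym elim!: successively_mono)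
qed

lemma out_letter_rev:
  assumes "i \<le> length ls"
  shows "out_letter (map letter_inv (rev ls)) i d = out_letter ls (length ls - i) (\<not> d)"
  using assms by (cases i) (auto simp: out_letter_def rev_nth)

lemma nxt_rev:
  assumes "i \<le> length ls" "out_letter ls (length ls - i) (\<not> d) = Some l"
  shows "length ls - nxt i d = nxt (length ls - i) (\<not> d)"
  using assms by (auto simp: nxt_def out_letter_def split: if_splits)

lemma rev_walk_length [simp]: "length (snd (rev_walk w)) = length (snd w)"
  by (simp add: rev_walk_def)

lemma sfam_rev:
  assumes w: "is_str w" and b: "sfam M w b"
  shows "sfam M (rev_walk w) (\<lambda>i. b (length (snd w) - i))"
proof (rule sfamI)
  fix i a d assume i: "i \<le> length (snd (rev_walk w))" and a: "a \<in> arcs Q"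
    and o: "out_letter (snd (rev_walk w)) i d = Some (Dir a)"
  then have o': "out_letter (snd w) (length (snd w) - i) (\<not> d) = Some (Dir a)"
    using out_letter_rev[of i "snd w" d] by (simp add: rev_walk_def)
  show "act Q M a (b (length (snd w) - i)) = b (length (snd w) - nxt i d)"
    using sfam_out[OF w b _ a o'] nxt_rev[OF _ o'] i by simp
next
  fix i a assume i: "i \<le> length (snd (rev_walk w))" and a: "a \<in> arcs Q"
    and o: "out_letter (snd (rev_walk w)) i True \<noteq> Some (Dir a)" "out_letter (snd (rev_walk w)) i False \<noteq> Some (Dir a)"
  have "out_letter (snd w) (length (snd w) - i) d \<noteq> Some (Dir a)" for d
    using out_letter_rev[of i "snd w" "\<not> d"] i o by (cases d) (auto simp: rev_walk_def)
  then show "act Q M a (b (length (snd w) - i)) = 0" using sfam_zero[OF b _ a] by simp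
qed (use sfamD[OF b] in \<open>auto simp: walk_verts_rev[OF w]\<close>)

lemma sum_rev_atMost: "(\<Sum>i\<le>(n::nat). f (n - i)) = (\<Sum>i\<le>n. f i)"
  by (rule sum.reindex_bij_witness[of _ "\<lambda>i. n - i" "\<lambda>i. n - i"]) auto

lemma sbasis_rev:
  assumes w: "is_str w" and b: "sbasis M w b"
  shows "sbasis M (rev_walk w) (\<lambda>i. b (length (snd w) - i))"
  unfolding sbasis_def
proof (intro conjI ballI allI impI)
  let ?n = "length (snd w)"
  show "sfam M (rev_walk w) (\<lambda>i. b (?n - i))" by (rule sfam_rev[OF w sbasisD(1)[OF b]])
  show "\<exists>c. x = (\<Sum>i\<le>length (snd (rev_walk w)). c i *\<^sub>F b (?n - i))" if x: "x \<in> tot Q M" for x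
  proof -
    obtain c where "x = (\<Sum>i\<le>?n. c i *\<^sub>F b i)" using sbasisD(2)[OF b x] by blast
    then have "x = (\<Sum>i\<le>?n. c (?n - i) *\<^sub>F b (?n - i))"
      using sum_rev_atMost[of "\<lambda>i. c i *\<^sub>F b i" ?n] by simp
    then show ?thesis by auto
  qed
  fix c i assume c: "(\<Sum>i\<le>length (snd (rev_walk w)). c i *\<^sub>F b (?n - i)) = 0" "i \<le> length (snd (rev_walk w))"
  have "(\<Sum>i\<le>?n. c (?n - i) *\<^sub>F b i) = (\<Sum>i\<le>?n. c i *\<^sub>F b (?n - i))"
    by (subst sum_rev_atMost[symmetric]) (auto intro!: sum.cong)
  then have "(\<Sum>i\<le>?n. c (?n - i) *\<^sub>F b i) = 0" using c by simp
  from sbasisD(3)[OF b this, of "?n - i"] c(2) show "c i = 0" by simp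
qed

lemma count_list_take_less:
  assumes "i < j" "j < length vs" "vs ! i = vs ! j"
  shows "count_list (take i vs) (vs ! i) < count_list (take j vs) (vs ! j)"
proof -
  have "take j vs = take i vs @ vs ! i # drop (Suc i) (take j vs)"
    using assms id_take_nth_drop[of i "take j vs"] by simp
  then have "count_list (take j vs) (vs ! j) = count_list (take i vs) (vs ! j) + 1 + count_list (drop (Suc i) (take j vs)) (vs ! j)"
    using assms(3) by (metis add.assoc add.commute count_list.simps(2) count_list_append)
  then show ?thesis using assms(3) by simp
qed

lemma count_list_take_bound:
  assumes "i < length vs"
  shows "count_list (take i vs) (vs ! i) < count_list vs (vs ! i)"
proof -
  have "vs = take i vs @ vs ! i # drop (Suc i) vs" using assms by (rule id_take_nth_drop)
  then have "count_list vs (vs ! i) = count_list (take i vs) (vs ! i) + count_list (vs ! i # drop (Suc i) vs) (vs ! i)"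
    by (metis count_list_append)
  then show ?thesis by simp
qed

lemma count_list_take_surj:
  "r < count_list vs v \<Longrightarrow> \<exists>i<length vs. vs ! i = v \<and> count_list (take i vs) v = r"
proof (induction vs arbitrary: r)
  case (Cons x vs)
  show ?case
  proof (cases "x = v \<and> r = 0")
    case True
    then show ?thesis by (intro exI[of _ 0]) simp
  next
    case False
    then have "r - (if x = v then 1 else 0) < count_list vs v" using Cons.prems by (auto split: if_splits)
    from Cons.IH[OF this] obtain i where "i < length vs" "vs ! i = v"
      "count_list (take i vs) v = r - (if x = v then 1 else 0)" by blast
    then show ?thesis using False by (intro exI[of _ "Suc i"]) (auto split: if_splits)
  qed
qed simp

lemma walk_pos_inj:
  assumes "i \<le> length (snd w)" "j \<le> length (snd w)" "walk_verts Q w ! i = walk_verts Q w ! j"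
    "walk_pos Q w i = walk_pos Q w j"
  shows "i = j"
  using count_list_take_less[of i j "walk_verts Q w"] count_list_take_less[of j i "walk_verts Q w"] assms
  by (cases i j rule: linorder_cases) (auto simp: walk_pos_def)

lemma is_rep_string: "is_rep Q (string_rep Q w)"
  by (simp add: is_rep_def string_rep_def Let_def)

lemma rdim_string: "rdim (string_rep Q w) v = count_list (walk_verts Q w) v"
  by (simp add: string_rep_def Let_def)

text \<open>Positions of the walk correspond bijectively to pairs of a vertex and a coordinate:
  repeated visits have different values of \<open>walk_pos\<close>, and every coordinate is
  attained. The matrix entries of an arrow are then exactly the graph of \<open>stp\<close>.\<close>

lemma sbasis_string_rep:
  assumes w: "is_str w"
  shows "sbasis (string_rep Q w :: ('v, 'a, 'k::field) rep) w (\<lambda>i. unitf (walk_verts Q w ! i) (walk_pos Q w i))"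
    (is "sbasis ?M w ?b")
proof -
  let ?n = "length (snd w)" and ?v = "\<lambda>i. walk_verts Q w ! i" and ?p = "walk_pos Q w"
  have pl: "?p i < rdim ?M (?v i)" if "i \<le> ?n" for i
    using count_list_take_bound[of i "walk_verts Q w"] that by (simp add: walk_pos_def rdim_string)
  have at: "?b j (?v i, ?p i) = (if i = j then 1 else 0)" if "i \<le> ?n" "j \<le> ?n" for i j
    using walk_pos_inj[OF that] by (auto simp: unitf_def)
  have act_val: "act Q ?M a (?b i) (v, r) = (if v = head Q a \<and> r < rdim ?M v \<and> ?v i = tail Q a
      then rmap ?M a $$ (r, ?p i) else 0)" if "i \<le> ?n" for a i v r
    using pl[OF that]
    by (auto simp: act_def unitf_def if_distrib[where f = "\<lambda>x. _ * x"] cong: if_cong)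
  have entry: "rmap ?M a $$ (r, ?p i) = (if \<exists>j. stp (snd w) a i = Some j \<and> r = ?p j then 1 else 0)"
    if i: "i \<le> ?n" and vi: "?v i = tail Q a" and r: "r < rdim ?M (head Q a)" for a i r
  proof -
    have eq: "?p i = ?p k \<longleftrightarrow> i = k" if "k \<le> ?n" "?v k = tail Q a" for k
      using walk_pos_inj[OF i that(1)] vi that(2) by auto
    have "(\<exists>k<?n. snd w ! k = Dir a \<and> ?p i = ?p k \<and> r = ?p (Suc k) \<or>
        snd w ! k = Inv a \<and> ?p i = ?p (Suc k) \<and> r = ?p k) \<longleftrightarrow>
        (\<exists>j. stp (snd w) a i = Some j \<and> r = ?p j)" (is "?l \<longleftrightarrow> ?r")
    proof
      assume ?l
      then obtain k where k: "k < ?n" "snd w ! k = Dir a \<and> ?p i = ?p k \<and> r = ?p (Suc k) \<or>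
        snd w ! k = Inv a \<and> ?p i = ?p (Suc k) \<and> r = ?p k" by blast
      then show ?r
      proof (elim disjE conjE)
        assume d: "snd w ! k = Dir a" "?p i = ?p k" "r = ?p (Suc k)"
        then have "?v k = tail Q a" using w k(1) by (auto simp: is_str_nth)
        then have "i = k" using eq[of k] d k(1) by simp
        then have "out_letter (snd w) i True = Some (Dir a)" using d k(1) by (simp add: out_letter_def)
        then show ?r using d \<open>i = k\<close> by (intro exI[of _ "Suc k"]) (auto simp: stp_def nxt_def)
      next
        assume d: "snd w ! k = Inv a" "?p i = ?p (Suc k)" "r = ?p k"
        then have "?v (Suc k) = tail Q a" using k(1) by (simp add: walk_verts_Suc)
        then have ik: "i = Suc k" using eq[of "Suc k"] d k(1) by simp
        then have "out_letter (snd w) i False = Some (Dir a)" using d by (simp add: out_letter_def)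
        then have "stp (snd w) a i = Some (nxt i False)" using stp_Some_iff[OF w] by blast
        then show ?r using d ik by (intro exI[of _ k]) (auto simp: nxt_def)
      qed
    next
      assume ?r
      then obtain j where j: "stp (snd w) a i = Some j" "r = ?p j" by blast
      then obtain d where d: "out_letter (snd w) i d = Some (Dir a)" "j = nxt i d" using stp_Some_iff[OF w] by blast
      show ?l
      proof (cases d)
        case True
        then show ?l using d j by (intro exI[of _ i]) (auto simp: out_letter_def nxt_def split: if_splits)
      next
        case False
        then show ?l using d j i by (intro exI[of _ "i - 1"]) (auto simp: out_letter_def nxt_def split: if_splits)
      qed
    qed
    then show ?thesis
      using pl[OF i] r vi by (simp add: string_rep_def Let_def)
  qed
  have fam: "sfam ?M w ?b"
    unfolding sfam_def
  proof (intro allI impI conjI ballI)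
    fix i assume i: "i \<le> ?n"
    show "?b i \<in> tot Q ?M" using i pl walk_verts_in[OF w] by (intro tot_unitf) auto
    show "pr (?v i) (?b i) = ?b i" by (auto simp: pr_def unitf_def fun_eq_iff)
    fix a assume a: "a \<in> arcs Q"
    show "act Q ?M a (?b i) = (case stp (snd w) a i of None \<Rightarrow> 0 | Some j \<Rightarrow> ?b j)"
    proof
      fix p :: "'v \<times> nat"
      obtain v r where p: "p = (v, r)" by force
      show "act Q ?M a (?b i) p = (case stp (snd w) a i of None \<Rightarrow> 0 | Some j \<Rightarrow> ?b j) p"
      proof (cases "stp (snd w) a i")
        case None
        then show ?thesis using act_val[OF i] entry[OF i] by (auto simp: p zero_fun_apply)
      next
        case (Some j)
        then show ?thesis using act_val[OF i] entry[OF i] stp_verts[OF w i Some] pl[of j]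
          by (auto simp: p unitf_def)
      qed
    qed
  qed
  have span: "x = (\<Sum>i\<le>?n. x (?v i, ?p i) *\<^sub>F ?b i)" if x: "x \<in> tot Q ?M" for x
  proof
    fix p :: "'v \<times> nat"
    obtain v r where p: "p = (v, r)" by force
    show "x p = (\<Sum>i\<le>?n. x (?v i, ?p i) *\<^sub>F ?b i) p"
    proof (cases "r < rdim ?M v")
      case True
      then obtain i where i: "i \<le> ?n" "?v i = v" "?p i = r"
        using count_list_take_surj[of r "walk_verts Q w" v] by (auto simp: rdim_string walk_pos_def less_Suc_eq_le)
      have "(\<Sum>j\<le>?n. x (?v j, ?p j) *\<^sub>F ?b j) p = (\<Sum>j\<le>?n. if i = j then x (?v j, ?p j) else 0)"
        unfolding sum_fun_apply smul_apply p using at[OF i(1)] i by (intro sum.cong refl) auto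
      then show ?thesis using i p by simp
    next
      case False
      then have "x p = 0" using x by (auto simp: tot_def p)
      moreover have "?b i p = 0" if "i \<le> ?n" for i
        using pl[OF that] False by (auto simp: p unitf_def)
      ultimately show ?thesis by (simp add: fun_ops)
    qed
  qed
  have ind: "c i = 0" if "(\<Sum>i\<le>?n. c i *\<^sub>F ?b i) = 0" "i \<le> ?n" for c i
  proof -
    have "(\<Sum>j\<le>?n. c j *\<^sub>F ?b j) (?v i, ?p i) = (\<Sum>j\<le>?n. if i = j then c j else 0)"
      unfolding sum_fun_apply smul_apply using at[OF that(2)] by (intro sum.cong refl) auto
    then show ?thesis using that by (simp add: zero_fun_apply)
  qed
  show ?thesis
    unfolding sbasis_def
  proof (intro conjI ballI allI impI fam)
    show "\<exists>c. x = (\<Sum>i\<le>?n. c i *\<^sub>F ?b i)" if "x \<in> tot Q ?M" for x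
      by (rule exI, rule span[OF that])
    show "c i = 0" if "(\<Sum>i\<le>?n. c i *\<^sub>F ?b i) = 0" "i \<le> ?n" for c i by (rule ind[OF that])
  qed
qed

lemma amod_string_rep: "is_str w \<Longrightarrow> amod (string_rep Q w)"
  using sbasis_amod[OF is_rep_string sbasis_string_rep] by blast

lemma sbasis_iff_miso:
  assumes "is_str w"
  shows "(\<exists>b. sbasis M w b) \<longleftrightarrow> (\<exists>F. miso M (string_rep Q w) F)"
  using sbasis_miso[OF _ sbasis_string_rep[OF assms]] sbasis_transport[OF sbasis_string_rep[OF assms] _ assms] miso_sym
  by metis

lemma string_rep_rev:
  assumes "is_str w"
  shows "\<exists>F. miso (string_rep Q w) (string_rep Q (rev_walk w)) F"
  using sbasis_rev[OF assms sbasis_string_rep[OF assms]] sbasis_iff_miso[OF is_str_rev[OF assms]] by blast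

end

section \<open>Indecomposability of string modules\<close>

context gentle_quiver
begin

text \<open>The word read outwards from position \<open>i\<close>. To the left it is inverted, so
  that in both directions \<open>Dir\<close> means an arrow leading away from
  \<open>i\<close>.\<close>

definition half :: "'a letter list \<Rightarrow> nat \<Rightarrow> bool \<Rightarrow> 'a letter list" where
  "half ls i d = (if d then drop i ls else map letter_inv (rev (take i ls)))"

lemma half_unfold:
  "i \<le> length ls \<Longrightarrow> half ls i d = (case out_letter ls i d of None \<Rightarrow> [] | Some l \<Rightarrow> l # half ls (nxt i d) d)"
  by (cases d; cases i) (auto simp: half_def out_letter_def nxt_def Cons_nth_drop_Suc take_Suc_conv_app_nth)

text \<open>A numerical version of the lexicographic order on half-words in which a direct letter counts
  more than the end of the word, and an inverse letter less.\<close>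

fun weight :: "'a letter list \<Rightarrow> real" where
  "weight [] = 0"
| "weight (Dir a # ls) = 1 + weight ls / 3"
| "weight (Inv a # ls) = - 1 + weight ls / 3"

text \<open>Because of the factor 1/3 the tail contributes less than 1/2 in absolute value. The
  first letter decides: weights of words beginning with \<open>Dir\<close> exceed 1/2, those
  beginning with \<open>Inv\<close> are below -1/2, and the empty word has 0.\<close>

lemma weight_bound: "\<bar>weight ls\<bar> < 3 / 2"
  by (induction ls rule: weight.induct) auto

text \<open>Orients a position by saying that direction \<open>d\<close> lies on side
  \<open>s\<close> of the vertex. This identifies directions at different positions over the same
  vertex. At an end of the walk one clause is empty, and on a trivial walk both values of
  \<open>s\<close> qualify.\<close>

definition sided :: "'a letter list \<Rightarrow> nat \<Rightarrow> bool \<Rightarrow> bool \<Rightarrow> bool" where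
  "sided ls i d s \<longleftrightarrow> (\<forall>l. out_letter ls i d = Some l \<longrightarrow> side l = s) \<and>
     (\<forall>l. out_letter ls i (\<not> d) = Some l \<longrightarrow> side l = (\<not> s))"

lemma sided_ex:
  assumes w: "is_str w" and i: "i \<le> length (snd w)"
  shows "\<exists>s. sided (snd w) i d s"
proof (cases "out_letter (snd w) i d")
  case None
  then show ?thesis
    by (cases "out_letter (snd w) i (\<not> d)") (auto simp: sided_def)
next
  case (Some l)
  have "side l' = (\<not> side l)" if "out_letter (snd w) i (\<not> d) = Some l'" for l'
  proof -
    have "opp l l'"
      using out_letter_opp[OF w, of i l l'] out_letter_opp[OF w, of i l' l] Some that opp_sym[of l l']
      by (cases d) auto
    then show ?thesis
      using opp_iff_side[OF out_letterD(1)[OF w i Some] out_letterD(1)[OF w i that]] by blast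
  qed
  then show ?thesis using Some by (auto simp: sided_def)
qed

lemma sided_flip: "sided ls i d s \<Longrightarrow> sided ls i (\<not> d) (\<not> s)"
  by (auto simp: sided_def)

lemma sided_step:
  assumes w: "is_str w" and i: "i \<le> length (snd w)" and l: "out_letter (snd w) i d = Some l"
  shows "sided (snd w) (nxt i d) d (\<not> side (letter_inv l))"
proof -
  note * = out_letterD[OF w i l]
  obtain s where s: "sided (snd w) (nxt i d) d s" using sided_ex[OF w *(3)] by blast
  then have "side (letter_inv l) = (\<not> s)" using *(4) by (auto simp: sided_def)
  then show ?thesis using s by simp
qed

definition endo_mat where
  "endo_mat w b f m \<longleftrightarrow> (\<forall>i\<le>length (snd w). f (b i) = (\<Sum>j\<le>length (snd w). m i j *\<^sub>F b j))"

lemma endo_mat_ex: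
  assumes "sbasis M w b" "mhom Q M M f"
  obtains m where "endo_mat w b f m"
proof -
  have "\<exists>c. f (b i) = (\<Sum>j\<le>length (snd w). c j *\<^sub>F b j)" if "i \<le> length (snd w)" for i
    using sbasisD(2)[OF assms(1)] mhomD(1)[OF assms(2)] sfamD(1)[OF sbasisD(1)[OF assms(1)] that] by blast
  then have "\<forall>i. \<exists>c. i \<le> length (snd w) \<longrightarrow> f (b i) = (\<Sum>j\<le>length (snd w). c j *\<^sub>F b j)" by blast
  from choice[OF this] obtain m where
    "\<forall>i. i \<le> length (snd w) \<longrightarrow> f (b i) = (\<Sum>j\<le>length (snd w). m i j *\<^sub>F b j)" by blast
  then show thesis using that by (auto simp: endo_mat_def)
qed

context
  fixes M :: "('v, 'a, 'k::field) rep" and w b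
  assumes w: "is_str w" and b: "sbasis M w b"
begin

lemma act_combination:
  assumes a: "a \<in> arcs Q"
  shows "act Q M a (\<Sum>j\<le>length (snd w). c j *\<^sub>F b j) = (\<Sum>j'\<le>length (snd w). (\<Sum>j\<le>length (snd w). if stp (snd w) a j = Some j' then c j else 0) *\<^sub>F b j')"
proof -
  have "act Q M a (\<Sum>j\<le>length (snd w). c j *\<^sub>F b j) = (\<Sum>j\<le>length (snd w). \<Sum>j'\<le>length (snd w). (if stp (snd w) a j = Some j' then c j else 0) *\<^sub>F b j')"
    unfolding act_sum act_linear
  proof (intro sum.cong refl)
    fix j assume "j \<in> {..length (snd w)}"
    then have j: "j \<le> length (snd w)" by simp
    show "c j *\<^sub>F act Q M a (b j) = (\<Sum>j'\<le>length (snd w). (if stp (snd w) a j = Some j' then c j else 0) *\<^sub>F b j')"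
    proof (cases "stp (snd w) a j")
      case None
      then show ?thesis using sfamD(3)[OF sbasisD(1)[OF b] j a] by simp
    next
      case (Some k)
      have "(\<Sum>j'\<le>length (snd w). (if k = j' then c j else 0) *\<^sub>F b j') = (\<Sum>j'\<le>length (snd w). if k = j' then c j *\<^sub>F b j' else 0)"
        by (intro sum.cong) auto
      then show ?thesis using Some sfamD(3)[OF sbasisD(1)[OF b] j a] stp_verts(3)[OF w j Some] by simp
    qed
  qed
  also have "\<dots> = (\<Sum>j'\<le>length (snd w). (\<Sum>j\<le>length (snd w). if stp (snd w) a j = Some j' then c j else 0) *\<^sub>F b j')"
    by (subst sum.swap) (simp add: fun_ops sum_distrib_right)
  finally show ?thesis .
qed

context
  fixes f m
  assumes f: "mhom Q M M f" and m: "endo_mat w b f m"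
begin

text \<open>Compares the coefficients of \<open>b j'\<close> in the two expressions for the image of
  \<open>act Q M a (b i)\<close> under \<open>f\<close>.\<close>

lemma endo_step:
  assumes i: "i \<le> length (snd w)" and j': "j' \<le> length (snd w)" and a: "a \<in> arcs Q"
  shows "(\<Sum>j\<le>length (snd w). if stp (snd w) a j = Some j' then m i j else 0) = (case stp (snd w) a i of None \<Rightarrow> 0 | Some k \<Rightarrow> m k j')"
proof -
  note bs = sbasisD(1)[OF b]
  have fb: "f (b i) = (\<Sum>j\<le>length (snd w). m i j *\<^sub>F b j)" using m i by (simp add: endo_mat_def)
  have "(\<Sum>j'\<le>length (snd w). (\<Sum>j\<le>length (snd w). if stp (snd w) a j = Some j' then m i j else 0) *\<^sub>F b j') = f (act Q M a (b i))"
    using mhomD(5)[OF f a sfamD(1)[OF bs i]] fb act_combination[OF a] by simp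
  also have "\<dots> = (\<Sum>j'\<le>length (snd w). (case stp (snd w) a i of None \<Rightarrow> 0 | Some k \<Rightarrow> m k j') *\<^sub>F b j')"
  proof (cases "stp (snd w) a i")
    case None
    then show ?thesis using sfamD(3)[OF bs i a] mhom_0[OF f] by simp
  next
    case (Some k)
    then have "f (b k) = (\<Sum>j\<le>length (snd w). m k j *\<^sub>F b j)"
      using m stp_verts(3)[OF w i Some] by (simp add: endo_mat_def)
    then show ?thesis using Some sfamD(3)[OF bs i a] by simp
  qed
  finally show ?thesis by (rule sbasis_unique[OF b _ j'])
qed

lemma endo_step_Some:
  assumes i: "i \<le> length (snd w)" and j: "j \<le> length (snd w)" and a: "a \<in> arcs Q" and s: "stp (snd w) a j = Some j'"
  shows "m i j = (case stp (snd w) a i of None \<Rightarrow> 0 | Some k \<Rightarrow> m k j')"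
proof -
  have "stp (snd w) a l = Some j' \<longleftrightarrow> l = j" if "l \<le> length (snd w)" for l
    using stp_inj[OF w that j _ s] s by blast
  then have "(\<Sum>l\<le>length (snd w). if stp (snd w) a l = Some j' then m i l else 0) = (\<Sum>l\<le>length (snd w). if l = j then m i l else 0)"
    by (intro sum.cong) simp_all
  then show ?thesis using endo_step[OF i stp_verts(3)[OF w j s] a] j by simp
qed

text \<open>Suppose \<open>b j\<close> occurs in \<open>f (b i)\<close>. An arrow that moves
  \<open>j\<close> cannot kill \<open>i\<close>, and if \<open>b i\<close> lies in the image of an
  arrow then \<open>j\<close> is hit by the same arrow. So \<open>Dir\<close> at \<open>j\<close>
  forces the same letter at \<open>i\<close>, and \<open>Inv\<close> at \<open>i\<close> the same
  letter at \<open>j\<close>. Along equal letters the argument is repeated; at the first difference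
  \<open>i\<close> has the heavier word.\<close>

lemma endo_weight:
  assumes "i \<le> length (snd w)" "j \<le> length (snd w)" "m i j \<noteq> 0" "sided (snd w) i d s" "sided (snd w) j d' s"
  shows "weight (half (snd w) i d) \<ge> weight (half (snd w) j d') \<and>
    (weight (half (snd w) i d) = weight (half (snd w) j d') \<longrightarrow> half (snd w) i d = half (snd w) j d')"
  using assms
proof (induction "length (half (snd w) i d)" arbitrary: i j s rule: less_induct)
  case less
  note i = less.prems(1) and j = less.prems(2) and nz = less.prems(3)
  let ?i = "nxt i d" and ?j = "nxt j d'"
  have dir: "out_letter (snd w) i d = Some (Dir c)" if c: "out_letter (snd w) j d' = Some (Dir c)" for c
  proof -
    have "stp (snd w) c j = Some ?j" using stp_Some_iff[OF w] c by blast
    then have "stp (snd w) c i \<noteq> None"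
      using endo_step_Some[OF i j, of c] nz out_letterD(1)[OF w j c]
      by (cases "stp (snd w) c i") (auto simp: at_vertex_def)
    then obtain e where e: "out_letter (snd w) i e = Some (Dir c)" using stp_Some_iff[OF w] by blast
    have "e = d"
    proof (rule ccontr)
      assume ne: "e \<noteq> d"
      then have "side (Dir c) = (\<not> s)" using e less.prems(4) by (cases e; cases d) (auto simp: sided_def)
      moreover have "side (Dir c) = s" using c less.prems(5) by (auto simp: sided_def)
      ultimately show False by simp
    qed
    then show ?thesis using e by simp
  qed
  have inv: "out_letter (snd w) j d' = Some (Inv a)" if a: "out_letter (snd w) i d = Some (Inv a)" for a
  proof -
    note di = out_letterD[OF w i a]
    have ar: "a \<in> arcs Q" using di(1) by (simp add: at_vertex_def)
    have s1: "stp (snd w) a ?i = Some i"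
      using di(4) stp_Some_iff[OF w] nxt_nxt[OF a] by force
    obtain k where k: "k \<le> length (snd w)" "stp (snd w) a k = Some j"
    proof (rule ccontr)
      assume "\<not> thesis"
      then have "(\<Sum>l\<le>length (snd w). if stp (snd w) a l = Some j then m ?i l else 0) = 0"
        using that by (intro sum.neutral) auto
      then show False using endo_step[OF di(3) j ar] s1 nz by simp
    qed
    then obtain e where e: "out_letter (snd w) j e = Some (Inv a)" using stp_Some_iff'[OF w j] by blast
    have "e = d'"
    proof (rule ccontr)
      assume ne: "e \<noteq> d'"
      then have "side (Inv a) = (\<not> s)" using e less.prems(5) by (cases e; cases d') (auto simp: sided_def)
      moreover have "side (Inv a) = s" using a less.prems(4) by (auto simp: sided_def)
      ultimately show False by simp
    qed
    then show ?thesis using e by simp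
  qed
  have step: ?case if l: "out_letter (snd w) i d = Some l" "out_letter (snd w) j d' = Some l" for l
  proof -
    note di = out_letterD[OF w i l(1)] and dj = out_letterD[OF w j l(2)]
    have "m ?i ?j \<noteq> 0"
    proof (cases l)
      case (Dir c)
      have c: "c \<in> arcs Q" using di(1) Dir by (simp add: at_vertex_def)
      have "stp (snd w) c i = Some ?i" "stp (snd w) c j = Some ?j" using stp_Some_iff[OF w] l Dir by blast+
      then show ?thesis using endo_step_Some[OF i j c] nz by simp
    next
      case (Inv c)
      have c: "c \<in> arcs Q" using di(1) Inv by (simp add: at_vertex_def)
      have "stp (snd w) c ?i = Some i" "stp (snd w) c ?j = Some j"
        using stp_Some_iff[OF w] di(4) dj(4) Inv nxt_nxt[OF l(1)] nxt_nxt[OF l(2)] by force+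
      then show ?thesis using endo_step_Some[OF di(3) dj(3) c] nz by simp
    qed
    moreover have hi: "half (snd w) i d = l # half (snd w) ?i d" and hj: "half (snd w) j d' = l # half (snd w) ?j d'"
      using half_unfold[OF i, of d] half_unfold[OF j, of d'] l by simp_all
    ultimately have "weight (half (snd w) ?i d) \<ge> weight (half (snd w) ?j d') \<and>
      (weight (half (snd w) ?i d) = weight (half (snd w) ?j d') \<longrightarrow> half (snd w) ?i d = half (snd w) ?j d')"
      using less.hyps[of ?i ?j "\<not> side (letter_inv l)"] di(3) dj(3) sided_step[OF w i l(1)] sided_step[OF w j l(2)]
      by simp
    then show ?thesis unfolding hi hj by (cases l) auto
  qed
  show ?case
  proof (cases "out_letter (snd w) i d")
    case None
    then have hi: "half (snd w) i d = []" using half_unfold[OF i, of d] by simp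
    show ?thesis
    proof (cases "out_letter (snd w) j d'")
      case None
      then show ?thesis using hi half_unfold[OF j, of d'] by simp
    next
      case (Some l)
      then have hj: "half (snd w) j d' = l # half (snd w) ?j d'" using half_unfold[OF j, of d'] by simp
      show ?thesis using weight_bound[of "half (snd w) ?j d'"] dir Some None unfolding hi hj by (cases l) auto
    qed
  next
    case (Some l)
    then have hi: "half (snd w) i d = l # half (snd w) ?i d" using half_unfold[OF i, of d] by simp
    show ?thesis
    proof (cases l)
      case (Inv a)
      then show ?thesis using step[of l] inv[of a] Some by simp
    next
      case (Dir a)
      show ?thesis
      proof (cases "out_letter (snd w) j d'")
        case None
        then have "half (snd w) j d' = []" using half_unfold[OF j, of d'] by simp
        then show ?thesis using weight_bound[of "half (snd w) ?i d"] Dir unfolding hi by auto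
      next
        case (Some l')
        then have hj: "half (snd w) j d' = l' # half (snd w) ?j d'" using half_unfold[OF j, of d'] by simp
        show ?thesis
        proof (cases l')
          case (Dir c)
          then show ?thesis using step[of "Dir c"] dir[of c] Some by simp
        next
          case (Inv c)
          then show ?thesis
            using weight_bound[of "half (snd w) ?i d"] weight_bound[of "half (snd w) ?j d'"] \<open>l = Dir a\<close> unfolding hi hj by auto
        qed
      qed
    qed
  qed
qed

end

text \<open>The order for which matrices of endomorphisms are triangular: by
  \<open>endo_level\<close>, a nonzero entry off the diagonal leads to a strictly smaller
  level.\<close>

definition level :: "nat \<Rightarrow> real" where
  "level i = weight (half (snd w) i True) + weight (half (snd w) i False)"

text \<open>In the middle of a word equal to its own inverse stands either a letter followed by its
  inverse, which a string does not allow, or a single letter that is its own inverse.\<close>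

lemma string_not_palindrome:
  assumes "snd w = map letter_inv (rev (snd w))"
  shows "snd w = []"
proof (rule ccontr)
  assume ne: "snd w \<noteq> []"
  have e: "snd w ! i = letter_inv (snd w ! (length (snd w) - Suc i))" if "i < length (snd w)" for i
    using arg_cong[OF assms, of "\<lambda>xs. xs ! i"] that by (simp add: rev_nth)
  show False
  proof (cases "even (length (snd w))")
    case True
    then obtain h where h: "length (snd w) = 2 * h" by blast
    then have "h > 0" using ne by (cases h) auto
    then have "snd w ! (h - 1) = letter_inv (snd w ! h)" using e[of "h - 1"] h by simp
    moreover have "Suc (h - 1) < length (snd w)" using h \<open>h > 0\<close> by simp
    then have "opp (letter_inv (snd w ! (h - 1))) (snd w ! Suc (h - 1))" using w by (simp add: is_str_nth)
    ultimately have "opp (snd w ! h) (snd w ! h)" using \<open>h > 0\<close> by simp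
    then show False by simp
  next
    case False
    then obtain h where "length (snd w) = 2 * h + 1" using oddE by blast
    then show False using e[of h] by (auto dest: sym)
  qed
qed

text \<open>Both half-words of \<open>i\<close> weigh at least as much as those of \<open>j\<close>.
  If both agreed, either the two positions would coincide or the string would equal its
  inverse.\<close>

lemma endo_level:
  assumes f: "mhom Q M M f" and m: "endo_mat w b f m" and i: "i \<le> length (snd w)" and j: "j \<le> length (snd w)"
    and nz: "m i j \<noteq> 0" and ne: "i \<noteq> j"
  shows "level j < level i"
proof -
  obtain s where s: "sided (snd w) i True s" using sided_ex[OF w i] by blast
  obtain s' where s': "sided (snd w) j True s'" using sided_ex[OF w j] by blast
  \<comment> \<open>The direction at \<open>j\<close> that lies on the same side as the right
    direction at \<open>i\<close>.\<close>
  define d where "d \<longleftrightarrow> s = s'"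
  have d: "sided (snd w) j d s" using s' sided_flip[OF s'] by (cases "s = s'"; cases s; cases s') (auto simp: d_def)
  have l: "level j = weight (half (snd w) j d) + weight (half (snd w) j (\<not> d))" by (cases d) (auto simp: level_def)
  have 1: "weight (half (snd w) i True) \<ge> weight (half (snd w) j d) \<and>
      (weight (half (snd w) i True) = weight (half (snd w) j d) \<longrightarrow> half (snd w) i True = half (snd w) j d)"
    by (rule endo_weight[OF f m i j nz s d])
  have 2: "weight (half (snd w) i False) \<ge> weight (half (snd w) j (\<not> d)) \<and>
      (weight (half (snd w) i False) = weight (half (snd w) j (\<not> d)) \<longrightarrow> half (snd w) i False = half (snd w) j (\<not> d))"
    using endo_weight[OF f m i j nz sided_flip[OF s] sided_flip[OF d]] by simp
  have "\<not> (half (snd w) i True = half (snd w) j d \<and> half (snd w) i False = half (snd w) j (\<not> d))"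
  proof
    assume a: "half (snd w) i True = half (snd w) j d \<and> half (snd w) i False = half (snd w) j (\<not> d)"
    show False
    proof (cases d)
      case True
      then have "drop i (snd w) = drop j (snd w)" using a by (simp add: half_def)
      from arg_cong[OF this, of length] have "length (snd w) - i = (length (snd w)) - j" by simp
      then show False using i j ne by simp
    next
      case False
      then have r: "drop i (snd w) = map letter_inv (rev (take j (snd w)))" "map letter_inv (rev (take i (snd w))) = drop j (snd w)"
        using a by (simp_all add: half_def)
      have "map letter_inv (rev (snd w)) = map letter_inv (rev (drop i (snd w))) @ map letter_inv (rev (take i (snd w)))"
        by (simp flip: map_append rev_append)
      also have "\<dots> = take j (snd w) @ drop j (snd w)" unfolding r by (simp add: rev_map comp_def)
      finally have "snd w = []" using string_not_palindrome by simp
      then show False using i j ne by simp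
    qed
  qed
  then show ?thesis using 1 2 l unfolding level_def by linarith
qed

text \<open>Neighbouring positions are joined by an arrow, and commuting with it identifies their
  diagonal entries.\<close>

lemma endo_diag:
  assumes f: "mhom Q M M f" and m: "endo_mat w b f m" and i: "i \<le> length (snd w)"
  shows "m i i = m 0 0"
  using i
proof (induction i)
  case (Suc i)
  have l: "out_letter (snd w) i True = Some (snd w ! i)" using Suc.prems by (simp add: out_letter_def)
  have le: "i \<le> length (snd w)" using Suc.prems by simp
  have "m i i = m (Suc i) (Suc i)"
  proof (cases "snd w ! i")
    case (Dir c)
    have c: "c \<in> arcs Q" using out_letterD(1)[OF w le l] Dir by (simp add: at_vertex_def)
    have s: "stp (snd w) c i = Some (Suc i)" using l Dir by (simp add: stp_def nxt_def)
    then show ?thesis using endo_step_Some[OF f m le le c s] by simp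
  next
    case (Inv c)
    have c: "c \<in> arcs Q" using out_letterD(1)[OF w le l] Inv by (simp add: at_vertex_def)
    have "out_letter (snd w) (Suc i) False = Some (Dir c)" using Inv by (simp add: out_letter_def)
    then have s: "stp (snd w) c (Suc i) = Some i" using stp_Some_iff[OF w, of c "Suc i" i] by (auto simp: nxt_def)
    then show ?thesis using endo_step_Some[OF f m Suc.prems Suc.prems c s] by simp
  qed
  then show ?case using Suc.IH le by simp
qed simp

text \<open>By triangularity the products of entries off the diagonal do not reach
  \<open>m 0 0\<close>, which is thus an idempotent scalar. If it is zero, the matrix is strictly
  triangular and idempotent, hence zero.\<close>

lemma idempotent_diag_zero:
  assumes f: "mhom Q M M f" and m: "endo_mat w b f m" and id: "\<And>x. x \<in> tot Q M \<Longrightarrow> f (f x) = f x"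
  shows "m 0 0 = 0 \<or> m 0 0 = 1" "m 0 0 = 0 \<Longrightarrow> x \<in> tot Q M \<Longrightarrow> f x = 0"
proof -
  note bt = sfamD(1)[OF sbasisD(1)[OF b]]
  have fb: "f (b i) = (\<Sum>j\<le>length (snd w). m i j *\<^sub>F b j)" if "i \<le> length (snd w)" for i using m that by (simp add: endo_mat_def)
  have mm: "m i j = (\<Sum>k\<le>length (snd w). m i k * m k j)" if i: "i \<le> length (snd w)" and j: "j \<le> length (snd w)" for i j
  proof (rule sbasis_unique[OF b _ j])
    have "f (f (b i)) = (\<Sum>k\<le>length (snd w). f (m i k *\<^sub>F b k))"
      unfolding fb[OF i] using bt by (intro mhom_sum[OF f]) (auto intro: tot_intros)
    also have "\<dots> = (\<Sum>k\<le>length (snd w). \<Sum>j\<le>length (snd w). (m i k * m k j) *\<^sub>F b j)"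
      by (intro sum.cong refl) (simp add: mhomD(3)[OF f bt] fb smul_sum)
    also have "\<dots> = (\<Sum>j\<le>length (snd w). (\<Sum>k\<le>length (snd w). m i k * m k j) *\<^sub>F b j)"
      by (subst sum.swap) (simp add: fun_ops sum_distrib_right)
    finally show "(\<Sum>j\<le>length (snd w). m i j *\<^sub>F b j) = (\<Sum>j\<le>length (snd w). (\<Sum>k\<le>length (snd w). m i k * m k j) *\<^sub>F b j)"
      using id[OF bt[OF i]] fb[OF i] by simp
  qed
  have lev: "i = j \<or> level j < level i" if "m i j \<noteq> 0" "i \<le> length (snd w)" "j \<le> length (snd w)" for i j
    using endo_level[OF f m that(2,3,1)] by blast
  have "m 0 0 = (\<Sum>k\<le>length (snd w). m 0 k * m k 0)" by (rule mm) simp_all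
  also have "\<dots> = (\<Sum>k\<le>length (snd w). if k = 0 then m 0 0 * m 0 0 else 0)"
  proof (intro sum.cong refl)
    fix k assume "k \<in> {..length (snd w)}"
    then have k: "k \<le> length (snd w)" by simp
    show "m 0 k * m k 0 = (if k = 0 then m 0 0 * m 0 0 else 0)"
    proof (cases "k = 0")
      case False
      have "m 0 k = 0 \<or> m k 0 = 0"
      proof (rule ccontr)
        assume "\<not> ?thesis"
        then have "level k < level 0" "level 0 < level k" using lev[of 0 k] lev[of k 0] k False by auto
        then show False by simp
      qed
      then show ?thesis using False by auto
    qed simp
  qed
  finally have "m 0 0 = m 0 0 * m 0 0" by simp
  then show "m 0 0 = 0 \<or> m 0 0 = 1" by simp
  assume z: "m 0 0 = 0" and x: "x \<in> tot Q M"
  have zero: "m i j = 0" if "i \<le> length (snd w)" "j \<le> length (snd w)" for i j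
  proof (rule ccontr)
    assume nz: "m i j \<noteq> 0"
    \<comment> \<open>The nonzero rows. Writing an entry of a row of least level as an entry of the
      square of \<open>m\<close> produces a nonzero row of smaller level.\<close>
    define S where "S = {i. i \<le> length (snd w) \<and> (\<exists>j\<le>length (snd w). m i j \<noteq> 0)}"
    have S: "finite S" "S \<noteq> {}" using that nz by (auto simp: S_def)
    define i0 where "i0 = arg_min_on level S"
    have i0: "i0 \<in> S" "\<And>k. k \<in> S \<Longrightarrow> \<not> level k < level i0"
      unfolding i0_def using arg_min_if_finite[OF S] by auto
    then obtain j0 where j0: "i0 \<le> length (snd w)" "j0 \<le> length (snd w)" "m i0 j0 \<noteq> 0" by (auto simp: S_def)
    obtain k where k: "k \<le> length (snd w)" "m i0 k * m k j0 \<noteq> 0"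
    proof (rule ccontr)
      assume "\<not> thesis"
      then have "(\<Sum>k\<le>length (snd w). m i0 k * m k j0) = 0" using that by (intro sum.neutral) auto
      then show False using mm[OF j0(1,2)] j0(3) by simp
    qed
    have "i0 \<noteq> k" using k endo_diag[OF f m j0(1)] z by auto
    then have "level k < level i0" using lev[of i0 k] k j0 by auto
    then show False using i0(2)[of k] k j0 by (auto simp: S_def)
  qed
  obtain c where c: "x = (\<Sum>i\<le>length (snd w). c i *\<^sub>F b i)" using sbasisD(2)[OF b x] by blast
  have "f x = (\<Sum>i\<le>length (snd w). c i *\<^sub>F f (b i))"
    unfolding c using bt by (subst mhom_sum[OF f]) (auto intro!: tot_intros sum.cong simp: mhomD(3)[OF f])
  then show "f x = 0" using fb zero by (simp add: sum.neutral)
qed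

text \<open>The diagonal of an idempotent is constantly 0 or constantly 1; the second case is the
  first one for the complementary idempotent.\<close>

lemma sbasis_indec:
  assumes r: "is_rep Q M"
  shows "indec M"
proof (rule indecI)
  show "amod M" by (rule sbasis_amod[OF r b w])
  have "b 0 \<noteq> 0"
  proof
    assume "b 0 = 0"
    then have "(\<Sum>i\<le>length (snd w). (if i = 0 then 1 else 0) *\<^sub>F b i) = 0"
      using sum_smul_single[of 0 "length (snd w)" b] by simp
    from sbasisD(3)[OF b this, of 0] show False by simp
  qed
  then show "tot Q M \<noteq> {0}" using sfamD(1)[OF sbasisD(1)[OF b], of 0] by auto
  fix e assume e: "mhom Q M M e" "\<And>x. x \<in> tot Q M \<Longrightarrow> e (e x) = e x"
  obtain m where m: "endo_mat w b e m" using endo_mat_ex[OF b e(1)] by blast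
  from idempotent_diag_zero(1)[OF e(1) m e(2)] show "(\<forall>x\<in>tot Q M. e x = 0) \<or> (\<forall>x\<in>tot Q M. e x = x)"
  proof
    assume "m 0 0 = 0"
    then show ?thesis using idempotent_diag_zero(2)[OF e(1) m e(2)] by blast
  next
    assume one: "m 0 0 = 1"
    have e': "mhom Q M M (\<lambda>x. x - e x)" by (intro mhom_minus mhom_id e)
    have i': "(x - e x) - e (x - e x) = x - e x" if "x \<in> tot Q M" for x
      using that mhomD(1)[OF e(1) that] by (simp add: mhom_diff[OF e(1)] e(2))
    have m': "endo_mat w b (\<lambda>x. x - e x) (\<lambda>i j. (if j = i then 1 else 0) - m i j)"
      unfolding endo_mat_def
    proof (intro allI impI)
      fix i assume i: "i \<le> length (snd w)"
      then show "b i - e (b i) = (\<Sum>j\<le>length (snd w). ((if j = i then 1 else 0) - m i j) *\<^sub>F b j)"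
        using m sum_smul_single[OF i, of b] by (simp add: diff_smul sum_subtractf endo_mat_def)
    qed
    have "x - e x = 0" if "x \<in> tot Q M" for x
      by (rule idempotent_diag_zero(2)[where f = "\<lambda>x. x - e x" and
            m = "\<lambda>i j. (if j = i then 1 else 0) - m i j", OF e' m' i' _ that]) (simp_all add: one)
    then show ?thesis by auto
  qed
qed

end

lemma indec_string_rep: "is_str w \<Longrightarrow> indec (string_rep Q w)"
  using sbasis_indec[OF _ sbasis_string_rep is_rep_string] by blast

end

section \<open>Paths, peaks and the families generated by a top vector\<close>

context gentle_quiver
begin

definition dpath :: "'v \<Rightarrow> 'a list \<Rightarrow> bool" where
  "dpath v p \<longleftrightarrow> set p \<subseteq> arcs Q \<and> successively (\<lambda>a b. head Q a = tail Q b \<and> \<not> R a b) p \<and>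
     (p \<noteq> [] \<longrightarrow> tail Q (hd p) = v)"

text \<open>True of the empty path, which stands for a missing side of a peak and not for a path
  that cannot be continued.\<close>

definition dmax :: "'a list \<Rightarrow> bool" where
  "dmax p \<longleftrightarrow> (p \<noteq> [] \<longrightarrow> (\<forall>c\<in>arcs Q. tail Q c = head Q (last p) \<longrightarrow> R (last p) c))"

definition path_vert :: "'v \<Rightarrow> 'a list \<Rightarrow> nat \<Rightarrow> 'v" where
  "path_vert v p t = (if t = 0 then v else head Q (p ! (t - 1)))"

text \<open>The walk \<open>p\<^sup>-\<^sup>1 q\<close>, for two paths \<open>p\<close> and \<open>q\<close> starting at \<open>v\<close>.\<close>

definition peak :: "'v \<Rightarrow> 'a list \<Rightarrow> 'a list \<Rightarrow> ('v, 'a) walk" where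
  "peak v p q = (path_vert v p (length p), map Inv (rev p) @ map Dir q)"

definition apart :: "'a list \<Rightarrow> 'a list \<Rightarrow> bool" where
  "apart p q \<longleftrightarrow> (p \<noteq> [] \<and> q \<noteq> [] \<longrightarrow> hd p \<noteq> hd q)"

definition pvec where
  "pvec M x p t = foldl (\<lambda>y a. act Q M a y) x (take t p)"

lemma snd_peak [simp]: "length (snd (peak v p q)) = length p + length q"
  by (simp add: peak_def)

lemma pvec_0 [simp]: "pvec M x p 0 = x"
  by (simp add: pvec_def)

lemma pvec_Suc: "t < length p \<Longrightarrow> pvec M x p (Suc t) = act Q M (p ! t) (pvec M x p t)"
  by (simp add: pvec_def take_Suc_conv_app_nth)

lemma dpath_nth:
  assumes "dpath v p" "t < length p"
  shows "p ! t \<in> arcs Q" "tail Q (p ! t) = path_vert v p t"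
    "Suc t < length p \<Longrightarrow> \<not> R (p ! t) (p ! Suc t)"
proof -
  show "p ! t \<in> arcs Q" using assms by (auto simp: dpath_def)
  show "tail Q (p ! t) = path_vert v p t"
    using assms by (cases t) (auto simp: dpath_def path_vert_def successively_nth hd_conv_nth)
  show "Suc t < length p \<Longrightarrow> \<not> R (p ! t) (p ! Suc t)" using assms by (auto simp: dpath_def successively_nth)
qed

lemma path_vert_Suc [simp]: "path_vert v p (Suc t) = head Q (p ! t)"
  by (simp add: path_vert_def)

lemma path_vert_0 [simp]: "path_vert v p 0 = v"
  by (simp add: path_vert_def)

lemma path_vert_in: "v \<in> verts Q \<Longrightarrow> dpath v p \<Longrightarrow> t \<le> length p \<Longrightarrow> path_vert v p t \<in> verts Q"
  using dpath_nth(1)[of v p "t - 1"] head_verts by (cases t) auto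

lemma nth_peak:
  assumes "i < length p + length q"
  shows "snd (peak v p q) ! i = (if i < length p then Inv (p ! (length p - Suc i)) else Dir (q ! (i - length p)))"
  using assms by (auto simp: peak_def nth_append rev_nth)

lemma walk_verts_peak:
  assumes p: "dpath v p" and q: "dpath v q" and i: "i \<le> length p + length q"
  shows "walk_verts Q (peak v p q) ! i =
    (if i \<le> length p then path_vert v p (length p - i) else path_vert v q (i - length p))"
proof (cases i)
  case 0
  then show ?thesis by (simp add: peak_def)
next
  case (Suc j)
  then have "walk_verts Q (peak v p q) ! i = letter_target Q (snd (peak v p q) ! j)"
    using i by (simp add: walk_verts_Suc)
  also have "\<dots> = (if i \<le> length p then path_vert v p (length p - i) else path_vert v q (i - length p))"
    using Suc i dpath_nth(2)[OF p, of "length p - Suc j"]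
    by (auto simp: nth_peak Suc_diff_le path_vert_def)
  finally show ?thesis .
qed

lemma out_letter_peak:
  assumes i: "i \<le> length p + length q"
  shows "out_letter (snd (peak v p q)) i True = (if i < length p then Some (Inv (p ! (length p - Suc i)))
      else if i < length p + length q then Some (Dir (q ! (i - length p))) else None)"
    "out_letter (snd (peak v p q)) i False = (if i = 0 then None else if i \<le> length p then Some (Dir (p ! (length p - i)))
      else Some (Inv (q ! (i - Suc (length p)))))"
  using i by (auto simp: out_letter_def nth_peak)

lemma is_str_peak:
  assumes v: "v \<in> verts Q" and p: "dpath v p" and q: "dpath v q" and "apart p q"
  shows "is_str (peak v p q)"
  unfolding is_str_nth
proof (intro conjI allI impI)
  show "fst (peak v p q) \<in> verts Q"
    using path_vert_in[OF v p] by (simp add: peak_def)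
next
  fix i assume "i < length (snd (peak v p q))"
  then have i: "i < length p + length q" by simp
  show "letter_arrow (snd (peak v p q) ! i) \<in> arcs Q"
    using i dpath_nth(1)[OF p] dpath_nth(1)[OF q] by (simp add: nth_peak)
  show "letter_source Q (snd (peak v p q) ! i) = walk_verts Q (peak v p q) ! i"
  proof (cases "i < length p")
    case True
    then have e: "length p - i = Suc (length p - Suc i)" by simp
    have "path_vert v p (length p - i) = head Q (p ! (length p - Suc i))" unfolding e by simp
    then show ?thesis using i True by (simp add: nth_peak walk_verts_peak[OF p q])
  next
    case False
    then show ?thesis using i dpath_nth(2)[OF q, of "i - length p"] by (auto simp: nth_peak walk_verts_peak[OF p q])
  qed
next
  fix i assume "Suc i < length (snd (peak v p q))"
  then have i: "Suc i < length p + length q" by simp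
  consider "Suc i < length p" | "Suc i = length p" | "length p \<le> i" by linarith
  then show "opp (letter_inv (snd (peak v p q) ! i)) (snd (peak v p q) ! Suc i)"
  proof cases
    case 1
    then have "Suc (length p - Suc (Suc i)) = length p - Suc i" by simp
    then show ?thesis using 1 i dpath_nth(3)[OF p, of "length p - Suc (Suc i)"] by (simp add: nth_peak)
  next
    case 2
    then have "length p - Suc i = 0" "p \<noteq> []" "q \<noteq> []" using i by auto
    then show ?thesis using 2 i assms(4) by (simp add: nth_peak hd_conv_nth apart_def)
  next
    case 3
    then show ?thesis using i dpath_nth(3)[OF q, of "i - length p"] by (simp add: nth_peak Suc_diff_le)
  qed
qed

lemma rev_walk_peak:
  assumes "dpath v p" "dpath v q"
  shows "rev_walk (peak v p q) = peak v q p"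
proof -
  have "walk_verts Q (peak v p q) ! (length p + length q) = path_vert v q (length q)"
    using walk_verts_peak[OF assms, of "length p + length q"] by auto
  then show ?thesis by (simp add: rev_walk_def peak_def rev_map comp_def)
qed

lemma pvec_tot: "x \<in> tot Q M \<Longrightarrow> set p \<subseteq> arcs Q \<Longrightarrow> t \<le> length p \<Longrightarrow> pvec M x p t \<in> tot Q M"
  by (induction t) (auto simp: pvec_Suc intro!: tot_act)

lemma pvec_pr:
  assumes "pr v x = x" "t \<le> length p"
  shows "pr (path_vert v p t) (pvec M x p t) = pvec M x p t"
  using assms by (cases t) (auto simp: pvec_Suc pr_act)

text \<open>After at least one step, only the next arrow of \<open>p\<close> can act: by
  \<open>nonrel_right\<close> any other composable arrow forms a relation with the arrow just used,
  and at the end of \<open>p\<close> right maximality says the same. At the top, where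
  \<open>t = 0\<close>, nothing of the kind holds.\<close>

lemma act_pvec:
  assumes E: "amod E" and p: "dpath v p" "dmax p" and x: "x \<in> tot Q E" and t: "0 < t" "t \<le> length p" and a: "a \<in> arcs Q"
  shows "act Q E a (pvec E x p t) = (if t < length p \<and> a = p ! t then pvec E x p (Suc t) else 0)"
proof -
  obtain s where s: "t = Suc s" using t by (cases t) auto
  let ?c = "p ! s" and ?y = "pvec E x p s"
  have y: "?y \<in> tot Q E" using pvec_tot[OF x] p(1) t s by (simp add: dpath_def)
  have c: "?c \<in> arcs Q" using dpath_nth(1)[OF p(1)] t s by simp
  have e: "pvec E x p t = act Q E ?c ?y" using s t by (simp add: pvec_Suc)
  show ?thesis
  proof (cases "t < length p \<and> a = p ! t")
    case True
    then show ?thesis by (simp add: pvec_Suc)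
  next
    case False
    have "act Q E a (act Q E ?c ?y) = 0"
    proof (cases "tail Q a = head Q ?c")
      case True
      have "R ?c a"
      proof (cases "t < length p")
        case lt: True
        show ?thesis
        proof (rule ccontr)
          assume "\<not> R ?c a"
          then have "a = p ! t"
            using nonrel_right[OF c a dpath_nth(1)[OF p(1) lt]] True dpath_nth(2)[OF p(1) lt]
              dpath_nth(3)[OF p(1), of s] lt s by simp
          then show False using False lt by simp
        qed
      next
        case False
        then have "p \<noteq> []" "s = length p - 1" using s t by auto
        then have "?c = last p" "p \<noteq> []" using last_conv_nth[of p] by auto
        then show ?thesis using p(2) a True by (simp add: dmax_def)
      qed
      then show ?thesis using E c a True y by (simp add: amod_def)
    next
      case False
      then show ?thesis using act_pr[of Q E a "head Q ?c" "act Q E ?c ?y"] by (simp add: pr_act)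
    qed
    then show ?thesis using False e by auto
  qed
qed

definition peak_fam where
  "peak_fam E x p q i = (if i \<le> length p then pvec E x p (length p - i) else pvec E x q (i - length p))"

text \<open>The module of a peak is generated by its top vector. The only condition on that vector
  is that arrows beginning neither side kill it; lower down \<open>act_pvec\<close> takes care of
  everything.\<close>

lemma sfam_peak:
  assumes E: "amod E" and v: "v \<in> verts Q" and p: "dpath v p" "dmax p" and q: "dpath v q" "dmax q" and pq: "apart p q"
    and x: "x \<in> tot Q E" "pr v x = x"
    and miss: "\<And>a. a \<in> arcs Q \<Longrightarrow> tail Q a = v \<Longrightarrow> \<not> (p \<noteq> [] \<and> a = hd p) \<Longrightarrow> \<not> (q \<noteq> [] \<and> a = hd q) \<Longrightarrow> act Q E a x = 0"
  shows "sfam E (peak v p q) (peak_fam E x p q)"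
proof (rule sfamI)
  fix i assume "i \<le> length (snd (peak v p q))"
  then have i: "i \<le> length p + length q" by simp
  show "peak_fam E x p q i \<in> tot Q E"
    using pvec_tot[OF x(1)] p(1) q(1) i by (simp add: peak_fam_def dpath_def)
  show "pr (walk_verts Q (peak v p q) ! i) (peak_fam E x p q i) = peak_fam E x p q i"
    using pvec_pr[OF x(2), of "length p - i" p] pvec_pr[OF x(2), of "i - length p" q] i
    by (simp add: walk_verts_peak[OF p(1) q(1)] peak_fam_def)
  fix a assume a: "a \<in> arcs Q"
  {
    fix d assume d: "out_letter (snd (peak v p q)) i d = Some (Dir a)"
    show "act Q E a (peak_fam E x p q i) = peak_fam E x p q (nxt i d)"
    proof (cases d)
      case True
      then have "length p \<le> i" "i < length p + length q" "a = q ! (i - length p)"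
        using d out_letter_peak(1)[OF i, of v] by (auto split: if_splits)
      then show ?thesis using True pvec_Suc[of "i - length p" q E x]
        by (cases "i = length p") (auto simp: peak_fam_def nxt_def Suc_diff_le)
    next
      case False
      then have "0 < i" "i \<le> length p" "a = p ! (length p - i)"
        using d out_letter_peak(2)[OF i, of v] by (auto split: if_splits)
      then show ?thesis using False pvec_Suc[of "length p - i" p E x]
        by (auto simp: peak_fam_def nxt_def Suc_diff_le)
    qed
  next
    assume o: "out_letter (snd (peak v p q)) i True \<noteq> Some (Dir a)" "out_letter (snd (peak v p q)) i False \<noteq> Some (Dir a)"
    consider "i < length p" | "i = length p" | "length p < i" by linarith
    then show "act Q E a (peak_fam E x p q i) = 0"
    proof cases
      case 1
      then have "\<not> (length p - i < length p \<and> a = p ! (length p - i))"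
        using 1 o(2) out_letter_peak(2)[OF i, of v] by (cases "i = 0") auto
      then show ?thesis using 1 act_pvec[OF E p x(1), of "length p - i" a] a by (auto simp: peak_fam_def)
    next
      case 3
      then have "\<not> (i - length p < length q \<and> a = q ! (i - length p))"
        using 3 o(1) out_letter_peak(1)[OF i, of v] by (cases "i < length p + length q") auto
      then show ?thesis using 3 act_pvec[OF E q x(1), of "i - length p" a] a i by (auto simp: peak_fam_def)
    next
      case 2
      have "\<not> (p \<noteq> [] \<and> a = hd p)" "\<not> (q \<noteq> [] \<and> a = hd q)"
        using o 2 out_letter_peak[OF i, of v] by (auto simp: hd_conv_nth)
      then have "act Q E a x = 0"
        using miss[OF a] x(2) act_pr[of Q E a v x] by (cases "tail Q a = v") auto
      then show ?thesis using 2 by (simp add: peak_fam_def)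
    qed
  }
qed

lemma sfam_peak_fam:
  assumes s: "is_str (peak v p q)" and x: "sfam X (peak v p q) x" and p: "dpath v p" and q: "dpath v q"
    and i: "i \<le> length p + length q"
  shows "peak_fam X (x (length p)) p q i = x i"
proof -
  have P: "pvec X (x (length p)) p t = x (length p - t)" if "t \<le> length p" for t
    using that
  proof (induction t)
    case (Suc t)
    have "out_letter (snd (peak v p q)) (length p - t) False = Some (Dir (p ! t))"
      using Suc.prems out_letter_peak(2)[of "length p - t" p q v] by auto
    then have "act Q X (p ! t) (x (length p - t)) = x (length p - Suc t)"
      using sfam_out[OF s x _ dpath_nth(1)[OF p]] Suc.prems by (auto simp: nxt_def)
    then show ?case using Suc by (simp add: pvec_Suc)
  qed simp
  have Q: "pvec X (x (length p)) q t = x (length p + t)" if "t \<le> length q" for t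
    using that
  proof (induction t)
    case (Suc t)
    have "out_letter (snd (peak v p q)) (length p + t) True = Some (Dir (q ! t))"
      using Suc.prems out_letter_peak(1)[of "length p + t" p q v] by auto
    then have "act Q X (q ! t) (x (length p + t)) = x (Suc (length p + t))"
      using sfam_out[OF s x _ dpath_nth(1)[OF q]] Suc.prems by (auto simp: nxt_def)
    then show ?case using Suc by (simp add: pvec_Suc)
  qed simp
  show ?thesis using P[of "length p - i"] Q[of "i - length p"] i by (auto simp: peak_fam_def)
qed

lemma mhom_pvec:
  assumes "mhom Q E X G" "x \<in> tot Q E" "set p \<subseteq> arcs Q" "t \<le> length p"
  shows "G (pvec E x p t) = pvec X (G x) p t"
  using assms(4)
proof (induction t)
  case (Suc t)
  then show ?case
    using mhomD(5)[OF assms(1) _ pvec_tot[OF assms(2,3)], of "p ! t" t] subsetD[OF assms(3) nth_mem[of t p]]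
    by (auto simp: pvec_Suc)
qed simp

lemma mhom_peak_fam:
  assumes "mhom Q E X G" "x \<in> tot Q E" "dpath v p" "dpath v q" "i \<le> length p + length q"
  shows "G (peak_fam E x p q i) = peak_fam X (G x) p q i"
  using mhom_pvec[OF assms(1,2)] assms(3-5) by (simp add: peak_fam_def dpath_def)

text \<open>A string module with a single peak and only one side missing at the top is projective up to
  that missing side.\<close>

lemma peak_section:
  assumes E: "amod E" and v: "v \<in> verts Q" and p: "dpath v p" "dmax p" and q: "dpath v q" "dmax q" and pq: "apart p q"
    and x: "x \<in> tot Q E" "pr v x = x"
    and miss: "\<And>a. a \<in> arcs Q \<Longrightarrow> tail Q a = v \<Longrightarrow> \<not> (p \<noteq> [] \<and> a = hd p) \<Longrightarrow> \<not> (q \<noteq> [] \<and> a = hd q) \<Longrightarrow> act Q E a x = 0"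
    and X: "sbasis X (peak v p q) b" and G: "mhom Q E X G" "G x = b (length p)"
  shows "\<exists>S. mhom Q X E S \<and> (\<forall>z\<in>tot Q X. G (S z) = z)"
proof -
  note s = is_str_peak[OF v p(1) q(1) pq]
  have fam: "sfam E (peak v p q) (peak_fam E x p q)"
    by (rule sfam_peak[OF E v p q pq x miss])
  obtain S where S: "mhom Q X E S" "\<And>i. i \<le> length (snd (peak v p q)) \<Longrightarrow> S (b i) = peak_fam E x p q i"
    "\<And>c. S (\<Sum>i\<le>length (snd (peak v p q)). c i *\<^sub>F b i) =
      (\<Sum>i\<le>length (snd (peak v p q)). c i *\<^sub>F peak_fam E x p q i)"
    by (rule sbasis_hom[OF X fam], rule that, assumption+)
  have G': "G (peak_fam E x p q i) = b i" if "i \<le> length p + length q" for i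
    using mhom_peak_fam[OF G(1) x(1) p(1) q(1) that] sfam_peak_fam[OF s sbasisD(1)[OF X] p(1) q(1) that] G(2) by simp
  have "G (S z) = z" if z: "z \<in> tot Q X" for z
  proof -
    obtain c where c: "z = (\<Sum>i\<le>length (snd (peak v p q)). c i *\<^sub>F b i)" using sbasisD(2)[OF X z] by blast
    have "G (S z) = G (\<Sum>i\<le>length (snd (peak v p q)). c i *\<^sub>F peak_fam E x p q i)"
      by (simp only: c S(3))
    also have "\<dots> = (\<Sum>i\<le>length (snd (peak v p q)). G (c i *\<^sub>F peak_fam E x p q i))"
      using sfamD(1)[OF fam] by (intro mhom_sum[OF G(1)] tot_smul) simp
    also have "\<dots> = (\<Sum>i\<le>length (snd (peak v p q)). c i *\<^sub>F b i)"
      using sfamD(1)[OF fam] G' by (intro sum.cong refl) (simp add: mhomD(3)[OF G(1)])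
    finally show ?thesis by (simp only: c)
  qed
  then show ?thesis by (intro exI[of _ S] conjI ballI S(1))
qed

lemma sbasis_smul:
  assumes b: "sbasis M w b" and c: "(c :: 'k::field) \<noteq> 0"
  shows "sbasis M w (\<lambda>i. c *\<^sub>F b i)"
  unfolding sbasis_def
proof (intro conjI ballI allI impI)
  show "sfam M w (\<lambda>i. c *\<^sub>F b i)"
    using sfamD[OF sbasisD(1)[OF b]] by (auto simp: sfam_def tot_smul split: option.splits)
  show "\<exists>d. x = (\<Sum>i\<le>length (snd w). d i *\<^sub>F c *\<^sub>F b i)" if x: "x \<in> tot Q M" for x
  proof -
    obtain d where "x = (\<Sum>i\<le>length (snd w). d i *\<^sub>F b i)" using sbasisD(2)[OF b x] by blast
    then show ?thesis using c by (intro exI[of _ "\<lambda>i. d i / c"]) simp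
  qed
  fix d i assume "(\<Sum>i\<le>length (snd w). d i *\<^sub>F c *\<^sub>F b i) = 0" "i \<le> length (snd w)"
  then have "d i * c = 0" by (intro sbasisD(3)[OF b, of "\<lambda>i. d i * c"]) simp_all
  then show "d i = 0" using c by simp
qed

text \<open>If \<open>w\<close> and \<open>w\<^sup>-\<^sup>1\<close> agree on their first \<open>m\<close> letters and then \<open>w\<close> continues with a direct and
  \<open>w\<^sup>-\<^sup>1\<close> with an inverse letter, then the first \<open>m + 1\<close> basis vectors can be mapped to the last
  ones by a nilpotent endomorphism. Adding it to a scalar gives a new basis.\<close>

lemma sbasis_twist:
  assumes w: "is_str w" and b: "sbasis M w b" and m: "m < length (snd w)"
    and eq: "\<And>i. i < m \<Longrightarrow> snd w ! i = snd (rev_walk w) ! i"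
    and c: "snd w ! m = Dir c" and e: "snd (rev_walk w) ! m = Inv e"
    and v: "walk_verts Q w ! 0 = walk_verts Q w ! length (snd w)" and \<alpha>: "\<alpha> \<noteq> 0"
  shows "sbasis M w (\<lambda>i. \<alpha> *\<^sub>F b i + (if i \<le> m then \<beta> *\<^sub>F b (length (snd w) - i) else 0))"
proof -
  let ?n = "length (snd w)" and ?ls = "snd w" and ?ls' = "snd (rev_walk w)"
  define b' where "b' i = b (?n - i)" for i
  define y where "y i = \<alpha> *\<^sub>F b i + (if i \<le> m then \<beta> *\<^sub>F b' i else 0)" for i
  note fam = sbasisD(1)[OF b]
  have fam': "sfam M (rev_walk w) b'" unfolding b'_def by (rule sfam_rev[OF w fam])
  have L: "?ls' ! i = letter_inv (?ls ! (?n - Suc i))" if "i < ?n" for i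
    using that by (simp add: rev_walk_def rev_nth)
  \<comment> \<open>The first difference lies in the first half, because the letters at mirrored
    positions determine each other. So the positions up to \<open>m\<close> and their mirror images
    are disjoint, and the added endomorphism has square zero.\<close>
  have half: "m < ?n - m"
  proof (rule ccontr)
    assume "\<not> m < ?n - m"
    then have lt: "?n - Suc m < m" using m by linarith
    have "?ls' ! m = letter_inv (?ls ! (?n - Suc m))" using L m by simp
    moreover have "?ls ! (?n - Suc m) = letter_inv (?ls ! m)"
      using eq[OF lt] L[of "?n - Suc m"] m by simp
    ultimately show False using c e by simp
  qed
  \<comment> \<open>Up to \<open>m\<close> both walks take the same steps. In \<open>w\<close> no
    arrow leads back from \<open>m + 1\<close> to \<open>m\<close>, and in the reversed walk none
    leads from \<open>m\<close> to \<open>m + 1\<close>; hence the family \<open>b'\<close>, cut off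
    after \<open>m\<close>, still follows the pattern of \<open>w\<close>.\<close>
  have out: "out_letter ?ls i d = out_letter ?ls' i d" if "i < m \<or> (i = m \<and> \<not> d)" for i d
    using that m eq by (cases d; cases i) (auto simp: out_letter_def)
  have outm: "out_letter ?ls m True = Some (Dir c)" "out_letter ?ls' m True = Some (Inv e)"
    using m c e by (auto simp: out_letter_def)
  have vert: "walk_verts Q (rev_walk w) ! i = walk_verts Q w ! i" if "i \<le> m" for i
  proof (cases i)
    case 0
    then show ?thesis using v walk_verts_rev[OF w, of 0] by simp
  next
    case (Suc j)
    then have "walk_verts Q w ! i = letter_target Q (?ls ! j)"
      "walk_verts Q (rev_walk w) ! i = letter_target Q (?ls' ! j)"
      using that m by (auto simp: walk_verts_Suc)
    then show ?thesis using eq[of j] Suc that by simp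
  qed
  have "sfam M w y"
    unfolding sfam_def
  proof (intro allI impI conjI ballI)
    fix i assume i: "i \<le> ?n"
    show "y i \<in> tot Q M"
      using sfamD(1)[OF fam i] sfamD(1)[OF fam', of i] i by (auto simp: y_def intro!: tot_intros)
    show "pr (walk_verts Q w ! i) (y i) = y i"
      using sfamD(2)[OF fam i] sfamD(2)[OF fam', of i] vert[of i] i by (auto simp: y_def)
    fix a assume a: "a \<in> arcs Q"
    have acts: "act Q M a (b i) = (case stp ?ls a i of None \<Rightarrow> 0 | Some j \<Rightarrow> b j)"
      "act Q M a (b' i) = (case stp ?ls' a i of None \<Rightarrow> 0 | Some j \<Rightarrow> b' j)"
      using sfamD(3)[OF fam i a] sfamD(3)[OF fam' _ a, of i] i by auto
    consider "i < m" | "i = m" "a = c" | "i = m" "a \<noteq> c" | "m < i" by linarith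
    then show "act Q M a (y i) = (case stp ?ls a i of None \<Rightarrow> 0 | Some j \<Rightarrow> y j)"
    proof cases
      case 1
      have "stp ?ls a i = stp ?ls' a i" unfolding stp_def using out[of i] 1 by simp
      then show ?thesis using 1 acts by (auto simp: y_def stp_def nxt_def split: option.splits if_splits)
    next
      case 2
      have "out_letter ?ls m False \<noteq> Some (Dir c)" using out_letter_eq[OF w outm(1), of False] by auto
      then have "stp ?ls' a i = None" unfolding stp_def using 2 outm out[of m False] by simp
      moreover have "stp ?ls a i = Some (Suc m)" using 2 outm by (simp add: stp_def nxt_def)
      ultimately show ?thesis using 2 acts by (simp add: y_def)
    next
      case 3
      have "stp ?ls a i = stp ?ls' a i" unfolding stp_def using out[of m False] outm 3 by simp
      moreover have "stp ?ls a i = None \<or> stp ?ls a i = Some (m - 1)"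
        using outm 3 by (auto simp: stp_def nxt_def)
      ultimately show ?thesis using 3 acts by (auto simp: y_def)
    next
      case 4
      have "j > m" if j: "stp ?ls a i = Some j" for j
      proof (rule ccontr)
        assume "\<not> j > m"
        then have "i = Suc m" "out_letter ?ls i False = Some (Dir a)"
          using j 4 by (auto simp: stp_def nxt_def split: if_splits)
        then show False using c by (simp add: out_letter_def)
      qed
      then show ?thesis using 4 acts by (auto simp: y_def split: option.splits)
    qed
  qed
  have comb: "(\<Sum>i\<le>?n. d i *\<^sub>F y i) = (\<Sum>i\<le>?n. (\<alpha> * d i + (if ?n - i \<le> m then \<beta> * d (?n - i) else 0)) *\<^sub>F b i)" for d
  proof -
    have "(\<Sum>i\<le>?n. d i *\<^sub>F y i) = (\<Sum>i\<le>?n. (\<alpha> * d i) *\<^sub>F b i) + (\<Sum>i\<le>?n. (if i \<le> m then \<beta> * d i else 0) *\<^sub>F b (?n - i))"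
      unfolding sum.distrib[symmetric] y_def b'_def
      by (intro sum.cong refl) (auto simp: smul_add mult.commute)
    also have "(\<Sum>i\<le>?n. (if i \<le> m then \<beta> * d i else 0) *\<^sub>F b (?n - i)) =
        (\<Sum>i\<le>?n. (if ?n - i \<le> m then \<beta> * d (?n - i) else 0) *\<^sub>F b i)"
      by (subst sum_rev_atMost[symmetric]) (auto intro!: sum.cong)
    finally show ?thesis by (simp add: add_smul sum.distrib)
  qed
  have "sbasis M w y"
    unfolding sbasis_def
  proof (intro conjI ballI allI impI \<open>sfam M w y\<close>)
    fix x assume "x \<in> tot Q M"
    then obtain d where d: "x = (\<Sum>i\<le>?n. d i *\<^sub>F b i)" using sbasisD(2)[OF b] by blast
    \<comment> \<open>Inverts the change of basis: the coefficients up to \<open>m\<close> are only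
      scaled, so their scaled values can be used to correct those at the mirrored positions.\<close>
    define d' where "d' i = (d i - (if ?n - i \<le> m then \<beta> * (d (?n - i) / \<alpha>) else 0)) / \<alpha>" for i
    have "d' i = d i / \<alpha>" if "i \<le> m" for i using half that by (auto simp: d'_def)
    then have "\<alpha> * d' i + (if ?n - i \<le> m then \<beta> * d' (?n - i) else 0) = d i" for i
      using \<alpha> by (auto simp: d'_def)
    then have "x = (\<Sum>i\<le>?n. d' i *\<^sub>F y i)" unfolding comb d by simp
    then show "\<exists>c. x = (\<Sum>i\<le>?n. c i *\<^sub>F y i)" by blast
  next
    fix d i assume z: "(\<Sum>i\<le>?n. d i *\<^sub>F y i) = 0" and i: "i \<le> ?n"
    have z': "\<alpha> * d i + (if ?n - i \<le> m then \<beta> * d (?n - i) else 0) = 0" if "i \<le> ?n" for i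
      by (rule sbasisD(3)[OF b z[unfolded comb] that])
    have small: "d i = 0" if "i \<le> m" for i
    proof -
      have "\<not> ?n - i \<le> m" "i \<le> ?n" using half that by linarith+
      then show ?thesis using z'[of i] \<alpha> by simp
    qed
    show "d i = 0" using z'[OF i] small[of "?n - i"] \<alpha> by (auto split: if_splits)
  qed
  then show ?thesis unfolding y_def b'_def .
qed

end

section \<open>Bases with a prescribed end vector, and gluing\<close>

context gentle_quiver
begin

text \<open>The comparison of \<open>w\<close> with \<open>w\<^sup>-\<^sup>1\<close> decides which of the two ends of \<open>w\<close> absorbs the other.\<close>

lemma sbasis_two_ends:
  assumes w: "is_str w" and b: "sbasis M w b" and n: "0 < length (snd w)"
    and l0: "at_vertex v l0"
    and ends: "walk_verts Q w ! 0 = v" "walk_verts Q w ! length (snd w) = v"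
    and opp0: "\<And>l. out_letter (snd w) 0 True = Some l \<Longrightarrow> opp l0 l"
    and oppn: "\<And>l. out_letter (snd w) (length (snd w)) False = Some l \<Longrightarrow> opp l0 l"
    and nz: "\<alpha> \<noteq> 0" "\<beta> \<noteq> 0"
  shows "\<exists>b'. (sbasis M w b' \<or> sbasis M (rev_walk w) b') \<and> b' 0 = \<alpha> *\<^sub>F b 0 + \<beta> *\<^sub>F b (length (snd w))"
proof -
  let ?n = "length (snd w)" and ?ls = "snd w" and ?ls' = "snd (rev_walk w)"
  note w' = is_str_rev[OF w]
  have "?ls \<noteq> ?ls'"
    using string_not_palindrome[OF w b] n by (auto simp: rev_walk_def)
  then have "\<exists>i<?n. ?ls ! i \<noteq> ?ls' ! i" using nth_equalityI[of ?ls ?ls'] by auto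
  then have ex: "\<exists>i. i < ?n \<and> ?ls ! i \<noteq> ?ls' ! i" by blast
  define m where "m = (LEAST i. i < ?n \<and> ?ls ! i \<noteq> ?ls' ! i)"
  have m: "m < ?n" "?ls ! m \<noteq> ?ls' ! m" using LeastI_ex[OF ex] by (auto simp: m_def)
  have eq: "?ls ! i = ?ls' ! i" if "i < m" for i
    using not_less_Least[of i "\<lambda>i. i < ?n \<and> ?ls ! i \<noteq> ?ls' ! i"] that m(1) by (auto simp: m_def)
  have o: "out_letter ?ls m True = Some (?ls ! m)" "out_letter ?ls' m True = Some (?ls' ! m)"
    using m(1) by (auto simp: out_letter_def)
  have rv0: "walk_verts Q (rev_walk w) ! 0 = v" using walk_verts_rev[OF w, of 0] ends by simp
  have at: "at_vertex (walk_verts Q w ! m) (?ls ! m)" "at_vertex (walk_verts Q (rev_walk w) ! m) (?ls' ! m)"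
    using out_letterD(1)[OF w _ o(1)] out_letterD(1)[OF w' _ o(2)] m(1) by auto
  \<comment> \<open>At the first difference both words come from the same direction, namely from the
    previous common letter, or from \<open>l0\<close> if they differ at once. So both next letters
    are \<open>opp\<close> to one letter.\<close>
  have "\<exists>l. at_vertex (walk_verts Q w ! m) l \<and> opp l (?ls ! m) \<and> opp l (?ls' ! m) \<and>
      walk_verts Q (rev_walk w) ! m = walk_verts Q w ! m"
  proof (cases m)
    case 0
    have "out_letter ?ls ?n False = Some (?ls' ! 0)"
      using n by (simp add: out_letter_def rev_walk_def rev_nth)
    then show ?thesis using 0 l0 ends rv0 opp0 oppn o(1) by auto
  next
    case (Suc j)
    then have p: "out_letter ?ls m False = Some (letter_inv (?ls ! j))"
        "out_letter ?ls' m False = Some (letter_inv (?ls' ! j))"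
      by (auto simp: out_letter_def)
    have "opp (letter_inv (?ls ! j)) (?ls ! m)" "opp (letter_inv (?ls' ! j)) (?ls' ! m)"
      using out_letter_opp[OF w o(1) p(1)] out_letter_opp[OF w' o(2) p(2)] opp_sym by auto
    moreover have "at_vertex (walk_verts Q w ! m) (letter_inv (?ls ! j))"
      using out_letterD(1)[OF w _ p(1)] m(1) by simp
    moreover have "walk_verts Q (rev_walk w) ! m = walk_verts Q w ! m"
      using eq[of j] Suc m(1) by (simp add: walk_verts_Suc)
    ultimately show ?thesis using eq[of j] Suc by (intro exI[of _ "letter_inv (?ls ! j)"]) auto
  qed
  then obtain l where l: "at_vertex (walk_verts Q w ! m) l" "opp l (?ls ! m)" "opp l (?ls' ! m)"
    "at_vertex (walk_verts Q w ! m) (?ls' ! m)" using at by auto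
  \<comment> \<open>Both letters thus lie on the same side. Being different and not
    \<open>opp\<close>, they cannot be of the same kind, so one is direct and the other
    inverse.\<close>
  have nopp: "\<not> opp (?ls ! m) (?ls' ! m)"
    using opp_opp[OF at(1) l(1,4)] l(2,3) opp_sym by blast
  consider c e where "?ls ! m = Dir c" "?ls' ! m = Inv e" | c e where "?ls ! m = Inv e" "?ls' ! m = Dir c"
    using nopp m(2) by (cases "?ls ! m"; cases "?ls' ! m") auto
  then show ?thesis
  proof cases
    case 1
    have "sbasis M w (\<lambda>i. \<alpha> *\<^sub>F b i + (if i \<le> m then \<beta> *\<^sub>F b (?n - i) else 0))"
      by (rule sbasis_twist[OF w b m(1) eq 1 _ nz(1)]) (use ends in simp_all)
    then show ?thesis by (intro exI[of _ "\<lambda>i. \<alpha> *\<^sub>F b i + (if i \<le> m then \<beta> *\<^sub>F b (?n - i) else 0)"]) simp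
  next
    case 2
    have rr: "snd (rev_walk (rev_walk w)) = snd w" by (simp add: rev_walk_def rev_map comp_def)
    have m': "m < length (snd (rev_walk w))" using m(1) by simp
    have "sbasis M (rev_walk w) (\<lambda>i. \<beta> *\<^sub>F b (?n - i) + (if i \<le> m then \<alpha> *\<^sub>F b (?n - (length (snd (rev_walk w)) - i)) else 0))"
      by (rule sbasis_twist[OF w' sbasis_rev[OF w b] m' _ 2(2) _ _ nz(2)])
        (use eq 2(1) rr ends rv0 walk_verts_rev[OF w] in auto)
    then show ?thesis
      by (intro exI[of _ "\<lambda>i. \<beta> *\<^sub>F b (?n - i) + (if i \<le> m then \<alpha> *\<^sub>F b (?n - (length (snd (rev_walk w)) - i)) else 0)"])
        (simp add: add.commute)
  qed
qed

text \<open>Makes a vector suitable for gluing: \<open>x\<close> becomes the first vector of a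
  string basis. At an inner position the two letters lie on different sides and cannot both be
  \<open>opp\<close> to \<open>l0\<close>, so only the ends occur in \<open>x\<close>; if both do,
  \<open>sbasis_two_ends\<close> merges them.\<close>

lemma sbasis_end_vector:
  assumes w: "is_str w" and b: "sbasis M w b" and l0: "at_vertex v l0"
    and x: "x = (\<Sum>k\<le>length (snd w). \<nu> k *\<^sub>F b k)" "x \<noteq> 0"
    and supp: "\<And>k. k \<le> length (snd w) \<Longrightarrow> \<nu> k \<noteq> 0 \<Longrightarrow> walk_verts Q w ! k = v \<and>
      (\<forall>d l. out_letter (snd w) k d = Some l \<longrightarrow> opp l0 l)"
  shows "\<exists>w' b'. is_str w' \<and> sbasis M w' b' \<and> b' 0 = x \<and> walk_verts Q w' ! 0 = v \<and>
    (\<forall>l. out_letter (snd w') 0 True = Some l \<longrightarrow> opp l0 l)"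
proof -
  let ?n = "length (snd w)"
  note w' = is_str_rev[OF w]
  have ends: "k = 0 \<or> k = ?n" if k: "k \<le> ?n" "\<nu> k \<noteq> 0" for k
  proof (rule ccontr)
    assume "\<not> ?thesis"
    then obtain l l' where l: "out_letter (snd w) k True = Some l" "out_letter (snd w) k False = Some l'"
      using k by (auto simp: out_letter_def)
    have v: "walk_verts Q w ! k = v" "opp l0 l" "opp l0 l'" using supp[OF k] l by blast+
    have "\<not> opp l l'"
      using opp_opp[of v l l0 l'] out_letterD(1)[OF w k(1) l(1)] out_letterD(1)[OF w k(1) l(2)] v l0
        opp_sym[of l0 l] by simp
    then show False using out_letter_opp[OF w l] by simp
  qed
  have first: "out_letter (snd (rev_walk w)) 0 True = out_letter (snd w) ?n False"
    using out_letter_rev[of 0 "snd w" True] by (simp add: rev_walk_def)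
  have rv: "walk_verts Q (rev_walk w) ! 0 = walk_verts Q w ! ?n" using walk_verts_rev[OF w, of 0] by simp
  have xx: "x = \<nu> 0 *\<^sub>F b 0 + (if ?n = 0 then 0 else \<nu> ?n *\<^sub>F b ?n)"
  proof -
    have "x = (\<Sum>k\<in>{0, ?n}. \<nu> k *\<^sub>F b k)"
      unfolding x(1) using ends by (intro sum.mono_neutral_right) (auto simp: smul_eq_0_iff)
    then show ?thesis by (cases "?n = 0") auto
  qed
  consider "?n = 0 \<or> \<nu> ?n = 0" "\<nu> 0 \<noteq> 0" | "\<nu> 0 = 0" "?n \<noteq> 0" "\<nu> ?n \<noteq> 0" | "?n \<noteq> 0" "\<nu> 0 \<noteq> 0" "\<nu> ?n \<noteq> 0"
    using xx x(2) by (cases "?n = 0"; cases "\<nu> 0 = 0"; cases "\<nu> ?n = 0") auto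
  then show ?thesis
  proof cases
    case 1
    then have "x = \<nu> 0 *\<^sub>F b 0" using xx by auto
    then show ?thesis using w sbasis_smul[OF b 1(2)] supp[OF le0 1(2)] by blast
  next
    case 2
    then have "x = \<nu> ?n *\<^sub>F b (?n - 0)" using xx by simp
    then show ?thesis using w' sbasis_smul[OF sbasis_rev[OF w b] 2(3)] supp[OF order_refl 2(3)] first rv
      by (intro exI[of _ "rev_walk w"] exI[of _ "\<lambda>i. \<nu> ?n *\<^sub>F b (?n - i)"]) auto
  next
    case 3
    have s: "walk_verts Q w ! 0 = v" "walk_verts Q w ! ?n = v"
      "\<And>l. out_letter (snd w) 0 True = Some l \<Longrightarrow> opp l0 l" "\<And>l. out_letter (snd w) ?n False = Some l \<Longrightarrow> opp l0 l"
      using supp[OF le0 3(2)] supp[OF order_refl 3(3)] by blast+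
    obtain b' where b': "sbasis M w b' \<or> sbasis M (rev_walk w) b'" "b' 0 = \<nu> 0 *\<^sub>F b 0 + \<nu> ?n *\<^sub>F b ?n"
      using sbasis_two_ends[OF w b _ l0 s 3(2,3)] 3(1) by blast
    have "b' 0 = x" using b'(2) xx 3(1) by simp
    from b'(1) show ?thesis
    proof
      assume "sbasis M w b'"
      then show ?thesis using w s \<open>b' 0 = x\<close> by (intro exI[of _ w] exI[of _ b']) simp
    next
      assume "sbasis M (rev_walk w) b'"
      then show ?thesis using w' s first rv \<open>b' 0 = x\<close> by (intro exI[of _ "rev_walk w"] exI[of _ b']) simp
    qed
  qed
qed

lemma sum_atMost_add_Suc:
  fixes g :: "nat \<Rightarrow> 'b::comm_monoid_add"
  shows "(\<Sum>i\<le>Suc (k + l). g i) = (\<Sum>i\<le>k. g (k - i)) + (\<Sum>i\<le>l. g (Suc (k + i)))"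
proof -
  have "(\<Sum>i\<le>Suc (k + l). g i) = (\<Sum>i<Suc k + Suc l. g i)" by (simp add: lessThan_Suc_atMost)
  also have "\<dots> = (\<Sum>i\<le>k. g i) + (\<Sum>i\<le>l. g (Suc (k + i)))"
    unfolding sum_lessThan_add by (simp add: lessThan_Suc_atMost)
  finally show ?thesis using sum_rev_atMost[of g k] by simp
qed

text \<open>The middle term of an extension of a string module by a uniserial one, glued along the
  arrow \<open>a\<close> that is missing at the top of the latter.\<close>

lemma glue:
  assumes E: "amod E" and v: "v \<in> verts Q" and q: "dpath v q" "dmax q"
    and a: "a \<in> arcs Q" "tail Q a = v" "q \<noteq> [] \<longrightarrow> a \<noteq> hd q"
    and only: "\<And>c. c \<in> arcs Q \<Longrightarrow> tail Q c = v \<Longrightarrow> c = a \<or> (q \<noteq> [] \<and> c = hd q)"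
    and x: "x \<in> tot Q E" "pr v x = x"
    and ex: "exact N F E G X" and X: "sbasis X (peak v [] q) b" "G x = b 0"
    and w: "is_str w" and N: "sbasis N w y" and y0: "F (y 0) = act Q E a x"
    and w0: "walk_verts Q w ! 0 = head Q a" "\<And>l. out_letter (snd w) 0 True = Some l \<Longrightarrow> opp (Inv a) l"
  shows "\<exists>w' z. is_str w' \<and> sbasis E w' z"
proof -
  let ?m = "length q" and ?n = "length (snd w)"
  have Fh: "mhom Q N E F" and Gh: "mhom Q E X G" and inj: "inj_on F (tot Q N)"
    and im: "F ` tot Q N = {y \<in> tot Q E. G y = 0}"
    using ex by (auto simp: exact_def)
  \<comment> \<open>The string of the middle term is the inverse of \<open>q\<close>, followed by
    \<open>a\<close> and by \<open>w\<close>. Position \<open>?m\<close> carries the lift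
    \<open>x\<close>, and position \<open>Suc ?m\<close> the first basis vector of the
    submodule.\<close>
  define ls where "ls = map Inv (rev q) @ Dir a # snd w"
  define w' where "w' = (path_vert v q ?m, ls)"
  define z where "z i = (if i \<le> ?m then pvec E x q (?m - i) else F (y (i - Suc ?m)))" for i
  have len: "length ls = Suc (?m + ?n)" by (simp add: ls_def)
  have pk0: "dpath v []" "dmax []" "apart [] q" "apart q []" by (auto simp: dpath_def dmax_def apart_def)
  note s = is_str_peak[OF v q(1) pk0(1,4)]
  have nthl: "ls ! i = (if i < ?m then Inv (q ! (?m - Suc i)) else if i = ?m then Dir a else snd w ! (i - Suc ?m))"
    if "i < Suc (?m + ?n)" for i
    using that by (auto simp: ls_def nth_append rev_nth nth_Cons' )
  have pre: "walk_verts Q w' ! i = path_vert v q (?m - i)" if "i \<le> ?m" for i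
  proof -
    have "walk_verts Q w' ! i = walk_verts Q (peak v q []) ! i"
      using that by (cases i) (auto simp: w'_def peak_def ls_def walk_verts_Suc nth_append)
    then show ?thesis using walk_verts_peak[OF q(1) pk0(1), of i] that by simp
  qed
  have post: "walk_verts Q w' ! Suc (?m + i) = walk_verts Q w ! i" if "i \<le> ?n" for i
  proof (cases i)
    case 0
    then show ?thesis using w0(1) nthl[of ?m] by (simp add: w'_def walk_verts_Suc len)
  next
    case (Suc j)
    then show ?thesis using that nthl[of "Suc (?m + j)"] by (simp add: w'_def walk_verts_Suc len)
  qed
  have "is_str w'"
    unfolding is_str_nth
  proof (intro conjI allI impI)
    show "fst w' \<in> verts Q" using path_vert_in[OF v q(1)] by (simp add: w'_def)
  next
    fix i assume "i < length (snd w')"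
    then have i: "i < Suc (?m + ?n)" by (simp add: w'_def len)
    have si: "snd w' ! i = ls ! i" by (simp add: w'_def)
    consider "i < ?m" | "i = ?m" | j where "i = Suc (?m + j)" "j < ?n"
    proof -
      consider "i < ?m" | "i = ?m" | "?m < i" by linarith
      then show thesis
      proof cases
        case 3
        then obtain j where "i = Suc (?m + j)" using less_imp_Suc_add by blast
        then show thesis using that(3) i by simp
      qed (use that in auto)
    qed
    note cs = this
    show "letter_arrow (snd w' ! i) \<in> arcs Q"
      using cs
    proof cases
      case 1 then show ?thesis using si nthl[OF i] dpath_nth(1)[OF q(1)] by simp
    next
      case 2 then show ?thesis using si nthl[OF i] a(1) by simp
    next
      case 3 then show ?thesis using si nthl[OF i] w by (simp add: is_str_nth)
    qed
    show "letter_source Q (snd w' ! i) = walk_verts Q w' ! i"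
      using cs
    proof cases
      case 1
      then have e: "?m - i = Suc (?m - Suc i)" by simp
      have "path_vert v q (?m - i) = head Q (q ! (?m - Suc i))" unfolding e by simp
      then show ?thesis using 1 si nthl[OF i] pre[of i] by simp
    next
      case 2 then show ?thesis using si nthl[OF i] pre[of i] a(2) by simp
    next
      case 3 then show ?thesis using si nthl[OF i] post[of j] w by (simp add: is_str_nth)
    qed
  next
    fix i assume "Suc i < length (snd w')"
    then have i: "Suc i < Suc (?m + ?n)" by (simp add: w'_def len)
    have si: "snd w' ! i = ls ! i" "snd w' ! Suc i = ls ! Suc i" by (simp_all add: w'_def)
    have n1: "ls ! i = (if i < ?m then Inv (q ! (?m - Suc i)) else if i = ?m then Dir a else snd w ! (i - Suc ?m))"
      using nthl[of i] i by simp
    note n2 = nthl[OF i]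
    consider "Suc i < ?m" | "Suc i = ?m" | "i = ?m" | j where "i = Suc (?m + j)" "Suc j < ?n"
    proof -
      consider "Suc i < ?m" | "Suc i = ?m" | "i = ?m" | "?m < i" by linarith
      then show thesis
      proof cases
        case 4
        then obtain j where "i = Suc (?m + j)" using less_imp_Suc_add by blast
        then show thesis using that(4) i by simp
      qed (use that in auto)
    qed
    then show "opp (letter_inv (snd w' ! i)) (snd w' ! Suc i)"
    proof cases
      case 1
      then have "Suc (?m - Suc (Suc i)) = ?m - Suc i" by simp
      then show ?thesis using 1 si n1 n2 dpath_nth(3)[OF q(1), of "?m - Suc (Suc i)"] by simp
    next
      case 2
      then have "?m - Suc i = 0" "q \<noteq> []" by auto
      then show ?thesis using 2 si n1 n2 a(3) by (simp add: hd_conv_nth)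
    next
      case 3
      then have "out_letter (snd w) 0 True = Some (snd w ! 0)" using i by (simp add: out_letter_def)
      then show ?thesis using 3 si n1 n2 w0(2) by simp
    next
      case 4 then show ?thesis using si n1 n2 w by (simp add: is_str_nth)
    qed
  qed
  note w'_str = this
  have outq: "out_letter ls i d = out_letter (snd (peak v q [])) i d" if "i < ?m \<or> (i = ?m \<and> \<not> d)" for i d
    using that by (cases d; cases i) (auto simp: out_letter_def peak_def ls_def nth_append)
  have outm: "out_letter ls ?m True = Some (Dir a)" "out_letter ls (Suc ?m) False = Some (Inv a)"
    using nthl[of ?m] by (auto simp: out_letter_def len)
  \<comment> \<open>The first position of \<open>w\<close> is excepted on the left: it was an end
    before, and now the letter \<open>Inv a\<close> leaves it there.\<close>
  have outw: "out_letter ls (Suc (?m + i)) d = out_letter (snd w) i d" if "i \<le> ?n" "0 < i \<or> d" for i d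
  proof (cases d)
    case True
    then show ?thesis using that nthl[of "Suc (?m + i)"] by (auto simp: out_letter_def len)
  next
    case False
    then have "0 < i" using that(2) by simp
    then obtain j where "i = Suc j" by (cases i) auto
    then show ?thesis using False that nthl[of "Suc (?m + j)"] by (auto simp: out_letter_def len)
  qed
  note Nf = sbasisD(1)[OF N]
  have ytot: "F (y i) \<in> tot Q E" if "i \<le> ?n" for i using mhomD(1)[OF Fh sfamD(1)[OF Nf that]] .
  have actx: "act Q E c x = 0" if "c \<in> arcs Q" "tail Q c \<noteq> v" for c
    using act_pr[of Q E c v x] x(2) that by simp
  have "sfam E w' z"
  proof (rule sfamI)
    fix i assume "i \<le> length (snd w')"
    then have i: "i \<le> Suc (?m + ?n)" by (simp add: w'_def len)
    consider "i < ?m" | "i = ?m" | j where "i = Suc (?m + j)" "j \<le> ?n"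
    proof -
      consider "i < ?m" | "i = ?m" | "?m < i" by linarith
      then show thesis
      proof cases
        case 3
        then obtain j where "i = Suc (?m + j)" using less_imp_Suc_add by blast
        then show thesis using that(3) i by simp
      qed (use that in auto)
    qed
    note cs = this
    show "z i \<in> tot Q E"
      using cs pvec_tot[OF x(1), of q "?m - i"] q(1) ytot by cases (auto simp: z_def dpath_def)
    show "pr (walk_verts Q w' ! i) (z i) = z i"
      using cs
    proof cases
      case 3
      then show ?thesis
        using post[of j] mhomD(4)[OF Fh walk_verts_in[OF w] sfamD(1)[OF Nf], of j j] sfamD(2)[OF Nf, of j]
        by (simp add: z_def)
    qed (use pre[of i] pvec_pr[OF x(2), of "?m - i" q] in \<open>auto simp: z_def\<close>)
    fix c assume c: "c \<in> arcs Q"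
    {
      fix d assume d: "out_letter (snd w') i d = Some (Dir c)"
      then have d: "out_letter ls i d = Some (Dir c)" by (simp add: w'_def)
      have lq: "act Q E c (z i) = z (nxt i d)" if "i \<le> ?m" "\<not> d"
      proof -
        have "out_letter (snd (peak v q [])) i False = Some (Dir c)" using d outq[of i False] that by (cases "i < ?m") auto
        then have "0 < i" "c = q ! (?m - i)" using out_letter_peak(2)[of i q "[]" v] that by (auto split: if_splits)
        then show ?thesis using that pvec_Suc[of "?m - i" q E x] by (auto simp: z_def nxt_def Suc_diff_le)
      qed
      show "act Q E c (z i) = z (nxt i d)"
        using cs
      proof cases
        case 1
        then have "\<not> d" using d outq[of i d] out_letter_peak(1)[of i q "[]" v] by (cases d) auto
        then show ?thesis using lq 1 by simp
      next
        case 2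
        show ?thesis
        proof (cases d)
          case True
          then show ?thesis using 2 d outm y0 by (simp add: z_def nxt_def)
        qed (use lq 2 in simp)
      next
        case 3
        have "0 < j \<or> d" using d 3 outm(2) by (cases j; cases d) auto
        then have "out_letter (snd w) j d = Some (Dir c)" using outw[OF 3(2)] d 3 by simp
        then have "act Q N c (y j) = y (nxt j d)" "nxt j d \<le> ?n"
          using sfam_out[OF w Nf 3(2) c] out_letterD(3)[OF w 3(2)] by auto
        moreover have "nxt i d = Suc (?m + nxt j d)" using 3 \<open>0 < j \<or> d\<close> by (auto simp: nxt_def)
        ultimately show ?thesis using mhomD(5)[OF Fh c sfamD(1)[OF Nf 3(2)]] 3 by (simp add: z_def)
      qed
    next
      assume o: "out_letter (snd w') i True \<noteq> Some (Dir c)" "out_letter (snd w') i False \<noteq> Some (Dir c)"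
      then have o: "out_letter ls i True \<noteq> Some (Dir c)" "out_letter ls i False \<noteq> Some (Dir c)"
        by (simp_all add: w'_def)
      show "act Q E c (z i) = 0"
        using cs
      proof cases
        case 1
        then have "\<not> (?m - i < ?m \<and> c = q ! (?m - i))"
          using o(2) outq[of i False] out_letter_peak(2)[of i q "[]" v] by (cases "i = 0") auto
        then show ?thesis using 1 act_pvec[OF E q x(1), of "?m - i" c] c by (auto simp: z_def)
      next
        case 2
        have "c \<noteq> a" using o(1) 2 outm(1) by auto
        moreover have "\<not> (q \<noteq> [] \<and> c = hd q)"
          using o(2) 2 outq[of ?m False] out_letter_peak(2)[of ?m q "[]" v] by (auto simp: hd_conv_nth)
        ultimately have "tail Q c \<noteq> v" using only[OF c] by blast
        then show ?thesis using 2 actx[OF c] by (simp add: z_def)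
      next
        case 3
        have "out_letter (snd w) j d \<noteq> Some (Dir c)" for d
        proof (cases "0 < j \<or> d")
          case True
          then show ?thesis using outw[OF 3(2) True] o 3 by (cases d) auto
        qed (auto simp: out_letter_def)
        then have "act Q N c (y j) = 0" using sfam_zero[OF Nf 3(2) c] by simp
        then show ?thesis using mhomD(5)[OF Fh c sfamD(1)[OF Nf 3(2)]] mhom_0[OF Fh] 3 by (simp add: z_def)
      qed
    }
  qed
  moreover
  have split: "(\<Sum>i\<le>length (snd w'). c i *\<^sub>F z i) =
      (\<Sum>i\<le>?m. c (?m - i) *\<^sub>F pvec E x q i) + F (\<Sum>i\<le>?n. c (Suc (?m + i)) *\<^sub>F y i)" for c
  proof -
    have "(\<Sum>i\<le>length (snd w'). c i *\<^sub>F z i) =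
        (\<Sum>i\<le>?m. c (?m - i) *\<^sub>F z (?m - i)) + (\<Sum>i\<le>?n. c (Suc (?m + i)) *\<^sub>F z (Suc (?m + i)))"
      unfolding w'_def snd_conv len by (rule sum_atMost_add_Suc)
    also have "(\<Sum>i\<le>?m. c (?m - i) *\<^sub>F z (?m - i)) = (\<Sum>i\<le>?m. c (?m - i) *\<^sub>F pvec E x q i)"
      by (intro sum.cong refl) (auto simp: z_def)
    also have "(\<Sum>i\<le>?n. c (Suc (?m + i)) *\<^sub>F z (Suc (?m + i))) = (\<Sum>i\<le>?n. F (c (Suc (?m + i)) *\<^sub>F y i))"
      using sfamD(1)[OF Nf] by (intro sum.cong refl) (simp add: z_def mhomD(3)[OF Fh])
    also have "\<dots> = F (\<Sum>i\<le>?n. c (Suc (?m + i)) *\<^sub>F y i)"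
      using sfamD(1)[OF Nf] by (intro mhom_sum[OF Fh, symmetric] tot_smul) simp
    finally show ?thesis .
  qed
  have Gp: "G (pvec E x q i) = b i" if "i \<le> ?m" for i
  proof -
    have "peak_fam X (b 0) [] q i = b i"
      using sfam_peak_fam[OF is_str_peak[OF v pk0(1) q(1) pk0(3)] sbasisD(1)[OF X(1)] pk0(1) q(1), of i] that by simp
    then show ?thesis using mhom_peak_fam[OF Gh x(1) pk0(1) q(1), of i] that X(2) by (cases "i = 0") (simp_all add: peak_fam_def)
  qed
  have Gsum: "G (\<Sum>i\<le>?m. d i *\<^sub>F pvec E x q i) = (\<Sum>i\<le>?m. d i *\<^sub>F b i)" for d
  proof -
    have t: "pvec E x q i \<in> tot Q E" if "i \<le> ?m" for i using pvec_tot[OF x(1) _ that] q(1) by (simp add: dpath_def)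
    have "G (\<Sum>i\<le>?m. d i *\<^sub>F pvec E x q i) = (\<Sum>i\<le>?m. G (d i *\<^sub>F pvec E x q i))"
      using t by (intro mhom_sum[OF Gh] tot_smul) simp
    also have "\<dots> = (\<Sum>i\<le>?m. d i *\<^sub>F b i)"
      using t Gp by (intro sum.cong refl) (simp add: mhomD(3)[OF Gh])
    finally show ?thesis .
  qed
  have ptot: "(\<Sum>i\<le>?m. d i *\<^sub>F pvec E x q i) \<in> tot Q E" for d
    using pvec_tot[OF x(1)] q(1) by (intro tot_sum tot_smul) (simp add: dpath_def)
  have ysum: "(\<Sum>i\<le>?n. d i *\<^sub>F y i) \<in> tot Q N" for d
    using sfamD(1)[OF Nf] by (intro tot_sum tot_smul) simp
  have GF: "G (F u) = 0" if "u \<in> tot Q N" for u using im that by blast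
  have "\<exists>c. e = (\<Sum>i\<le>length (snd w'). c i *\<^sub>F z i)" if e: "e \<in> tot Q E" for e
  proof -
    obtain d where d: "G e = (\<Sum>i\<le>?m. d i *\<^sub>F b i)"
      using sbasisD(2)[OF X(1) mhomD(1)[OF Gh e]] by auto
    let ?p = "\<Sum>i\<le>?m. d i *\<^sub>F pvec E x q i"
    have "G (e - ?p) = 0" using mhom_diff[OF Gh e ptot] Gsum d by simp
    then have "e - ?p \<in> F ` tot Q N" using im tot_diff[OF e ptot] by simp
    then obtain u where u: "u \<in> tot Q N" "e - ?p = F u" by auto
    obtain f where f: "u = (\<Sum>i\<le>?n. f i *\<^sub>F y i)" using sbasisD(2)[OF N u(1)] by blast
    define c where "c i = (if i \<le> ?m then d (?m - i) else f (i - Suc ?m))" for i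
    have "(\<Sum>i\<le>length (snd w'). c i *\<^sub>F z i) = ?p + F u"
      unfolding split f by (simp add: c_def)
    then have "e = (\<Sum>i\<le>length (snd w'). c i *\<^sub>F z i)" using u(2) by (simp add: algebra_simps)
    then show ?thesis by blast
  qed
  moreover have "c i = 0" if c: "(\<Sum>i\<le>length (snd w'). c i *\<^sub>F z i) = 0" and i: "i \<le> length (snd w')" for c i
  proof -
    let ?p = "\<Sum>i\<le>?m. c (?m - i) *\<^sub>F pvec E x q i" and ?y = "\<Sum>i\<le>?n. c (Suc (?m + i)) *\<^sub>F y i"
    have pF: "?p + F ?y = 0" using c split by simp
    then have "G (?p + F ?y) = 0" using mhom_0[OF Gh] by simp
    then have "(\<Sum>i\<le>?m. c (?m - i) *\<^sub>F b i) = 0"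
      using mhomD(2)[OF Gh ptot mhomD(1)[OF Fh ysum]] GF[OF ysum] Gsum by simp
    then have z1: "c (?m - i) = 0" if "i \<le> ?m" for i
      using sbasisD(3)[OF X(1), of "\<lambda>i. c (?m - i)" i] that by simp
    then have "?p = 0" by (intro sum.neutral) simp
    then have "F ?y = F 0" using pF mhom_0[OF Fh] by simp
    then have "?y = 0" using inj_onD[OF inj _ ysum tot_0] by simp
    then have z2: "c (Suc (?m + i)) = 0" if "i \<le> ?n" for i
      using sbasisD(3)[OF N, of "\<lambda>i. c (Suc (?m + i))" i] that by simp
    show ?thesis
    proof (cases "i \<le> ?m")
      case True then show ?thesis using z1[of "?m - i"] by simp
    next
      case False
      then obtain j where "i = Suc (?m + j)" using less_imp_Suc_add[of ?m i] by auto
      then show ?thesis using z2[of j] i by (simp add: w'_def len)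
    qed
  qed
  ultimately have "sbasis E w' z" unfolding sbasis_def by blast
  then show ?thesis using w'_str by blast
qed

end

section \<open>Extensions whose quotient is a peak with right maximal sides\<close>

context gentle_quiver
begin

text \<open>The generator of \<open>X\<close> is lifted to \<open>E\<close>, where \<open>a\<close>
  sends it to an element of \<open>N\<close>. The lift may be changed by elements of
  \<open>N\<close> at \<open>v\<close>, which removes everything that lies in the image of
  \<open>a\<close>. If nothing remains, the lift defines a section; otherwise the remainder becomes
  an end vector, and \<open>glue\<close> applies.\<close>

lemma extension_uniserial:
  fixes E :: "('v, 'a, 'k::field) rep"
  assumes E: "amod E" and v: "v \<in> verts Q" and q: "dpath v q" "dmax q"
    and a: "a \<in> arcs Q" "tail Q a = v" "q \<noteq> [] \<longrightarrow> a \<noteq> hd q"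
    and only: "\<And>c. c \<in> arcs Q \<Longrightarrow> tail Q c = v \<Longrightarrow> c = a \<or> (q \<noteq> [] \<and> c = hd q)"
    and ex: "exact N F E G X" and X: "sbasis X (peak v [] q) b"
    and w: "is_str w" and N: "sbasis N w y"
  shows "(\<exists>S. mhom Q X E S \<and> (\<forall>z\<in>tot Q X. G (S z) = z)) \<or> (\<exists>w' z. is_str w' \<and> sbasis E w' z)"
proof -
  let ?n = "length (snd w)"
  have Fh: "mhom Q N E F" and Gh: "mhom Q E X G" and inj: "inj_on F (tot Q N)"
    and im: "F ` tot Q N = {y \<in> tot Q E. G y = 0}" and sur: "G ` tot Q E = tot Q X"
    using ex by (auto simp: exact_def)
  have GF: "G (F u) = 0" if "u \<in> tot Q N" for u using im that by blast
  have pk0: "dpath v []" "dmax []" "apart [] q" by (auto simp: dpath_def dmax_def apart_def)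
  note s = is_str_peak[OF v pk0(1) q(1) pk0(3)]
  note Xf = sbasisD(1)[OF X] and Nf = sbasisD(1)[OF N]
  have vt0: "walk_verts Q (peak v [] q) ! 0 = v" using walk_verts_peak[OF pk0(1) q(1), of 0] by simp
  have "b 0 \<in> G ` tot Q E" using sur sfamD(1)[OF Xf, of 0] by simp
  then obtain x0 where x0: "x0 \<in> tot Q E" "G x0 = b 0" by auto
  define x1 where "x1 = pr v x0"
  have x1: "x1 \<in> tot Q E" "pr v x1 = x1" "G x1 = b 0"
    using x0 sfamD(2)[OF Xf, of 0] vt0 mhomD(4)[OF Gh v x0(1)] by (auto simp: x1_def tot_pr)
  have "out_letter (snd (peak v [] q)) 0 d \<noteq> Some (Dir a)" for d
    using a(3) out_letter_peak[of 0 "[]" q v] by (cases d) (auto simp: hd_conv_nth split: if_splits)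
  then have "act Q X a (b 0) = 0" using sfam_zero[OF Xf _ a(1), of 0] by simp
  then have "G (act Q E a x1) = 0" using mhomD(5)[OF Gh a(1) x1(1)] x1(3) by simp
  then have "act Q E a x1 \<in> F ` tot Q N" using im tot_act[OF a(1)] by simp
  then obtain n0 where n0: "n0 \<in> tot Q N" "act Q E a x1 = F n0" by auto
  obtain \<nu> where \<nu>: "n0 = (\<Sum>k\<le>?n. \<nu> k *\<^sub>F y k)" using sbasisD(2)[OF N n0(1)] by blast
  \<comment> \<open>Marks the basis vectors of \<open>N\<close> in the image of \<open>a\<close>.
    The element \<open>u\<close> below is chosen so that \<open>a\<close> sends it to the part of
    \<open>n0\<close> supported on these, and \<open>n1\<close> is the rest.\<close>
  define rg where "rg k \<longleftrightarrow> (\<exists>k'\<le>?n. stp (snd w) a k' = Some k)" for k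
  define cc where "cc k' = (case stp (snd w) a k' of None \<Rightarrow> 0 | Some k \<Rightarrow> \<nu> k)" for k'
  define u where "u = (\<Sum>k\<le>?n. cc k *\<^sub>F y k)"
  define \<mu> where "\<mu> k = (if rg k then 0 else \<nu> k)" for k
  define n1 where "n1 = (\<Sum>k\<le>?n. \<mu> k *\<^sub>F y k)"
  have u: "u \<in> tot Q N" unfolding u_def using sfamD(1)[OF Nf] by (intro tot_sum tot_smul) simp
  have n1t: "n1 \<in> tot Q N" unfolding n1_def using sfamD(1)[OF Nf] by (intro tot_sum tot_smul) simp
  have pru: "pr v u = u"
    unfolding u_def pr_sum
  proof (intro sum.cong refl)
    fix k assume "k \<in> {..?n}"
    then show "pr v (cc k *\<^sub>F y k) = cc k *\<^sub>F y k"
      using stp_verts(1)[OF w, of k a] a(2) by (auto simp: cc_def sfam_pr[OF Nf] split: option.splits)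
  qed
  have actu: "act Q N a u = (\<Sum>k\<le>?n. (if rg k then \<nu> k else 0) *\<^sub>F y k)"
    unfolding u_def act_combination[OF w N a(1)]
  proof (intro sum.cong refl)
    fix k assume "k \<in> {..?n}"
    show "(\<Sum>j\<le>?n. if stp (snd w) a j = Some k then cc j else 0) *\<^sub>F y k = (if rg k then \<nu> k else 0) *\<^sub>F y k"
    proof (cases "rg k")
      case True
      then obtain k' where k': "k' \<le> ?n" "stp (snd w) a k' = Some k" by (auto simp: rg_def)
      have "stp (snd w) a j = Some k \<longleftrightarrow> j = k'" if "j \<le> ?n" for j
        using stp_inj[OF w that k'(1) _ k'(2)] k'(2) by blast
      then have "(\<Sum>j\<le>?n. if stp (snd w) a j = Some k then cc j else 0) = (\<Sum>j\<le>?n. if j = k' then cc j else 0)"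
        by (intro sum.cong) simp_all
      then show ?thesis using True k' by (simp add: cc_def)
    next
      case False
      then have "(\<Sum>j\<le>?n. if stp (snd w) a j = Some k then cc j else 0) = 0"
        by (intro sum.neutral) (auto simp: rg_def)
      then show ?thesis using False by simp
    qed
  qed
  have "n0 - act Q N a u = n1"
    unfolding actu \<nu> n1_def sum_subtractf[symmetric]
    by (intro sum.cong refl) (auto simp: \<mu>_def simp flip: diff_smul)
  define x where "x = x1 - F u"
  have xt: "x \<in> tot Q E" using x1 mhomD(1)[OF Fh u] by (simp add: x_def tot_diff)
  have prx: "pr v x = x" using x1 pru mhomD(4)[OF Fh v u] by (simp add: x_def)
  have Gx: "G x = b 0" using mhom_diff[OF Gh x1(1) mhomD(1)[OF Fh u]] GF[OF u] x1(3) by (simp add: x_def)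
  have "F n1 = F n0 - F (act Q N a u)"
    using mhom_diff[OF Fh n0(1) tot_act[OF a(1)], of u] \<open>n0 - act Q N a u = n1\<close> by simp
  then have actx: "act Q E a x = F n1"
    using n0(2) mhomD(5)[OF Fh a(1) u] by (simp add: x_def)
  show ?thesis
  proof (cases "n1 = 0")
    case True
    have "act Q E c x = 0" if "c \<in> arcs Q" "tail Q c = v" "\<not> (([] :: 'a list) \<noteq> [] \<and> c = hd [])" "\<not> (q \<noteq> [] \<and> c = hd q)" for c
      using only[OF that(1,2)] that(4) actx True mhom_0[OF Fh] by auto
    moreover have "G x = b (length ([] :: 'a list))" using Gx by simp
    ultimately have "\<exists>S. mhom Q X E S \<and> (\<forall>z\<in>tot Q X. G (S z) = z)"
      by (rule peak_section[OF E v pk0(1,2) q pk0(3) xt prx _ X Gh])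
    then show ?thesis by (rule disjI1)
  next
    case False
    have l0: "at_vertex (head Q a) (Inv a)" using a(1) by (simp add: at_vertex_def)
    have prn: "pr (head Q a) n1 = n1"
    proof (rule inj_onD[OF inj _ tot_pr[OF n1t] n1t])
      show "F (pr (head Q a) n1) = F n1"
        using mhomD(4)[OF Fh head_verts[OF a(1)] n1t] actx by (metis pr_act)
    qed
    \<comment> \<open>A letter \<open>Inv a\<close> would put the position in the range of
      \<open>a\<close>. For a letter \<open>Dir c\<close> with \<open>R a c\<close>, the arrow
      \<open>c\<close> kills \<open>n1\<close>, being a relation applied to \<open>x\<close>, and
      yet moves this position to another basis vector with the same coefficient.\<close>
    have supp: "walk_verts Q w ! k = head Q a \<and> (\<forall>d l. out_letter (snd w) k d = Some l \<longrightarrow> opp (Inv a) l)"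
      if k: "k \<le> ?n" "\<mu> k \<noteq> 0" for k
    proof -
      have "pr (head Q a) n1 = (\<Sum>k\<le>?n. (if head Q a = walk_verts Q w ! k then \<mu> k else 0) *\<^sub>F y k)"
        unfolding n1_def pr_sum by (intro sum.cong refl) (simp add: sfam_pr[OF Nf])
      then have "(\<Sum>k\<le>?n. \<mu> k *\<^sub>F y k) = (\<Sum>k\<le>?n. (if head Q a = walk_verts Q w ! k then \<mu> k else 0) *\<^sub>F y k)"
        unfolding prn by (simp only: n1_def)
      from sbasis_unique[OF N this k(1)] k(2) have vk: "walk_verts Q w ! k = head Q a" by (auto split: if_splits)
      have "opp (Inv a) l" if o: "out_letter (snd w) k d = Some l" for d l
      proof (cases l)
        case (Inv c)
        have "c \<noteq> a"
        proof
          assume "c = a"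
          then have "rg k" using stp_Some_iff'[OF w k(1), of a "nxt k d"] o Inv by (auto simp: rg_def)
          then show False using k(2) by (simp add: \<mu>_def)
        qed
        then show ?thesis using Inv by simp
      next
        case (Dir c)
        have c: "c \<in> arcs Q" "tail Q c = head Q a"
          using out_letterD(1)[OF w k(1) o] Dir vk by (auto simp: at_vertex_def)
        have "\<not> R a c"
        proof
          assume "R a c"
          then have "act Q E c (act Q E a x) = 0" using E a(1) c xt by (simp add: amod_def)
          then have "F (act Q N c n1) = F 0" using actx mhomD(5)[OF Fh c(1) n1t] mhom_0[OF Fh] by simp
          then have "act Q N c n1 = 0" using inj_onD[OF inj _ tot_act[OF c(1)] tot_0] by blast
          then have z: "(\<Sum>j'\<le>?n. (\<Sum>j\<le>?n. if stp (snd w) c j = Some j' then \<mu> j else 0) *\<^sub>F y j') = 0"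
            unfolding n1_def act_combination[OF w N c(1)] .
          have st: "stp (snd w) c k = Some (nxt k d)" using stp_Some_iff[OF w] o Dir by blast
          have le: "nxt k d \<le> ?n" using out_letterD(3)[OF w k(1) o] .
          have "stp (snd w) c j = Some (nxt k d) \<longleftrightarrow> j = k" if "j \<le> ?n" for j
            using stp_inj[OF w that k(1) _ st] st by blast
          then have "(\<Sum>j\<le>?n. if stp (snd w) c j = Some (nxt k d) then \<mu> j else 0) = (\<Sum>j\<le>?n. if j = k then \<mu> j else 0)"
            by (intro sum.cong) simp_all
          then show False using sbasisD(3)[OF N z le] k by simp
        qed
        then show ?thesis using Dir by simp
      qed
      then show ?thesis using vk by blast
    qed
    obtain w' y' where w': "is_str w'" "sbasis N w' y'" "y' 0 = n1" "walk_verts Q w' ! 0 = head Q a"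
      "\<And>l. out_letter (snd w') 0 True = Some l \<Longrightarrow> opp (Inv a) l"
      using sbasis_end_vector[OF w N l0 n1_def False supp] by blast
    have "\<exists>w'' z. is_str w'' \<and> sbasis E w'' z"
      by (rule glue[OF E v q a only xt prx ex X Gx w'(1,2) _ w'(4,5)]) (use actx w'(3) in simp_all)
    then show ?thesis by blast
  qed
qed

text \<open>The strings \<open>p\<^sup>-\<^sup>1 q\<close> with right maximal sides at \<open>v\<close>: two sides give the projective cover of
  the simple module at \<open>v\<close>; one side may be missing, and both may be missing if at most one
  arrow starts at \<open>v\<close>.\<close>

definition proj_peak :: "'v \<Rightarrow> 'a list \<Rightarrow> 'a list \<Rightarrow> bool" where
  "proj_peak v p q \<longleftrightarrow> v \<in> verts Q \<and> dpath v p \<and> dmax p \<and> dpath v q \<and> dmax q \<and> apart p q \<and>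
     (p = [] \<and> q = [] \<longrightarrow> (\<forall>a\<in>arcs Q. \<forall>b\<in>arcs Q. tail Q a = v \<and> tail Q b = v \<longrightarrow> a = b))"

definition proj_string :: "('v, 'a) walk \<Rightarrow> bool" where
  "proj_string w \<longleftrightarrow> (\<exists>v p q. proj_peak v p q \<and> w = peak v p q)"

lemma is_str_proj: "proj_string w \<Longrightarrow> is_str w"
  unfolding proj_string_def proj_peak_def using is_str_peak by blast

text \<open>If every arrow starting at \<open>v\<close> begins one of the sides, any lift of the top
  vector gives a section. Otherwise an arrow is missing; since at most two arrows start at
  \<open>v\<close>, one side is empty, and the uniserial case applies, after reversing the walk if
  the empty side is \<open>q\<close>.\<close>

lemma extension_peak:
  fixes E :: "('v, 'a, 'k::field) rep"
  assumes P: "proj_peak v p q" and E: "amod E" and ex: "exact N F E G X" and X: "sbasis X (peak v p q) b"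
    and w: "is_str w" and N: "sbasis N w y"
  shows "(\<exists>S. mhom Q X E S \<and> (\<forall>z\<in>tot Q X. G (S z) = z)) \<or> (\<exists>w' z. is_str w' \<and> sbasis E w' z)"
proof -
  have v: "v \<in> verts Q" and p: "dpath v p" "dmax p" and q: "dpath v q" "dmax q" and pq: "apart p q"
    using P by (auto simp: proj_peak_def)
  have heads: "p \<noteq> [] \<Longrightarrow> hd p \<in> arcs Q \<and> tail Q (hd p) = v" "q \<noteq> [] \<Longrightarrow> hd q \<in> arcs Q \<and> tail Q (hd q) = v"
    using p(1) q(1) by (auto simp: dpath_def subset_iff)
  show ?thesis
  proof (cases "\<exists>a\<in>arcs Q. tail Q a = v \<and> \<not> (p \<noteq> [] \<and> a = hd p) \<and> \<not> (q \<noteq> [] \<and> a = hd q)")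
    case True
    then obtain a where a: "a \<in> arcs Q" "tail Q a = v" "p \<noteq> [] \<longrightarrow> a \<noteq> hd p" "q \<noteq> [] \<longrightarrow> a \<noteq> hd q" by blast
    have "p = [] \<or> q = []"
    proof (rule ccontr)
      assume "\<not> ?thesis"
      then have ne: "p \<noteq> []" "q \<noteq> []" by auto
      then have "hd p \<noteq> hd q" using pq by (simp add: apart_def)
      then show False using out_two[of a "hd p" "hd q"] a heads ne by metis
    qed
    then show ?thesis
    proof
      assume p0: "p = []"
      have "c = a \<or> (q \<noteq> [] \<and> c = hd q)" if "c \<in> arcs Q" "tail Q c = v" for c
      proof (cases "q = []")
        case True
        then show ?thesis using P p0 a that by (auto simp: proj_peak_def)
      next
        case False
        then show ?thesis using out_two[of c a "hd q"] a heads(2) that by metis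
      qed
      then show ?thesis by (rule extension_uniserial[OF E v q a(1,2,4) _ ex X[unfolded p0] w N])
    next
      assume q0: "q = []"
      have "c = a \<or> (p \<noteq> [] \<and> c = hd p)" if "c \<in> arcs Q" "tail Q c = v" for c
      proof (cases "p = []")
        case True
        then show ?thesis using P q0 a that by (auto simp: proj_peak_def)
      next
        case False
        then show ?thesis using out_two[of c a "hd p"] a heads(1) that by metis
      qed
      moreover have "sbasis X (peak v [] p) (\<lambda>i. b (length p - i))"
        using sbasis_rev[OF is_str_peak[OF v p(1) q(1) pq] X] rev_walk_peak[OF p(1) q(1)] q0 by simp
      ultimately show ?thesis by (rule extension_uniserial[OF E v p a(1-3) _ ex _ w N])
    qed
  next
    case False
    have sur: "G ` tot Q E = tot Q X" and Gh: "mhom Q E X G" using ex by (auto simp: exact_def)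
    have i: "length p \<le> length (snd (peak v p q))" by simp
    note Xf = sbasisD(1)[OF X]
    have vt: "walk_verts Q (peak v p q) ! length p = v" using walk_verts_peak[OF p(1) q(1), of "length p"] by simp
    have "b (length p) \<in> G ` tot Q E" using sur sfamD(1)[OF Xf i] by simp
    then obtain x0 where x0: "x0 \<in> tot Q E" "G x0 = b (length p)" by auto
    have x: "pr v x0 \<in> tot Q E" "pr v (pr v x0) = pr v x0" "G (pr v x0) = b (length p)"
      using x0 sfamD(2)[OF Xf i] vt mhomD(4)[OF Gh v x0(1)] by (auto simp: tot_pr)
    have "act Q E c (pr v x0) = 0"
      if "c \<in> arcs Q" "tail Q c = v" "\<not> (p \<noteq> [] \<and> c = hd p)" "\<not> (q \<noteq> [] \<and> c = hd q)" for c
      using False that by blast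
    from peak_section[OF E v p q pq x(1,2) this X Gh x(3)]
    have "\<exists>S. mhom Q X E S \<and> (\<forall>z\<in>tot Q X. G (S z) = z)" .
    then show ?thesis by (rule disjI1)
  qed
qed

end

section \<open>Bad pairs obtained by cutting a string\<close>

lemma sum_atMost_tail:
  fixes f :: "nat \<Rightarrow> 'b::comm_monoid_add"
  assumes "\<And>i. i < k \<Longrightarrow> f i = 0"
  shows "(\<Sum>i\<le>k + l. f i) = (\<Sum>i\<le>l. f (k + i))"
proof -
  have "(\<Sum>i\<le>k + l. f i) = (\<Sum>i<k + Suc l. f i)" by (simp add: lessThan_Suc_atMost)
  also have "\<dots> = (\<Sum>i<k. f i) + (\<Sum>i\<le>l. f (k + i))"
    unfolding sum_lessThan_add by (simp add: lessThan_Suc_atMost)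
  finally show ?thesis using assms by simp
qed

context bound_quiver
begin

text \<open>In the order of the arguments \<open>M\<close> is the quotient and \<open>N\<close> the
  submodule.\<close>

definition bad :: "('v, 'a, 'k::field) rep \<Rightarrow> ('v, 'a, 'k) rep \<Rightarrow> bool" where
  "bad M N \<longleftrightarrow> (\<exists>E f g. amod E \<and> short_exact Q N f E g M \<and> \<not> splits Q E g M \<and> \<not> indec E)"

end

context gentle_quiver
begin

lemma not_bad_proj:
  assumes P: "proj_string x" and w: "is_str w" and r: "is_rep Q M" "is_rep Q N"
    and M: "sbasis M x b" and N: "sbasis N w y"
  shows "\<not> bad M N"
proof
  assume "bad M N"
  then obtain E f g where E: "amod E" "short_exact Q N f E g M" "\<not> splits Q E g M" "\<not> indec E"
    unfolding bad_def by blast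
  obtain v p q where x: "proj_peak v p q" "x = peak v p q" using P by (auto simp: proj_string_def)
  have fg: "rep_hom Q N E f" "rep_hom Q E M g" using E(2) by (auto simp: short_exact_def)
  have "exact N (app Q N E f) E (app Q E M g) M"
    using short_exact_iff[OF r(2) amod_rep[OF E(1)] r(1) fg] E(2) by blast
  from extension_peak[OF x(1) E(1) this _ w N] M x(2)
  have "(\<exists>S. mhom Q M E S \<and> (\<forall>z\<in>tot Q M. app Q E M g (S z) = z)) \<or> (\<exists>w' z. is_str w' \<and> sbasis E w' z)"
    by blast
  then show False
    using E(3,4) splits_iff[OF amod_rep[OF E(1)] r(1) fg(2)] sbasis_indec[OF _ _ amod_rep[OF E(1)]] by blast
qed

definition cont :: "('v, 'a) walk \<Rightarrow> nat \<Rightarrow> 'a list \<Rightarrow> ('v, 'a) walk" where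
  "cont w k q = (fst w, take k (snd w) @ map Dir q)"

text \<open>Ends of the walk are included, not only valleys: what matters is that every arrow kills
  the basis vector at the position.\<close>

definition sink :: "'a letter list \<Rightarrow> nat \<Rightarrow> bool" where
  "sink xs k \<longleftrightarrow> (\<forall>d c. out_letter xs k d \<noteq> Some (Dir c))"

context
  fixes w k q j
  assumes w: "is_str w" and k: "k \<le> length (snd w)" and sk: "sink (snd w) k" and vk: "walk_verts Q w ! k = j"
    and q: "dpath j q" "dmax q"
    and join: "\<And>a. out_letter (snd w) k False = Some (Inv a) \<Longrightarrow> q \<noteq> [] \<Longrightarrow> \<not> R a (hd q)"
begin

lemma cont_length: "length (snd (cont w k q)) = k + length q"
  using k by (simp add: cont_def)

lemma cont_nth: "i < k + length q \<Longrightarrow> snd (cont w k q) ! i = (if i < k then snd w ! i else Dir (q ! (i - k)))"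
  using k by (auto simp: cont_def nth_append)

lemma cont_verts: "i \<le> k \<Longrightarrow> walk_verts Q (cont w k q) ! i = walk_verts Q w ! i"
proof (cases i)
  case 0
  then show ?thesis by (simp add: cont_def)
next
  case (Suc l)
  moreover assume "i \<le> k"
  ultimately show ?thesis using k cont_length cont_nth[of l] by (simp add: walk_verts_Suc)
qed

lemma cont_out:
  "i < k \<or> (i = k \<and> \<not> d) \<Longrightarrow> out_letter (snd (cont w k q)) i d = out_letter (snd w) i d"
  "q \<noteq> [] \<Longrightarrow> out_letter (snd (cont w k q)) k True = Some (Dir (hd q))"
  "q = [] \<Longrightarrow> out_letter (snd (cont w k q)) k True = None"
  "k < i \<Longrightarrow> i \<le> k + length q \<Longrightarrow> out_letter (snd (cont w k q)) i False = Some (Inv (q ! (i - Suc k)))"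
  "k \<le> i \<Longrightarrow> i < k + length q \<Longrightarrow> out_letter (snd (cont w k q)) i True = Some (Dir (q ! (i - k)))"
proof -
  assume "i < k \<or> (i = k \<and> \<not> d)"
  then show "out_letter (snd (cont w k q)) i d = out_letter (snd w) i d"
    using k cont_length cont_nth[of i] cont_nth[of "i - 1"] by (cases d; cases i) (auto simp: out_letter_def)
qed (use cont_length cont_nth[of k] cont_nth[of "i - 1"] cont_nth[of i] in \<open>auto simp: out_letter_def hd_conv_nth\<close>)

lemma is_str_cont: "is_str (cont w k q)"
  unfolding is_str_nth
proof (intro conjI allI impI)
  show "fst (cont w k q) \<in> verts Q" using w by (simp add: cont_def is_str_def)
next
  fix i assume "i < length (snd (cont w k q))"
  then have i: "i < k + length q" using cont_length by simp
  show "letter_arrow (snd (cont w k q) ! i) \<in> arcs Q"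
    using cont_nth[OF i] w k i dpath_nth(1)[OF q(1), of "i - k"] by (auto simp: is_str_nth)
  show "letter_source Q (snd (cont w k q) ! i) = walk_verts Q (cont w k q) ! i"
  proof (cases "i \<le> k")
    case True
    then show ?thesis
      using cont_nth[OF i] cont_verts[OF True] w k i dpath_nth(2)[OF q(1), of 0] vk by (auto simp: is_str_nth)
  next
    case False
    then obtain l where l: "i = Suc l" "k \<le> l" by (cases i) auto
    have "walk_verts Q (cont w k q) ! i = head Q (q ! (l - k))"
      using l i cont_nth[of l] cont_length by (simp add: walk_verts_Suc)
    then show ?thesis using cont_nth[OF i] l i dpath_nth(2)[OF q(1), of "i - k"] by (simp add: Suc_diff_le)
  qed
next
  fix i assume "Suc i < length (snd (cont w k q))"
  then have i: "Suc i < k + length q" using cont_length by simp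
  consider "Suc i < k" | "Suc i = k" | "k \<le> i" by linarith
  then show "opp (letter_inv (snd (cont w k q) ! i)) (snd (cont w k q) ! Suc i)"
  proof cases
    case 1
    then show ?thesis using cont_nth[of i] cont_nth[OF i] i w k by (simp add: is_str_nth)
  next
    case 2
    then have o: "out_letter (snd w) k False = Some (letter_inv (snd w ! i))" by (auto simp: out_letter_def)
    then obtain a where a: "snd w ! i = Dir a" using sk by (cases "snd w ! i") (auto simp: sink_def)
    have "q \<noteq> []" using 2 i by auto
    then have "\<not> R a (hd q)" using join[of a] o a by simp
    then show ?thesis using cont_nth[of i] cont_nth[OF i] i 2 a \<open>q \<noteq> []\<close> by (simp add: hd_conv_nth)
  next
    case 3
    then show ?thesis using cont_nth[of i] cont_nth[OF i] i dpath_nth(3)[OF q(1), of "i - k"] by (simp add: Suc_diff_le)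
  qed
qed

context
  fixes L :: "('v, 'a, 'k::field) rep" and b
  assumes L: "sbasis L w b"
begin

lemma sink_act: "c \<in> arcs Q \<Longrightarrow> act Q L c (b k) = 0"
  using sfam_zero[OF sbasisD(1)[OF L] k] sk by (auto simp: sink_def)

text \<open>Defines the map from the module of the continued string that keeps the first piece of
  \<open>w\<close> and kills the continuation. It respects the arrow \<open>hd q\<close> because
  position \<open>k\<close> is a sink of \<open>w\<close>.\<close>

lemma sfam_cont: "sfam L (cont w k q) (\<lambda>i. if i \<le> k then b i else 0)"
proof (rule sfamI)
  note Lf = sbasisD(1)[OF L]
  fix i assume "i \<le> length (snd (cont w k q))"
  then have i: "i \<le> k + length q" using cont_length by simp
  show "(if i \<le> k then b i else 0) \<in> tot Q L" using sfamD(1)[OF Lf] k by auto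
  show "pr (walk_verts Q (cont w k q) ! i) (if i \<le> k then b i else 0) = (if i \<le> k then b i else 0)"
    using sfamD(2)[OF Lf] k cont_verts by auto
  fix a assume a: "a \<in> arcs Q"
  {
    fix d assume d: "out_letter (snd (cont w k q)) i d = Some (Dir a)"
    consider "i < k" | "i = k" | "k < i" by linarith
    then show "act Q L a (if i \<le> k then b i else 0) = (if nxt i d \<le> k then b (nxt i d) else 0)"
    proof cases
      case 1
      then have o: "out_letter (snd w) i d = Some (Dir a)" using cont_out(1) d by simp
      have "nxt i d \<le> k" using 1 by (auto simp: nxt_def)
      then show ?thesis using 1 sfam_out[OF w Lf _ a o] k by simp
    next
      case 2
      have "d" using d cont_out(1)[of k False] sk 2 by (cases d) (auto simp: sink_def)
      then show ?thesis using 2 sink_act[OF a] by (simp add: nxt_def)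
    next
      case 3
      then have "d" using d cont_out(4)[of i] i by (cases d) auto
      then show ?thesis using 3 by (simp add: nxt_def)
    qed
  next
    assume o: "out_letter (snd (cont w k q)) i True \<noteq> Some (Dir a)" "out_letter (snd (cont w k q)) i False \<noteq> Some (Dir a)"
    consider "i < k" | "i = k" | "k < i" by linarith
    then show "act Q L a (if i \<le> k then b i else 0) = 0"
    proof cases
      case 1
      then have "out_letter (snd w) i d \<noteq> Some (Dir a)" for d using cont_out(1)[of i d] o by (cases d) auto
      then show ?thesis using 1 sfam_zero[OF Lf _ a, of i] k by simp
    qed (use sink_act[OF a] in auto)
  }
qed

context
  fixes E1 :: "('v, 'a, 'k) rep" and c
  assumes E1: "sbasis E1 (cont w k q) c"
begin

lemma cont_act:
  assumes "a \<in> arcs Q" "\<not> (q \<noteq> [] \<and> a = hd q)"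
  shows "act Q E1 a (c k) = 0"
proof -
  have "out_letter (snd (cont w k q)) k d \<noteq> Some (Dir a)" for d
    using cont_out(1)[of k False] cont_out(2,3) assms(2) sk by (cases d; cases "q = []") (auto simp: sink_def)
  then show ?thesis using sfam_zero[OF sbasisD(1)[OF E1] _ assms(1), of k] cont_length by simp
qed

lemma cont_pvec: "t \<le> length q \<Longrightarrow> pvec E1 (c k) q t = c (k + t)"
proof (induction t)
  case (Suc t)
  have "out_letter (snd (cont w k q)) (k + t) True = Some (Dir (q ! t))"
    using cont_out(5)[of "k + t"] Suc.prems by simp
  from sfam_out[OF is_str_cont sbasisD(1)[OF E1] _ dpath_nth(1)[OF q(1)] this]
  show ?case using Suc cont_length by (simp add: pvec_Suc nxt_def)
qed simp

text \<open>The obstruction to splitting. If \<open>q\<close> is nonempty, \<open>hd q\<close> kills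
  \<open>b k\<close> but moves \<open>c k\<close>. If \<open>q\<close> is empty, \<open>w\<close>
  continues to the right of the sink, so \<open>b k\<close> lies in the image of an arrow that does
  not reach \<open>c k\<close>.\<close>

lemma cont_coeff:
  assumes H: "mhom Q L E1 H" and \<alpha>: "H (b k) = (\<Sum>i\<le>k + length q. \<alpha> i *\<^sub>F c i)"
    and nd: "k < length (snd w) \<or> q \<noteq> []"
  shows "\<alpha> k = 0"
proof (cases "q = []")
  case False
  define a where "a = hd q"
  have a: "a \<in> arcs Q" using False q(1) by (auto simp: a_def dpath_def subset_iff)
  have st: "stp (snd (cont w k q)) a k = Some (Suc k)"
    using cont_out(2)[OF False] by (simp add: stp_def a_def nxt_def)
  have "act Q E1 a (H (b k)) = 0"
    using mhomD(5)[OF H a sfamD(1)[OF sbasisD(1)[OF L] k]] sink_act[OF a] mhom_0[OF H] by simp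
  then have z: "(\<Sum>j'\<le>length (snd (cont w k q)). (\<Sum>i\<le>length (snd (cont w k q)).
      if stp (snd (cont w k q)) a i = Some j' then \<alpha> i else 0) *\<^sub>F c j') = 0"
    using act_combination[OF is_str_cont E1 a, of \<alpha>] \<alpha> by (simp add: cont_length)
  have len: "k \<le> length (snd (cont w k q))" "Suc k \<le> length (snd (cont w k q))"
    using False cont_length by (cases q; simp)+
  have "stp (snd (cont w k q)) a i = Some (Suc k) \<longleftrightarrow> i = k" if "i \<le> length (snd (cont w k q))" for i
    using stp_inj[OF is_str_cont that len(1) _ st] st by blast
  then have "(\<Sum>i\<le>length (snd (cont w k q)). if stp (snd (cont w k q)) a i = Some (Suc k) then \<alpha> i else 0) =
      (\<Sum>i\<le>length (snd (cont w k q)). if i = k then \<alpha> i else 0)"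
    by (intro sum.cong) simp_all
  then show ?thesis using sbasisD(3)[OF E1 z len(2)] len(1) by simp
next
  case True
  then have kn: "k < length (snd w)" using nd by simp
  then have o: "out_letter (snd w) k True = Some (snd w ! k)" by (simp add: out_letter_def)
  then obtain e where e: "snd w ! k = Inv e" using sk by (cases "snd w ! k") (auto simp: sink_def)
  have ea: "e \<in> arcs Q" using out_letterD(1)[OF w k o] e by (simp add: at_vertex_def)
  have o': "out_letter (snd w) (Suc k) False = Some (Dir e)" using e by (simp add: out_letter_def)
  have bk: "act Q L e (b (Suc k)) = b k"
    using sfam_out[OF w sbasisD(1)[OF L] _ ea o'] kn by (simp add: nxt_def)
  note bt = sfamD(1)[OF sbasisD(1)[OF L], of "Suc k"]
  obtain \<gamma> where \<gamma>: "H (b (Suc k)) = (\<Sum>i\<le>length (snd (cont w k q)). \<gamma> i *\<^sub>F c i)"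
    using sbasisD(2)[OF E1 mhomD(1)[OF H bt]] kn by auto
  have "H (b k) = act Q E1 e (H (b (Suc k)))"
    using mhomD(5)[OF H ea bt] bk kn by simp
  then have "(\<Sum>i\<le>length (snd (cont w k q)). \<alpha> i *\<^sub>F c i) = (\<Sum>j'\<le>length (snd (cont w k q)).
      (\<Sum>i\<le>length (snd (cont w k q)). if stp (snd (cont w k q)) e i = Some j' then \<gamma> i else 0) *\<^sub>F c j')"
    using act_combination[OF is_str_cont E1 ea, of \<gamma>] \<alpha> \<gamma> by (simp add: cont_length)
  from sbasis_unique[OF E1 this, of k]
  have "\<alpha> k = (\<Sum>i\<le>length (snd (cont w k q)). if stp (snd (cont w k q)) e i = Some k then \<gamma> i else 0)"
    by (simp add: cont_length)
  also have "\<dots> = 0"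
  proof (intro sum.neutral ballI)
    fix i assume i: "i \<in> {..length (snd (cont w k q))}"
    have "out_letter (snd (cont w k q)) k d \<noteq> Some (Inv e)" for d
      using cont_out(1)[of k False] cont_out(3)[OF True] out_letter_eq[OF w, of k True "Inv e" False] o e
      by (cases d) auto
    then have "stp (snd (cont w k q)) e i \<noteq> Some k"
      using stp_Some_iff'[OF is_str_cont, of k e i] i cont_length by auto
    then show "(if stp (snd (cont w k q)) e i = Some k then \<gamma> i else 0) = 0" by simp
  qed
  finally show ?thesis .
qed

end
end
end

lemma pvec_add:
  assumes "mhom Q A E i" "mhom Q B E j" "x \<in> tot Q A" "y \<in> tot Q B" "set p \<subseteq> arcs Q" "t \<le> length p"
  shows "pvec E (i x + j y) p t = i (pvec A x p t) + j (pvec B y p t)"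
  using assms(6)
proof (induction t)
  case (Suc t)
  have a: "p ! t \<in> arcs Q" using Suc.prems assms(5) nth_mem[of t p] by auto
  show ?case
    using Suc mhomD(5)[OF assms(1) a pvec_tot[OF assms(3,5)], of t] mhomD(5)[OF assms(2) a pvec_tot[OF assms(4,5)], of t]
    by (simp add: pvec_Suc)
qed simp

lemma pvec_zero:
  assumes "p \<noteq> [] \<Longrightarrow> act Q M (hd p) x = 0" "0 < t" "t \<le> length p"
  shows "pvec M x p t = 0"
  using assms(2,3)
proof (induction t)
  case (Suc t)
  show ?case
  proof (cases t)
    case 0
    then show ?thesis using Suc.prems assms(1) by (cases p) (auto simp: pvec_Suc)
  next
    case (Suc s)
    then show ?thesis using Suc.IH Suc.prems by (simp add: pvec_Suc)
  qed
qed simp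

end

context gentle_quiver
begin

lemma sum_restrict:
  fixes f :: "nat \<Rightarrow> 'b::comm_monoid_add"
  assumes "k \<le> m"
  shows "(\<Sum>i\<le>m. if i \<le> k then f i else 0) = (\<Sum>i\<le>k. f i)"
proof -
  have "(\<Sum>i\<le>k. f i) = (\<Sum>i\<le>k. if i \<le> k then f i else 0)" by (intro sum.cong) auto
  also have "\<dots> = (\<Sum>i\<le>m. if i \<le> k then f i else 0)"
    using assms by (intro sum.mono_neutral_left) auto
  finally show ?thesis by simp
qed

text \<open>At a position of \<open>w\<close> that no arrow leaves, the string can be cut, and the two pieces can be
  continued along the two sides of the projective cover of the simple module at that vertex.\<close>

lemma bad_sink:
  assumes w: "is_str w" and k: "k \<le> length (snd w)" and sk: "sink (snd w) k" and vk: "walk_verts Q w ! k = j"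
    and p: "dpath j p" "dmax p" and q: "dpath j q" "dmax q" and pq: "apart p q"
    and cover: "\<And>c. c \<in> arcs Q \<Longrightarrow> tail Q c = j \<Longrightarrow> (p \<noteq> [] \<and> c = hd p) \<or> (q \<noteq> [] \<and> c = hd q)"
    and jq: "\<And>a. out_letter (snd w) k False = Some (Inv a) \<Longrightarrow> q \<noteq> [] \<Longrightarrow> \<not> R a (hd q)"
    and jp: "\<And>a. out_letter (snd w) k True = Some (Inv a) \<Longrightarrow> p \<noteq> [] \<Longrightarrow> \<not> R a (hd p)"
    and nd: "k < length (snd w) \<or> q \<noteq> []" "0 < k \<or> p \<noteq> []"
  shows "bad (string_rep Q w :: ('v, 'a, 'k::field) rep) (string_rep Q (peak j p q))"
proof -
  let ?n = "length (snd w)"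
  let ?w = "rev_walk w" and ?k = "length (snd w) - k"
  let ?L = "string_rep Q w :: ('v, 'a, 'k) rep" and ?P = "string_rep Q (peak j p q) :: ('v, 'a, 'k) rep"
  note w' = is_str_rev[OF w]
  have jv: "j \<in> verts Q" using walk_verts_in[OF w k] vk by simp
  have k': "?k \<le> length (snd ?w)" by simp
  have olr: "out_letter (snd ?w) ?k d = out_letter (snd w) k (\<not> d)" for d
    using out_letter_rev[of ?k "snd w" d] k by (simp add: rev_walk_def)
  have sk': "sink (snd ?w) ?k" using sk by (simp add: sink_def olr)
  have vk': "walk_verts Q ?w ! ?k = j" using walk_verts_rev[OF w, of ?k] k vk by simp
  have jp': "\<not> R a (hd p)" if "out_letter (snd ?w) ?k False = Some (Inv a)" "p \<noteq> []" for a
    using jp that olr by simp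
  note cw = w k sk vk q jq and cw' = w' k' sk' vk' p jp'
  \<comment> \<open>The middle term is the direct sum of two string modules: the left piece of
    \<open>w\<close> continued by \<open>q\<close>, and the right piece, read towards the cut,
    continued by \<open>p\<close>.\<close>
  define w1 where "w1 = cont w k q"
  define w2 where "w2 = cont ?w ?k p"
  have len1: "length (snd w1) = k + length q" unfolding w1_def by (rule cont_length[OF cw])
  have len2: "length (snd w2) = ?k + length p" unfolding w2_def by (rule cont_length[OF cw'])
  have s1: "is_str w1" unfolding w1_def by (rule is_str_cont[OF cw])
  have s2: "is_str w2" unfolding w2_def by (rule is_str_cont[OF cw'])
  have sp: "is_str (peak j p q)" by (rule is_str_peak[OF jv p(1) q(1) pq])
  define E1 where "E1 = (string_rep Q w1 :: ('v, 'a, 'k) rep)"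
  define E2 where "E2 = (string_rep Q w2 :: ('v, 'a, 'k) rep)"
  define E where "E = dsum Q E1 E2"
  obtain b where b: "sbasis ?L w b" using sbasis_string_rep[OF w] by blast
  obtain c where c: "sbasis E1 w1 c" unfolding E1_def using sbasis_string_rep[OF s1] by blast
  obtain c' where c': "sbasis E2 w2 c'" unfolding E2_def using sbasis_string_rep[OF s2] by blast
  obtain xb where xb: "sbasis ?P (peak j p q) xb" using sbasis_string_rep[OF sp] by blast
  have am1: "amod E1" and am2: "amod E2" and amL: "amod ?L" and amP: "amod ?P"
    by (simp_all add: amod_string_rep s1 s2 w sp E1_def E2_def)
  have amE: "amod E" unfolding E_def by (rule amod_dsum[OF am1 am2])
  define b' where "b' i = b (?n - i)" for i
  have b': "sbasis ?L ?w b'" unfolding b'_def by (rule sbasis_rev[OF w b])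
  have bk: "b' ?k = b k" using k by (simp add: b'_def)
  obtain i1 p1 i2 p2 where bp: "biprod E E1 E2 i1 p1 i2 p2"
    unfolding E_def using biprod_dsum[OF amod_rep[OF am1] amod_rep[OF am2]] by blast
  have h: "mhom Q E1 E i1" "mhom Q E E1 p1" "mhom Q E2 E i2" "mhom Q E E2 p2"
    and pi: "\<And>x. x \<in> tot Q E1 \<Longrightarrow> p1 (i1 x) = x" "\<And>x. x \<in> tot Q E1 \<Longrightarrow> p2 (i1 x) = 0"
      "\<And>y. y \<in> tot Q E2 \<Longrightarrow> p2 (i2 y) = y" "\<And>y. y \<in> tot Q E2 \<Longrightarrow> p1 (i2 y) = 0"
    and ip: "\<And>t. t \<in> tot Q E \<Longrightarrow> i1 (p1 t) + i2 (p2 t) = t"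
    using bp by (auto simp: biprod_def)
  have pii: "p1 (i1 x + i2 y) = x" "p2 (i1 x + i2 y) = y" if "x \<in> tot Q E1" "y \<in> tot Q E2" for x y
    using that pi mhomD(2)[OF h(2) mhomD(1)[OF h(1) that(1)] mhomD(1)[OF h(3) that(2)]]
      mhomD(2)[OF h(4) mhomD(1)[OF h(1) that(1)] mhomD(1)[OF h(3) that(2)]] by simp_all
  have ct: "c i \<in> tot Q E1" if "i \<le> k + length q" for i using sfamD(1)[OF sbasisD(1)[OF c]] that len1 by simp
  have ct': "c' i \<in> tot Q E2" if "i \<le> ?k + length p" for i using sfamD(1)[OF sbasisD(1)[OF c']] that len2 by simp
  have sct: "(\<Sum>i\<le>k + length q. \<alpha> i *\<^sub>F c i) \<in> tot Q E1" for \<alpha> using ct by (intro tot_sum tot_smul) simp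
  have sct': "(\<Sum>i\<le>?k + length p. \<beta> i *\<^sub>F c' i) \<in> tot Q E2" for \<beta> using ct' by (intro tot_sum tot_smul) simp
  obtain G1 where G1: "mhom Q E1 ?L G1"
    "\<And>\<alpha>. G1 (\<Sum>i\<le>length (snd w1). \<alpha> i *\<^sub>F c i) = (\<Sum>i\<le>length (snd w1). \<alpha> i *\<^sub>F (if i \<le> k then b i else 0))"
    using sbasis_hom[OF c sfam_cont[OF cw b, folded w1_def]] by blast
  obtain G2 where G2: "mhom Q E2 ?L G2"
    "\<And>\<beta>. G2 (\<Sum>i\<le>length (snd w2). \<beta> i *\<^sub>F c' i) = (\<Sum>i\<le>length (snd w2). \<beta> i *\<^sub>F (if i \<le> ?k then b' i else 0))"
    using sbasis_hom[OF c' sfam_cont[OF cw' b', folded w2_def]] by blast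
  \<comment> \<open>Both summands contain a copy of \<open>b k\<close>. The minus sign makes the
    copies cancel on the diagonal vector \<open>x\<close> defined below, which will generate the
    kernel.\<close>
  define G where "G t = G1 (p1 t) - G2 (p2 t)" for t
  have G: "mhom Q E ?L G" unfolding G_def by (rule mhom_minus[OF mhom_comp[OF h(2) G1(1)] mhom_comp[OF h(4) G2(1)]])
  have Gval: "G (i1 (\<Sum>i\<le>k + length q. \<alpha> i *\<^sub>F c i) + i2 (\<Sum>i\<le>?k + length p. \<beta> i *\<^sub>F c' i)) =
      (\<Sum>i\<le>?n. ((if i \<le> k then \<alpha> i else 0) - (if k \<le> i then \<beta> (?n - i) else 0)) *\<^sub>F b i)" for \<alpha> \<beta>
  proof -
    have "(\<Sum>i\<le>k + length q. \<alpha> i *\<^sub>F (if i \<le> k then b i else 0)) = (\<Sum>i\<le>k + length q. if i \<le> k then \<alpha> i *\<^sub>F b i else 0)"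
      by (intro sum.cong) auto
    also have "\<dots> = (\<Sum>i\<le>?n. if i \<le> k then \<alpha> i *\<^sub>F b i else 0)" using k by (simp add: sum_restrict)
    also have "\<dots> = (\<Sum>i\<le>?n. (if i \<le> k then \<alpha> i else 0) *\<^sub>F b i)" by (intro sum.cong) auto
    finally have 1: "G1 (\<Sum>i\<le>k + length q. \<alpha> i *\<^sub>F c i) = (\<Sum>i\<le>?n. (if i \<le> k then \<alpha> i else 0) *\<^sub>F b i)"
      using G1(2)[of \<alpha>] len1 by simp
    have "(\<Sum>i\<le>?k + length p. \<beta> i *\<^sub>F (if i \<le> ?k then b' i else 0)) = (\<Sum>i\<le>?k + length p. if i \<le> ?k then \<beta> i *\<^sub>F b' i else 0)"
      by (intro sum.cong) auto
    also have "\<dots> = (\<Sum>i\<le>?n. if i \<le> ?k then \<beta> i *\<^sub>F b' i else 0)" by (simp add: sum_restrict)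
    also have "\<dots> = (\<Sum>i\<le>?n. if ?n - i \<le> ?k then \<beta> (?n - i) *\<^sub>F b' (?n - i) else 0)"
      by (rule sum_rev_atMost[symmetric])
    also have "\<dots> = (\<Sum>i\<le>?n. (if k \<le> i then \<beta> (?n - i) else 0) *\<^sub>F b i)"
      using k by (intro sum.cong) (auto simp: b'_def)
    finally have 2: "G2 (\<Sum>i\<le>?k + length p. \<beta> i *\<^sub>F c' i) = (\<Sum>i\<le>?n. (if k \<le> i then \<beta> (?n - i) else 0) *\<^sub>F b i)"
      using G2(2)[of \<beta>] len2 by simp
    show ?thesis unfolding G_def by (simp only: pii[OF sct sct'] 1 2 diff_smul sum_subtractf)
  qed
  \<comment> \<open>The image of the top of the peak: \<open>hd q\<close> acts nontrivially only on
    the first component and \<open>hd p\<close> only on the second, as \<open>zp\<close> and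
    \<open>zq\<close> record.\<close>
  define x where "x = i1 (c k) + i2 (c' ?k)"
  have xt: "x \<in> tot Q E" unfolding x_def using mhomD(1)[OF h(1) ct] mhomD(1)[OF h(3) ct'] by (simp add: tot_add)
  have vc: "pr j (c k) = c k" "pr j (c' ?k) = c' ?k"
    using sfamD(2)[OF sbasisD(1)[OF c], of k] sfamD(2)[OF sbasisD(1)[OF c'], of ?k] len1 len2
      cont_verts[OF cw, of k] cont_verts[OF cw', of ?k] vk vk' by (simp_all add: w1_def w2_def)
  have prx: "pr j x = x"
    unfolding x_def using vc mhomD(4)[OF h(1) jv ct, of k] mhomD(4)[OF h(3) jv ct', of ?k] by simp
  have hds: "p \<noteq> [] \<Longrightarrow> hd p \<in> arcs Q" "q \<noteq> [] \<Longrightarrow> hd q \<in> arcs Q"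
    using p(1) q(1) by (auto simp: dpath_def subset_iff)
  have sets: "set p \<subseteq> arcs Q" "set q \<subseteq> arcs Q" using p(1) q(1) by (auto simp: dpath_def)
  \<comment> \<open>The two components of the family generated by \<open>x\<close>. Indices from
    \<open>length p\<close> on run along \<open>q\<close> in \<open>E1\<close>, indices up to
    \<open>length p\<close> along \<open>p\<close> in \<open>E2\<close>; the top is the only index
    where both are present.\<close>
  define A where "A i = (if length p \<le> i then c (k + (i - length p)) else 0)" for i
  define B where "B i = (if i \<le> length p then c' (?k + (length p - i)) else 0)" for i
  have At: "A i \<in> tot Q E1" and Bt: "B i \<in> tot Q E2" if "i \<le> length p + length q" for i
    using that ct ct' by (auto simp: A_def B_def)
  have zp: "pvec E1 (c k) p t = 0" if "0 < t" "t \<le> length p" for t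
  proof (rule pvec_zero[OF _ that])
    assume ne: "p \<noteq> []"
    then show "act Q E1 (hd p) (c k) = 0"
      using pq by (intro cont_act[OF cw b c[unfolded w1_def]] hds) (auto simp: apart_def)
  qed
  have zq: "pvec E2 (c' ?k) q t = 0" if "0 < t" "t \<le> length q" for t
  proof (rule pvec_zero[OF _ that])
    assume ne: "q \<noteq> []"
    then show "act Q E2 (hd q) (c' ?k) = 0"
      using pq by (intro cont_act[OF cw' b' c'[unfolded w2_def]] hds) (auto simp: apart_def)
  qed
  have pf: "peak_fam E x p q i = i1 (A i) + i2 (B i)" if i: "i \<le> length p + length q" for i
  proof (cases "i \<le> length p")
    case True
    have "pvec E x p (length p - i) = i1 (pvec E1 (c k) p (length p - i)) + i2 (pvec E2 (c' ?k) p (length p - i))"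
      unfolding x_def by (rule pvec_add[OF h(1,3) ct ct' sets(1)]) auto
    also have "pvec E2 (c' ?k) p (length p - i) = c' (?k + (length p - i))"
      by (rule cont_pvec[OF cw' b' c'[unfolded w2_def]]) simp_all
    also have "pvec E1 (c k) p (length p - i) = A i"
      using True zp[of "length p - i"] by (cases "i = length p") (auto simp: A_def)
    finally show ?thesis using True by (simp add: peak_fam_def B_def)
  next
    case False
    have "pvec E x q (i - length p) = i1 (pvec E1 (c k) q (i - length p)) + i2 (pvec E2 (c' ?k) q (i - length p))"
      unfolding x_def by (rule pvec_add[OF h(1,3) ct ct' sets(2)]) (use i in auto)
    also have "pvec E1 (c k) q (i - length p) = c (k + (i - length p))"
      by (rule cont_pvec[OF cw b c[unfolded w1_def]]) (use i in simp_all)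
    also have "pvec E2 (c' ?k) q (i - length p) = B i"
      using False zq[of "i - length p"] i by (simp add: B_def)
    finally show ?thesis using False by (simp add: peak_fam_def A_def)
  qed
  have fam: "sfam E (peak j p q) (peak_fam E x p q)"
    by (rule sfam_peak[OF amE jv p q pq xt prx]) (use cover in blast)
  obtain F where F: "mhom Q ?P E F"
    "\<And>d. F (\<Sum>i\<le>length (snd (peak j p q)). d i *\<^sub>F xb i) = (\<Sum>i\<le>length (snd (peak j p q)). d i *\<^sub>F peak_fam E x p q i)"
    using sbasis_hom[OF xb fam] by blast
  have SA: "(\<Sum>i\<le>length p + length q. d i *\<^sub>F A i) = (\<Sum>i\<le>k + length q. (if k \<le> i then d (length p + (i - k)) else 0) *\<^sub>F c i)" for d
  proof -
    have "(\<Sum>i\<le>length p + length q. d i *\<^sub>F A i) = (\<Sum>i\<le>length q. d (length p + i) *\<^sub>F A (length p + i))"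
      by (rule sum_atMost_tail) (simp add: A_def)
    moreover have "(\<Sum>i\<le>k + length q. (if k \<le> i then d (length p + (i - k)) else 0) *\<^sub>F c i) =
        (\<Sum>i\<le>length q. (if k \<le> k + i then d (length p + (k + i - k)) else 0) *\<^sub>F c (k + i))"
      by (rule sum_atMost_tail) simp
    ultimately show ?thesis by (simp add: A_def)
  qed
  have SB: "(\<Sum>i\<le>length p + length q. d i *\<^sub>F B i) = (\<Sum>i\<le>?k + length p. (if ?k \<le> i then d (length p - (i - ?k)) else 0) *\<^sub>F c' i)" for d
  proof -
    have "(\<Sum>i\<le>length p + length q. d i *\<^sub>F B i) = (\<Sum>i\<le>length p + length q. if i \<le> length p then d i *\<^sub>F c' (?k + (length p - i)) else 0)"
      by (intro sum.cong) (auto simp: B_def)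
    also have "\<dots> = (\<Sum>i\<le>length p. d i *\<^sub>F c' (?k + (length p - i)))" by (simp add: sum_restrict)
    also have "\<dots> = (\<Sum>i\<le>length p. d (length p - (length p - i)) *\<^sub>F c' (?k + (length p - i)))"
      by (intro sum.cong) auto
    also have "\<dots> = (\<Sum>t\<le>length p. d (length p - t) *\<^sub>F c' (?k + t))"
      by (rule sum_rev_atMost)
    also have "\<dots> = (\<Sum>t\<le>length p. (if ?k \<le> ?k + t then d (length p - (?k + t - ?k)) else 0) *\<^sub>F c' (?k + t))"
      by simp
    also have "\<dots> = (\<Sum>i\<le>?k + length p. (if ?k \<le> i then d (length p - (i - ?k)) else 0) *\<^sub>F c' i)"
      by (rule sum_atMost_tail[symmetric]) simp
    finally show ?thesis .
  qed
  have Fval: "F (\<Sum>i\<le>length p + length q. d i *\<^sub>F xb i) =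
      i1 (\<Sum>i\<le>k + length q. (if k \<le> i then d (length p + (i - k)) else 0) *\<^sub>F c i) +
      i2 (\<Sum>i\<le>?k + length p. (if ?k \<le> i then d (length p - (i - ?k)) else 0) *\<^sub>F c' i)" for d
  proof -
    have "F (\<Sum>i\<le>length p + length q. d i *\<^sub>F xb i) = (\<Sum>i\<le>length p + length q. d i *\<^sub>F i1 (A i) + d i *\<^sub>F i2 (B i))"
      using F(2)[of d] pf by (simp add: smul_add)
    also have "\<dots> = (\<Sum>i\<le>length p + length q. i1 (d i *\<^sub>F A i)) + (\<Sum>i\<le>length p + length q. i2 (d i *\<^sub>F B i))"
      unfolding sum.distrib[symmetric] using At Bt by (intro sum.cong refl) (simp add: mhomD(3)[OF h(1)] mhomD(3)[OF h(3)])
    also have "\<dots> = i1 (\<Sum>i\<le>length p + length q. d i *\<^sub>F A i) + i2 (\<Sum>i\<le>length p + length q. d i *\<^sub>F B i)"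
    proof -
      have "(\<Sum>i\<le>length p + length q. i1 (d i *\<^sub>F A i)) = i1 (\<Sum>i\<le>length p + length q. d i *\<^sub>F A i)"
        using At by (intro mhom_sum[OF h(1), symmetric] tot_smul) simp
      moreover have "(\<Sum>i\<le>length p + length q. i2 (d i *\<^sub>F B i)) = i2 (\<Sum>i\<le>length p + length q. d i *\<^sub>F B i)"
        using Bt by (intro mhom_sum[OF h(3), symmetric] tot_smul) simp
      ultimately show ?thesis by simp
    qed
    finally show ?thesis unfolding SA SB .
  qed
  have Pspan: "\<exists>d. z = (\<Sum>i\<le>length p + length q. d i *\<^sub>F xb i)" if "z \<in> tot Q ?P" for z
    using sbasisD(2)[OF xb that] by simp
  have Etot: "e = i1 (\<Sum>i\<le>k + length q. \<alpha> i *\<^sub>F c i) + i2 (\<Sum>i\<le>?k + length p. \<beta> i *\<^sub>F c' i)"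
    if "e \<in> tot Q E" "p1 e = (\<Sum>i\<le>k + length q. \<alpha> i *\<^sub>F c i)" "p2 e = (\<Sum>i\<le>?k + length p. \<beta> i *\<^sub>F c' i)" for e \<alpha> \<beta>
    using ip[OF that(1)] that by simp
  have Eex: "\<exists>\<alpha> \<beta>. p1 e = (\<Sum>i\<le>k + length q. \<alpha> i *\<^sub>F c i) \<and> p2 e = (\<Sum>i\<le>?k + length p. \<beta> i *\<^sub>F c' i)"
    if "e \<in> tot Q E" for e
    using sbasisD(2)[OF c mhomD(1)[OF h(2) that]] sbasisD(2)[OF c' mhomD(1)[OF h(4) that]] len1 len2 by simp
  have inj: "inj_on F (tot Q ?P)"
  proof (rule inj_onI)
    fix y z assume yz: "y \<in> tot Q ?P" "z \<in> tot Q ?P" "F y = F z"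
    have F0: "F (y - z) = 0" using mhom_diff[OF F(1) yz(1,2)] yz(3) by simp
    obtain d where d: "y - z = (\<Sum>i\<le>length p + length q. d i *\<^sub>F xb i)" using Pspan[OF tot_diff[OF yz(1,2)]] by blast
    let ?a = "\<Sum>i\<le>k + length q. (if k \<le> i then d (length p + (i - k)) else 0) *\<^sub>F c i"
    let ?b = "\<Sum>i\<le>?k + length p. (if ?k \<le> i then d (length p - (i - ?k)) else 0) *\<^sub>F c' i"
    have e: "i1 ?a + i2 ?b = 0" using F0 unfolding d Fval .
    have "?a = 0" using pii(1)[OF sct sct', of "\<lambda>i. if k \<le> i then d (length p + (i - k)) else 0" "\<lambda>i. if ?k \<le> i then d (length p - (i - ?k)) else 0"]
      unfolding e using mhom_0[OF h(2)] by simp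
    then have q0: "d (length p + s) = 0" if "s \<le> length q" for s
      using sbasisD(3)[OF c, of "\<lambda>i. if k \<le> i then d (length p + (i - k)) else 0" "k + s"] len1 that by simp
    have "?b = 0" using pii(2)[OF sct sct', of "\<lambda>i. if k \<le> i then d (length p + (i - k)) else 0" "\<lambda>i. if ?k \<le> i then d (length p - (i - ?k)) else 0"]
      unfolding e using mhom_0[OF h(4)] by simp
    then have p0: "d (length p - s) = 0" if "s \<le> length p" for s
      using sbasisD(3)[OF c', of "\<lambda>i. if ?k \<le> i then d (length p - (i - ?k)) else 0" "?k + s"] len2 that by simp
    have "d i = 0" if "i \<le> length p + length q" for i
      using q0[of "i - length p"] p0[of "length p - i"] that by (cases "i \<le> length p") auto
    then have "y - z = 0" unfolding d by (intro sum.neutral) simp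
    then show "y = z" by simp
  qed
  have GF: "G (F z) = 0" if z: "z \<in> tot Q ?P" for z
  proof -
    obtain d where d: "z = (\<Sum>i\<le>length p + length q. d i *\<^sub>F xb i)" using Pspan[OF z] by blast
    show ?thesis unfolding d Fval Gval using k by (intro sum.neutral) auto
  qed
  have ker: "e \<in> F ` tot Q ?P" if e: "e \<in> tot Q E" "G e = 0" for e
  proof -
    obtain \<alpha> \<beta> where ab: "p1 e = (\<Sum>i\<le>k + length q. \<alpha> i *\<^sub>F c i)" "p2 e = (\<Sum>i\<le>?k + length p. \<beta> i *\<^sub>F c' i)"
      using Eex[OF e(1)] by blast
    note ee = Etot[OF e(1) ab]
    have co: "(if i \<le> k then \<alpha> i else 0) - (if k \<le> i then \<beta> (?n - i) else 0) = 0" if "i \<le> ?n" for i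
      using sbasisD(3)[OF b _ that, of "\<lambda>i. (if i \<le> k then \<alpha> i else 0) - (if k \<le> i then \<beta> (?n - i) else 0)"]
        e(2) unfolding ee Gval by blast
    have a0: "\<alpha> i = 0" if "i < k" for i using co[of i] that k by simp
    have b0: "\<beta> i = 0" if "i < ?k" for i
    proof -
      have "\<not> ?n - i \<le> k" "k \<le> ?n - i" "?n - (?n - i) = i" using that by linarith+
      then show ?thesis using co[of "?n - i"] by simp
    qed
    have akbk: "\<alpha> k = \<beta> ?k" using co[OF k] by simp
    \<comment> \<open>Coefficients along the peak of a vector in the kernel. At the top either
      coefficient could be taken, since \<open>akbk\<close> makes them equal.\<close>
    define d where "d i = (if length p \<le> i then \<alpha> (k + (i - length p)) else \<beta> (?k + (length p - i)))" for i
    have 1: "(\<Sum>i\<le>k + length q. (if k \<le> i then d (length p + (i - k)) else 0) *\<^sub>F c i) = (\<Sum>i\<le>k + length q. \<alpha> i *\<^sub>F c i)"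
      using a0 by (intro sum.cong refl) (auto simp: d_def)
    have 2: "(\<Sum>i\<le>?k + length p. (if ?k \<le> i then d (length p - (i - ?k)) else 0) *\<^sub>F c' i) = (\<Sum>i\<le>?k + length p. \<beta> i *\<^sub>F c' i)"
    proof (intro sum.cong refl)
      fix i assume i: "i \<in> {..?k + length p}"
      have "(if ?k \<le> i then d (length p - (i - ?k)) else 0) = \<beta> i"
      proof (cases "?k \<le> i")
        case True
        then have "length p \<le> length p - (i - ?k) \<longleftrightarrow> i = ?k \<or> p = []" using i by (cases p) auto
        then show ?thesis using True i akbk by (auto simp: d_def)
      next
        case False
        then show ?thesis using b0[of i] by simp
      qed
      then show "(if ?k \<le> i then d (length p - (i - ?k)) else 0) *\<^sub>F c' i = \<beta> i *\<^sub>F c' i" by simp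
    qed
    have "e = F (\<Sum>i\<le>length p + length q. d i *\<^sub>F xb i)" unfolding Fval 1 2 by (rule ee)
    moreover have "(\<Sum>i\<le>length p + length q. d i *\<^sub>F xb i) \<in> tot Q ?P"
      using sfamD(1)[OF sbasisD(1)[OF xb]] by (intro tot_sum tot_smul) simp
    ultimately show ?thesis by blast
  qed
  have sur: "y \<in> G ` tot Q E" if y: "y \<in> tot Q ?L" for y
  proof -
    obtain d where d: "y = (\<Sum>i\<le>?n. d i *\<^sub>F b i)" using sbasisD(2)[OF b y] by blast
    define \<alpha> where "\<alpha> i = (if i \<le> k then d i else 0)" for i
    define \<beta> where "\<beta> i = (if i < ?k then - d (?n - i) else 0)" for i
    have "G (i1 (\<Sum>i\<le>k + length q. \<alpha> i *\<^sub>F c i) + i2 (\<Sum>i\<le>?k + length p. \<beta> i *\<^sub>F c' i)) = y"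
      unfolding Gval d using k by (intro sum.cong refl) (auto simp: \<alpha>_def \<beta>_def)
    moreover have "i1 (\<Sum>i\<le>k + length q. \<alpha> i *\<^sub>F c i) + i2 (\<Sum>i\<le>?k + length p. \<beta> i *\<^sub>F c' i) \<in> tot Q E"
      using mhomD(1)[OF h(1) sct] mhomD(1)[OF h(3) sct'] by (intro tot_add)
    ultimately show ?thesis by (rule image_eqI[OF sym])
  qed
  have Ft: "F z \<in> tot Q E" if "z \<in> tot Q ?P" for z using mhomD(1)[OF F(1) that] .
  have Gt: "G e \<in> tot Q ?L" if "e \<in> tot Q E" for e using mhomD(1)[OF G that] .
  have ex: "exact ?P F E G ?L"
    unfolding exact_def
  proof (intro conjI F(1) G inj)
    show "F ` tot Q ?P = {y \<in> tot Q E. G y = 0}" using Ft GF ker by auto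
    show "G ` tot Q E = tot Q ?L" using Gt sur by auto
  qed
  \<comment> \<open>For a section, the coefficients at the cut of the two components of
    \<open>S (b k)\<close> would differ by 1, while \<open>cont_coeff\<close> makes both
    zero.\<close>
  have nosplit: False if S: "mhom Q ?L E S" "\<And>z. z \<in> tot Q ?L \<Longrightarrow> G (S z) = z" for S
  proof -
    have bt: "b k \<in> tot Q ?L" using sfamD(1)[OF sbasisD(1)[OF b] k] .
    obtain \<alpha> \<beta> where ab: "p1 (S (b k)) = (\<Sum>i\<le>k + length q. \<alpha> i *\<^sub>F c i)" "p2 (S (b k)) = (\<Sum>i\<le>?k + length p. \<beta> i *\<^sub>F c' i)"
      using Eex[OF mhomD(1)[OF S(1) bt]] by blast
    have "G (S (b k)) = b k" using S(2)[OF bt] .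
    then have "(\<Sum>i\<le>?n. ((if i \<le> k then \<alpha> i else 0) - (if k \<le> i then \<beta> (?n - i) else 0)) *\<^sub>F b i) = b k"
      unfolding Etot[OF mhomD(1)[OF S(1) bt] ab] Gval .
    also have "b k = (\<Sum>i\<le>?n. (if i = k then 1 else 0) *\<^sub>F b i)" using sum_smul_single[OF k, of b] by simp
    finally have eq: "(\<Sum>i\<le>?n. ((if i \<le> k then \<alpha> i else 0) - (if k \<le> i then \<beta> (?n - i) else 0)) *\<^sub>F b i) =
        (\<Sum>i\<le>?n. (if i = k then 1 else 0) *\<^sub>F b i)" .
    have "\<alpha> k - \<beta> ?k = 1" using sbasis_unique[OF b eq k] by simp
    moreover have "\<alpha> k = 0"
      by (rule cont_coeff[OF cw b c[unfolded w1_def] mhom_comp[OF S(1) h(2)] ab(1) nd(1)])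
    moreover have "\<beta> ?k = 0"
    proof (rule cont_coeff[OF cw' b' c'[unfolded w2_def] mhom_comp[OF S(1) h(4)]])
      show "p2 (S (b' ?k)) = (\<Sum>i\<le>?k + length p. \<beta> i *\<^sub>F c' i)" using ab(2) bk by simp
      show "?k < length (snd ?w) \<or> p \<noteq> []" using nd(2) k by auto
    qed
    ultimately show False by simp
  qed
  obtain f where f: "rep_hom Q ?P E f" "\<And>x. x \<in> tot Q ?P \<Longrightarrow> app Q ?P E f x = F x"
    using mhom_rep_hom[OF amod_rep[OF amP] amod_rep[OF amE] F(1)] by blast
  obtain g where g: "rep_hom Q E ?L g" "\<And>x. x \<in> tot Q E \<Longrightarrow> app Q E ?L g x = G x"
    using mhom_rep_hom[OF amod_rep[OF amE] amod_rep[OF amL] G] by blast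
  have "exact ?P (app Q ?P E f) E (app Q E ?L g) ?L"
    unfolding exact_def
  proof (intro conjI)
    show "mhom Q ?P E (app Q ?P E f)" by (rule rep_hom_mhom[OF amod_rep[OF amP] amod_rep[OF amE] f(1)])
    show "mhom Q E ?L (app Q E ?L g)" by (rule rep_hom_mhom[OF amod_rep[OF amE] amod_rep[OF amL] g(1)])
    show "inj_on (app Q ?P E f) (tot Q ?P)" using inj inj_on_cong[of "tot Q ?P" "app Q ?P E f" F] f(2) by blast
    have "app Q ?P E f ` tot Q ?P = F ` tot Q ?P" using f(2) by (intro image_cong) auto
    also have "\<dots> = {y \<in> tot Q E. G y = 0}" using ex by (simp add: exact_def)
    also have "\<dots> = {y \<in> tot Q E. app Q E ?L g y = 0}" using g(2) by auto
    finally show "app Q ?P E f ` tot Q ?P = {y \<in> tot Q E. app Q E ?L g y = 0}" .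
    have "app Q E ?L g ` tot Q E = G ` tot Q E" using g(2) by (intro image_cong) auto
    then show "app Q E ?L g ` tot Q E = tot Q ?L" using ex by (simp add: exact_def)
  qed
  then have se: "short_exact Q ?P f E g ?L"
    using short_exact_iff[OF amod_rep[OF amP] amod_rep[OF amE] amod_rep[OF amL] f(1) g(1)] by blast
  have ns: "\<not> splits Q E g ?L"
  proof
    assume "splits Q E g ?L"
    then obtain S where S: "mhom Q ?L E S" "\<forall>x\<in>tot Q ?L. app Q E ?L g (S x) = x"
      using splits_iff[OF amod_rep[OF amE] amod_rep[OF amL] g(1)] by blast
    then have "G (S z) = z" if "z \<in> tot Q ?L" for z using g(2)[OF mhomD(1)[OF S(1) that]] that by simp
    from nosplit[OF S(1) this] show False .
  qed
  have "rep_iso Q E (dsum Q E1 E2)"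
    using rep_iso_iff[OF amod_rep[OF amE] amod_rep[OF amE]] miso_id[of E] unfolding E_def by blast
  moreover have "\<not> is_zero_rep Q E1" "\<not> is_zero_rep Q E2"
    using indec_string_rep[OF s1] indec_string_rep[OF s2] by (auto simp: indec_def E1_def E2_def)
  ultimately have "\<not> indec E" using am1 am2 unfolding indec_def by blast
  then show ?thesis unfolding bad_def using amE se ns by blast
qed

end

section \<open>Every string outside the class of peaks with right maximal sides has a bad
  extension\<close>

context gentle_quiver
begin

text \<open>The bound on the length of paths without relations, a consequence of admissibility,
  allows a longest path beginning with \<open>c\<close> to be taken.\<close>

lemma maximal_path_ex:
  assumes c: "c \<in> arcs Q" "tail Q c = v"
  shows "\<exists>p. p \<noteq> [] \<and> hd p = c \<and> dpath v p \<and> dmax p"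
proof -
  obtain m where m: "\<And>p. dpath v p \<Longrightarrow> length p < m"
    using bounded unfolding dpath_def by blast
  define S where "S = {p. p \<noteq> [] \<and> hd p = c \<and> dpath v p}"
  have "[c] \<in> S" using c by (simp add: S_def dpath_def)
  moreover have "\<forall>p. p \<in> S \<longrightarrow> length p < m" using m by (auto simp: S_def)
  ultimately have "\<exists>p. p \<in> S \<and> (\<forall>p'. p' \<in> S \<longrightarrow> length p' \<le> length p)"
    by (rule ex_has_greatest_nat[where P = "\<lambda>p. p \<in> S" and f = length])
  then obtain p where p: "p \<in> S" "\<forall>p'. p' \<in> S \<longrightarrow> length p' \<le> length p" by (elim exE conjE)
  have "dmax p"
    unfolding dmax_def
  proof (intro impI ballI, rule ccontr)
    fix a assume a: "a \<in> arcs Q" "tail Q a = head Q (last p)" "\<not> R (last p) a"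
    have "p @ [a] \<in> S" using p(1) a by (auto simp: S_def dpath_def successively_append_iff)
    then have "length (p @ [a]) \<le> length p" using p(2) by blast
    then show False by simp
  qed
  then show ?thesis using p(1) by (auto simp: S_def)
qed

text \<open>The value \<open>None\<close> asks for a missing side, so that both cases of a peak side
  are handled by one statement.\<close>

lemma side_ex:
  assumes "\<And>c. oc = Some c \<Longrightarrow> c \<in> arcs Q \<and> tail Q c = v"
  shows "\<exists>p. dpath v p \<and> dmax p \<and> (p \<noteq> [] \<longleftrightarrow> oc \<noteq> None) \<and> (\<forall>c. oc = Some c \<longrightarrow> hd p = c)"
proof (cases oc)
  case None
  then show ?thesis by (intro exI[of _ "[]"]) (simp add: dpath_def dmax_def)
next
  case (Some c)
  have "c \<in> arcs Q" "tail Q c = v" using assms[OF Some] by auto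
  from maximal_path_ex[OF this] obtain p where p: "p \<noteq> []" "hd p = c" "dpath v p" "dmax p" by blast
  show ?thesis by (rule exI[of _ p]) (simp add: p Some)
qed

text \<open>Reduces \<open>bad_sink\<close> to the choice of the first arrows of the two sides,
  which are then prolonged maximally. If both are missing, \<open>cover\<close> says that no arrow
  starts at \<open>j\<close>, which meets the last clause of \<open>proj_peak\<close>.\<close>

lemma bad_at:
  assumes w: "is_str w" and k: "k \<le> length (snd w)" and sk: "sink (snd w) k" and vk: "walk_verts Q w ! k = j"
    and oq: "\<And>c. oq = Some c \<Longrightarrow> c \<in> arcs Q \<and> tail Q c = j" and op: "\<And>c. op = Some c \<Longrightarrow> c \<in> arcs Q \<and> tail Q c = j"
    and dis: "\<And>c. oq = Some c \<Longrightarrow> op \<noteq> Some c"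
    and cover: "\<And>c. c \<in> arcs Q \<Longrightarrow> tail Q c = j \<Longrightarrow> oq = Some c \<or> op = Some c"
    and jq: "\<And>a c. out_letter (snd w) k False = Some (Inv a) \<Longrightarrow> oq = Some c \<Longrightarrow> \<not> R a c"
    and jp: "\<And>a c. out_letter (snd w) k True = Some (Inv a) \<Longrightarrow> op = Some c \<Longrightarrow> \<not> R a c"
    and nd: "k < length (snd w) \<or> oq \<noteq> None" "0 < k \<or> op \<noteq> None"
  shows "\<exists>x. proj_string x \<and> bad (string_rep Q w :: ('v, 'a, 'k::field) rep) (string_rep Q x)"
proof -
  obtain q where q: "dpath j q" "dmax q" "q \<noteq> [] \<longleftrightarrow> oq \<noteq> None" "\<And>c. oq = Some c \<Longrightarrow> hd q = c"
    using side_ex[of oq j] oq by blast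
  obtain p where p: "dpath j p" "dmax p" "p \<noteq> [] \<longleftrightarrow> op \<noteq> None" "\<And>c. op = Some c \<Longrightarrow> hd p = c"
    using side_ex[of op j] op by blast
  have pq: "apart p q" using dis p(3,4) q(3,4) by (cases oq; cases op) (auto simp: apart_def)
  have cov: "(p \<noteq> [] \<and> c = hd p) \<or> (q \<noteq> [] \<and> c = hd q)" if "c \<in> arcs Q" "tail Q c = j" for c
    using cover[OF that] p(3,4) q(3,4) by auto
  have "proj_peak j p q"
    unfolding proj_peak_def using p(1,2) q(1,2) pq walk_verts_in[OF w k] vk cov by blast
  then have "proj_string (peak j p q)" by (auto simp: proj_string_def)
  moreover have "bad (string_rep Q w :: ('v, 'a, 'k) rep) (string_rep Q (peak j p q))"
  proof (rule bad_sink[OF w k sk vk p(1,2) q(1,2) pq cov])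
    show "\<not> R a (hd q)" if "out_letter (snd w) k False = Some (Inv a)" "q \<noteq> []" for a
      using jq[OF that(1)] q(3,4) that(2) by (cases oq) auto
    show "\<not> R a (hd p)" if "out_letter (snd w) k True = Some (Inv a)" "p \<noteq> []" for a
      using jp[OF that(1)] p(3,4) that(2) by (cases op) auto
  qed (use nd p(3) q(3) in auto)
  ultimately show ?thesis by blast
qed

lemma no_valley_shape:
  "(\<And>i. Suc i < length xs \<Longrightarrow> \<not> (\<exists>a e. xs ! i = Dir a \<and> xs ! Suc i = Inv e)) \<Longrightarrow>
    \<exists>p q. xs = map Inv p @ map Dir q"
proof (induction xs)
  case (Cons x xs)
  have "\<exists>p q. xs = map Inv p @ map Dir q"
    by (rule Cons.IH) (use Cons.prems[of "Suc _"] in auto)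
  then obtain p q where pq: "xs = map Inv p @ map Dir q" by blast
  show ?case
  proof (cases x)
    case (Inv a)
    then show ?thesis using pq by (intro exI[of _ "a # p"] exI[of _ q]) simp
  next
    case (Dir a)
    have "p = []"
    proof (cases p)
      case (Cons e p')
      then show ?thesis using Cons.prems[of 0] Dir pq by simp
    qed
    then show ?thesis using pq Dir by (intro exI[of _ "[]"] exI[of _ "a # q"]) simp
  qed
qed simp

lemma is_str_peakD:
  assumes "is_str w" "snd w = map Inv (rev p) @ map Dir q"
  shows "\<exists>v\<in>verts Q. dpath v p \<and> dpath v q \<and> apart p q \<and> w = peak v p q"
proof -
  define v where "v = (if p \<noteq> [] then tail Q (hd p) else fst w)"
  have s: "successively (\<lambda>l l'. letter_target Q l = letter_source Q l' \<and> opp (letter_inv l) l') (map Inv (rev p) @ map Dir q)"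
    and ar: "\<forall>l\<in>set (snd w). letter_arrow l \<in> arcs Q" and fw: "fst w \<in> verts Q"
    and so: "snd w \<noteq> [] \<longrightarrow> letter_source Q (hd (snd w)) = fst w"
    using assms by (auto simp: is_str_def)
  have arp: "set p \<subseteq> arcs Q" and arq: "set q \<subseteq> arcs Q" using ar[unfolded assms(2)] by (simp_all add: ball_Un subset_iff)
  have sp: "successively (\<lambda>a b. head Q a = tail Q b \<and> \<not> R a b) p"
    using s by (auto simp: successively_append_iff successively_map elim!: successively_mono)
  have sq: "successively (\<lambda>a b. head Q a = tail Q b \<and> \<not> R a b) q"
    using s by (auto simp: successively_append_iff successively_map elim!: successively_mono)
  have jn: "tail Q (hd p) = tail Q (hd q) \<and> hd p \<noteq> hd q" if "p \<noteq> []" "q \<noteq> []"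
    using s that by (auto simp: successively_append_iff last_map last_rev hd_map)
  have "v \<in> verts Q" using fw arp tail_verts[of "hd p"] hd_in_set[of p] by (auto simp: v_def simp del: hd_in_set)
  moreover have "dpath v p" using arp sp by (auto simp: dpath_def v_def)
  moreover have "dpath v q"
    using arq sq jn so assms(2) by (auto simp: dpath_def v_def hd_map)
  moreover have "apart p q" using jn by (auto simp: apart_def)
  moreover have "fst w = path_vert v p (length p)"
    using so assms(2) by (cases p rule: rev_cases) (auto simp: v_def path_vert_def)
  then have "w = peak v p q" using assms(2) by (simp add: peak_def prod_eq_iff)
  ultimately show ?thesis by blast
qed

text \<open>The shape can fail in three ways: by a valley, by a side that can be prolonged, or on a
  trivial string by two arrows starting at its vertex. The valley, the end of the short side or the
  only position is a sink to which \<open>bad_at\<close> applies.\<close>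

lemma bad_or_proj:
  assumes w: "is_str w" and np: "\<not> proj_string w"
  shows "\<exists>x. proj_string x \<and> bad (string_rep Q w :: ('v, 'a, 'k::field) rep) (string_rep Q x)"
proof (rule ccontr)
  assume nb: "\<not> ?thesis"
  let ?n = "length (snd w)"
  have "\<not> (\<exists>a e. snd w ! i = Dir a \<and> snd w ! Suc i = Inv e)" if i: "Suc i < ?n" for i
  proof
    assume "\<exists>a e. snd w ! i = Dir a \<and> snd w ! Suc i = Inv e"
    then obtain a e where ae: "snd w ! i = Dir a" "snd w ! Suc i = Inv e" by blast
    have o: "out_letter (snd w) (Suc i) False = Some (Inv a)" "out_letter (snd w) (Suc i) True = Some (Inv e)"
      using ae i by (auto simp: out_letter_def)
    define j where "j = walk_verts Q w ! Suc i"
    have ar: "a \<in> arcs Q" "e \<in> arcs Q" "head Q a = j" "head Q e = j" "a \<noteq> e"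
      using out_letterD(1)[OF w _ o(1)] out_letterD(1)[OF w _ o(2)] out_letter_opp[OF w o(2,1)] i
      by (auto simp: at_vertex_def j_def)
    \<comment> \<open>\<open>ch b\<close> will be the arrow that prolongs \<open>b\<close> without a
      relation, if there is one. The arrows \<open>a\<close> and \<open>e\<close> entering the
      valley differ, so their prolongations differ by \<open>nonrel_left\<close>, and by
      \<open>rel_left\<close> every arrow leaving \<open>j\<close> prolongs one of them.\<close>
    define P where "P b c \<longleftrightarrow> c \<in> arcs Q \<and> tail Q c = j \<and> \<not> R b c" for b c
    define ch where "ch b = (if \<exists>c. P b c then Some (SOME c. P b c) else None)" for b
    have ch: "P b c" if "ch b = Some c" for b c
      using that someI_ex[of "P b"] by (auto simp: ch_def split: if_splits)
    have ch': "ch b = Some c" if "P b c" "b \<in> arcs Q" "head Q b = j" for b c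
    proof -
      have "P b (SOME c. P b c)" using that(1) by (rule someI)
      then have "(SOME c. P b c) = c"
        using nonrel_right[of b "SOME c. P b c" c] that by (auto simp: P_def)
      then show ?thesis using that(1) by (auto simp: ch_def)
    qed
    have "\<exists>x. proj_string x \<and> bad (string_rep Q w :: ('v, 'a, 'k) rep) (string_rep Q x)"
    proof (rule bad_at[OF w _ _ j_def[symmetric], of "ch a" "ch e"])
      show "sink (snd w) (Suc i)" using o by (auto simp: sink_def all_bool_eq)
      show "ch a = Some c \<Longrightarrow> ch e \<noteq> Some c" for c
        using ch[of a c] ch[of e c] nonrel_left[of c a e] ar by (auto simp: P_def)
      show "ch a = Some c \<or> ch e = Some c" if "c \<in> arcs Q" "tail Q c = j" for c
        using ch'[of a c] ch'[of e c] rel_left[of c a e] ar that by (auto simp: P_def)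
    qed (use i o ch P_def in auto)
    then show False using nb by blast
  qed
  from no_valley_shape[of "snd w", OF this] obtain p' q where "snd w = map Inv p' @ map Dir q" by blast
  then have sh: "snd w = map Inv (rev (rev p')) @ map Dir q" by simp
  define p where "p = rev p'"
  obtain v where v: "v \<in> verts Q" "dpath v p" "dpath v q" "apart p q" "w = peak v p q"
    using is_str_peakD[OF w sh] unfolding p_def by blast
  have n: "?n = length p + length q" using v(5) by simp
  \<comment> \<open>The second arrow leaving a vertex, if present, serves as the other side of the
    peak; it may well be in relation with the end of the string.\<close>
  have other: "\<exists>oo. (\<forall>d. oo = Some d \<longrightarrow> d \<in> arcs Q \<and> tail Q d = u \<and> d \<noteq> c) \<and>
      (\<forall>d\<in>arcs Q. tail Q d = u \<longrightarrow> d = c \<or> oo = Some d)" if c: "c \<in> arcs Q" "tail Q c = u" for c u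
  proof (cases "\<exists>d\<in>arcs Q. tail Q d = u \<and> d \<noteq> c")
    case True
    then obtain d where d: "d \<in> arcs Q" "tail Q d = u" "d \<noteq> c" by blast
    have "d' = c \<or> d' = d" if "d' \<in> arcs Q" "tail Q d' = u" for d'
      using out_two[of d' c d] c d that by auto
    then show ?thesis using d by (intro exI[of _ "Some d"]) auto
  next
    case False
    then show ?thesis by (intro exI[of _ None]) auto
  qed
  have "dmax q"
    unfolding dmax_def
  proof (intro impI ballI, rule ccontr)
    fix c assume q: "q \<noteq> []" and c: "c \<in> arcs Q" "tail Q c = head Q (last q)" "\<not> R (last q) c"
    have o: "out_letter (snd w) ?n False = Some (Inv (last q))" "out_letter (snd w) ?n True = None"
      using q v(5) n out_letter_peak[of ?n p q v] by (auto simp: last_conv_nth)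
    have vt: "walk_verts Q w ! ?n = head Q (last q)"
      using out_letterD(1)[OF w _ o(1)] by (simp add: at_vertex_def)
    obtain oo where oo: "\<forall>d. oo = Some d \<longrightarrow> d \<in> arcs Q \<and> tail Q d = head Q (last q) \<and> d \<noteq> c"
      "\<forall>d\<in>arcs Q. tail Q d = head Q (last q) \<longrightarrow> d = c \<or> oo = Some d" using other[OF c(1,2)] by blast
    have "\<exists>x. proj_string x \<and> bad (string_rep Q w :: ('v, 'a, 'k) rep) (string_rep Q x)"
      by (rule bad_at[OF w order_refl _ vt, of "Some c" oo])
        (use o oo c n q in \<open>auto simp: sink_def all_bool_eq\<close>)
    then show False using nb by blast
  qed
  moreover have "dmax p"
    unfolding dmax_def
  proof (intro impI ballI, rule ccontr)
    fix c assume p: "p \<noteq> []" and c: "c \<in> arcs Q" "tail Q c = head Q (last p)" "\<not> R (last p) c"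
    have o: "out_letter (snd w) 0 True = Some (Inv (last p))" "out_letter (snd w) 0 False = None"
      using p v(5) out_letter_peak[of 0 p q v] by (auto simp: last_conv_nth)
    have vt: "walk_verts Q w ! 0 = head Q (last p)"
      using out_letterD(1)[OF w _ o(1)] by (simp add: at_vertex_def)
    obtain oo where oo: "\<forall>d. oo = Some d \<longrightarrow> d \<in> arcs Q \<and> tail Q d = head Q (last p) \<and> d \<noteq> c"
      "\<forall>d\<in>arcs Q. tail Q d = head Q (last p) \<longrightarrow> d = c \<or> oo = Some d" using other[OF c(1,2)] by blast
    have "\<exists>x. proj_string x \<and> bad (string_rep Q w :: ('v, 'a, 'k) rep) (string_rep Q x)"
      by (rule bad_at[OF w le0 _ vt, of oo "Some c"])
        (use o oo c n p in \<open>auto simp: sink_def all_bool_eq\<close>)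
    then show False using nb by blast
  qed
  moreover have "a = b" if e: "p = []" "q = []" and ab: "a \<in> arcs Q" "b \<in> arcs Q" "tail Q a = v" "tail Q b = v" for a b
  proof (rule ccontr)
    assume ne: "a \<noteq> b"
    have o: "out_letter (snd w) 0 True = None" "out_letter (snd w) 0 False = None"
      using e v(5) out_letter_peak[of 0 p q v] by auto
    have vt: "walk_verts Q w ! 0 = v" using walk_verts_peak[OF v(2,3), of 0] e v(5) by simp
    have "\<exists>x. proj_string x \<and> bad (string_rep Q w :: ('v, 'a, 'k) rep) (string_rep Q x)"
      by (rule bad_at[OF w le0 _ vt, of "Some a" "Some b"])
        (use o ab ne out_two[of _ a b] in \<open>auto simp: sink_def all_bool_eq\<close>)
    then show False using nb by blast
  qed
  ultimately have "proj_peak v p q" unfolding proj_peak_def using v by blast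
  then show False using np v(5) by (auto simp: proj_string_def)
qed

lemma finite_proj_strings: "finite {w. proj_string w}"
proof -
  obtain m where m: "\<And>v p. dpath v p \<Longrightarrow> length p < m"
    using bounded unfolding dpath_def by blast
  define P where "P = {p. set p \<subseteq> arcs Q \<and> length p \<le> m}"
  have "finite P" unfolding P_def by (rule finite_lists_length_le[OF finite_arcs])
  then have "finite ((\<lambda>(v, p, q). peak v p q) ` (verts Q \<times> P \<times> P))" using finite_verts by auto
  moreover have "{w. proj_string w} \<subseteq> (\<lambda>(v, p, q). peak v p q) ` (verts Q \<times> P \<times> P)"
  proof
    fix w assume "w \<in> {w. proj_string w}"
    then obtain v p q where "proj_peak v p q" "w = peak v p q" by (auto simp: proj_string_def)
    moreover from this have "length p \<le> m" "length q \<le> m"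
      using m[of v p] m[of v q] by (simp_all add: proj_peak_def less_imp_le)
    ultimately show "w \<in> (\<lambda>(v, p, q). peak v p q) ` (verts Q \<times> P \<times> P)"
      by (intro image_eqI[of _ _ "(v, p, q)"]) (simp_all add: proj_peak_def P_def dpath_def)
  qed
  ultimately show ?thesis by (rule rev_finite_subset)
qed

end

section \<open>Duality with the opposite quiver by transposition\<close>

definition opq :: "('v, 'a) pre_digraph \<Rightarrow> ('v, 'a) pre_digraph" where
  "opq Q = \<lparr>verts = verts Q, arcs = arcs Q, tail = head Q, head = tail Q\<rparr>"

lemma opq_simps [simp]:
  "verts (opq Q) = verts Q" "arcs (opq Q) = arcs Q" "tail (opq Q) = head Q" "head (opq Q) = tail Q"
  "opq (opq Q) = Q"
  by (simp_all add: opq_def)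

definition dual :: "('v, 'a, 'k::field) rep \<Rightarrow> ('v, 'a, 'k) rep" where
  "dual M = \<lparr>rdim = rdim M, rmap = (\<lambda>a. transpose_mat (rmap M a))\<rparr>"

lemma dual_simps [simp]:
  "rdim (dual M) = rdim M" "rmap (dual M) a = transpose_mat (rmap M a)" "dual (dual M) = M"
  by (simp_all add: dual_def)

lemma is_rep_dual [simp]: "is_rep (opq Q) (dual M) \<longleftrightarrow> is_rep Q M"
  by (simp add: is_rep_def)

lemma is_zero_rep_dual [simp]: "is_zero_rep (opq Q) (dual M) \<longleftrightarrow> is_zero_rep Q M"
  by (simp add: is_zero_rep_def)

text \<open>Turning the arrows around inverts each letter but leaves the visited vertices, and hence
  the numbering of coordinates, unchanged; the matrices of zeros and ones are transposed.\<close>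

lemma string_rep_dual:
  "dual (string_rep Q w) = string_rep (opq Q) (fst w, map letter_inv (snd w))"
proof -
  have "letter_target (opq Q) (letter_inv l) = letter_target Q l" for l by (cases l) auto
  then have wv: "walk_verts (opq Q) (fst w, map letter_inv (snd w)) = walk_verts Q w"
    by (simp add: walk_verts_def)
  have inv: "letter_inv l = Dir a \<longleftrightarrow> l = Inv a" "letter_inv l = Inv a \<longleftrightarrow> l = Dir a" for l :: "'b letter" and a
    by (cases l; simp)+
  show ?thesis
    by (auto simp: dual_def string_rep_def Let_def wv walk_pos_def inv fun_eq_iff intro!: eq_matI)
qed

lemma rep_hom_dual:
  assumes "is_rep Q M" "is_rep Q N" "rep_hom Q M N f"
    and arcs: "\<And>a. a \<in> arcs Q \<Longrightarrow> tail Q a \<in> verts Q" "\<And>a. a \<in> arcs Q \<Longrightarrow> head Q a \<in> verts Q"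
  shows "rep_hom (opq Q) (dual N) (dual M) (\<lambda>v. transpose_mat (f v))"
  unfolding rep_hom_def
proof (intro conjI ballI)
  show "transpose_mat (f v) \<in> carrier_mat (rdim (dual M) v) (rdim (dual N) v)" if "v \<in> verts (opq Q)" for v
    using assms(3) that by (simp add: rep_hom_def)
  fix a assume "a \<in> arcs (opq Q)"
  then have a: "a \<in> arcs Q" by simp
  have c: "f (head Q a) \<in> carrier_mat (rdim N (head Q a)) (rdim M (head Q a))"
    "f (tail Q a) \<in> carrier_mat (rdim N (tail Q a)) (rdim M (tail Q a))"
    "rmap M a \<in> carrier_mat (rdim M (head Q a)) (rdim M (tail Q a))"
    "rmap N a \<in> carrier_mat (rdim N (head Q a)) (rdim N (tail Q a))"
    "f (head Q a) * rmap M a = rmap N a * f (tail Q a)"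
    using assms a arcs[OF a] by (auto simp: rep_hom_def is_rep_def)
  show "transpose_mat (f (head (opq Q) a)) * rmap (dual N) a = rmap (dual M) a * transpose_mat (f (tail (opq Q) a))"
    using arg_cong[OF c(5), of transpose_mat]
    by (simp add: transpose_mult[OF c(1,3)] transpose_mult[OF c(4,2)])
qed

lemma mat_choice:
  fixes A B :: "'k::field mat"
  assumes A: "A \<in> carrier_mat p e" and B: "B \<in> carrier_mat p m"
    and ex: "\<And>j. j < m \<Longrightarrow> \<exists>x\<in>carrier_vec e. A *\<^sub>v x = col B j"
  shows "\<exists>X\<in>carrier_mat e m. A * X = B"
proof -
  define x where "x j = (SOME x. x \<in> carrier_vec e \<and> A *\<^sub>v x = col B j)" for j
  have x: "x j \<in> carrier_vec e" "A *\<^sub>v x j = col B j" if "j < m" for j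
    using someI_ex[of "\<lambda>x. x \<in> carrier_vec e \<and> A *\<^sub>v x = col B j"] ex[OF that] by (auto simp: x_def)
  define X where "X = mat e m (\<lambda>(i, j). x j $ i)"
  have X: "X \<in> carrier_mat e m" by (simp add: X_def)
  have cX: "col X j = x j" if "j < m" for j
    using x(1)[OF that] that by (intro eq_vecI) (auto simp: X_def)
  have "A * X = B"
  proof (rule eq_matI)
    fix i j assume "i < dim_row B" "j < dim_col B"
    then have ij: "i < p" "j < m" using B by auto
    have "(A * X) $$ (i, j) = (A *\<^sub>v x j) $ i" using ij A X cX by simp
    then show "(A * X) $$ (i, j) = B $$ (i, j)" using x(2) ij B by simp
  qed (use A B X in auto)
  then show ?thesis using X by blast
qed

lemma mult_unit_vec: "A \<in> carrier_mat p n \<Longrightarrow> j < n \<Longrightarrow> A *\<^sub>v unit_vec n j = col (A :: 'k::field mat) j"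
  using col_mult2[of A p n "1\<^sub>m n" n j] by simp

text \<open>At a single vertex an exact sequence splits linearly, by matrices \<open>r\<close> and
  \<open>s\<close>. The resulting identities are preserved by transposition, which is not visible
  from images and kernels.\<close>

lemma exact_mat_iff:
  fixes f g :: "'k::field mat"
  assumes f: "f \<in> carrier_mat e n" and g: "g \<in> carrier_mat m e"
  shows "inj_on (\<lambda>x. f *\<^sub>v x) (carrier_vec n) \<and>
      (\<lambda>x. f *\<^sub>v x) ` carrier_vec n = {y \<in> carrier_vec e. g *\<^sub>v y = 0\<^sub>v m} \<and>
      (\<lambda>y. g *\<^sub>v y) ` carrier_vec e = carrier_vec m \<longleftrightarrow>
    (\<exists>r\<in>carrier_mat n e. \<exists>s\<in>carrier_mat e m. r * f = 1\<^sub>m n \<and> g * s = 1\<^sub>m m \<and> g * f = 0\<^sub>m m n \<and> f * r + s * g = 1\<^sub>m e)"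
    (is "?L \<longleftrightarrow> ?R")
proof
  assume L: ?L
  then have inj: "inj_on (\<lambda>x. f *\<^sub>v x) (carrier_vec n)"
    and im: "(\<lambda>x. f *\<^sub>v x) ` carrier_vec n = {y \<in> carrier_vec e. g *\<^sub>v y = 0\<^sub>v m}"
    and su: "(\<lambda>y. g *\<^sub>v y) ` carrier_vec e = carrier_vec m" by auto
  have "\<exists>s\<in>carrier_mat e m. g * s = 1\<^sub>m m"
  proof (rule mat_choice[OF g])
    fix j assume "j < m"
    then have "col (1\<^sub>m m :: 'k mat) j \<in> (\<lambda>y. g *\<^sub>v y) ` carrier_vec e" unfolding su by simp
    then show "\<exists>x\<in>carrier_vec e. g *\<^sub>v x = col (1\<^sub>m m) j" by auto
  qed simp
  then obtain s where s: "s \<in> carrier_mat e m" "g * s = 1\<^sub>m m" by blast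
  have gf: "g * f = 0\<^sub>m m n"
  proof (rule eq_matI)
    fix i j assume "i < dim_row (0\<^sub>m m n :: 'k mat)" "j < dim_col (0\<^sub>m m n :: 'k mat)"
    then have ij: "i < m" "j < n" by auto
    have "f *\<^sub>v unit_vec n j \<in> {y \<in> carrier_vec e. g *\<^sub>v y = 0\<^sub>v m}" unfolding im[symmetric] by simp
    then have "g *\<^sub>v col f j = 0\<^sub>v m" using mult_unit_vec[OF f ij(2)] by simp
    then have "(g *\<^sub>v col f j) $ i = 0" using ij by simp
    then show "(g * f) $$ (i, j) = 0\<^sub>m m n $$ (i, j)" using ij f g by simp
  qed (use f g in auto)
  \<comment> \<open>A projection onto the kernel of \<open>g\<close>, which is the image of
    \<open>f\<close>; its columns therefore lift through \<open>f\<close>.\<close>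
  define B where "B = 1\<^sub>m e - s * g"
  have B: "B \<in> carrier_mat e e" unfolding B_def by (rule minus_carrier_mat[OF mult_carrier_mat[OF s(1) g]])
  have gsg: "g * (s * g) = g" using s g assoc_mult_mat[OF g s(1) g] by simp
  have gB: "g * B = 0\<^sub>m m e"
    unfolding B_def using g s by (subst mult_minus_distrib_mat[of _ m e _ e]) (auto simp: gsg minus_r_inv_mat)
  have "\<exists>r\<in>carrier_mat n e. f * r = B"
  proof (rule mat_choice[OF f B])
    fix j assume j: "j < e"
    have "g *\<^sub>v col B j = col (g * B) j" using g B j by simp
    also have "\<dots> = 0\<^sub>v m" using j by (simp add: gB)
    finally have "col B j \<in> (\<lambda>x. f *\<^sub>v x) ` carrier_vec n" unfolding im using B j by simp
    then show "\<exists>x\<in>carrier_vec n. f *\<^sub>v x = col B j" by auto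
  qed
  then obtain r where r: "r \<in> carrier_mat n e" "f * r = B" by blast
  have "s * g * f = 0\<^sub>m e n" using assoc_mult_mat[OF s(1) g f] s gf by simp
  then have Bf: "B * f = f"
    unfolding B_def using f s g by (subst minus_mult_distrib_mat[of _ e e _ _ n]) (auto intro!: eq_matI)
  have "f * (r * f) = f" using assoc_mult_mat[OF f r(1) f] r(2) Bf by simp
  then have "f *\<^sub>v col (r * f) j = f *\<^sub>v col (1\<^sub>m n) j" if "j < n" for j
  proof -
    have "f *\<^sub>v col (r * f) j = col (f * (r * f)) j"
      by (rule col_mult2[OF f mult_carrier_mat[OF r(1) f] that, symmetric])
    also have "\<dots> = col f j" using \<open>f * (r * f) = f\<close> by simp
    finally show ?thesis using that mult_unit_vec[OF f that] by simp
  qed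
  then have "col (r * f) j = col (1\<^sub>m n) j" if "j < n" for j
    using inj_onD[OF inj, of "col (r * f) j" "col (1\<^sub>m n) j"] that r f by auto
  then have rf: "r * f = 1\<^sub>m n" using r f by (intro mat_col_eqI) auto
  have "f * r + s * g = 1\<^sub>m e" unfolding r(2) B_def using s g by (auto intro!: eq_matI)
  then show ?R using r s rf gf by blast
next
  assume ?R
  then obtain r s where r: "r \<in> carrier_mat n e" and s: "s \<in> carrier_mat e m" and e: "r * f = 1\<^sub>m n" "g * s = 1\<^sub>m m"
    "g * f = 0\<^sub>m m n" "f * r + s * g = 1\<^sub>m e" by blast
  have rf: "r *\<^sub>v (f *\<^sub>v x) = x" if "x \<in> carrier_vec n" for x
    using assoc_mult_mat_vec[OF r f that] e(1) that by simp
  have gs: "g *\<^sub>v (s *\<^sub>v x) = x" if "x \<in> carrier_vec m" for x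
    using assoc_mult_mat_vec[OF g s that] e(2) that by simp
  have gf: "g *\<^sub>v (f *\<^sub>v x) = 0\<^sub>v m" if "x \<in> carrier_vec n" for x
  proof -
    have "0\<^sub>m m n *\<^sub>v x = 0\<^sub>v m" by (rule eq_vecI) (use that in auto)
    then show ?thesis using assoc_mult_mat_vec[OF g f that] e(3) by simp
  qed
  have sum: "f *\<^sub>v (r *\<^sub>v y) + s *\<^sub>v (g *\<^sub>v y) = y" if "y \<in> carrier_vec e" for y
  proof -
    have "(f * r + s * g) *\<^sub>v y = (f * r) *\<^sub>v y + (s * g) *\<^sub>v y"
      using f r s g that by (intro add_mult_distrib_mat_vec) auto
    then show ?thesis using that e(4) assoc_mult_mat_vec[OF f r that] assoc_mult_mat_vec[OF s g that] by simp
  qed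
  have "y \<in> (\<lambda>x. f *\<^sub>v x) ` carrier_vec n" if "y \<in> carrier_vec e" "g *\<^sub>v y = 0\<^sub>v m" for y
  proof -
    have "s *\<^sub>v 0\<^sub>v m = 0\<^sub>v e" by (rule eq_vecI) (use s in auto)
    moreover have "f *\<^sub>v (r *\<^sub>v y) \<in> carrier_vec e" using f r that(1) by simp
    ultimately have "f *\<^sub>v (r *\<^sub>v y) = y" using sum[OF that(1)] that(2) by simp
    then show ?thesis using r that(1) by (intro image_eqI[of _ _ "r *\<^sub>v y"]) auto
  qed
  moreover have "inj_on (\<lambda>x. f *\<^sub>v x) (carrier_vec n)" by (rule inj_on_inverseI[where g = "\<lambda>y. r *\<^sub>v y"]) (rule rf)
  moreover have "y \<in> (\<lambda>y. g *\<^sub>v y) ` carrier_vec e" if "y \<in> carrier_vec m" for y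
    using gs[OF that] s that by (intro image_eqI[of _ _ "s *\<^sub>v y"]) auto
  ultimately show ?L using gf f g by auto
qed

lemma exact_mat_dual:
  fixes f g :: "'k::field mat"
  assumes f: "f \<in> carrier_mat e n" and g: "g \<in> carrier_mat m e" and r: "r \<in> carrier_mat n e" and s: "s \<in> carrier_mat e m"
    and e: "r * f = 1\<^sub>m n" "g * s = 1\<^sub>m m" "g * f = 0\<^sub>m m n" "f * r + s * g = 1\<^sub>m e"
  shows "transpose_mat s * transpose_mat g = 1\<^sub>m m \<and> transpose_mat f * transpose_mat r = 1\<^sub>m n \<and>
    transpose_mat f * transpose_mat g = 0\<^sub>m n m \<and>
    transpose_mat g * transpose_mat s + transpose_mat r * transpose_mat f = 1\<^sub>m e"
proof (intro conjI)
  show "transpose_mat s * transpose_mat g = 1\<^sub>m m" using transpose_mult[OF g s] e(2) by simp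
  show "transpose_mat f * transpose_mat r = 1\<^sub>m n" using transpose_mult[OF r f] e(1) by simp
  show "transpose_mat f * transpose_mat g = 0\<^sub>m n m" using transpose_mult[OF g f] e(3) by simp
  have "transpose_mat (f * r + s * g) = transpose_mat r * transpose_mat f + transpose_mat g * transpose_mat s"
    using f g r s transpose_mult[OF f r] transpose_mult[OF s g] by (subst transpose_add[of _ e e]) auto
  then show "transpose_mat g * transpose_mat s + transpose_mat r * transpose_mat f = 1\<^sub>m e"
    using e(4) f g r s by (simp add: comm_add_mat[of _ e e])
qed

context finite_quiver
begin

lemma finite_quiver_op: "finite_quiver (opq Q)"
  using finite_verts finite_arcs tail_verts head_verts by unfold_locales auto

lemma short_exact_dual:
  fixes N E M :: "('v, 'a, 'k::field) rep"
  assumes r: "is_rep Q N" "is_rep Q E" "is_rep Q M" and se: "short_exact Q N f E g M"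
  shows "short_exact (opq Q) (dual M) (\<lambda>v. transpose_mat (g v)) (dual E) (\<lambda>v. transpose_mat (f v)) (dual N)"
proof -
  have h: "rep_hom Q N E f" "rep_hom Q E M g" using se by (auto simp: short_exact_def)
  note h' = rep_hom_dual[OF r(1,2) h(1) tail_verts head_verts] rep_hom_dual[OF r(2,3) h(2) tail_verts head_verts]
  show ?thesis
    unfolding short_exact_def
  proof (intro conjI(1) conjI h' ballI)
    fix v assume "v \<in> verts (opq Q)"
    then have v: "v \<in> verts Q" by simp
    have f: "f v \<in> carrier_mat (rdim E v) (rdim N v)" and g: "g v \<in> carrier_mat (rdim M v) (rdim E v)"
      using h v by (auto simp: rep_hom_def)
    have f': "transpose_mat (f v) \<in> carrier_mat (rdim (dual N) v) (rdim (dual E) v)"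
      and g': "transpose_mat (g v) \<in> carrier_mat (rdim (dual E) v) (rdim (dual M) v)"
      using f g by auto
    obtain r s where rs: "r \<in> carrier_mat (rdim N v) (rdim E v)" "s \<in> carrier_mat (rdim E v) (rdim M v)"
      "r * f v = 1\<^sub>m (rdim N v)" "g v * s = 1\<^sub>m (rdim M v)" "g v * f v = 0\<^sub>m (rdim M v) (rdim N v)"
      "f v * r + s * g v = 1\<^sub>m (rdim E v)"
      using se v exact_mat_iff[OF f g] by (auto simp: short_exact_def)
    have "\<exists>r\<in>carrier_mat (rdim (dual M) v) (rdim (dual E) v). \<exists>s\<in>carrier_mat (rdim (dual E) v) (rdim (dual N) v).
        r * transpose_mat (g v) = 1\<^sub>m (rdim (dual M) v) \<and> transpose_mat (f v) * s = 1\<^sub>m (rdim (dual N) v) \<and>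
        transpose_mat (f v) * transpose_mat (g v) = 0\<^sub>m (rdim (dual N) v) (rdim (dual M) v) \<and>
        transpose_mat (g v) * r + s * transpose_mat (f v) = 1\<^sub>m (rdim (dual E) v)"
      using exact_mat_dual[OF f g rs] rs(1,2)
      by (intro bexI[of _ "transpose_mat s"] bexI[of _ "transpose_mat r"]) auto
    note * = this[folded exact_mat_iff[OF g' f']]
    show "inj_on (\<lambda>x. transpose_mat (g v) *\<^sub>v x) (carrier_vec (rdim (dual M) v))" using * by blast
    show "(\<lambda>x. transpose_mat (g v) *\<^sub>v x) ` carrier_vec (rdim (dual M) v) =
        {y \<in> carrier_vec (rdim (dual E) v). transpose_mat (f v) *\<^sub>v y = 0\<^sub>v (rdim (dual N) v)}" using * by blast
    show "(\<lambda>y. transpose_mat (f v) *\<^sub>v y) ` carrier_vec (rdim (dual E) v) = carrier_vec (rdim (dual N) v)"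
      using * by blast
  qed
qed

lemma rep_iso_dual:
  assumes r: "is_rep Q M" "is_rep Q N" and iso: "rep_iso Q M N"
  shows "rep_iso (opq Q) (dual M) (dual N)"
proof -
  obtain f g where fg: "rep_hom Q M N f" "rep_hom Q N M g"
    "\<And>v. v \<in> verts Q \<Longrightarrow> g v * f v = 1\<^sub>m (rdim M v)" "\<And>v. v \<in> verts Q \<Longrightarrow> f v * g v = 1\<^sub>m (rdim N v)"
    using iso unfolding rep_iso_def by blast
  have c: "f v \<in> carrier_mat (rdim N v) (rdim M v)" "g v \<in> carrier_mat (rdim M v) (rdim N v)"
    if "v \<in> verts Q" for v using fg(1,2) that by (auto simp: rep_hom_def)
  show ?thesis
    unfolding rep_iso_def
  proof (intro exI conjI ballI)
    show "rep_hom (opq Q) (dual M) (dual N) (\<lambda>v. transpose_mat (g v))"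
      by (rule rep_hom_dual[OF r(2,1) fg(2) tail_verts head_verts])
    show "rep_hom (opq Q) (dual N) (dual M) (\<lambda>v. transpose_mat (f v))"
      by (rule rep_hom_dual[OF r(1,2) fg(1) tail_verts head_verts])
    show "transpose_mat (f v) * transpose_mat (g v) = 1\<^sub>m (rdim (dual M) v)"
      "transpose_mat (g v) * transpose_mat (f v) = 1\<^sub>m (rdim (dual N) v)" if "v \<in> verts (opq Q)" for v
      using transpose_mult[OF c(2,1)] transpose_mult[OF c] fg(3,4) that by auto
  qed
qed

text \<open>Bridges records that agree on the quiver but may differ outside it, such as the dual of
  a direct sum and the direct sum of the duals.\<close>

lemma rep_iso_cong:
  assumes "is_rep Q M" "\<And>v. v \<in> verts Q \<Longrightarrow> rdim N v = rdim M v" "\<And>a. a \<in> arcs Q \<Longrightarrow> rmap N a = rmap M a"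
  shows "rep_iso Q M N"
  unfolding rep_iso_def rep_hom_def
  using assms tail_verts head_verts
  by (intro exI[of _ "\<lambda>v. 1\<^sub>m (rdim M v)"]) (auto simp: is_rep_def)

lemma rep_iso_sym: "rep_iso Q M N \<Longrightarrow> rep_iso Q N M"
  unfolding rep_iso_def by blast

lemma rep_iso_trans: "is_rep Q M \<Longrightarrow> is_rep Q N \<Longrightarrow> is_rep Q L \<Longrightarrow> rep_iso Q M N \<Longrightarrow> rep_iso Q N L \<Longrightarrow> rep_iso Q M L"
  using rep_iso_iff miso_comp by metis

lemma dual_dsum:
  assumes "is_rep Q X" "is_rep Q Y"
  shows "rep_iso (opq Q) (dual (dsum Q X Y)) (dsum (opq Q) (dual X) (dual Y))"
proof (rule finite_quiver.rep_iso_cong[OF finite_quiver_op])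
  show "is_rep (opq Q) (dual (dsum Q X Y))" using assms by (auto simp: is_rep_def dsum_def)
  show "rmap (dsum (opq Q) (dual X) (dual Y)) a = rmap (dual (dsum Q X Y)) a" if "a \<in> arcs (opq Q)" for a
    unfolding dsum_def dual_simps rep.simps
    by (subst transpose_four_block_mat[of _ "rdim X (head Q a)" "rdim X (tail Q a)" _ "rdim Y (tail Q a)" _ "rdim Y (head Q a)"])
      (use assms that in \<open>auto simp: is_rep_def\<close>)
qed (simp add: dsum_def)

end

context bound_quiver
begin

lemma amod_mat:
  fixes M :: "('v, 'a, 'k::field) rep"
  shows "amod M \<longleftrightarrow> is_rep Q M \<and> (\<forall>a\<in>arcs Q. \<forall>b\<in>arcs Q. head Q a = tail Q b \<and> R a b \<longrightarrow>
    rmap M b * rmap M a = 0\<^sub>m (rdim M (head Q b)) (rdim M (tail Q a)))"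
proof -
  have "(\<forall>x\<in>tot Q M. act Q M b (act Q M a x) = 0) \<longleftrightarrow>
      rmap M b * rmap M a = 0\<^sub>m (rdim M (head Q b)) (rdim M (tail Q a))"
    if r: "is_rep Q M" and ab: "a \<in> arcs Q" "b \<in> arcs Q" "head Q a = tail Q b" for a b
  proof -
    have c: "rmap M a \<in> carrier_mat (rdim M (tail Q b)) (rdim M (tail Q a))"
      "rmap M b \<in> carrier_mat (rdim M (head Q b)) (rdim M (tail Q b))" using r ab by (auto simp: is_rep_def)
    have ix: "(rmap M b * rmap M a) $$ (i, j) = (\<Sum>l<rdim M (tail Q b). rmap M b $$ (i, l) * rmap M a $$ (l, j))"
      if "i < rdim M (head Q b)" "j < rdim M (tail Q a)" for i j
      using mat_times_index[OF c(2,1) that] .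
    have act2: "act Q M b (act Q M a x) (head Q b, i) =
        (\<Sum>j<rdim M (tail Q a). (rmap M b * rmap M a) $$ (i, j) * x (tail Q a, j))" if "i < rdim M (head Q b)" for x i
    proof -
      have "act Q M b (act Q M a x) (head Q b, i) =
          (\<Sum>l<rdim M (tail Q b). \<Sum>j<rdim M (tail Q a). rmap M b $$ (i, l) * (rmap M a $$ (l, j) * x (tail Q a, j)))"
        using that ab by (simp add: act_def sum_distrib_left)
      also have "\<dots> = (\<Sum>j<rdim M (tail Q a). \<Sum>l<rdim M (tail Q b). rmap M b $$ (i, l) * (rmap M a $$ (l, j) * x (tail Q a, j)))"
        by (rule sum.swap)
      finally show ?thesis using that by (simp add: ix sum_distrib_right mult.assoc)
    qed
    show ?thesis
    proof
      assume z: "\<forall>x\<in>tot Q M. act Q M b (act Q M a x) = 0"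
      show "rmap M b * rmap M a = 0\<^sub>m (rdim M (head Q b)) (rdim M (tail Q a))"
      proof (rule eq_matI)
        fix i j assume "i < dim_row (0\<^sub>m (rdim M (head Q b)) (rdim M (tail Q a)) :: 'k mat)"
          "j < dim_col (0\<^sub>m (rdim M (head Q b)) (rdim M (tail Q a)) :: 'k mat)"
        then have ij: "i < rdim M (head Q b)" "j < rdim M (tail Q a)" by auto
        have "act Q M b (act Q M a (unitf (tail Q a) j)) (head Q b, i) = 0"
          using z tot_unitf[of "tail Q a" Q j M] tail_verts ab ij by (simp add: zero_fun_apply)
        then have "(\<Sum>l<rdim M (tail Q a). if l = j then (rmap M b * rmap M a) $$ (i, l) else 0) = 0"
          unfolding act2[OF ij(1)] by (simp add: unitf_def if_distrib cong: if_cong)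
        then show "(rmap M b * rmap M a) $$ (i, j) = 0\<^sub>m (rdim M (head Q b)) (rdim M (tail Q a)) $$ (i, j)"
          using ij by simp
      qed (use c in auto)
    next
      assume z: "rmap M b * rmap M a = 0\<^sub>m (rdim M (head Q b)) (rdim M (tail Q a))"
      show "\<forall>x\<in>tot Q M. act Q M b (act Q M a x) = 0"
      proof (intro ballI ext)
        fix x :: "('v, 'k) tvec" and p :: "'v \<times> nat"
        obtain v i where p: "p = (v, i)" by (cases p)
        show "act Q M b (act Q M a x) p = 0 p"
        proof (cases "v = head Q b \<and> i < rdim M (head Q b)")
          case True
          then show ?thesis using act2[of i x] p by (simp add: z zero_fun_apply)
        next
          case False
          then show ?thesis using p by (auto simp: act_def zero_fun_apply)
        qed
      qed
    qed
  qed
  then show ?thesis unfolding amod_def by blast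
qed

lemma bound_quiver_op: "bound_quiver (opq Q)"
  unfolding bound_quiver_def by (rule finite_quiver_op)

lemma amod_dual: "amod M \<Longrightarrow> bound_quiver.amod (opq Q) (\<lambda>a b. R b a) (dual M)"
proof -
  assume "amod M"
  then have r: "is_rep Q M" and z: "\<And>a b. a \<in> arcs Q \<Longrightarrow> b \<in> arcs Q \<Longrightarrow> head Q a = tail Q b \<Longrightarrow> R a b \<Longrightarrow>
      rmap M b * rmap M a = 0\<^sub>m (rdim M (head Q b)) (rdim M (tail Q a))" by (auto simp: amod_mat)
  have "transpose_mat (rmap M a) * transpose_mat (rmap M b) = 0\<^sub>m (rdim M (tail Q a)) (rdim M (head Q b))"
    if ab: "a \<in> arcs Q" "b \<in> arcs Q" "head Q a = tail Q b" "R a b" for a b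
  proof -
    have c: "rmap M a \<in> carrier_mat (rdim M (tail Q b)) (rdim M (tail Q a))"
      "rmap M b \<in> carrier_mat (rdim M (head Q b)) (rdim M (tail Q b))" using r ab by (auto simp: is_rep_def)
    show ?thesis using transpose_mult[OF c(2,1)] z[OF ab] by simp
  qed
  then show ?thesis unfolding bound_quiver.amod_mat[OF bound_quiver_op] using r by simp
qed

lemma amod_dual_iff: "bound_quiver.amod (opq Q) (\<lambda>a b. R b a) (dual M) \<longleftrightarrow> amod M"
  using amod_dual bound_quiver.amod_dual[OF bound_quiver_op, of "\<lambda>a b. R b a" "dual M"] by auto

lemma indec_dual:
  assumes M: "indec M"
  shows "bound_quiver.indec (opq Q) (\<lambda>a b. R b a) (dual M)"
  unfolding bound_quiver.indec_def[OF bound_quiver_op]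
proof (intro conjI allI impI)
  have aM: "amod M" and nz: "\<not> is_zero_rep Q M" using M by (auto simp: indec_def)
  show "bound_quiver.amod (opq Q) (\<lambda>a b. R b a) (dual M)" by (rule amod_dual[OF aM])
  show "\<not> is_zero_rep (opq Q) (dual M)" using nz by simp
  fix X Y assume "bound_quiver.amod (opq Q) (\<lambda>a b. R b a) X \<and> bound_quiver.amod (opq Q) (\<lambda>a b. R b a) Y \<and>
    rep_iso (opq Q) (dual M) (dsum (opq Q) X Y)"
  then have X: "bound_quiver.amod (opq Q) (\<lambda>a b. R b a) X" and Y: "bound_quiver.amod (opq Q) (\<lambda>a b. R b a) Y"
    and iso: "rep_iso (opq Q) (dual M) (dsum (opq Q) X Y)" by auto
  have aX: "amod (dual X)" and aY: "amod (dual Y)" using amod_dual_iff[of "dual X"] amod_dual_iff[of "dual Y"] X Y by auto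
  have rX: "is_rep (opq Q) X" and rY: "is_rep (opq Q) Y"
    using bound_quiver.amod_rep[OF bound_quiver_op X] bound_quiver.amod_rep[OF bound_quiver_op Y] .
  have rS: "is_rep (opq Q) (dsum (opq Q) X Y)" by (rule bound_quiver.is_rep_dsum[OF bound_quiver_op rX rY])
  have 1: "rep_iso Q M (dual (dsum (opq Q) X Y))"
    using finite_quiver.rep_iso_dual[OF finite_quiver_op _ rS iso] aM by simp
  have 2: "rep_iso Q (dual (dsum (opq Q) X Y)) (dsum Q (dual X) (dual Y))"
    using finite_quiver.dual_dsum[OF finite_quiver_op rX rY] by simp
  have "is_rep Q (dual (dsum (opq Q) X Y))" using rS is_rep_dual[of "opq Q" "dsum (opq Q) X Y"] by simp
  from rep_iso_trans[OF amod_rep[OF aM] this amod_rep[OF amod_dsum[OF aX aY]] 1 2]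
  have "is_zero_rep Q (dual X) \<or> is_zero_rep Q (dual Y)" using M aX aY unfolding indec_def by blast
  then show "is_zero_rep (opq Q) X \<or> is_zero_rep (opq Q) Y" by (simp add: is_zero_rep_def)
qed

lemma indec_dual_iff: "bound_quiver.indec (opq Q) (\<lambda>a b. R b a) (dual M) \<longleftrightarrow> indec M"
  using indec_dual bound_quiver.indec_dual[OF bound_quiver_op, of "\<lambda>a b. R b a" "dual M"] by auto

text \<open>Transposing a section yields a retraction, whereas \<open>splits\<close> asks for a
  section. The section sends an element to any preimage \<open>x\<close> corrected to
  \<open>x - F (P x)\<close>, and the correction removes the dependence on the choice.\<close>

lemma splits_of_retraction:
  fixes E :: "('v, 'a, 'k::field) rep"
  assumes r: "is_rep Q N" "is_rep Q E" "is_rep Q M" and se: "short_exact Q N f E g M"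
    and \<rho>: "rep_hom Q E N \<rho>" "\<And>v. v \<in> verts Q \<Longrightarrow> \<rho> v * f v = 1\<^sub>m (rdim N v)"
  shows "splits Q E g M"
proof -
  have h: "rep_hom Q N E f" "rep_hom Q E M g" using se by (auto simp: short_exact_def)
  define F where "F = app Q N E f"
  define G where "G = app Q E M g"
  define P where "P = app Q E N \<rho>"
  have F: "mhom Q N E F" and G: "mhom Q E M G" and P: "mhom Q E N P"
    unfolding F_def G_def P_def using rep_hom_mhom r h \<rho>(1) by blast+
  have PF: "P (F x) = x" if "x \<in> tot Q N" for x
  proof -
    have "P (F x) = app Q N N (\<lambda>v. \<rho> v * f v) x"
      unfolding P_def F_def using h(1) \<rho>(1) by (intro app_comp[symmetric]) (auto simp: rep_hom_def)
    then show ?thesis using app_one[OF that, of "\<lambda>v. \<rho> v * f v"] \<rho>(2) by simp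
  qed
  have ex: "exact N F E G M" unfolding F_def G_def using short_exact_iff[OF r h] se by blast
  then have im: "F ` tot Q N = {y \<in> tot Q E. G y = 0}" and su: "G ` tot Q E = tot Q M" by (auto simp: exact_def)
  define K where "K x = x - F (P x)" for x
  have K: "mhom Q E E K" unfolding K_def by (rule mhom_minus[OF mhom_id mhom_comp[OF P F]])
  have KF: "K (F x) = 0" if "x \<in> tot Q N" for x unfolding K_def using PF[OF that] by simp
  have GK: "G (K x) = G x" if "x \<in> tot Q E" for x
  proof -
    have Px: "P x \<in> tot Q N" using mhomD(1)[OF P that] .
    have "F (P x) \<in> {y \<in> tot Q E. G y = 0}" unfolding im[symmetric] using Px by (rule imageI)
    then show ?thesis unfolding K_def using mhom_diff[OF G that, of "F (P x)"] by simp
  qed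
  have Keq: "K x = K y" if "x \<in> tot Q E" "y \<in> tot Q E" "G x = G y" for x y
  proof -
    have "x - y \<in> F ` tot Q N" unfolding im using that mhom_diff[OF G that(1,2)] by (simp add: tot_diff)
    then obtain z where "x - y = F z" "z \<in> tot Q N" by (elim imageE)
    then have "K (x - y) = 0" using KF by simp
    then show ?thesis using mhom_diff[OF K that(1,2)] by simp
  qed
  define S where "S y = K (SOME x. x \<in> tot Q E \<and> G x = y)" for y
  have SG: "S (G x) = K x" if "x \<in> tot Q E" for x
  proof -
    have "(SOME x'. x' \<in> tot Q E \<and> G x' = G x) \<in> tot Q E \<and> G (SOME x'. x' \<in> tot Q E \<and> G x' = G x) = G x"
      by (rule someI[of _ x]) (use that in simp)
    then show ?thesis unfolding S_def using Keq that by blast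
  qed
  have S: "mhom Q M E S"
    unfolding mhom_def
  proof (intro conjI ballI allI)
    fix y assume "y \<in> tot Q M"
    then obtain x where x: "x \<in> tot Q E" "y = G x" unfolding su[symmetric] by (elim imageE)
    show "S y \<in> tot Q E" using SG x mhomD(1)[OF K x(1)] by simp
    show "S (c *\<^sub>F y) = c *\<^sub>F S y" for c
      using x SG[OF x(1)] SG[OF tot_smul[OF x(1), of c]] mhomD(3)[OF K x(1)] mhomD(3)[OF G x(1)] by simp
    show "S (pr v y) = pr v (S y)" if "v \<in> verts Q" for v
      using x SG[OF x(1)] SG[OF tot_pr[OF x(1), of v]] mhomD(4)[OF K that x(1)] mhomD(4)[OF G that x(1)] by simp
    show "S (act Q M a y) = act Q E a (S y)" if "a \<in> arcs Q" for a
      using x SG[OF x(1)] SG[OF tot_act[OF that, of E x]] mhomD(5)[OF K that x(1)] mhomD(5)[OF G that x(1)] by simp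
    fix y' assume "y' \<in> tot Q M"
    then obtain x' where x': "x' \<in> tot Q E" "y' = G x'" unfolding su[symmetric] by (elim imageE)
    show "S (y + y') = S y + S y'"
      using x x' SG[OF x(1)] SG[OF x'(1)] SG[OF tot_add[OF x(1) x'(1)]] mhomD(2)[OF K x(1) x'(1)] mhomD(2)[OF G x(1) x'(1)]
      by simp
  qed
  have GS: "\<forall>y\<in>tot Q M. app Q E M g (S y) = y"
  proof
    fix y assume "y \<in> tot Q M"
    then obtain x where x: "x \<in> tot Q E" "y = G x" unfolding su[symmetric] by (elim imageE)
    show "app Q E M g (S y) = y" unfolding x(2) SG[OF x(1)] G_def[symmetric] by (rule GK[OF x(1)])
  qed
  show ?thesis
    by (rule splits_iff[OF r(2,3) h(2), THEN iffD2]) (rule exI[of _ S], rule conjI[OF S GS])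
qed

text \<open>Transposition reverses the sequence, so quotient and submodule change places.\<close>

lemma bad_dual:
  assumes M: "is_rep Q M" "is_rep Q N" and b: "bad M N"
  shows "bound_quiver.bad (opq Q) (\<lambda>a b. R b a) (dual N) (dual M)"
proof -
  obtain E f g where E: "amod E" and se: "short_exact Q N f E g M" and ns: "\<not> splits Q E g M" and ni: "\<not> indec E"
    using b unfolding bad_def by blast
  have h: "rep_hom Q N E f" using se by (simp add: short_exact_def)
  have "\<not> splits (opq Q) (dual E) (\<lambda>v. transpose_mat (f v)) (dual N)"
  proof
    assume "splits (opq Q) (dual E) (\<lambda>v. transpose_mat (f v)) (dual N)"
    then obtain s where s: "rep_hom (opq Q) (dual N) (dual E) s"
      "\<And>v. v \<in> verts Q \<Longrightarrow> transpose_mat (f v) * s v = 1\<^sub>m (rdim N v)" by (auto simp: splits_def)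
    have "rep_hom (opq (opq Q)) (dual (dual E)) (dual (dual N)) (\<lambda>v. transpose_mat (s v))"
      by (rule rep_hom_dual[OF _ _ s(1)]) (use M E tail_verts head_verts in auto)
    then have 1: "rep_hom Q E N (\<lambda>v. transpose_mat (s v))" by simp
    have 2: "transpose_mat (s v) * f v = 1\<^sub>m (rdim N v)" if v: "v \<in> verts Q" for v
    proof -
      have c: "transpose_mat (f v) \<in> carrier_mat (rdim N v) (rdim E v)" "s v \<in> carrier_mat (rdim E v) (rdim N v)"
        using h s(1) v by (auto simp: rep_hom_def)
      show ?thesis using transpose_mult[OF c] s(2)[OF v] by simp
    qed
    show False using splits_of_retraction[OF M(2) amod_rep[OF E] M(1) se 1 2] ns by blast
  qed
  moreover have "\<not> bound_quiver.indec (opq Q) (\<lambda>a b. R b a) (dual E)" using ni indec_dual_iff by blast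
  ultimately show ?thesis
    unfolding bound_quiver.bad_def[OF bound_quiver_op]
    using amod_dual[OF E] short_exact_dual[OF M(2) amod_rep[OF E] M(1) se] by blast
qed

lemma bad_dual_iff:
  assumes "is_rep Q M" "is_rep Q N"
  shows "bound_quiver.bad (opq Q) (\<lambda>a b. R b a) (dual N) (dual M) \<longleftrightarrow> bad M N"
  using bad_dual[OF assms] bound_quiver.bad_dual[OF bound_quiver_op, of "dual N" "dual M" "\<lambda>a b. R b a"] assms by auto

end

context gentle_quiver
begin

lemma gentle_quiver_op: "gentle_quiver (opq Q) (\<lambda>a b. R b a)"
proof -
  obtain m where m: "\<And>p. set p \<subseteq> arcs Q \<Longrightarrow> successively (\<lambda>a b. head Q a = tail Q b \<and> \<not> R a b) p \<Longrightarrow> length p < m"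
    using bounded by blast
  have "length p < m" if "set p \<subseteq> arcs Q" "successively (\<lambda>a b. tail Q a = head Q b \<and> \<not> R b a) p" for p
  proof -
    have "successively (\<lambda>a b. head Q a = tail Q b \<and> \<not> R a b) (rev p)"
      unfolding successively_rev using that(2) by (rule successively_mono) auto
    then show ?thesis using m[of "rev p"] that(1) by simp
  qed
  then have bd: "\<exists>m. \<forall>p. set p \<subseteq> arcs (opq Q) \<and>
      successively (\<lambda>a b. head (opq Q) a = tail (opq Q) b \<and> \<not> R b a) p \<longrightarrow> length p < m" by auto
  show ?thesis
    unfolding gentle_quiver_def gentle_quiver_axioms_def
  proof (intro conjI bound_quiver_op allI impI, goal_cases)
    case (1 a b c) show ?case by (rule in_two) (use 1 in simp_all)
  next
    case (2 a b c) show ?case by (rule out_two) (use 2 in simp_all)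
  next
    case (3 a b c) show ?case by (rule nonrel_left[of a]) (use 3 in simp_all)
  next
    case (4 a b c) show ?case by (rule nonrel_right[of a]) (use 4 in simp_all)
  next
    case (5 a b c) show ?case by (rule rel_left[of a]) (use 5 in simp_all)
  next
    case (6 a b c) show ?case by (rule rel_right[of a]) (use 6 in simp_all)
  next
    case 7 then show ?case using bd .
  qed
qed

text \<open>Letters are inverted but not reversed in order: the walk stays the same, only the arrows
  of the quiver are turned around.\<close>

definition dwalk :: "('v, 'a) walk \<Rightarrow> ('v, 'a) walk" where
  "dwalk w = (fst w, map letter_inv (snd w))"

lemma is_str_dwalk: "is_str w \<Longrightarrow> gentle_quiver.is_str (opq Q) (\<lambda>a b. R b a) (dwalk w)"
proof -
  assume w: "is_str w"
  have s: "letter_source (opq Q) (letter_inv l) = letter_source Q l" "letter_target (opq Q) (letter_inv l) = letter_target Q l" for l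
    by (cases l; simp)+
  have o: "gentle_quiver.opp (\<lambda>a b. R b a) (letter_inv l) (letter_inv l') = opp l l'" for l l'
    by (cases l; cases l'; simp add: gentle_quiver.opp.simps[OF gentle_quiver_op])
  have "successively (\<lambda>l l'. letter_target (opq Q) l = letter_source (opq Q) l' \<and>
      gentle_quiver.opp (\<lambda>a b. R b a) (letter_inv l) l') (map letter_inv (snd w))"
    unfolding successively_map using w by (simp only: is_str_def s o)
  then show ?thesis
    unfolding gentle_quiver.is_str_def[OF gentle_quiver_op] using w
    by (auto simp: is_str_def dwalk_def hd_map s)
qed

lemma string_rep_dwalk: "dual (string_rep Q w) = string_rep (opq Q) (dwalk w)"
  by (simp add: string_rep_dual dwalk_def)

text \<open>In terms of \<open>Q\<close> these are the words with a single valley and left maximal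
  sides, with the corresponding rule for missing sides; the full ones belong to injective envelopes
  of simple modules.\<close>

definition inj_string :: "('v, 'a) walk \<Rightarrow> bool" where
  "inj_string w \<longleftrightarrow> gentle_quiver.proj_string (opq Q) (\<lambda>a b. R b a) (dwalk w)"

end

section \<open>Strings of the dual shape, and strings of both shapes\<close>

lemma map_letter_eq:
  "map Dir p = map Dir q \<longleftrightarrow> p = q" "map Inv p = map Inv q \<longleftrightarrow> p = q"
  by (rule inj_map_eq_map, simp add: inj_def)+

lemma map_Inv_Dir_eq_Dir: "map Inv p @ map Dir q = map Dir q' \<longleftrightarrow> p = [] \<and> q = q'"
proof (cases p)
  case Nil
  then show ?thesis by (simp add: map_letter_eq)
next
  case (Cons a p')
  then show ?thesis by (cases q') simp_all
qed

lemma map_Inv_Dir_eq_Inv: "map Inv p @ map Dir q = map Inv p' \<longleftrightarrow> p = p' \<and> q = []"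
proof (induction p arbitrary: p')
  case Nil
  then show ?case by (cases q; cases p') simp_all
next
  case (Cons a p)
  then show ?case by (cases p') simp_all
qed

context gentle_quiver
begin

interpretation op: gentle_quiver "opq Q" "\<lambda>a b. R b a"
  by (rule gentle_quiver_op)

lemma dwalk_dwalk [simp]: "dwalk (dwalk w) = w"
  by (simp add: dwalk_def o_def)

lemma is_str_dwalk_iff: "op.is_str (dwalk w) \<longleftrightarrow> is_str w"
  using is_str_dwalk[of w] op.is_str_dwalk[of "dwalk w"] by auto

lemma is_str_inj: "inj_string w \<Longrightarrow> is_str w"
  using op.is_str_proj[of "dwalk w"] is_str_dwalk_iff[of w] by (simp add: inj_string_def)

lemma finite_inj_strings: "finite {w. inj_string w}"
proof -
  have "{w. inj_string w} \<subseteq> dwalk ` {w. op.proj_string w}"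
  proof
    fix w assume "w \<in> {w. inj_string w}"
    then show "w \<in> dwalk ` {w. op.proj_string w}"
      by (intro image_eqI[of _ _ "dwalk w"]) (simp_all add: inj_string_def)
  qed
  then show ?thesis using op.finite_proj_strings finite_subset by blast
qed

lemma sbasis_dual:
  assumes M: "amod M" "sbasis M w b" and w: "is_str w"
  shows "\<exists>b. op.sbasis (dual M) (dwalk w) b"
proof -
  have "rep_iso Q M (string_rep Q w)"
    using sbasis_iff_miso[OF w, of M] M rep_iso_iff[OF amod_rep[OF M(1)] is_rep_string] by blast
  then have "rep_iso (opq Q) (dual M) (string_rep (opq Q) (dwalk w))"
    using rep_iso_dual[OF amod_rep[OF M(1)] is_rep_string] by (simp add: string_rep_dwalk)
  then show ?thesis
    using op.sbasis_iff_miso[OF is_str_dwalk[OF w], of "dual M"] M(1)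
      op.rep_iso_iff[OF _ op.is_rep_string, of "dual M" "dwalk w"] by simp
qed

lemma not_bad_inj:
  assumes x: "inj_string x" and w: "is_str w" and r: "amod M" "amod N"
    and M: "sbasis M w y" and N: "sbasis N x b"
  shows "\<not> bad M N"
proof
  assume "bad M N"
  then have bd: "op.bad (dual N) (dual M)" by (rule bad_dual[OF amod_rep[OF r(1)] amod_rep[OF r(2)]])
  obtain y' where y': "op.sbasis (dual M) (dwalk w) y'" using sbasis_dual[OF r(1) M w] by blast
  obtain b' where b': "op.sbasis (dual N) (dwalk x) b'" using sbasis_dual[OF r(2) N is_str_inj[OF x]] by blast
  show False
    using op.not_bad_proj[OF x[unfolded inj_string_def] is_str_dwalk[OF w] _ _ b' y'] bd r by simp
qed

lemma bad_or_inj: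
  assumes w: "is_str w" and np: "\<not> inj_string w"
  shows "\<exists>x. inj_string x \<and> bad (string_rep Q x) (string_rep Q w :: ('v, 'a, 'k::field) rep)"
proof -
  obtain x where x: "op.proj_string x"
    "op.bad (string_rep (opq Q) (dwalk w) :: ('v, 'a, 'k) rep) (string_rep (opq Q) x)"
    using op.bad_or_proj[OF is_str_dwalk[OF w] np[unfolded inj_string_def]] by blast
  have eq: "string_rep (opq Q) x = (dual (string_rep Q (dwalk x)) :: ('v, 'a, 'k) rep)"
    using string_rep_dwalk[of "dwalk x", symmetric] by simp
  have "bad (string_rep Q (dwalk x)) (string_rep Q w :: ('v, 'a, 'k) rep)"
    using x(2) unfolding string_rep_dwalk[of w, symmetric] eq bad_dual_iff[OF is_rep_string is_rep_string] .
  moreover have "inj_string (dwalk x)" using x(1) by (simp add: inj_string_def)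
  ultimately show ?thesis by blast
qed

lemma is_str_direct: "v \<in> verts Q \<Longrightarrow> is_str (v, map Dir q) \<longleftrightarrow> dpath v q"
  by (auto simp: is_str_def dpath_def successively_map hd_map)

lemma peak_direct: "peak v [] q = (v, map Dir q)"
  by (simp add: peak_def path_vert_def)

lemma proj_direct_iff:
  assumes "q \<noteq> []" "v \<in> verts Q"
  shows "proj_string (v, map Dir q) \<longleftrightarrow> dpath v q \<and> dmax q"
proof
  assume "proj_string (v, map Dir q)"
  then obtain v' p' q' where pk: "proj_peak v' p' q'" "(v, map Dir q) = peak v' p' q'" by (auto simp: proj_string_def)
  have "map Dir q = map Inv (rev p') @ map Dir q'" using pk(2) by (simp add: peak_def)
  then have "map Inv (rev p') @ map Dir q' = map Dir q" by (rule sym)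
  then have "p' = []" "q' = q" unfolding map_Inv_Dir_eq_Dir by simp_all
  then show "dpath v q \<and> dmax q" using pk by (simp add: proj_peak_def peak_direct)
next
  assume "dpath v q \<and> dmax q"
  then have "proj_peak v [] q" using assms by (simp add: proj_peak_def dpath_def dmax_def apart_def)
  then show "proj_string (v, map Dir q)" unfolding proj_string_def peak_direct[symmetric] by blast
qed

text \<open>In the opposite quiver all letters of this word are inverse, so it is the left side of a
  peak whose top is the end of the path. The side is \<open>rev q\<close>, and its right maximality
  there is left maximality of \<open>q\<close> in \<open>Q\<close>.\<close>

lemma inj_direct_iff:
  assumes "q \<noteq> []" "dpath v q" "v \<in> verts Q"
  shows "inj_string (v, map Dir q) \<longleftrightarrow> (\<forall>c\<in>arcs Q. head Q c = v \<longrightarrow> R c (hd q))"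
proof -
  have w: "op.is_str (dwalk (v, map Dir q))" using assms is_str_direct is_str_dwalk by blast
  have sd: "snd (dwalk (v, map Dir q)) = map Inv (rev (rev q)) @ map Dir []" by (simp add: dwalk_def)
  from op.is_str_peakD[OF w sd] obtain u where u: "u \<in> verts Q" "op.dpath u (rev q)" "op.dpath u []"
    "op.apart (rev q) []" "dwalk (v, map Dir q) = op.peak u (rev q) []" by auto
  have hv: "tail Q (hd q) = v" using assms by (simp add: dpath_def)
  have dm: "op.dmax (rev q) \<longleftrightarrow> (\<forall>c\<in>arcs Q. head Q c = v \<longrightarrow> R c (hd q))"
    using assms(1) hv by (simp add: op.dmax_def last_rev)
  show ?thesis
  proof
    assume "inj_string (v, map Dir q)"
    then obtain v' p' q' where pk: "op.proj_peak v' p' q'" "dwalk (v, map Dir q) = op.peak v' p' q'"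
      by (auto simp: inj_string_def op.proj_string_def)
    have "map Inv (rev p') @ map Dir q' = map Inv q" using arg_cong[OF pk(2), of snd] by (simp add: dwalk_def op.peak_def o_def)
    then have "rev p' = q" unfolding map_Inv_Dir_eq_Inv by simp
    then have "p' = rev q" by auto
    then show "\<forall>c\<in>arcs Q. head Q c = v \<longrightarrow> R c (hd q)" using pk(1) dm by (simp add: op.proj_peak_def)
  next
    assume "\<forall>c\<in>arcs Q. head Q c = v \<longrightarrow> R c (hd q)"
    then have "op.proj_peak u (rev q) []"
      using u assms(1) dm by (simp add: op.proj_peak_def op.dmax_def)
    then show "inj_string (v, map Dir q)" unfolding inj_string_def op.proj_string_def using u(5) by blast
  qed
qed

lemma proj_trivial_iff:
  assumes "v \<in> verts Q"
  shows "proj_string (v, []) \<longleftrightarrow> (\<forall>a\<in>arcs Q. \<forall>b\<in>arcs Q. tail Q a = v \<and> tail Q b = v \<longrightarrow> a = b)"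
proof
  assume "proj_string (v, [])"
  then obtain v' p' q' where "proj_peak v' p' q'" "(v, []) = peak v' p' q'" by (auto simp: proj_string_def)
  then show "\<forall>a\<in>arcs Q. \<forall>b\<in>arcs Q. tail Q a = v \<and> tail Q b = v \<longrightarrow> a = b"
    by (auto simp: proj_peak_def peak_def path_vert_def)
next
  assume "\<forall>a\<in>arcs Q. \<forall>b\<in>arcs Q. tail Q a = v \<and> tail Q b = v \<longrightarrow> a = b"
  then have "proj_peak v [] []" using assms by (simp add: proj_peak_def dpath_def dmax_def apart_def)
  then show "proj_string (v, [])" unfolding proj_string_def
    by (intro exI[of _ v] exI[of _ "[]"]) (simp add: peak_direct)
qed

lemma inj_trivial_iff:
  assumes "v \<in> verts Q"
  shows "inj_string (v, []) \<longleftrightarrow> (\<forall>a\<in>arcs Q. \<forall>b\<in>arcs Q. head Q a = v \<and> head Q b = v \<longrightarrow> a = b)"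
  using gentle_quiver.proj_trivial_iff[OF gentle_quiver_op, of v] assms by (simp add: inj_string_def dwalk_def)

text \<open>A string of both kinds has no peak and no valley.\<close>

lemma proj_inj_cases:
  assumes p: "proj_string w" and i: "inj_string w"
  obtains v q where "v \<in> verts Q" "dpath v q" "w = (v, map Dir q) \<or> w = rev_walk (v, map Dir q)"
    "q \<noteq> [] \<Longrightarrow> dmax q \<and> (\<forall>c\<in>arcs Q. head Q c = v \<longrightarrow> R c (hd q))"
proof -
  obtain v p q where pk: "proj_peak v p q" "w = peak v p q" using p by (auto simp: proj_string_def)
  have d: "v \<in> verts Q" "dpath v p" "dpath v q" "dmax p" "dmax q" using pk(1) by (auto simp: proj_peak_def)
  obtain v' p' q' where pk': "op.proj_peak v' p' q'" "dwalk w = op.peak v' p' q'"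
    using i by (auto simp: inj_string_def op.proj_string_def)
  have eq: "map Dir (rev p) @ map Inv q = map Inv (rev p') @ map Dir q'"
    using pk(2) pk'(2) by (simp add: dwalk_def peak_def op.peak_def o_def)
  show thesis
  proof (cases "p = []")
    case True
    have w: "w = (v, map Dir q)" using pk(2) True by (simp add: peak_direct)
    show thesis
    proof (rule that[OF d(1,3)])
      show "w = (v, map Dir q) \<or> w = rev_walk (v, map Dir q)" using w by simp
      show "dmax q \<and> (\<forall>c\<in>arcs Q. head Q c = v \<longrightarrow> R c (hd q))" if "q \<noteq> []"
        using inj_direct_iff[OF that d(3,1)] i d(5) unfolding w by simp
    qed
  next
    case False
    have "p' = []"
    proof (rule ccontr)
      assume "p' \<noteq> []"
      then have "hd (map Inv (rev p') @ map Dir q') = Inv (last p')" by (simp add: hd_map hd_rev hd_append)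
      moreover have "hd (map Dir (rev p) @ map Inv q) = Dir (last p)" using False by (simp add: hd_map hd_rev hd_append)
      ultimately show False using eq by simp
    qed
    have q: "q = []"
    proof (rule ccontr)
      assume "q \<noteq> []"
      then have "last (map Dir (rev p) @ map Inv q) = Inv (last q)" by (simp add: last_map)
      moreover have "q' \<noteq> []" using eq unfolding \<open>p' = []\<close> using False by (cases q') simp_all
      then have "last (map Inv (rev p') @ map Dir q') = Dir (last q')" by (simp add: last_map)
      ultimately show False using eq by simp
    qed
    have q': "q' = rev p" using eq unfolding \<open>p' = []\<close> q by (simp add: map_letter_eq )
    have rw: "rev_walk (v, map Dir p) = w"
      using rev_walk_peak[of v "[]" p] d pk(2) q by (simp add: peak_direct)
    have "op.dmax (rev p)" using pk'(1) q' by (simp add: op.proj_peak_def)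
    then have "\<forall>c\<in>arcs Q. head Q c = v \<longrightarrow> R c (hd p)"
      using False d(2) by (simp add: op.dmax_def last_rev dpath_def)
    then have "dmax p \<and> (\<forall>c\<in>arcs Q. head Q c = v \<longrightarrow> R c (hd p))" using d(4) by blast
    then show thesis by (intro that[OF d(1,2) disjI2[OF rw[symmetric]]])
  qed
qed

end

section \<open>Almost rigid modules and required summands\<close>

locale gentle_bound = gentle_quiver Q R for Q :: "('v, 'a) pre_digraph" and R +
  fixes I :: "(('v, 'a) qpath \<Rightarrow> 'k::field) set"
  assumes A_module_iff: "A_module Q I M \<longleftrightarrow> amod M"
    and is_string_iff: "is_string Q I w \<longleftrightarrow> is_str w"
begin

lemma indecomposable_iff: "indecomposable Q I M \<longleftrightarrow> indec M"
  by (simp add: indecomposable_def indec_def A_module_iff)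

lemma direct_summand_iff: "direct_summand Q I M T \<longleftrightarrow> dsummand M T"
  by (simp add: direct_summand_def dsummand_def A_module_iff)

lemma string_module_iff: "string_module Q I M \<longleftrightarrow> amod M \<and> (\<exists>w b. is_str w \<and> sbasis M w b)"
proof -
  have "rep_iso Q M (string_rep Q w) \<longleftrightarrow> (\<exists>b. sbasis M w b)" if "amod M" "is_str w" for w
    using sbasis_iff_miso[OF that(2), of M] rep_iso_iff[OF amod_rep[OF that(1)] is_rep_string, of w] by simp
  then show ?thesis unfolding string_module_def A_module_iff is_string_iff by blast
qed

lemma sbasis_indec': "amod M \<Longrightarrow> is_str w \<Longrightarrow> sbasis M w b \<Longrightarrow> indec M"
  using sbasis_indec amod_rep by blast

lemma dsummand_sys:
  assumes "amod T" "sys T Ms ii pp" "k < length Ms" "amod M" "miso M (Ms ! k) F"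
  shows "dsummand M T"
proof -
  obtain G where G: "miso (Ms ! k) M G" "\<forall>x\<in>tot Q M. G (F x) = x" using miso_sym[OF assms(5)] by blast
  note h = miso_mhom[OF assms(5)] miso_mhom[OF G(1)]
  have "G (pp k (ii k (F x))) = x" if "x \<in> tot Q M" for x
    using sysD(3)[OF assms(2,3,3) mhomD(1)[OF h(1) that]] G(2) that by simp
  then show ?thesis
    unfolding dsummand_iff using assms(1,4)
    by (intro conjI exI[of _ "\<lambda>x. ii k (F x)"] exI[of _ "\<lambda>t. G (pp k t)"] ballI
      mhom_comp[OF h(1) sysD(1)[OF assms(2,3)]] mhom_comp[OF sysD(2)[OF assms(2,3)] h(2)]) auto
qed

lemma dsummand_miso:
  assumes "dsummand M T" "amod M'" "miso M' M F"
  shows "dsummand M' T"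
proof -
  obtain \<iota> \<pi> where ip: "amod T" "mhom Q M T \<iota>" "mhom Q T M \<pi>" "\<And>x. x \<in> tot Q M \<Longrightarrow> \<pi> (\<iota> x) = x"
    using assms(1) by (auto simp: dsummand_iff)
  obtain G where G: "miso M M' G" "\<forall>x\<in>tot Q M'. G (F x) = x" using miso_sym[OF assms(3)] by blast
  note h = miso_mhom[OF assms(3)] miso_mhom[OF G(1)]
  have "G (\<pi> (\<iota> (F x))) = x" if "x \<in> tot Q M'" for x
    using ip(4)[OF mhomD(1)[OF h(1) that]] G(2) that by simp
  then show ?thesis
    unfolding dsummand_iff using assms(2) ip(1)
    by (intro conjI exI[of _ "\<lambda>x. \<iota> (F x)"] exI[of _ "\<lambda>t. G (\<pi> t)"] ballI
      mhom_comp[OF h(1) ip(2)] mhom_comp[OF ip(3) h(2)]) auto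
qed

lemma dsummand_biprod:
  assumes bp: "biprod S T X i1 p1 i2 p2" and S: "amod S"
  shows "dsummand M T \<Longrightarrow> dsummand M S" and "amod X \<Longrightarrow> dsummand X S"
proof -
  have h: "mhom Q T S i1" "mhom Q S T p1" "mhom Q X S i2" "mhom Q S X p2"
    "\<And>x. x \<in> tot Q T \<Longrightarrow> p1 (i1 x) = x" "\<And>x. x \<in> tot Q X \<Longrightarrow> p2 (i2 x) = x" using bp by (auto simp: biprod_def)
  show "dsummand X S" if "amod X"
    unfolding dsummand_iff using that S h(3,4,6) by blast
  assume "dsummand M T"
  then obtain \<iota> \<pi> where ip: "amod M" "mhom Q M T \<iota>" "mhom Q T M \<pi>" "\<And>x. x \<in> tot Q M \<Longrightarrow> \<pi> (\<iota> x) = x"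
    by (auto simp: dsummand_iff)
  have "\<pi> (p1 (i1 (\<iota> x))) = x" if "x \<in> tot Q M" for x
    using ip(4)[OF that] h(5)[OF mhomD(1)[OF ip(2) that]] by simp
  then show "dsummand M S"
    unfolding dsummand_iff using S ip(1)
    by (intro conjI exI[of _ "\<lambda>x. i1 (\<iota> x)"] exI[of _ "\<lambda>t. \<pi> (p1 t)"] ballI
      mhom_comp[OF ip(2) h(1)] mhom_comp[OF h(2) ip(3)]) auto
qed

definition decomposition where
  "decomposition T Ms \<longleftrightarrow> amod T \<and> (\<forall>M\<in>set Ms. indec M) \<and> (\<exists>ii pp. sys T Ms ii pp)"

lemma decomposition_summand:
  assumes "decomposition T Ms" "indec M" "dsummand M T"
  shows "\<exists>k<length Ms. \<exists>F. miso M (Ms ! k) F"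
proof -
  obtain ii pp where sy: "sys T Ms ii pp" and Ms: "\<forall>M\<in>set Ms. indec M" using assms(1) by (auto simp: decomposition_def)
  obtain \<iota> \<pi> where ip: "mhom Q M T \<iota>" "mhom Q T M \<pi>" "\<And>x. x \<in> tot Q M \<Longrightarrow> \<pi> (\<iota> x) = x"
    using assms(3) by (auto simp: dsummand_iff)
  show ?thesis using krull_schmidt_summand[OF assms(2) ip sy Ms] by blast
qed

lemma decomposition_dsummand:
  assumes "decomposition T Ms" "k < length Ms" "amod M" "miso M (Ms ! k) F"
  shows "dsummand M T"
proof -
  obtain ii pp where "amod T" "sys T Ms ii pp" using assms(1) by (auto simp: decomposition_def)
  then show ?thesis using dsummand_sys assms(2-4) by blast
qed

definition non_iso where
  "non_iso Ms \<longleftrightarrow> (\<forall>i j F. i < j \<and> j < length Ms \<longrightarrow> \<not> miso (Ms ! i) (Ms ! j) F)"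

lemma rep_iso_decomposition:
  assumes "\<forall>M\<in>set Ms. indec M" "amod T"
  shows "rep_iso Q T (dsum_list Q Ms) \<longleftrightarrow> decomposition T Ms"
proof -
  have "\<forall>M\<in>set Ms. is_rep Q M" using assms(1) by (auto simp: indec_def)
  then show ?thesis
    using rep_iso_dsum_list_iff[OF amod_rep[OF assms(2)], of Ms] assms by (simp add: decomposition_def)
qed

lemma basic_module_iff: "basic_module Q I T \<longleftrightarrow> (\<exists>Ms. decomposition T Ms \<and> non_iso Ms)"
proof -
  have "(\<forall>i j. i < j \<and> j < length Ms \<longrightarrow> \<not> rep_iso Q (Ms ! i) (Ms ! j)) \<longleftrightarrow> non_iso Ms"
    if "\<forall>M\<in>set Ms. indec M" for Ms :: "('v, 'a, 'k) rep list"
  proof -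
    have "is_rep Q (Ms ! i)" if "i < length Ms" for i
      using that \<open>\<forall>M\<in>set Ms. indec M\<close> nth_mem[OF that] by (auto simp: indec_def)
    then have "rep_iso Q (Ms ! i) (Ms ! j) \<longleftrightarrow> (\<exists>F. miso (Ms ! i) (Ms ! j) F)" if "i < j" "j < length Ms" for i j
      using that rep_iso_iff[of "Ms ! i" "Ms ! j"] by simp
    then show ?thesis unfolding non_iso_def by blast
  qed
  note * = this
  show ?thesis
  proof
    assume "basic_module Q I T"
    then obtain Ms where Ms: "amod T" "\<forall>M\<in>set Ms. indec M"
      "\<forall>i j. i < j \<and> j < length Ms \<longrightarrow> \<not> rep_iso Q (Ms ! i) (Ms ! j)" "rep_iso Q T (dsum_list Q Ms)"
      unfolding basic_module_def A_module_iff indecomposable_iff by (elim conjE exE)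
    have "decomposition T Ms" using Ms(4) unfolding rep_iso_decomposition[OF Ms(2,1)] .
    moreover have "non_iso Ms" using Ms(3) unfolding *[OF Ms(2)] .
    ultimately show "\<exists>Ms. decomposition T Ms \<and> non_iso Ms" by (intro exI conjI)
  next
    assume "\<exists>Ms. decomposition T Ms \<and> non_iso Ms"
    then obtain Ms where d: "decomposition T Ms" "non_iso Ms" by (elim conjE exE)
    then have Ms: "amod T" "\<forall>M\<in>set Ms. indec M" by (simp_all add: decomposition_def)
    show "basic_module Q I T"
      unfolding basic_module_def A_module_iff indecomposable_iff
    proof (intro conjI exI[of _ Ms] Ms)
      show "\<forall>i j. i < j \<and> j < length Ms \<longrightarrow> \<not> rep_iso Q (Ms ! i) (Ms ! j)" unfolding *[OF Ms(2)] by (rule d(2))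
      show "rep_iso Q T (dsum_list Q Ms)" unfolding rep_iso_decomposition[OF Ms(2,1)] by (rule d(1))
    qed
  qed
qed

definition is_string_list where
  "is_string_list Ms \<longleftrightarrow> (\<forall>M\<in>set Ms. amod M \<and> (\<exists>w b. is_str w \<and> sbasis M w b))"

lemma is_string_list_indec: "is_string_list Ms \<Longrightarrow> \<forall>M\<in>set Ms. indec M"
  unfolding is_string_list_def using sbasis_indec' by blast

text \<open>The two decompositions come from separate clauses of the definition, one without
  repetitions and one into string modules, and are carried along side by side.\<close>

lemma almost_rigid_iff:
  "almost_rigid Q I T \<longleftrightarrow> (\<exists>Ms. decomposition T Ms \<and> non_iso Ms) \<and> (\<exists>Ms. is_string_list Ms \<and> decomposition T Ms) \<and>
    (\<forall>M N. indec M \<and> dsummand M T \<and> indec N \<and> dsummand N T \<longrightarrow> \<not> bad M N)"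
proof -
  have "(\<exists>Ms. (\<forall>M\<in>set Ms. string_module Q I M) \<and> rep_iso Q T (dsum_list Q Ms)) \<longleftrightarrow>
      (\<exists>Ms. is_string_list Ms \<and> decomposition T Ms)" if "amod T"
    unfolding string_module_iff is_string_list_def[symmetric]
    using rep_iso_decomposition[OF is_string_list_indec that] by blast
  moreover have "basic_module Q I T \<Longrightarrow> amod T" unfolding basic_module_def A_module_iff by (elim conjE)
  ultimately show ?thesis
    unfolding almost_rigid_def indecomposable_iff direct_summand_iff A_module_iff basic_module_iff[symmetric] bad_def
    by blast
qed

text \<open>By Krull-Schmidt every indecomposable summand of an almost rigid module inherits a
  string basis, which is what \<open>not_bad_proj\<close> and \<open>not_bad_inj\<close> ask of the
  partner in a pair.\<close>

lemma string_summand: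
  assumes "is_string_list Ms" "decomposition T Ms" "indec M" "dsummand M T"
  shows "\<exists>w b. is_str w \<and> sbasis M w b"
proof -
  obtain k F where k: "k < length Ms" "miso M (Ms ! k) F" using decomposition_summand[OF assms(2-4)] by blast
  then obtain w b where w: "is_str w" "sbasis (Ms ! k) w b"
    using assms(1) nth_mem[OF k(1)] unfolding is_string_list_def by blast
  obtain G where "miso (Ms ! k) M G" using miso_sym[OF k(2)] by blast
  then show ?thesis using sbasis_transport[OF w(2) _ w(1)] w(1) by blast
qed

lemma decomposition_biprod:
  assumes "decomposition T Ms" "indec X" "biprod S T X i1 p1 i2 p2" "is_rep Q S"
  shows "decomposition S (Ms @ [X])"
proof -
  obtain ii pp where sy: "sys T Ms ii pp" using assms(1) by (auto simp: decomposition_def)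
  have "amod S" using amod_biprod[OF assms(3,4)] assms(1,2) by (simp add: decomposition_def indec_def)
  then show ?thesis using sys_snoc[OF assms(3) sy] assms(1,2) unfolding decomposition_def by auto
qed

lemma required_if:
  assumes w: "proj_string w" "inj_string w" and X: "amod X" "sbasis X w b"
  shows "required_summand Q I X"
  unfolding required_summand_def direct_summand_iff
proof (intro allI impI, rule ccontr)
  fix T assume T: "maximal_almost_rigid Q I T" and ns: "\<not> dsummand X T"
  have ws: "is_str w" by (rule is_str_proj[OF w(1)])
  have iX: "indec X" by (rule sbasis_indec'[OF X(1) ws X(2)])
  have ar: "almost_rigid Q I T" using T by (simp add: maximal_almost_rigid_def)
  obtain Ms where Ms: "decomposition T Ms" "non_iso Ms" using ar unfolding almost_rigid_iff by (elim conjE exE)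
  obtain Ms' where Ms': "is_string_list Ms'" "decomposition T Ms'" using ar unfolding almost_rigid_iff by (elim conjE exE)
  have nb: "\<And>M N. indec M \<Longrightarrow> dsummand M T \<Longrightarrow> indec N \<Longrightarrow> dsummand N T \<Longrightarrow> \<not> bad M N"
    using ar unfolding almost_rigid_iff by simp
  have aT: "amod T" using Ms(1) by (simp add: decomposition_def)
  define S where "S = dsum Q T X"
  obtain i1 p1 i2 p2 where bp: "biprod S T X i1 p1 i2 p2"
    unfolding S_def using biprod_dsum[OF amod_rep[OF aT] amod_rep[OF X(1)]] by blast
  have aS: "amod S" unfolding S_def by (rule amod_dsum[OF aT X(1)])
  note d = decomposition_biprod[OF Ms(1) iX bp amod_rep[OF aS]] decomposition_biprod[OF Ms'(2) iX bp amod_rep[OF aS]]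
  have "\<exists>w b. is_str w \<and> sbasis X w b" using X ws by blast
  then have sl: "is_string_list (Ms' @ [X])" using Ms'(1) X(1) by (simp add: is_string_list_def)
  have "\<not> miso (Ms ! i) X F" if i: "i < length Ms" for i F
  proof
    assume "miso (Ms ! i) X F"
    then obtain G where "miso X (Ms ! i) G" using miso_sym by blast
    then show False using decomposition_dsummand[OF Ms(1) i X(1)] ns by blast
  qed
  then have ni: "non_iso (Ms @ [X])"
    using Ms(2) unfolding non_iso_def by (auto simp: nth_append less_Suc_eq)
  \<comment> \<open>Krull-Schmidt for the enlarged module: an indecomposable summand either comes
    from \<open>T\<close> or is isomorphic to \<open>X\<close>.\<close>
  have split: "dsummand M T \<or> (\<exists>b. sbasis M w b)" if M: "indec M" "dsummand M S" for M
  proof -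
    have aM: "amod M" using M(1) by (simp add: indec_def)
    obtain k F where k: "k < length (Ms @ [X])" "miso M ((Ms @ [X]) ! k) F"
      using decomposition_summand[OF d(1) M] by blast
    show ?thesis
    proof (cases "k < length Ms")
      case True
      then show ?thesis using decomposition_dsummand[OF Ms(1) True aM, of F] k by (simp add: nth_append)
    next
      case False
      then have "miso M X F" using k by (simp add: nth_append less_Suc_eq)
      then obtain G where "miso X M G" using miso_sym by blast
      then show ?thesis using sbasis_transport[OF X(2) _ ws] by blast
    qed
  qed
  have "\<not> bad M N" if MN: "indec M" "dsummand M S" "indec N" "dsummand N S" for M N
  proof -
    have a: "amod M" "amod N" using MN by (simp_all add: indec_def)
    obtain u y where u: "is_str u" "sbasis M u y" using string_summand[OF sl d(2) MN(1,2)] by blast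
    obtain u' y' where u': "is_str u'" "sbasis N u' y'" using string_summand[OF sl d(2) MN(3,4)] by blast
    \<comment> \<open>A pair inside \<open>T\<close> is not bad by assumption. If \<open>X\<close>
      occurs as the quotient, its shape in \<open>Q\<close> excludes badness; if it occurs as the
      submodule, its dual shape does.\<close>
    consider "dsummand M T" "dsummand N T" | b where "sbasis M w b" | b where "sbasis N w b"
      using split[OF MN(1,2)] split[OF MN(3,4)] by blast
    then show ?thesis
    proof cases
      case 1
      then show ?thesis using nb[OF MN(1) _ MN(3)] by simp
    next
      case (2 b)
      then show ?thesis using not_bad_proj[OF w(1) u'(1) amod_rep[OF a(1)] amod_rep[OF a(2)] _ u'(2)] by simp
    next
      case (3 b)
      then show ?thesis using not_bad_inj[OF w(2) u(1) a u(2)] by simp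
    qed
  qed
  then have "almost_rigid Q I S" unfolding almost_rigid_iff using d ni sl by blast
  moreover have "string_module Q I X" unfolding string_module_iff using X ws by blast
  moreover have "\<not> is_zero_rep Q X" using iX by (simp add: indec_def)
  ultimately show False using T unfolding maximal_almost_rigid_def S_def by blast
qed

text \<open>A string and its inverse have isomorphic modules, while the module to be built must be
  basic; so one string per isomorphism class is selected.\<close>

lemma representatives:
  assumes "finite W"
  shows "\<exists>ws. set ws \<subseteq> W \<and> non_iso (map (string_rep Q) ws :: ('v, 'a, 'k) rep list) \<and>
    (\<forall>x\<in>W. \<exists>y\<in>set ws. \<exists>F. miso (string_rep Q x :: ('v, 'a, 'k) rep) (string_rep Q y) F)"
  using assms
proof (induction W)
  case empty
  then show ?case by (intro exI[of _ "[]"]) (simp add: non_iso_def)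
next
  case (insert x W)
  then obtain ws where ws: "set ws \<subseteq> W" "non_iso (map (string_rep Q) ws :: ('v, 'a, 'k) rep list)"
    "\<And>x. x \<in> W \<Longrightarrow> \<exists>y\<in>set ws. \<exists>F. miso (string_rep Q x :: ('v, 'a, 'k) rep) (string_rep Q y) F" by blast
  show ?case
  proof (cases "\<exists>y\<in>set ws. \<exists>F. miso (string_rep Q x :: ('v, 'a, 'k) rep) (string_rep Q y) F")
    case True
    then show ?thesis using ws by (intro exI[of _ ws]) auto
  next
    case False
    have "\<not> miso (string_rep Q (ws ! i) :: ('v, 'a, 'k) rep) (string_rep Q x) F" if i: "i < length ws" for i F
    proof
      assume "miso (string_rep Q (ws ! i) :: ('v, 'a, 'k) rep) (string_rep Q x) F"
      then obtain G where "miso (string_rep Q x :: ('v, 'a, 'k) rep) (string_rep Q (ws ! i)) G" using miso_sym by blast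
      then show False using False nth_mem[OF i] by blast
    qed
    then have "non_iso (map (string_rep Q) (ws @ [x]) :: ('v, 'a, 'k) rep list)"
      using ws(2) unfolding non_iso_def by (auto simp: nth_append less_Suc_eq)
    moreover have "\<exists>F. miso (string_rep Q x :: ('v, 'a, 'k) rep) (string_rep Q x) F" using miso_id by blast
    ultimately show ?thesis using ws(1,3) by (intro exI[of _ "ws @ [x]"]) auto
  qed
qed

lemma amod_dsum_list: "\<forall>M\<in>set Ms. amod M \<Longrightarrow> amod (dsum_list Q Ms)"
proof (induction Ms)
  case Nil
  have "amod (zero_rep :: ('v, 'a, 'b) rep)"
    by (auto simp: amod_mat is_rep_def zero_rep_def intro!: eq_matI)
  then show ?case by (simp add: dsum_list_def)
next
  case (Cons M Ms)
  then show ?case using amod_dsum[of M "dsum_list Q Ms"] by (simp add: dsum_list_def)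
qed

text \<open>The common frame for both classes of strings. A further summand with string outside
  \<open>W\<close> would create a bad pair with a member of \<open>W\<close>, and one with string in
  \<open>W\<close> would occur twice in a basic module.\<close>

lemma mar_exists:
  assumes fin: "finite W" and W: "\<And>x. x \<in> W \<Longrightarrow> is_str x"
    and nb: "\<And>x y M N b c. x \<in> W \<Longrightarrow> y \<in> W \<Longrightarrow> amod M \<Longrightarrow> amod N \<Longrightarrow> sbasis M x b \<Longrightarrow> sbasis N y c \<Longrightarrow>
      \<not> bad (M :: ('v, 'a, 'k) rep) N"
    and bd: "\<And>w. is_str w \<Longrightarrow> w \<notin> W \<Longrightarrow> \<exists>x\<in>W. bad (string_rep Q w :: ('v, 'a, 'k) rep) (string_rep Q x) \<or>
      bad (string_rep Q x :: ('v, 'a, 'k) rep) (string_rep Q w)"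
  shows "\<exists>T. maximal_almost_rigid Q I T \<and> (\<forall>w. is_str w \<longrightarrow> dsummand (string_rep Q w) T \<longrightarrow> w \<in> W)"
proof -
  obtain ws where ws: "set ws \<subseteq> W" "non_iso (map (string_rep Q) ws :: ('v, 'a, 'k) rep list)"
    "\<And>x. x \<in> W \<Longrightarrow> \<exists>y\<in>set ws. \<exists>F. miso (string_rep Q x :: ('v, 'a, 'k) rep) (string_rep Q y) F"
    using representatives[OF fin] by blast
  define Ms where "Ms = (map (string_rep Q) ws :: ('v, 'a, 'k) rep list)"
  define T where "T = dsum_list Q Ms"
  have sMs: "amod M \<and> (\<exists>w b. is_str w \<and> sbasis M w b)" if "M \<in> set Ms" for M
  proof -
    obtain x where x: "x \<in> set ws" "M = string_rep Q x" using \<open>M \<in> set Ms\<close> unfolding Ms_def set_map by (elim imageE)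
    have "is_str x" using W[OF subsetD[OF ws(1) x(1)]] .
    then show ?thesis unfolding x(2) using amod_string_rep sbasis_string_rep by blast
  qed
  have aMs: "\<forall>M\<in>set Ms. amod M" and sl: "is_string_list Ms"
    using sMs unfolding is_string_list_def by blast+
  have aT: "amod T" unfolding T_def by (rule amod_dsum_list[OF aMs])
  have rMs: "\<forall>M\<in>set Ms. is_rep Q M" using aMs amod_rep by blast
  have dT: "decomposition T Ms"
    unfolding decomposition_def using aT is_string_list_indec[OF sl] sys_dsum_list[OF rMs] by (simp add: T_def)
  have inT: "dsummand (string_rep Q x) T" if x: "x \<in> W" for x
  proof -
    obtain y F where y: "y \<in> set ws" "miso (string_rep Q x :: ('v, 'a, 'k) rep) (string_rep Q y) F" using ws(3)[OF x] by blast
    obtain k where "k < length ws" "ws ! k = y" using y(1) by (auto simp: in_set_conv_nth)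
    then show ?thesis
      using decomposition_dsummand[OF dT, of k "string_rep Q x" F] y(2) amod_string_rep[OF W[OF x]] by (simp add: Ms_def)
  qed
  have mem: "\<exists>x b. x \<in> W \<and> sbasis M x b" if M: "indec M" "dsummand M T" for M
  proof -
    obtain k F where k: "k < length Ms" "miso M (Ms ! k) F" using decomposition_summand[OF dT M] by blast
    have x: "ws ! k \<in> W" using k(1) ws(1) nth_mem[of k ws] by (auto simp: Ms_def)
    have "miso M (string_rep Q (ws ! k)) F" using k by (simp add: Ms_def)
    then have "\<exists>b. sbasis M (ws ! k) b" using sbasis_iff_miso[OF W[OF x], of M] by blast
    then show ?thesis using x by blast
  qed
  have ar: "almost_rigid Q I T"
    unfolding almost_rigid_iff
  proof (intro conjI allI impI)
    show "\<exists>Ms. decomposition T Ms \<and> non_iso Ms" using dT ws(2) unfolding Ms_def by blast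
    show "\<exists>Ms. is_string_list Ms \<and> decomposition T Ms" using dT sl by blast
    fix M N :: "('v, 'a, 'k) rep" assume MN: "indec M \<and> dsummand M T \<and> indec N \<and> dsummand N T"
    obtain x b where x: "x \<in> W" "sbasis M x b" using mem[of M] MN by blast
    obtain y c where y: "y \<in> W" "sbasis N y c" using mem[of N] MN by blast
    show "\<not> bad M N" using nb[OF x(1) y(1) _ _ x(2) y(2)] MN by (simp add: indec_def)
  qed
  \<comment> \<open>Stated for any almost rigid \<open>S\<close> containing the summands of
    \<open>T\<close>: it is needed for the enlarged module and, with \<open>S\<close> equal to
    \<open>T\<close>, for the final claim.\<close>
  have out: "w \<in> W" if w: "is_str w" and S: "almost_rigid Q I S" "dsummand (string_rep Q w) S"
    and TS: "\<And>M. dsummand M T \<Longrightarrow> dsummand M S" for w S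
  proof (rule ccontr)
    assume "w \<notin> W"
    then obtain x where x: "x \<in> W" "bad (string_rep Q w :: ('v, 'a, 'k) rep) (string_rep Q x) \<or>
      bad (string_rep Q x :: ('v, 'a, 'k) rep) (string_rep Q w)" using bd[OF w] by blast
    have "\<And>M N. indec M \<Longrightarrow> dsummand M S \<Longrightarrow> indec N \<Longrightarrow> dsummand N S \<Longrightarrow> \<not> bad M N"
      using S(1) unfolding almost_rigid_iff by simp
    then show False
      using x(2) S(2) TS[OF inT[OF x(1)]] indec_string_rep[OF w] indec_string_rep[OF W[OF x(1)]] by metis
  qed
  have "\<not> almost_rigid Q I (dsum Q T L)" if L: "string_module Q I L" for L
  proof
    assume arS: "almost_rigid Q I (dsum Q T L)"
    obtain w b where aL: "amod L" and w: "is_str w" "sbasis L w b" using L unfolding string_module_iff by blast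
    define S where "S = dsum Q T L"
    obtain i1 p1 i2 p2 where bp: "biprod S T L i1 p1 i2 p2"
      unfolding S_def using biprod_dsum[OF amod_rep[OF aT] amod_rep[OF aL]] by blast
    have aS: "amod S" unfolding S_def by (rule amod_dsum[OF aT aL])
    obtain F where F: "miso L (string_rep Q w) F" using sbasis_iff_miso[OF w(1), of L] w(2) by blast
    then obtain F' where "miso (string_rep Q w) L F'" using miso_sym by blast
    then have "dsummand (string_rep Q w) S"
      using dsummand_miso[OF dsummand_biprod(2)[OF bp aS aL] amod_string_rep[OF w(1)]] by blast
    then have "w \<in> W" using out[OF w(1) arS] dsummand_biprod(1)[OF bp aS] by (simp add: S_def)
    \<comment> \<open>Now \<open>L\<close> sits inside \<open>T\<close> and is also the added
      summand. The projection to the added copy kills the one inside \<open>T\<close>, so the two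
      copies are independent as \<open>no_repeated_summand\<close> requires.\<close>
    then have "dsummand L T" using dsummand_miso[OF inT aL F] by blast
    then obtain \<iota> \<pi> where ip: "mhom Q L T \<iota>" "mhom Q T L \<pi>" "\<And>x. x \<in> tot Q L \<Longrightarrow> \<pi> (\<iota> x) = x"
      by (auto simp: dsummand_iff)
    obtain Ns where Ns: "decomposition S Ns" "non_iso Ns" using arS unfolding almost_rigid_iff S_def by (elim conjE exE)
    obtain ii pp where sy: "sys S Ns ii pp" and iNs: "\<forall>N\<in>set Ns. indec N" using Ns(1) by (auto simp: decomposition_def)
    have h: "mhom Q T S i1" "mhom Q S T p1" "mhom Q L S i2" "mhom Q S L p2"
      and e: "\<And>x. x \<in> tot Q T \<Longrightarrow> p1 (i1 x) = x" "\<And>x. x \<in> tot Q T \<Longrightarrow> p2 (i1 x) = 0"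
        "\<And>x. x \<in> tot Q L \<Longrightarrow> p2 (i2 x) = x" using bp by (auto simp: biprod_def)
    show False
    proof (rule no_repeated_summand[OF sbasis_indec'[OF aL w] mhom_comp[OF ip(1) h(1)] h(3) mhom_comp[OF h(2) ip(2)] h(4) _ _ _ sy iNs])
      show "\<pi> (p1 (i1 (\<iota> x))) = x" if "x \<in> tot Q L" for x using e(1)[OF mhomD(1)[OF ip(1) that]] ip(3)[OF that] by simp
      show "p2 (i2 x) = x" if "x \<in> tot Q L" for x using e(3)[OF that] .
      show "p2 (i1 (\<iota> x)) = 0" if "x \<in> tot Q L" for x using e(2)[OF mhomD(1)[OF ip(1) that]] .
      show "\<not> miso (Ns ! k) (Ns ! l) F" if "k < l" "l < length Ns" for k l F using Ns(2) that unfolding non_iso_def by blast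
    qed
  qed
  then have "maximal_almost_rigid Q I T" unfolding maximal_almost_rigid_def using ar by blast
  moreover have "w \<in> W" if "is_str w" "dsummand (string_rep Q w) T" for w using out[OF that(1) ar that(2)] by simp
  ultimately show ?thesis by blast
qed

lemma required_shapes:
  assumes M: "amod M" "sbasis M w b" and w: "is_str w" and req: "required_summand Q I M"
  shows "proj_string w" and "inj_string w"
proof -
  obtain F where "miso M (string_rep Q w) F" using sbasis_iff_miso[OF w, of M] M(2) by blast
  then obtain G where G: "miso (string_rep Q w) M G" using miso_sym by blast
  have sm: "dsummand (string_rep Q w) T" if "maximal_almost_rigid Q I T" for T
    using req that dsummand_miso[OF _ amod_string_rep[OF w] G] unfolding required_summand_def direct_summand_iff by blast
  have "\<exists>T. maximal_almost_rigid Q I T \<and> (\<forall>w. is_str w \<longrightarrow> dsummand (string_rep Q w) T \<longrightarrow> w \<in> {w. proj_string w})"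
  proof (rule mar_exists[OF finite_proj_strings])
    show "\<not> bad M N" if "x \<in> {w. proj_string w}" "y \<in> {w. proj_string w}" "amod M" "amod N" "sbasis M x b" "sbasis N y c"
      for x y b c and M N :: "('v, 'a, 'k) rep"
      using not_bad_proj[OF _ is_str_proj amod_rep amod_rep] that by blast
    show "\<exists>x\<in>{w. proj_string w}. bad (string_rep Q w :: ('v, 'a, 'k) rep) (string_rep Q x) \<or>
      bad (string_rep Q x :: ('v, 'a, 'k) rep) (string_rep Q w)" if "is_str w" "w \<notin> {w. proj_string w}" for w
      using bad_or_proj[OF that(1)] that(2) by blast
  qed (simp add: is_str_proj)
  then show "proj_string w" using sm w by blast
  have "\<exists>T. maximal_almost_rigid Q I T \<and> (\<forall>w. is_str w \<longrightarrow> dsummand (string_rep Q w) T \<longrightarrow> w \<in> {w. inj_string w})"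
  proof (rule mar_exists[OF finite_inj_strings])
    show "\<not> bad M N" if "x \<in> {w. inj_string w}" "y \<in> {w. inj_string w}" "amod M" "amod N" "sbasis M x b" "sbasis N y c"
      for x y b c and M N :: "('v, 'a, 'k) rep"
      using not_bad_inj[OF _ is_str_inj] that by blast
    show "\<exists>x\<in>{w. inj_string w}. bad (string_rep Q w :: ('v, 'a, 'k) rep) (string_rep Q x) \<or>
      bad (string_rep Q x :: ('v, 'a, 'k) rep) (string_rep Q w)" if "is_str w" "w \<notin> {w. inj_string w}" for w
      using bad_or_inj[OF that(1)] that(2) by blast
  qed (simp add: is_str_inj)
  then show "inj_string w" using sm w by blast
qed

text \<open>Prolonging on either side concerns only the outermost arrow, so maximality becomes the
  condition on the two ends of \<open>q\<close> used for the two shapes.\<close>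

lemma maximal_direct_iff:
  assumes "q \<noteq> []"
  shows "maximal_direct_string Q I (v, map Dir q) \<longleftrightarrow>
    v \<in> verts Q \<and> dpath v q \<and> dmax q \<and> (\<forall>c\<in>arcs Q. head Q c = v \<longrightarrow> R c (hd q))"
proof -
  have 1: "is_string Q I (u, map Dir p) \<longleftrightarrow> u \<in> verts Q \<and> dpath u p" for u p
    using is_str_direct[of u p] unfolding is_string_iff by (auto simp: is_str_def)
  have 2: "is_string Q I (v, map Dir q @ [Dir c]) \<longleftrightarrow> tail Q c = head Q (last q) \<and> \<not> R (last q) c"
    if "v \<in> verts Q" "dpath v q" "c \<in> arcs Q" for c
    using 1[of v "q @ [c]"] that assms by (auto simp: dpath_def successively_append_iff)
  have 3: "is_string Q I (tail Q c, Dir c # map Dir q) \<longleftrightarrow> \<not> R c (hd q)"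
    if "dpath v q" "c \<in> arcs Q" "head Q c = v" for c
    using 1[of "tail Q c" "c # q"] that assms tail_verts by (auto simp: dpath_def successively_Cons)
  show ?thesis
    unfolding maximal_direct_string_def direct_string_def fst_conv snd_conv 1
    using 2 3 assms unfolding dmax_def by auto
qed

lemma string_rep_trivial:
  assumes "v \<in> verts Q"
  shows "rep_iso Q (string_rep Q (v, [])) (simple_rep Q v)"
  by (rule rep_iso_cong[OF is_rep_string])
    (auto simp: string_rep_def simple_rep_def Let_def walk_verts_def intro!: eq_matI)

text \<open>\<open>proj_inj_cases\<close> yields a direct word or its inverse walk;
  \<open>string_rep_rev\<close> passes to the direct word, the form in which maximal direct strings
  are defined.\<close>

lemma required_iff:
  assumes "string_module Q I M"
  shows "required_summand Q I M \<longleftrightarrow>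
     (\<exists>i \<in> verts Q. in_degree Q i \<le> 1 \<and> out_degree Q i \<le> 1 \<and> rep_iso Q M (simple_rep Q i)) \<or>
     (\<exists>w. maximal_direct_string Q I w \<and> snd w \<noteq> [] \<and> rep_iso Q M (string_rep Q w))"
proof -
  have deg: "out_degree Q v \<le> 1 \<longleftrightarrow> (\<forall>a\<in>arcs Q. \<forall>b\<in>arcs Q. tail Q a = v \<and> tail Q b = v \<longrightarrow> a = b)"
    "in_degree Q v \<le> 1 \<longleftrightarrow> (\<forall>a\<in>arcs Q. \<forall>b\<in>arcs Q. head Q a = v \<and> head Q b = v \<longrightarrow> a = b)" for v
    using finite_arcs card_le_Suc0_iff_eq[of "out_arcs Q v"] card_le_Suc0_iff_eq[of "in_arcs Q v"]
    by (auto simp: out_degree_def in_degree_def out_arcs_def in_arcs_def)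
  have triv: "proj_string (v, []) \<and> inj_string (v, []) \<longleftrightarrow> in_degree Q v \<le> 1 \<and> out_degree Q v \<le> 1" if "v \<in> verts Q" for v
    unfolding proj_trivial_iff[OF that] inj_trivial_iff[OF that] deg by blast
  have rs: "is_rep Q (simple_rep Q v)" for v by (auto simp: is_rep_def simple_rep_def)
  obtain w b where aM: "amod M" and w: "is_str w" "sbasis M w b" using assms unfolding string_module_iff by blast
  note rM = amod_rep[OF aM]
  have iso: "rep_iso Q M (string_rep Q x) \<longleftrightarrow> (\<exists>b. sbasis M x b)" if "is_str x" for x
    using sbasis_iff_miso[OF that, of M] rep_iso_iff[OF rM is_rep_string, of x] by simp
  show ?thesis
  proof
    assume "required_summand Q I M"
    from proj_inj_cases[OF required_shapes[OF aM w(2,1) this]]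
    obtain v q where vq: "v \<in> verts Q" "dpath v q" "w = (v, map Dir q) \<or> w = rev_walk (v, map Dir q)"
      "q \<noteq> [] \<Longrightarrow> dmax q \<and> (\<forall>c\<in>arcs Q. head Q c = v \<longrightarrow> R c (hd q))" by auto
    have ps: "proj_string w" "inj_string w" using required_shapes[OF aM w(2,1) \<open>required_summand Q I M\<close>] .
    have s: "is_str (v, map Dir q)" using is_str_direct vq(1,2) by simp
    have Mq: "rep_iso Q M (string_rep Q (v, map Dir q))"
      using vq(3)
    proof
      assume "w = (v, map Dir q)"
      then show ?thesis using iso[OF w(1)] w(2) by blast
    next
      assume "w = rev_walk (v, map Dir q)"
      then obtain F where "miso (string_rep Q (v, map Dir q) :: ('v, 'a, 'k) rep) (string_rep Q w) F"
        using string_rep_rev[OF s] by blast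
      then have "rep_iso Q (string_rep Q (v, map Dir q) :: ('v, 'a, 'k) rep) (string_rep Q w)"
        using rep_iso_iff[OF is_rep_string is_rep_string] by blast
      moreover have "rep_iso Q M (string_rep Q w)" using iso[OF w(1)] w(2) by blast
      ultimately show ?thesis using rep_iso_trans[OF rM is_rep_string is_rep_string] rep_iso_sym by blast
    qed
    show "(\<exists>i \<in> verts Q. in_degree Q i \<le> 1 \<and> out_degree Q i \<le> 1 \<and> rep_iso Q M (simple_rep Q i)) \<or>
     (\<exists>w. maximal_direct_string Q I w \<and> snd w \<noteq> [] \<and> rep_iso Q M (string_rep Q w))"
    proof (cases "q = []")
      case True
      have "w = (v, [])" using vq(3) True by (auto simp: rev_walk_def)
      then have "in_degree Q v \<le> 1 \<and> out_degree Q v \<le> 1" using ps triv[OF vq(1)] by simp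
      moreover have "rep_iso Q M (simple_rep Q v)"
        using rep_iso_trans[OF rM is_rep_string rs Mq] string_rep_trivial[OF vq(1)] True by simp
      ultimately show ?thesis using vq(1) by blast
    next
      case False
      then have "maximal_direct_string Q I (v, map Dir q)" using maximal_direct_iff[OF False] vq by simp
      then show ?thesis using Mq False by (intro disjI2 exI[of _ "(v, map Dir q)"]) simp
    qed
  next
    assume "(\<exists>i \<in> verts Q. in_degree Q i \<le> 1 \<and> out_degree Q i \<le> 1 \<and> rep_iso Q M (simple_rep Q i)) \<or>
     (\<exists>w. maximal_direct_string Q I w \<and> snd w \<noteq> [] \<and> rep_iso Q M (string_rep Q w))"
    then obtain x where x: "proj_string x" "inj_string x" "rep_iso Q M (string_rep Q x)"
    proof (elim disjE bexE exE conjE)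
      fix i assume th: "\<And>x. proj_string x \<Longrightarrow> inj_string x \<Longrightarrow> rep_iso Q M (string_rep Q x) \<Longrightarrow> thesis"
        and i: "i \<in> verts Q" "in_degree Q i \<le> 1" "out_degree Q i \<le> 1" "rep_iso Q M (simple_rep Q i)"
      have "rep_iso Q M (string_rep Q (i, []))"
        by (rule rep_iso_trans[OF rM rs is_rep_string i(4) rep_iso_sym[OF string_rep_trivial[OF i(1)]]])
      then show thesis using th triv[OF i(1)] i(2,3) by blast
    next
      fix u assume th: "\<And>x. proj_string x \<Longrightarrow> inj_string x \<Longrightarrow> rep_iso Q M (string_rep Q x) \<Longrightarrow> thesis"
        and u: "maximal_direct_string Q I u" "snd u \<noteq> []" "rep_iso Q M (string_rep Q u)"
      have "\<forall>l\<in>set (snd u). \<exists>a. l = Dir a" using u(1) unfolding maximal_direct_string_def direct_string_def by blast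
      then have "snd u = map Dir (map letter_arrow (snd u))" by (auto intro!: map_idI[symmetric])
      then obtain v q where uq: "u = (v, map Dir q)" by (metis prod.collapse)
      then have q: "q \<noteq> []" using u(2) by simp
      have vq: "v \<in> verts Q" "dpath v q" "dmax q" "\<forall>c\<in>arcs Q. head Q c = v \<longrightarrow> R c (hd q)"
        using u(1) unfolding uq maximal_direct_iff[OF q] by blast+
      show thesis
        by (rule th[OF _ _ u(3)]) (use vq uq proj_direct_iff[OF q vq(1)] inj_direct_iff[OF q vq(2,1)] in simp_all)
    qed
    then show "required_summand Q I M" using required_if[OF x(1,2) aM] iso[OF is_str_proj[OF x(1)]] by blast
  qed
qed

end

section \<open>From the ideal of the path algebra to relations of length two\<close>

lemma (in finite_quiver) wf_quiver: "wf_digraph Q"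
  using tail_verts head_verts by unfold_locales

text \<open>A monomial ideal described through supports instead of generators: every path that
  occurs contains two consecutive arrows related by \<open>R\<close>.\<close>

definition support_ideal ::
    "('v, 'a) pre_digraph \<Rightarrow> ('a \<Rightarrow> 'a \<Rightarrow> bool) \<Rightarrow> (('v, 'a) qpath \<Rightarrow> 'k::field) set" where
  "support_ideal Q R = {x \<in> carrier (path_algebra Q).
     \<forall>u p v. x (u, p, v) \<noteq> 0 \<longrightarrow> \<not> successively (\<lambda>a b. \<not> R a b) p}"

text \<open>A path that contains a relation keeps it when prolonged, and by \<open>mult\<close> each
  path in the support of a product is composed of paths in the supports of the factors.\<close>

lemma ideal_support_ideal:
  fixes Q :: "('v, 'a) pre_digraph"
  assumes ring: "ring (path_algebra Q :: (('v, 'a) qpath \<Rightarrow> 'k::field) ring)"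
  shows "ideal (support_ideal Q R) (path_algebra Q :: (('v, 'a) qpath \<Rightarrow> 'k) ring)"
proof -
  let ?A = "path_algebra Q :: (('v, 'a) qpath \<Rightarrow> 'k) ring" and ?J = "support_ideal Q R :: (('v, 'a) qpath \<Rightarrow> 'k) set"
  interpret ring ?A by (rule ring)
  have sub: "?J \<subseteq> carrier ?A" by (auto simp: support_ideal_def)
  have z: "\<zero>\<^bsub>?A\<^esub> = (\<lambda>p. 0)" and add: "x \<oplus>\<^bsub>?A\<^esub> y = (\<lambda>p. x p + y p)" for x y by (simp_all add: path_algebra_def)
  have mult: "\<exists>p1 v p2. p = p1 @ p2 \<and> x (u, p1, v) \<noteq> 0 \<and> y (v, p2, w) \<noteq> 0"
    if "(x \<otimes>\<^bsub>?A\<^esub> y) (u, p, w) \<noteq> 0" for x y u p w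
  proof -
    have "(\<Sum>(p1, v, p2) \<in> {(p1, v, p2). p = p1 @ p2 \<and> (u, p1, v) \<in> qpaths Q \<and> (v, p2, w) \<in> qpaths Q}.
         x (u, p1, v) * y (v, p2, w)) \<noteq> 0" using that by (simp add: path_algebra_def)
    then obtain t where "t \<in> {(p1, v, p2). p = p1 @ p2 \<and> (u, p1, v) \<in> qpaths Q \<and> (v, p2, w) \<in> qpaths Q}"
      "(case t of (p1, v, p2) \<Rightarrow> x (u, p1, v) * y (v, p2, w)) \<noteq> 0" by (rule sum.not_neutral_contains_not_neutral)
    then show ?thesis by (cases t) auto
  qed
  have neg: "\<ominus>\<^bsub>?A\<^esub> x = (\<lambda>p. - x p)" and negc: "(\<lambda>p. - x p) \<in> carrier ?A" if x: "x \<in> carrier ?A" for x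
  proof -
    show c: "(\<lambda>p. - x p) \<in> carrier ?A" using x by (simp add: path_algebra_def)
    show "\<ominus>\<^bsub>?A\<^esub> x = (\<lambda>p. - x p)" by (rule minus_equality[OF _ x c]) (simp add: add z)
  qed
  show ?thesis
  proof (rule idealI[OF ring])
    show "subgroup ?J (add_monoid ?A)"
    proof (rule subgroup.intro)
      show "?J \<subseteq> carrier (add_monoid ?A)" using sub by simp
      show "x \<otimes>\<^bsub>add_monoid ?A\<^esub> y \<in> ?J" if "x \<in> ?J" "y \<in> ?J" for x y
      proof -
        have "x \<oplus>\<^bsub>?A\<^esub> y \<in> carrier ?A" using that sub by auto
        moreover have "\<not> successively (\<lambda>a b. \<not> R a b) p" if s: "x (u, p, v) + y (u, p, v) \<noteq> 0" for u p v
        proof -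
          have "x (u, p, v) \<noteq> 0 \<or> y (u, p, v) \<noteq> 0" using s by auto
          then show ?thesis using \<open>x \<in> ?J\<close> \<open>y \<in> ?J\<close> unfolding support_ideal_def by blast
        qed
        ultimately show ?thesis unfolding support_ideal_def by (simp add: add) blast
      qed
      show "\<one>\<^bsub>add_monoid ?A\<^esub> \<in> ?J" using zero_closed by (simp add: support_ideal_def z)
      show "inv\<^bsub>add_monoid ?A\<^esub> x \<in> ?J" if "x \<in> ?J" for x
      proof -
        have xc: "x \<in> carrier ?A" using that sub by blast
        have e: "inv\<^bsub>add_monoid ?A\<^esub> x = (\<lambda>p. - x p)" using neg[OF xc] unfolding a_inv_def .
        show ?thesis unfolding e using that negc[OF xc] by (simp add: support_ideal_def)
      qed
    qed
    show "x \<otimes>\<^bsub>?A\<^esub> a \<in> ?J" if "a \<in> ?J" "x \<in> carrier ?A" for a x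
    proof -
      have "x \<otimes>\<^bsub>?A\<^esub> a \<in> carrier ?A" using that sub by auto
      moreover have "\<not> successively (\<lambda>a b. \<not> R a b) p" if nz: "(x \<otimes>\<^bsub>?A\<^esub> a) (u, p, w) \<noteq> 0" for u p w
      proof -
        obtain p1 v p2 where m: "p = p1 @ p2" "(a (v, p2, w)) \<noteq> 0" using mult[OF nz] by blast
        have "\<not> successively (\<lambda>a b. \<not> R a b) p2"
          using \<open>a \<in> ?J\<close> m(2) unfolding support_ideal_def by blast
        then show ?thesis using m(1) by (simp add: successively_append_iff)
      qed
      ultimately show ?thesis unfolding support_ideal_def by blast
    qed
    show "a \<otimes>\<^bsub>?A\<^esub> x \<in> ?J" if "a \<in> ?J" "x \<in> carrier ?A" for a x
    proof -
      have "a \<otimes>\<^bsub>?A\<^esub> x \<in> carrier ?A" using that sub by auto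
      moreover have "\<not> successively (\<lambda>a b. \<not> R a b) p" if nz: "(a \<otimes>\<^bsub>?A\<^esub> x) (u, p, w) \<noteq> 0" for u p w
      proof -
        obtain p1 v p2 where m: "p = p1 @ p2" "(a (u, p1, v)) \<noteq> 0" using mult[OF nz] by blast
        have "\<not> successively (\<lambda>a b. \<not> R a b) p1"
          using \<open>a \<in> ?J\<close> m(2) unfolding support_ideal_def by blast
        then show ?thesis using m(1) by (simp add: successively_append_iff)
      qed
      ultimately show ?thesis unfolding support_ideal_def by blast
    qed
  qed
qed

lemma path_elem_carrier: "p \<in> qpaths Q \<Longrightarrow> path_elem p \<in> carrier (path_algebra Q)"
  by (simp add: path_algebra_def path_elem_def)

context finite_quiver
begin

lemma awalk_iff [simp]:
  "pre_digraph.awalk Q u [] v \<longleftrightarrow> u = v \<and> u \<in> verts Q"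
  "pre_digraph.awalk Q u (a # p) v \<longleftrightarrow> a \<in> arcs Q \<and> u = tail Q a \<and> pre_digraph.awalk Q (head Q a) p v"
  by (rule wf_digraph.awalk_Nil_iff[OF wf_quiver] wf_digraph.awalk_Cons_iff[OF wf_quiver])+

lemma awalk_successively:
  assumes "p \<noteq> []" "set p \<subseteq> arcs Q" "successively (\<lambda>a b. head Q a = tail Q b) p"
  shows "pre_digraph.awalk Q (tail Q (hd p)) p (head Q (last p))"
  using assms
proof (induction p)
  case (Cons a p)
  then show ?case by (cases p) (auto simp: head_verts)
qed simp

text \<open>Generation of \<open>I\<close> by paths of length two enters here: the generators lie in
  the support ideal, and \<open>I\<close> is the smallest ideal containing them.\<close>

lemma ideal_support:
  fixes I :: "(('v, 'a) qpath \<Rightarrow> 'k::field) set"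
  assumes I: "ideal I (path_algebra Q)" and P: "P \<subseteq> {(u, p, v) \<in> qpaths Q. length p = 2}"
    and gen: "I = genideal (path_algebra Q) (path_elem ` P)"
  shows "I \<subseteq> support_ideal Q (\<lambda>a b. two_path Q a b \<in> I)"
proof -
  have r: "ring (path_algebra Q :: (('v, 'a) qpath \<Rightarrow> 'k) ring)" using I by (simp add: ideal_def)
  have Pc: "path_elem ` P \<subseteq> carrier (path_algebra Q :: (('v, 'a) qpath \<Rightarrow> 'k) ring)"
    using P path_elem_carrier by fastforce
  have PI: "path_elem ` P \<subseteq> I" unfolding gen by (rule ring.genideal_self[OF r Pc])
  have "path_elem x \<in> (support_ideal Q (\<lambda>a b. two_path Q a b \<in> I) :: (('v, 'a) qpath \<Rightarrow> 'k) set)" if x: "x \<in> P" for x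
  proof -
    obtain u p v where xe: "x = (u, p, v)" by (cases x)
    have w: "pre_digraph.awalk Q u p v" "length p = 2" using P x xe by (auto simp: qpaths_def)
    then obtain a b where p: "p = [a, b]" by (auto simp: numeral_2_eq_2 length_Suc_conv)
    have "u = tail Q a" "v = head Q b" using w(1) p by auto
    then have "(two_path Q a b :: _ \<Rightarrow> 'k) \<in> I" using PI x xe p by blast
    moreover have "path_elem x \<in> carrier (path_algebra Q :: (('v, 'a) qpath \<Rightarrow> 'k) ring)" using Pc x by blast
    ultimately show ?thesis using xe p by (auto simp: support_ideal_def path_elem_def)
  qed
  then show ?thesis
    unfolding gen by (intro ring.genideal_minimal[OF r ideal_support_ideal[OF r]]) (auto simp: gen)
qed

lemma foldl_zero:
  assumes "is_rep Q M" "pre_digraph.awalk Q u p v"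
  shows "foldl (\<lambda>X a. rmap M a * X) (0\<^sub>m (rdim M u) n) p = 0\<^sub>m (rdim M v) n"
  using assms(2)
proof (induction p arbitrary: u)
  case (Cons a p)
  have "rmap M a \<in> carrier_mat (rdim M (head Q a)) (rdim M u)" using Cons.prems assms(1) by (auto simp: is_rep_def)
  then have "rmap M a * 0\<^sub>m (rdim M u) n = 0\<^sub>m (rdim M (head Q a)) n" by simp
  then show ?case using Cons by simp
qed simp

end

context bound_quiver
begin

text \<open>The starting matrix is arbitrary so that the induction can absorb the first arrow of the
  path into it.\<close>

lemma foldl_relation:
  assumes M: "amod M" and "pre_digraph.awalk Q u p v" "\<not> successively (\<lambda>a b. \<not> R a b) p" "X \<in> carrier_mat (rdim M u) n"
  shows "foldl (\<lambda>X a. rmap M a * X) X p = 0\<^sub>m (rdim M v) n"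
  using assms(2-4)
proof (induction p arbitrary: u X)
  case (Cons a p)
  have r: "is_rep Q M" using M by simp
  have a: "a \<in> arcs Q" "u = tail Q a" "pre_digraph.awalk Q (head Q a) p v" using Cons.prems(1) by auto
  have ca: "rmap M a \<in> carrier_mat (rdim M (head Q a)) (rdim M u)" using a r by (auto simp: is_rep_def)
  have aX: "rmap M a * X \<in> carrier_mat (rdim M (head Q a)) n" using ca Cons.prems(3) by simp
  show ?case
  proof (cases "successively (\<lambda>a b. \<not> R a b) p")
    case False
    then show ?thesis using Cons.IH[OF a(3) False aX] by simp
  next
    case True
    then obtain b p' where p: "p = b # p'" "R a b" using Cons.prems(2) by (cases p) auto
    have b: "b \<in> arcs Q" "head Q a = tail Q b" "pre_digraph.awalk Q (head Q b) p' v" using a(3) p(1) by auto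
    have cb: "rmap M b \<in> carrier_mat (rdim M (head Q b)) (rdim M (head Q a))" using b r by (auto simp: is_rep_def)
    have "rmap M b * rmap M a = 0\<^sub>m (rdim M (head Q b)) (rdim M u)"
      using M a b p(2) unfolding amod_mat by blast
    then have "rmap M b * (rmap M a * X) = 0\<^sub>m (rdim M (head Q b)) n"
      using assoc_mult_mat[OF cb ca Cons.prems(3)] Cons.prems(3) by simp
    then show ?thesis using foldl_zero[OF r b(3), of n] p(1) by simp
  qed
qed simp

text \<open>Forwards, \<open>two_path Q a b\<close> has a single path in its support, so its
  vanishing is a matrix equation. Backwards, every path in the support of an element of
  \<open>I\<close> contains a relation and acts as zero, so each sum vanishes term by term.\<close>

lemma A_module_amod:
  fixes I :: "(('v, 'a) qpath \<Rightarrow> 'k::field) set"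
  assumes R: "\<And>a b. a \<in> arcs Q \<Longrightarrow> b \<in> arcs Q \<Longrightarrow> R a b \<longleftrightarrow> two_path Q a b \<in> I"
    and I: "I \<subseteq> support_ideal Q R"
  shows "A_module Q I M \<longleftrightarrow> amod M"
proof
  assume A: "A_module Q I M"
  have r: "is_rep Q M" using A by (simp add: A_module_def)
  have "rmap M b * rmap M a = 0\<^sub>m (rdim M (head Q b)) (rdim M (tail Q a))"
    if ab: "a \<in> arcs Q" "b \<in> arcs Q" "head Q a = tail Q b" "R a b" for a b
  proof -
    have c: "rmap M a \<in> carrier_mat (rdim M (tail Q b)) (rdim M (tail Q a))"
      "rmap M b \<in> carrier_mat (rdim M (head Q b)) (rdim M (tail Q b))" using r ab by (auto simp: is_rep_def)
    have pm: "path_map M (tail Q a) [a, b] = rmap M b * rmap M a" using c by (simp add: path_map_def)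
    have sup: "{p. (two_path Q a b (tail Q a, p, head Q b) :: 'k) \<noteq> 0} = {[a, b]}" by (auto simp: path_elem_def)
    have x: "two_path Q a b \<in> I" using R ab by blast
    have "(rmap M b * rmap M a) $$ (i, j) = 0" if "i < rdim M (head Q b)" "j < rdim M (tail Q a)" for i j
    proof -
      have "(\<Sum>p\<in>{p. (two_path Q a b (tail Q a, p, head Q b) :: 'k) \<noteq> 0}.
          two_path Q a b (tail Q a, p, head Q b) * path_map M (tail Q a) p $$ (i, j)) = 0"
        using A x that tail_verts[OF ab(1)] head_verts[OF ab(2)] unfolding A_module_def by blast
      then show ?thesis unfolding sup by (simp add: pm path_elem_def)
    qed
    then show ?thesis using c by (intro eq_matI) auto
  qed
  then show "amod M" unfolding amod_mat using r by blast
next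
  assume M: "amod M"
  show "A_module Q I M"
    unfolding A_module_def
  proof (intro conjI ballI allI impI)
    show "is_rep Q M" using M by simp
    fix x u v i j assume x: "x \<in> I" and ij: "i < rdim M v" "j < rdim M u"
    show "(\<Sum>p\<in>{p. x (u, p, v) \<noteq> 0}. x (u, p, v) * path_map M u p $$ (i, j)) = 0"
    proof (intro sum.neutral ballI)
      fix p assume "p \<in> {p. x (u, p, v) \<noteq> 0}"
      then have p: "x (u, p, v) \<noteq> 0" by simp
      have xJ: "x \<in> support_ideal Q R" using I x by blast
      have "(u, p, v) \<in> qpaths Q" using xJ p by (auto simp: support_ideal_def path_algebra_def)
      then have "pre_digraph.awalk Q u p v" by (simp add: qpaths_def)
      moreover have "\<not> successively (\<lambda>a b. \<not> R a b) p" using xJ p by (auto simp: support_ideal_def)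
      ultimately have "path_map M u p = 0\<^sub>m (rdim M v) (rdim M u)"
        unfolding path_map_def by (rule foldl_relation[OF M]) simp
      then show "x (u, p, v) * path_map M u p $$ (i, j) = 0" using ij by simp
    qed
  qed
qed

end

lemma gentle_gentle_bound:
  fixes I :: "(('v, 'a) qpath \<Rightarrow> 'k::field) set"
  assumes g: "gentle Q I"
  shows "gentle_bound Q (\<lambda>a b. two_path Q a b \<in> I) I"
proof -
  let ?R = "\<lambda>a b. two_path Q a b \<in> I"
  interpret fin_digraph Q using g by (simp add: gentle_def)
  interpret fq: bound_quiver Q ?R
    using finite_verts finite_arcs tail_in_verts head_in_verts by unfold_locales
  have deg: "card (out_arcs Q v) \<le> 2" "card (in_arcs Q v) \<le> 2" if "v \<in> verts Q" for v
    using g that by (auto simp: gentle_def out_degree_def in_degree_def)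
  have two: "a = b \<or> b = c \<or> a = c" if "finite S" "card S \<le> 2" "a \<in> S" "b \<in> S" "c \<in> S" for a b c and S :: "'a set"
  proof (rule ccontr)
    assume "\<not> ?thesis"
    then have "card {a, b, c} = 3" by auto
    moreover have "card {a, b, c} \<le> card S" using that by (intro card_mono) auto
    ultimately show False using that(2) by simp
  qed
  have one: "b = c" if "card S \<le> 1" "S \<subseteq> arcs Q" "b \<in> S" "c \<in> S" for b c S
    using that card_le_Suc0_iff_eq[of S] finite_subset[OF that(2) finite_arcs] by auto
  have id: "ideal I (path_algebra Q)" and adm: "\<exists>m\<ge>2. arrow_ideal_power Q m \<subseteq> I"
    using g by (auto simp: gentle_def admissible_ideal_def)
  obtain P where P: "P \<subseteq> {(u, p, v) \<in> qpaths Q. length p = 2}" "I = genideal (path_algebra Q) (path_elem ` P)"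
    using g unfolding gentle_def by (elim conjE exE)
  have sup: "I \<subseteq> support_ideal Q ?R" by (rule fq.ideal_support[OF id P])
  obtain m where m: "m \<ge> 2" "arrow_ideal_power Q m \<subseteq> I" using adm by blast
  \<comment> \<open>A path of length at least \<open>m\<close> lies in the power of the arrow ideal
    contained in \<open>I\<close>, hence in the support ideal, and so contains a relation.\<close>
  have "length p < m" if p: "set p \<subseteq> arcs Q" "successively (\<lambda>a b. head Q a = tail Q b \<and> \<not> ?R a b) p" for p
  proof (rule ccontr)
    assume l: "\<not> length p < m"
    have ne: "p \<noteq> []" using l m(1) by auto
    have s: "successively (\<lambda>a b. head Q a = tail Q b) p" "successively (\<lambda>a b. \<not> ?R a b) p"
      using p(2) by (auto elim: successively_mono)
    let ?x = "path_elem (tail Q (hd p), p, head Q (last p)) :: ('v, 'a) qpath \<Rightarrow> 'k"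
    have "(tail Q (hd p), p, head Q (last p)) \<in> qpaths Q"
      using fq.awalk_successively[OF ne p(1) s(1)] by (simp add: qpaths_def)
    then have "?x \<in> arrow_ideal_power Q m"
      using l path_elem_carrier by (auto simp: arrow_ideal_power_def path_elem_def)
    then have "?x \<in> support_ideal Q ?R" using m(2) sup by blast
    then show False using s(2) by (auto simp: support_ideal_def path_elem_def)
  qed
  then have bd: "\<exists>m. \<forall>p. set p \<subseteq> arcs Q \<and> successively (\<lambda>a b. head Q a = tail Q b \<and> \<not> ?R a b) p \<longrightarrow> length p < m"
    by blast
  have nr: "b = c" if "a \<in> arcs Q" "b \<in> arcs Q" "c \<in> arcs Q" "head Q a = tail Q b" "head Q a = tail Q c" "\<not> ?R a b" "\<not> ?R a c" for a b c
    by (rule one[of "{b \<in> arcs Q. head Q a = tail Q b \<and> two_path Q a b \<notin> I}"]) (use g that in \<open>auto simp: gentle_def\<close>)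
  have nl: "b = c" if "a \<in> arcs Q" "b \<in> arcs Q" "c \<in> arcs Q" "head Q b = tail Q a" "head Q c = tail Q a" "\<not> ?R b a" "\<not> ?R c a" for a b c
    by (rule one[of "{c \<in> arcs Q. head Q c = tail Q a \<and> two_path Q c a \<notin> I}"]) (use g that in \<open>auto simp: gentle_def\<close>)
  have rr: "b = c" if "a \<in> arcs Q" "b \<in> arcs Q" "c \<in> arcs Q" "head Q a = tail Q b" "head Q a = tail Q c" "?R a b" "?R a c" for a b c
    by (rule one[of "{b \<in> arcs Q. head Q a = tail Q b \<and> two_path Q a b \<in> I}"]) (use g that in \<open>auto simp: gentle_def\<close>)
  have rl: "b = c" if "a \<in> arcs Q" "b \<in> arcs Q" "c \<in> arcs Q" "head Q b = tail Q a" "head Q c = tail Q a" "?R b a" "?R c a" for a b c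
    by (rule one[of "{c \<in> arcs Q. head Q c = tail Q a \<and> two_path Q c a \<in> I}"]) (use g that in \<open>auto simp: gentle_def\<close>)
  interpret gq: gentle_quiver Q ?R
  proof (unfold_locales, goal_cases)
    case (1 a b c)
    show ?case by (rule two[OF _ deg(1)[of "tail Q c"]]) (use 1 in auto)
  next
    case (2 a b c)
    show ?case by (rule two[OF _ deg(2)[of "head Q c"]]) (use 2 in auto)
  next
    case (3 a b c) then show ?case by (rule nr)
  next
    case (4 a b c) then show ?case by (rule nl)
  next
    case (5 a b c) then show ?case by (rule rr)
  next
    case (6 a b c) then show ?case by (rule rl)
  next
    case 7 show ?case by (rule bd)
  qed
  show ?thesis
  proof (unfold_locales)
    show "A_module Q I M \<longleftrightarrow> fq.amod M" for M by (rule fq.A_module_amod[OF refl sup])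
    have "gq.opp (letter_inv l) l' \<longleftrightarrow> l' \<noteq> letter_inv l \<and> (\<forall>a b. l = Dir a \<and> l' = Dir b \<longrightarrow> two_path Q a b \<notin> I) \<and>
        (\<forall>a b. l = Inv b \<and> l' = Inv a \<longrightarrow> two_path Q a b \<notin> I)" for l l' by (cases l; cases l') auto
    then show "is_string Q I w \<longleftrightarrow> gq.is_str w" for w
      unfolding is_string_def gq.is_str_nth by (cases w) simp
  qed
qed

theorem corollary3p10:
  fixes Q :: "('v, 'a) pre_digraph"
    and I :: "(('v, 'a) qpath \<Rightarrow> 'k::alg_closed_field) set"
    and M :: "('v, 'a, 'k) rep"
  assumes "gentle Q I"
    and "string_module Q I M"
  shows "required_summand Q I M \<longleftrightarrow>
     (\<exists>i \<in> verts Q. in_degree Q i \<le> 1 \<and> out_degree Q i \<le> 1 \<and> rep_iso Q M (simple_rep Q i)) \<or>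
     (\<exists>w. maximal_direct_string Q I w \<and> snd w \<noteq> [] \<and> rep_iso Q M (string_rep Q w))"
  by (rule gentle_bound.required_iff[OF gentle_gentle_bound[OF assms(1)] assms(2)])

end
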